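(* Let $A_1,\dots,A_m\subset\mathbb R^q$ be Borel sets such that for every $k$, $p_{A_k}:=\mathbb P(\mathbf Z\in A_k)>0$ and the conditional copula $C(\cdot|A_k)$ is continuously differentiable on $[0,1]^p$. Then for every $M\ge2$, as $n\to\infty$, the process $$\vec{\mathcal E}_{n,M,\mathcal A}(\vec{\mathbf u}_0,\dots,\vec{\mathbf u}_M):=\big(\vec{\mathbb C}_n(\vec{\mathbf u}_0|\mathcal A),\vec{\mathbb E}^*_{n,1}(\vec{\mathbf u}_1|\mathcal A),\dots,\vec{\mathbb E}^*_{n,M}(\vec{\mathbf u}_M|\mathcal A)\big)$$ converges weakly in $\ell^\infty([0,1]^{p(M+1)m},\mathbb R^{m(M+1)})$ to a process that concatenates $M+1$ independent copies of $\vec{\mathbb C}_\infty(\cdot|\mathcal A)$.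
   Context: Let $(\mathbf X,\mathbf Z)$ be a random vector in $\mathbb R^p\times\mathbb R^q$ with i.i.d. copies $(\mathbf X_i,\mathbf Z_i)_{i\le n}$; $\mathcal A:=\{A_1,\dots,A_m\}$; vector inequalities componentwise. For Borel $A$ with $p_A>0$: conditional margins $F_k(t|A):=\mathbb P(X_k\le t\mid\mathbf Z\in A)$ are continuous (standing assumption); $C(\cdot|A)$ is the conditional copula of $\mathbf X$ given $\mathbf Z\in A$; $\mathbf U^A:=(F_1(X_1|A),\dots,F_p(X_p|A))$; $D(\mathbf u,A):=\mathbb P(\mathbf U^A\le\mathbf u,\mathbf Z\in A)$ with partial derivatives $\partial_kD$ in $u_k$. Empirical: $\hat p_A:=n^{-1}\sum_i\mathbf 1(\mathbf Z_i\in A)$, $F_{n,k}(t|A):=\frac1{n\hat p_A}\sum_i\mathbf 1(X_{i,k}\le t,\mathbf Z_i\in A)$, $F^{-1}(u):=\inf\{t:F(t)\ge u\}$, $\overline C_n(\mathbf u|A):=\frac1{n\hat p_A}\sum_i\mathbf 1(X_{i,k}\le F^{-1}_{n,k}(u_k|A)\,\forall k,\mathbf Z_i\in A)$, $\overline{\mathbb C}_n(\mathbf u|A):=\sqrt n(\overline C_n-C)(\mathbf u|A)$. Nonparametric bootstrap: a resample $(\mathbf X^*_i,\mathbf Z^*_i)_{i\le n}$ drawn with replacement from the sample; $\overline C^*_n(\cdot|A)$ is $\overline C_n(\cdot|A)$ computed on the resample, and $\overline{\mathbb C}^*_n(\mathbf u|A):=\sqrt n(\overline C^*_n-\overline C_n)(\mathbf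 u|A)$. For $\vec{\mathbf u}=(\mathbf u_1,\dots,\mathbf u_m)$: $\vec{\mathbb C}_n(\vec{\mathbf u}|\mathcal A):=(\overline{\mathbb C}_n(\mathbf u_1|A_1),\dots,\overline{\mathbb C}_n(\mathbf u_m|A_m))$ and $\vec{\mathbb E}^*_{n,j}(\vec{\mathbf u}|\mathcal A):=(\overline{\mathbb C}^*_n(\mathbf u_1|A_1),\dots,\overline{\mathbb C}^*_n(\mathbf u_m|A_m))$ computed from the $j$-th of $M$ independent resamples (the same resample for all $A_k$). Limit: $\vec{\mathbb C}_\infty(\vec{\mathbf u}|\mathcal A):=(\mathbb C_\infty(\mathbf u_1|A_1),\dots,\mathbb C_\infty(\mathbf u_m|A_m))$, $\mathbb C_\infty(\mathbf u|A_j):=\frac{\mathbb B(\mathbf u,A_j)}{p_{A_j}}-\sum_{i=1}^p\frac{\partial_iD(\mathbf u,A_j)}{p_{A_j}^2}\big(\mathbb B((u_i,\mathbf 1_{-i}),A_j)-u_i\mathbb B(\mathbf 1,A_j)\big)-\frac{D(\mathbf u,A_j)}{p_{A_j}^2}\mathbb B(\mathbf 1,A_j)$ where $(u_i,\mathbf 1_{-i})$ has $i$-th coordinate $u_i$ and others $1$, and $(\mathbb B(\cdot,A_1),\dots,\mathbb B(\cdot,A_m))$ is jointly centered Gaussian with $\mathbb E[\mathbb B(\mathbf u,A_j)\mathbb B(\mathbf v,A_k)]=\mathbb P(\mathbf U^{A_j}\le\mathbf u,\mathbf U^{A_k}\le\mathbf v,\mathbf Z\in A_j\cap A_k)-D(\mathbf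 u,A_j)D(\mathbf v,A_k)$. *)

theory Defs
  imports "HOL-Probability.Probability"
begin

definition cube :: "(real^'p) set" where
  "cube = {u. \<forall>i. u $ i \<in> {0..1}}"

definition vupd :: "real^'p \<Rightarrow> 'p \<Rightarrow> real \<Rightarrow> real^'p" where
  "vupd u i t = (\<chi> l. if l = i then t else u $ l)"

definition onevec :: "real^'p" where
  "onevec = (\<chi> l. 1)"

definition cube_partial :: "(real^'p \<Rightarrow> real) \<Rightarrow> 'p \<Rightarrow> real^'p \<Rightarrow> real" where
  "cube_partial f i u =
     (THE d. ((\<lambda>t. f (vupd u i t)) has_real_derivative d) (at (u $ i) within {0..1}))"

definition C1_on_cube :: "(real^'p \<Rightarrow> real) \<Rightarrow> bool" where
  "C1_on_cube f \<longleftrightarrow>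
     (\<forall>i. \<forall>u\<in>cube. ((\<lambda>t. f (vupd u i t)) has_real_derivative cube_partial f i u)
                      (at (u $ i) within {0..1})) \<and>
     (\<forall>i. continuous_on cube (cube_partial f i))"

section \<open>Population quantities; Q is the law of (X,Z)\<close>

definition pA :: "((real^'p) \<times> 'z) measure \<Rightarrow> 'z set \<Rightarrow> real" where
  "pA Q A = measure Q {xz. snd xz \<in> A}"

definition condF :: "((real^'p) \<times> 'z) measure \<Rightarrow> 'z set \<Rightarrow> 'p \<Rightarrow> real \<Rightarrow> real" where
  "condF Q A k t = measure Q {xz. fst xz $ k \<le> t \<and> snd xz \<in> A} / pA Q A"

definition UA :: "((real^'p) \<times> 'z) measure \<Rightarrow> 'z set \<Rightarrow> real^'p \<Rightarrow> real^'p" where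
  "UA Q A x = (\<chi> k. condF Q A k (x $ k))"

definition Dfun :: "((real^'p) \<times> 'z) measure \<Rightarrow> 'z set \<Rightarrow> real^'p \<Rightarrow> real" where
  "Dfun Q A u = measure Q {xz. (\<forall>k. UA Q A (fst xz) $ k \<le> u $ k) \<and> snd xz \<in> A}"

text \<open>Conditional copula of X given Z in A (continuous conditional margins):
  the conditional distribution function of U^A given Z in A.\<close>
definition condcop :: "((real^'p) \<times> 'z) measure \<Rightarrow> 'z set \<Rightarrow> real^'p \<Rightarrow> real" where
  "condcop Q A u = Dfun Q A u / pA Q A"

definition Bcov :: "((real^'p) \<times> 'z) measure \<Rightarrow> 'z set \<Rightarrow> 'z set \<Rightarrow> real^'p \<Rightarrow> real^'p \<Rightarrow> real" where
  "Bcov Q A A' u v =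
     measure Q {xz. (\<forall>k. UA Q A (fst xz) $ k \<le> u $ k) \<and> (\<forall>k. UA Q A' (fst xz) $ k \<le> v $ k)
                    \<and> snd xz \<in> A \<inter> A'} - Dfun Q A u * Dfun Q A' v"

text \<open>The limit formula C_infinity(u|A) built from a path B of B(.,A).\<close>
definition Cinf_formula :: "((real^'p) \<times> 'z) measure \<Rightarrow> 'z set \<Rightarrow> (real^'p \<Rightarrow> real) \<Rightarrow> real^'p \<Rightarrow> real" where
  "Cinf_formula Q A B u =
     B u / pA Q A
     - (\<Sum>i\<in>UNIV. cube_partial (Dfun Q A) i u / (pA Q A)^2
                     * (B (vupd onevec i (u $ i)) - u $ i * B onevec))
     - Dfun Q A u / (pA Q A)^2 * B onevec"

definition phat :: "nat \<Rightarrow> (nat \<Rightarrow> (real^'p) \<times> 'z) \<Rightarrow> 'z set \<Rightarrow> real" where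
  "phat n xs A = real (card {i. i < n \<and> snd (xs i) \<in> A}) / real n"

definition Fn :: "nat \<Rightarrow> (nat \<Rightarrow> (real^'p) \<times> 'z) \<Rightarrow> 'z set \<Rightarrow> 'p \<Rightarrow> real \<Rightarrow> real" where
  "Fn n xs A k t = real (card {i. i < n \<and> fst (xs i) $ k \<le> t \<and> snd (xs i) \<in> A})
                   / (real n * phat n xs A)"

definition gen_inv :: "(real \<Rightarrow> real) \<Rightarrow> real \<Rightarrow> ereal" where
  "gen_inv F u = Inf {ereal t | t. u \<le> F t}"

definition Cbar :: "nat \<Rightarrow> (nat \<Rightarrow> (real^'p) \<times> 'z) \<Rightarrow> 'z set \<Rightarrow> real^'p \<Rightarrow> real" where
  "Cbar n xs A u =
     real (card {i. i < n \<and> (\<forall>k. ereal (fst (xs i) $ k) \<le> gen_inv (Fn n xs A k) (u $ k))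
                    \<and> snd (xs i) \<in> A}) / (real n * phat n xs A)"

definition linf_space :: "'t set \<Rightarrow> 'i set \<Rightarrow> ('t \<Rightarrow> 'i \<Rightarrow> real) set" where
  "linf_space T I = {f. (\<forall>t i. (t \<notin> T \<or> i \<notin> I) \<longrightarrow> f t i = 0) \<and>
                        (\<exists>B. \<forall>t\<in>T. \<forall>i\<in>I. \<bar>f t i\<bar> \<le> B)}"

definition linf_dist :: "'t set \<Rightarrow> 'i set \<Rightarrow> ('t \<Rightarrow> 'i \<Rightarrow> real) \<Rightarrow> ('t \<Rightarrow> 'i \<Rightarrow> real) \<Rightarrow> real" where
  "linf_dist T I f g = (SUP t\<in>T. SUP i\<in>I. \<bar>f t i - g t i\<bar>)"

definition linf_open :: "'t set \<Rightarrow> 'i set \<Rightarrow> ('t \<Rightarrow> 'i \<Rightarrow> real) set \<Rightarrow> bool" where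
  "linf_open T I U \<longleftrightarrow> U \<subseteq> linf_space T I \<and>
     (\<forall>f\<in>U. \<exists>e>0. \<forall>g\<in>linf_space T I. linf_dist T I f g < e \<longrightarrow> g \<in> U)"

definition linf_borel :: "'t set \<Rightarrow> 'i set \<Rightarrow> ('t \<Rightarrow> 'i \<Rightarrow> real) measure" where
  "linf_borel T I = sigma (linf_space T I) {U. linf_open T I U}"

definition linf_cont_bdd :: "'t set \<Rightarrow> 'i set \<Rightarrow> (('t \<Rightarrow> 'i \<Rightarrow> real) \<Rightarrow> real) \<Rightarrow> bool" where
  "linf_cont_bdd T I h \<longleftrightarrow>
     (\<exists>B. \<forall>f\<in>linf_space T I. \<bar>h f\<bar> \<le> B) \<and>
     (\<forall>f\<in>linf_space T I. \<forall>e>0. \<exists>d>0. \<forall>g\<in>linf_space T I.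
         linf_dist T I f g < d \<longrightarrow> \<bar>h g - h f\<bar> < e)"

definition outer_exp :: "'a measure \<Rightarrow> ('a \<Rightarrow> real) \<Rightarrow> real" where
  "outer_exp P Y = Inf {integral\<^sup>L P g | g. g \<in> borel_measurable P \<and> integrable P g \<and>
                                            (\<forall>\<omega>\<in>space P. Y \<omega> \<le> g \<omega>)}"

definition weak_conv_linf ::
  "'t set \<Rightarrow> 'i set \<Rightarrow> 'a measure \<Rightarrow> (nat \<Rightarrow> 'a \<Rightarrow> 't \<Rightarrow> 'i \<Rightarrow> real)
   \<Rightarrow> 'b measure \<Rightarrow> ('b \<Rightarrow> 't \<Rightarrow> 'i \<Rightarrow> real) \<Rightarrow> bool" where
  "weak_conv_linf T I P Xn Q L \<longleftrightarrow>
     (\<forall>n. \<forall>\<omega>\<in>space P. Xn n \<omega> \<in> linf_space T I) \<and>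
     L \<in> measurable Q (linf_borel T I) \<and>
     (\<forall>h. linf_cont_bdd T I h \<longrightarrow>
        (\<lambda>n. outer_exp P (\<lambda>\<omega>. h (Xn n \<omega>))) \<longlonglongrightarrow> integral\<^sup>L Q (\<lambda>\<omega>. h (L \<omega>)))"

definition centered_gaussian_family ::
  "'b measure \<Rightarrow> 's set \<Rightarrow> ('s \<Rightarrow> 'b \<Rightarrow> real) \<Rightarrow> ('s \<Rightarrow> 's \<Rightarrow> real) \<Rightarrow> bool" where
  "centered_gaussian_family Q S Y K \<longleftrightarrow>
     (\<forall>s\<in>S. Y s \<in> borel_measurable Q) \<and>
     (\<forall>F c \<theta>. finite F \<longrightarrow> F \<subseteq> S \<longrightarrow>
        char (distr Q borel (\<lambda>\<omega>. \<Sum>s\<in>F. c s * Y s \<omega>)) \<theta> =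
        complex_of_real (exp (- (\<theta>^2 / 2) * (\<Sum>s\<in>F. \<Sum>s'\<in>F. c s * c s' * K s s'))))"

text \<open>Index set [0,1]^{p(M+1)m}: vu j k is u_{j,k} (copy j \<le> M, set index k < m).\<close>
definition Tset :: "nat \<Rightarrow> nat \<Rightarrow> (nat \<Rightarrow> nat \<Rightarrow> real^'p) set" where
  "Tset M m = {vu. \<forall>j k. if j \<le> M \<and> k < m then vu j k \<in> cube else vu j k = 0}"

definition law :: "'a measure \<Rightarrow> (nat \<Rightarrow> 'a \<Rightarrow> real^'p) \<Rightarrow> (nat \<Rightarrow> 'a \<Rightarrow> 'z::topological_space)
                   \<Rightarrow> ((real^'p) \<times> 'z) measure" where
  "law P X Z = distr P borel (\<lambda>\<omega>. (X 0 \<omega>, Z 0 \<omega>))"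

definition sample :: "(nat \<Rightarrow> 'a \<Rightarrow> real^'p) \<Rightarrow> (nat \<Rightarrow> 'a \<Rightarrow> 'z) \<Rightarrow> 'a \<Rightarrow> nat \<Rightarrow> (real^'p) \<times> 'z" where
  "sample X Z \<omega> = (\<lambda>i. (X i \<omega>, Z i \<omega>))"

text \<open>The process E_{n,M,A}: component (0,k) is the empirical conditional copula process
  for A_k, component (j,k), 1 \<le> j \<le> M, the bootstrap process from the j-th resample
  (resample indices W n j l, l < n).\<close>
definition Eproc ::
  "((real^'p) \<times> 'z) measure \<Rightarrow> (nat \<Rightarrow> 'z set) \<Rightarrow> nat \<Rightarrow> nat \<Rightarrow>
   (nat \<Rightarrow> 'a \<Rightarrow> real^'p) \<Rightarrow> (nat \<Rightarrow> 'a \<Rightarrow> 'z) \<Rightarrow> (nat \<Rightarrow> nat \<Rightarrow> nat \<Rightarrow> 'a \<Rightarrow> nat) \<Rightarrow>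
   nat \<Rightarrow> 'a \<Rightarrow> (nat \<Rightarrow> nat \<Rightarrow> real^'p) \<Rightarrow> nat \<times> nat \<Rightarrow> real" where
  "Eproc Q A M m X Z W n \<omega> = (\<lambda>vu (j, k).
     if vu \<in> Tset M m \<and> j \<le> M \<and> k < m then
       (if j = 0 then
          sqrt (real n) * (Cbar n (sample X Z \<omega>) (A k) (vu 0 k) - condcop Q (A k) (vu 0 k))
        else
          sqrt (real n) * (Cbar n (\<lambda>l. sample X Z \<omega> (W n j l \<omega>)) (A k) (vu j k)
                           - Cbar n (sample X Z \<omega>) (A k) (vu j k)))
     else 0)"

text \<open>Limit: on the path space, \<omega>(j,k,u) is the j-th copy of B(u, A_k).\<close>
definition Lproc ::
  "((real^'p) \<times> 'z) measure \<Rightarrow> (nat \<Rightarrow> 'z set) \<Rightarrow> nat \<Rightarrow> nat \<Rightarrow>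
   (nat \<times> nat \<times> (real^'p) \<Rightarrow> real) \<Rightarrow> (nat \<Rightarrow> nat \<Rightarrow> real^'p) \<Rightarrow> nat \<times> nat \<Rightarrow> real" where
  "Lproc Q A M m \<omega> = (\<lambda>vu (j, k).
     if vu \<in> Tset M m \<and> j \<le> M \<and> k < m then
       Cinf_formula Q (A k) (\<lambda>u. \<omega> (j, k, u)) (vu j k)
     else 0)"

end

theory Submission
  imports Defs
begin

text \<open>Write \<open>G\<close> for the empirical process of the orthant indicators \<open>1(U\<^sup>A \<le> u, Z \<in> A)\<close> and \<open>B\<^sub>j\<close> for its
  \<open>j\<close>-th bootstrap version.  Pathwise, as soon as \<open>G\<close> is bounded and equicontinuous, the copula process
  differs from the linear image \<open>\<Phi>(G)\<close>, with \<open>\<Phi>\<close> the limit formula, by a small remainder; the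
  resampled copula process is centred at the same copula and driven by \<open>G + B\<^sub>j\<close>, so the bootstrap copula
  process is close to \<open>\<Phi>(G + B\<^sub>j) - \<Phi>(G) = \<Phi>(B\<^sub>j)\<close>.  Equicontinuity comes from an exponential bound
  for increments over dyadic links of mesh down to \<open>1/n\<close>, and from monotonicity below that scale.
  The joint finite-dimensional laws of \<open>G, B\<^sub>1, \<dots>, B\<^sub>M\<close> converge because, given the data, the
  characteristic function of \<open>B\<^sub>j\<close> is an \<open>n\<close>-th power whose distance to a Gaussian one is
  bounded deterministically.  The limit is built from independent normals by a Cholesky factorization of the
  covariance on dyadic points and extended by the same chaining.\<close>

section \<open>Cholesky factorization of countable kernels\<close>

text \<open>The space of bounded functions is not separable and the processes need not be measurable
  into it, so the proof avoids conditional weak convergence and reduces the claim to one inequality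
  for Lipschitz test functions with a measurable majorant that depends on finitely many values of
  the processes and on an exceptional event. The delta method is stated for an arbitrary sequence of
  points, without probability, so that it serves the sample and every resample alike. Resamples have
  ties even if the sample has none; ties are absorbed by the modulus of continuity of
  \<open>Gn\<close>. Differentiability up to the faces of the cube makes the first-order expansion
  uniform, so no boundary layer has to be cut off. Chaining stops near mesh 1/n because the
  exponential bounds hold only for parameters up to sqrt n. The limit lives on paths indexed by an
  uncountable cube, where the product sigma-algebra does not see continuity; its law is therefore
  put on a restricted space of paths that are uniform limits of their dyadic
  discretisations.\<close>

definition psd_kernel :: "(nat \<Rightarrow> nat \<Rightarrow> real) \<Rightarrow> bool" where
  "psd_kernel K \<longleftrightarrow> (\<forall>r s. K r s = K s r) \<and>
     (\<forall>S c. finite S \<longrightarrow> 0 \<le> (\<Sum>r\<in>S. \<Sum>s\<in>S. c r * c s * K r s))"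

text \<open>Residual kernel after eliminating the indices below \<open>i\<close>. A zero pivot makes
  the quotient 0 by the convention x / 0 = 0, so that step changes nothing; this is correct because
  a zero diagonal entry forces a zero column.\<close>

fun schur :: "(nat \<Rightarrow> nat \<Rightarrow> real) \<Rightarrow> nat \<Rightarrow> nat \<Rightarrow> nat \<Rightarrow> real" where
  "schur K 0 = K"
| "schur K (Suc i) = (\<lambda>r s. schur K i r s - schur K i r i * schur K i s i / schur K i i i)"

definition chol :: "(nat \<Rightarrow> nat \<Rightarrow> real) \<Rightarrow> nat \<Rightarrow> nat \<Rightarrow> real" where
  "chol K r i = schur K i r i / sqrt (schur K i i i)"

lemma psd_kernel_sym: "psd_kernel K \<Longrightarrow> K r s = K s r"
  by (simp add: psd_kernel_def)

lemma psd_kernel_nonneg: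
  "psd_kernel K \<Longrightarrow> finite S \<Longrightarrow> 0 \<le> (\<Sum>r\<in>S. \<Sum>s\<in>S. c r * c s * K r s)"
  unfolding psd_kernel_def by blast

lemma psd_kernel_diag: "psd_kernel K \<Longrightarrow> 0 \<le> K r r"
using psd_kernel_nonneg[of K "{r}" "\<lambda>_. 1"] by simp

text \<open>With coefficient 1 at \<open>r\<close> and \<open>t\<close> at \<open>i\<close> the
  quadratic form is affine in \<open>t\<close>; being nonnegative for every real \<open>t\<close>,
  it has slope 0.\<close>

lemma psd_kernel_zero_diag:
  assumes K: "psd_kernel K" and z: "K i i = 0"
  shows "K r i = 0"
proof (cases "r = i")
  case False
  have q: "0 \<le> K r r + 2 * t * K r i" for t
  proof -
    have "0 \<le> (\<Sum>a\<in>{r,i}. \<Sum>b\<in>{r,i}. (if a = r then 1 else t) * (if b = r then 1 else t) * K a b)"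
      by (rule psd_kernel_nonneg[OF K]) simp
    also have "\<dots> = K r r + 2 * t * K r i"
      using False z psd_kernel_sym[OF K, of i r] by simp
    finally show ?thesis .
  qed
  show ?thesis
  proof (rule ccontr)
    assume n: "K r i \<noteq> 0"
    \<comment> \<open>At this \<open>t\<close> the affine function equals -1.\<close>
    have "2 * (- (K r r + 1) / (2 * K r i)) * K r i = - (K r r + 1)" using n by simp
    then show False using q[of "- (K r r + 1) / (2 * K r i)"] by linarith
  qed
qed (use z in simp)

text \<open>The quadratic form of the residual is that of \<open>K\<close> minimised over a shift of
  the coefficient of \<open>i\<close>, so it stays nonnegative.\<close>

lemma psd_kernel_schur_step:
  assumes K: "psd_kernel K"
  shows "psd_kernel (\<lambda>r s. K r s - K r i * K s i / K i i)"
  unfolding psd_kernel_def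
proof (intro conjI allI impI)
  fix r s show "K r s - K r i * K s i / K i i = K s r - K s i * K r i / K i i"
    using psd_kernel_sym[OF K, of r s] by (simp add: mult.commute)
next
  fix S :: "nat set" and c :: "nat \<Rightarrow> real" assume S: "finite S"
  define T where "T = (\<Sum>s\<in>S. c s * K s i)"
  have T2: "(\<Sum>r\<in>S. \<Sum>s\<in>S. c r * c s * (K r i * K s i / K i i)) = T * T / K i i"
    unfolding T_def by (simp add: sum_product sum_divide_distrib mult_ac)
  have main: "(\<Sum>r\<in>S. \<Sum>s\<in>S. c r * c s * K r s) \<ge> T * T / K i i"
  proof (cases "K i i = 0")
    case True
    then show ?thesis using psd_kernel_nonneg[OF K S] by simp
  next
    case False
    define a where "a = T / K i i"
    define S' where "S' = insert i S"
    \<comment> \<open>Coefficients shifted at \<open>i\<close> by the minimiser \<open>a\<close>.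
      The index \<open>i\<close> may or may not lie in \<open>S\<close>, hence the two separate
      conditionals.\<close>
    define d where "d r = (if r \<in> S then c r else 0) - (if r = i then a else 0)" for r
    have S': "finite S'" "S \<subseteq> S'" "i \<in> S'" using S by (auto simp: S'_def)
    have lin: "(\<Sum>s\<in>S'. d s * f s) = (\<Sum>s\<in>S. c s * f s) - a * f i" for f
    proof -
      have "(\<Sum>s\<in>S'. d s * f s) = (\<Sum>s\<in>S'. (if s \<in> S then c s * f s else 0)) - (\<Sum>s\<in>S'. if s = i then a * f s else 0)"
        unfolding sum_subtractf[symmetric] by (intro sum.cong) (auto simp: d_def algebra_simps)
      also have "(\<Sum>s\<in>S'. (if s \<in> S then c s * f s else 0)) = (\<Sum>s\<in>S. c s * f s)"
        using S' by (simp add: sum.If_cases Int_absorb1 inf.absorb2)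
      also have "(\<Sum>s\<in>S'. if s = i then a * f s else 0) = a * f i"
        using S' by simp
      finally show ?thesis .
    qed
    have "0 \<le> (\<Sum>r\<in>S'. \<Sum>s\<in>S'. d r * d s * K r s)"
      by (rule psd_kernel_nonneg[OF K S'(1)])
    also have "\<dots> = (\<Sum>r\<in>S'. d r * (\<Sum>s\<in>S'. d s * K r s))"
      by (simp add: sum_distrib_left mult_ac)
    also have "\<dots> = (\<Sum>r\<in>S. c r * ((\<Sum>s\<in>S. c s * K r s) - a * K r i)) - a * ((\<Sum>s\<in>S. c s * K i s) - a * K i i)"
      by (simp add: lin)
    also have "(\<Sum>s\<in>S. c s * K i s) = T"
      unfolding T_def using psd_kernel_sym[OF K] by (intro sum.cong) auto
    also have "(\<Sum>r\<in>S. c r * ((\<Sum>s\<in>S. c s * K r s) - a * K r i)) = (\<Sum>r\<in>S. \<Sum>s\<in>S. c r * c s * K r s) - a * T"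
      by (simp add: T_def sum_distrib_left sum_subtractf right_diff_distrib mult_ac)
    also have "a * K i i = T" using False by (simp add: a_def)
    finally show ?thesis by (simp add: a_def)
  qed
  show "0 \<le> (\<Sum>r\<in>S. \<Sum>s\<in>S. c r * c s * (K r s - K r i * K s i / K i i))"
    using main T2 by (simp add: right_diff_distrib sum_subtractf)
qed

lemma psd_kernel_schur: "psd_kernel K \<Longrightarrow> psd_kernel (schur K i)"
  by (induction i) (auto intro: psd_kernel_schur_step)

text \<open>Eliminating \<open>i\<close> kills its column, by cancellation or by a zero pivot. Later
  steps keep it zero: their correction contains the factor \<open>schur K j i j\<close>, which
  vanishes by symmetry.\<close>

lemma schur_eq_0:
  assumes K: "psd_kernel K" and "i < j"
  shows "schur K j r i = 0"
  using \<open>i < j\<close>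
proof (induction j arbitrary: r)
  case (Suc j)
  have P: "psd_kernel (schur K j)" by (rule psd_kernel_schur[OF K])
  show ?case
  proof (cases "i = j")
    case True
    then show ?thesis
      using psd_kernel_zero_diag[OF P, of j r] by (cases "schur K j j j = 0") auto
  next
    case False
    then have z: "schur K j r i = 0" for r using Suc by simp
    have "schur K j i j = schur K j j i" by (rule psd_kernel_sym[OF P])
    then show ?thesis using z by simp
  qed
qed simp

lemma chol_eq_0: "psd_kernel K \<Longrightarrow> r < i \<Longrightarrow> chol K r i = 0"
  using schur_eq_0[of K r i i] psd_kernel_sym[OF psd_kernel_schur, of K i r i] by (simp add: chol_def)

lemma schur_decomposition:
  assumes K: "psd_kernel K"
  shows "K r s = (\<Sum>i<n. chol K r i * chol K s i) + schur K n r s"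
proof (induction n)
  case (Suc n)
  have "chol K r n * chol K s n = schur K n r n * schur K n s n / schur K n n n"
    using psd_kernel_diag[OF psd_kernel_schur[OF K, of n], of n]
    by (simp add: chol_def real_sqrt_mult_self)
  then show ?case using Suc by simp
qed simp

text \<open>The residual vanishes once one of the two indices has been eliminated, so a bound on
  \<open>r\<close> alone is enough and the factorization is a finite sum.\<close>

theorem cholesky:
  assumes K: "psd_kernel K" and "r < n"
  shows "(\<Sum>i<n. chol K r i * chol K s i) = K r s"
proof -
  have "schur K n r s = schur K n s r" by (rule psd_kernel_sym[OF psd_kernel_schur[OF K]])
  then show ?thesis using schur_decomposition[OF K, of r s n] schur_eq_0[OF K \<open>r < n\<close>, of s] by simp
qed

section \<open>Weak convergence of finite-dimensional vectors\<close>

text \<open>The error part of the majorants below: a small constant, plus a large constant on an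
  event of small probability.\<close>

lemma (in prob_space) affine_indicator:
  fixes a b :: real
  assumes A: "A \<in> events"
  shows integrable_affine_indicator: "integrable M (\<lambda>\<omega>. a + b * indicator A \<omega>)"
    and expectation_affine_indicator: "expectation (\<lambda>\<omega>. a + b * indicator A \<omega>) = a + b * prob A"
proof -
  have i: "integrable M (\<lambda>\<omega>. indicator A \<omega> :: real)"
    using A by (intro integrable_real_indicator) (auto simp: emeasure_eq_measure)
  then show "integrable M (\<lambda>\<omega>. a + b * indicator A \<omega>)" by simp
  have "expectation (\<lambda>\<omega>. a + b * indicator A \<omega>) = a + b * expectation (\<lambda>\<omega>. indicator A \<omega>)"
    using i by (subst Bochner_Integration.integral_add) (auto simp: prob_space)
  then show "expectation (\<lambda>\<omega>. a + b * indicator A \<omega>) = a + b * prob A"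
    using A by (simp add: Int_absorb2 sets.sets_into_space)
qed

text \<open>The phase \<open>b\<close> makes constants and sines instances of the cosine rule, and
  product-to-sum formulas close the class under multiplication. So it is an algebra, and convergence
  of expectations on it is what characteristic functions provide.\<close>

inductive trig_poly :: "'s set \<Rightarrow> (('s \<Rightarrow> real) \<Rightarrow> real) \<Rightarrow> bool" for F where
  cos: "trig_poly F (\<lambda>x. a * cos ((\<Sum>s\<in>F. t s * x s) + b))"
| add: "trig_poly F p \<Longrightarrow> trig_poly F q \<Longrightarrow> trig_poly F (\<lambda>x. p x + q x)"

lemma trig_poly_const: "trig_poly F (\<lambda>x. c)"
  using trig_poly.cos[of F c "\<lambda>_. 0" 0] by simp

lemma trig_poly_mult:
  assumes "trig_poly F p" "trig_poly F q"
  shows "trig_poly F (\<lambda>x. p x * q x)"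
  using assms
proof (induction rule: trig_poly.induct)
  case (cos a t b)
  note c = cos
  from c show ?case
  proof (induction rule: trig_poly.induct)
    case (cos a' t' b')
    have "(\<lambda>x. (a * cos ((\<Sum>s\<in>F. t s * x s) + b)) * (a' * cos ((\<Sum>s\<in>F. t' s * x s) + b')))
        = (\<lambda>x. (a * a' / 2) * cos ((\<Sum>s\<in>F. (t s - t' s) * x s) + (b - b'))
             + (a * a' / 2) * cos ((\<Sum>s\<in>F. (t s + t' s) * x s) + (b + b')))"
    proof
      fix x
      have e1: "(\<Sum>s\<in>F. (t s - t' s) * x s) + (b - b') = ((\<Sum>s\<in>F. t s * x s) + b) - ((\<Sum>s\<in>F. t' s * x s) + b')"
        by (simp add: left_diff_distrib sum_subtractf)
      have e2: "(\<Sum>s\<in>F. (t s + t' s) * x s) + (b + b') = ((\<Sum>s\<in>F. t s * x s) + b) + ((\<Sum>s\<in>F. t' s * x s) + b')"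
        by (simp add: distrib_right sum.distrib)
      show "(a * cos ((\<Sum>s\<in>F. t s * x s) + b)) * (a' * cos ((\<Sum>s\<in>F. t' s * x s) + b'))
        = (a * a' / 2) * cos ((\<Sum>s\<in>F. (t s - t' s) * x s) + (b - b'))
             + (a * a' / 2) * cos ((\<Sum>s\<in>F. (t s + t' s) * x s) + (b + b'))"
        unfolding e1 e2 cos_add cos_diff by (simp add: algebra_simps)
    qed
    then show ?case by (simp only:) (intro trig_poly.intros)
  next
    case (add p q)
    then show ?case by (simp add: distrib_left trig_poly.add)
  qed
next
  case (add p q')
  then show ?case by (simp add: distrib_right trig_poly.add)
qed

lemma trig_poly_real_polynomial:
  fixes q :: "real \<Rightarrow> real"
  assumes "real_polynomial_function q" "trig_poly F p"
  shows "trig_poly F (\<lambda>x. q (p x))"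
  using assms(1)
proof (induction rule: real_polynomial_function.induct)
  case (linear f)
  then have "f y = f 1 * y" for y
    by (metis bounded_linear.axioms(1) linear_scale mult.commute mult.right_neutral real_scaleR_def)
  then have "(\<lambda>x. f (p x)) = (\<lambda>x. f 1 * p x)" by (rule_tac ext) blast
  then show ?case using trig_poly_mult[OF trig_poly_const assms(2), of "f 1"] by metis
qed (auto intro: trig_poly_const trig_poly_mult trig_poly.add)

lemma trig_poly_bounded: "trig_poly F p \<Longrightarrow> \<exists>B. \<forall>x. \<bar>p x\<bar> \<le> B"
proof (induction rule: trig_poly.induct)
  case (cos a t b)
  show ?case by (rule exI[of _ "\<bar>a\<bar>"]) (auto simp: abs_mult intro: mult_left_le)
next
  case (add p q)
  then obtain B C where "\<forall>x. \<bar>p x\<bar> \<le> B" "\<forall>x. \<bar>q x\<bar> \<le> C" by auto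
  then have "\<forall>x. \<bar>p x + q x\<bar> \<le> B + C" by (meson abs_triangle_ineq add_mono order_trans)
  then show ?case by blast
qed

lemma continuous_on_coordinate: "continuous_on S (\<lambda>x::'s \<Rightarrow> real. x s)"
  by (rule continuous_on_subset[OF continuous_on_product_coordinates]) simp

lemma trig_poly_continuous:
  fixes p :: "('s::countable \<Rightarrow> real) \<Rightarrow> real"
  shows "trig_poly F p \<Longrightarrow> continuous_on S p"
  by (induction rule: trig_poly.induct) (auto intro!: continuous_intros continuous_on_coordinate)

text \<open>A finite-dimensional Cramer--Wold device. Stone--Weierstrass is used twice: trigonometric
  polynomials approximate a test function on a large box, and composing with a polynomial
  approximation of a truncation keeps the approximant bounded outside of the box.\<close>

lemma trig_poly_approx:
  fixes g :: "('s::countable \<Rightarrow> real) \<Rightarrow> real"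
  assumes F: "finite F" and cont: "continuous_on UNIV g" and B: "\<And>x. \<bar>g x\<bar> \<le> B"
    and R: "R \<ge> 0" and e: "e > 0"
  obtains p where "trig_poly F p" "\<And>x. \<bar>p x\<bar> \<le> B + e"
    "\<And>x. \<forall>s\<in>F. \<bar>x s\<bar> \<le> R \<Longrightarrow> \<forall>s. s \<notin> F \<longrightarrow> x s = 0 \<Longrightarrow> \<bar>g x - p x\<bar> \<le> e"
proof -
  \<comment> \<open>Coordinates outside \<open>F\<close> are pinned to 0: the box becomes compact,
    and functions of the coordinates in \<open>F\<close> separate its points.\<close>
  define K where "K = Pi\<^sub>E UNIV (\<lambda>s. if s \<in> F then {-R..R} else {0::real})"
  have K_iff: "x \<in> K \<longleftrightarrow> (\<forall>s\<in>F. \<bar>x s\<bar> \<le> R) \<and> (\<forall>s. s \<notin> F \<longrightarrow> x s = 0)" for x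
    by (auto simp: K_def PiE_iff abs_le_iff split: if_splits)
  have compK: "compact K"
  proof -
    have "compactin (product_topology (\<lambda>i. euclidean) UNIV) K"
      unfolding K_def compactin_PiE by (auto simp: compactin_euclidean_iff)
    then show ?thesis by (simp add: euclidean_product_topology)
  qed
  have sep: "\<exists>f. trig_poly F f \<and> f x \<noteq> f y" if xy: "x \<in> K" "y \<in> K" "x \<noteq> y" for x y
  proof -
    obtain s where s: "s \<in> F" "x s \<noteq> y s" using xy K_iff by (metis ext)
    \<comment> \<open>Scales the box into [-1, 1], inside the interval where the sine is injective;
      the phase -pi/2 below turns the cosine into that sine.\<close>
    define t where "t = 1 / (R + 1)"
    have t: "t > 0" using R by (simp add: t_def)
    have b: "\<bar>t * z\<bar> \<le> 1" if "\<bar>z\<bar> \<le> R" for z using that R by (simp add: t_def abs_mult field_simps)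
    define f where "f z = 1 * cos ((\<Sum>u\<in>F. (if u = s then t else 0) * z u) + - (pi/2))" for z :: "'s \<Rightarrow> real"
    have f: "f z = sin (t * z s)" for z
    proof -
      have "(\<Sum>u\<in>F. (if u = s then t else 0) * z u) = (\<Sum>u\<in>F. if u = s then t * z u else 0)"
        by (intro sum.cong) auto
      also have "\<dots> = t * z s" using F s by simp
      finally show ?thesis by (simp add: f_def cos_diff)
    qed
    have "sin (t * x s) \<noteq> sin (t * y s)"
    proof
      assume eq: "sin (t * x s) = sin (t * y s)"
      have "1 \<le> pi / 2" using pi_ge_two by simp
      then have "\<bar>t * x s\<bar> \<le> pi/2" "\<bar>t * y s\<bar> \<le> pi/2"
        using b[of "x s"] b[of "y s"] xy s K_iff by force+
      then have "- (pi/2) \<le> t * x s" "t * x s \<le> pi/2" "- (pi/2) \<le> t * y s" "t * y s \<le> pi/2" by linarith+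
      then have "t * x s = t * y s" using eq by (rule sin_inj_pi)
      then show False using t s by simp
    qed
    moreover have "trig_poly F f" unfolding f_def by (rule trig_poly.cos)
    ultimately show ?thesis using f by metis
  qed
  have "\<exists>p. trig_poly F p \<and> (\<forall>x\<in>K. \<bar>g x - p x\<bar> < e/2)"
    by (rule Stone_Weierstrass_HOL[OF compK])
       (use sep e in \<open>auto intro: trig_poly_const trig_poly.add trig_poly_mult trig_poly_continuous
          continuous_on_subset[OF cont]\<close>)
  then obtain p where p: "trig_poly F p" "\<And>x. x \<in> K \<Longrightarrow> \<bar>g x - p x\<bar> < e/2" by auto
  obtain C where C: "\<And>x. \<bar>p x\<bar> \<le> C" using trig_poly_bounded[OF p(1)] by auto
  \<comment> \<open>Clipping to the range of \<open>g\<close> does not increase the distance to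
    \<open>g\<close>; a polynomial close to the clipping on the whole range of \<open>p\<close>
    keeps the composite bounded off the box.\<close>
  define \<phi> where "\<phi> y = max (-B) (min B y)" for y :: real
  have B0: "B \<ge> 0" using B[of undefined] by linarith
  have "continuous_on {-C..C} \<phi>" unfolding \<phi>_def by (intro continuous_intros)
  then obtain q where q: "real_polynomial_function q" "\<And>y. y \<in> {-C..C} \<Longrightarrow> \<bar>\<phi> y - q y\<bar> < e/2"
    using Stone_Weierstrass_real_polynomial_function[of "{-C..C}" \<phi> "e/2"] e by auto
  show ?thesis
  proof
    show "trig_poly F (\<lambda>x. q (p x))" by (rule trig_poly_real_polynomial[OF q(1) p(1)])
    have pC: "p x \<in> {-C..C}" for x using C[of x] by (simp add: abs_le_iff)
    show "\<bar>q (p x)\<bar> \<le> B + e" for x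
    proof -
      have "\<bar>\<phi> (p x)\<bar> \<le> B" using B0 by (auto simp: \<phi>_def)
      then show ?thesis using q(2)[OF pC[of x]] e by linarith
    qed
    show "\<bar>g x - q (p x)\<bar> \<le> e" if "\<forall>s\<in>F. \<bar>x s\<bar> \<le> R" "\<forall>s. s \<notin> F \<longrightarrow> x s = 0" for x
    proof -
      have "x \<in> K" using that K_iff by auto
      then have "\<bar>g x - p x\<bar> < e/2" by (rule p)
      moreover have "\<bar>g x - \<phi> (p x)\<bar> \<le> \<bar>g x - p x\<bar>"
        using B[of x] by (auto simp: \<phi>_def max_def min_def abs_if split: if_splits)
      ultimately show ?thesis using q(2)[OF pC[of x]] by linarith
    qed
  qed
qed

theorem cramer_wold_finite:
  fixes V :: "nat \<Rightarrow> 'a \<Rightarrow> 's::countable \<Rightarrow> real" and V0 :: "'b \<Rightarrow> 's \<Rightarrow> real"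
    and g :: "('s \<Rightarrow> real) \<Rightarrow> real"
  assumes P: "prob_space P" and R: "prob_space R" and F: "finite F"
    and mV: "\<And>n s. (\<lambda>\<omega>. V n \<omega> s) \<in> borel_measurable P"
    and mV0: "\<And>s. (\<lambda>\<omega>. V0 \<omega> s) \<in> borel_measurable R"
    and zV: "\<And>n \<omega> s. s \<notin> F \<Longrightarrow> V n \<omega> s = 0" and zV0: "\<And>\<omega> s. s \<notin> F \<Longrightarrow> V0 \<omega> s = 0"
    and tight: "\<And>e. e > 0 \<Longrightarrow> \<exists>r\<ge>0. \<forall>\<^sub>F n in sequentially. measure P {\<omega>\<in>space P. \<exists>s\<in>F. \<bar>V n \<omega> s\<bar> > r} \<le> e"
    and tight0: "\<And>e. e > 0 \<Longrightarrow> \<exists>r\<ge>0. measure R {\<omega>\<in>space R. \<exists>s\<in>F. \<bar>V0 \<omega> s\<bar> > r} \<le> e"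
    and conv: "\<And>t b. (\<lambda>n. \<integral>\<omega>. cos ((\<Sum>s\<in>F. t s * V n \<omega> s) + b) \<partial>P)
                       \<longlonglongrightarrow> (\<integral>\<omega>. cos ((\<Sum>s\<in>F. t s * V0 \<omega> s) + b) \<partial>R)"
    and cont: "continuous_on UNIV g" and B: "\<And>x. \<bar>g x\<bar> \<le> B"
  shows "(\<lambda>n. \<integral>\<omega>. g (V n \<omega>) \<partial>P) \<longlonglongrightarrow> (\<integral>\<omega>. g (V0 \<omega>) \<partial>R)"
proof -
  interpret P: prob_space P by fact
  interpret R: prob_space R by fact
  have [measurable]: "V n \<in> borel_measurable P" "V0 \<in> borel_measurable R" for n
    by (intro measurable_coordinatewise_then_product mV mV0)+
  note [measurable] = mV mV0
  have [measurable]: "g \<in> borel_measurable borel" by (rule borel_measurable_continuous_onI[OF cont])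
  have trig_meas: "p \<in> borel_measurable borel" if "trig_poly F p" for p :: "('s \<Rightarrow> real) \<Rightarrow> real"
    by (rule borel_measurable_continuous_onI[OF trig_poly_continuous[OF that]])
  have trig_int: "integrable P (\<lambda>\<omega>. p (V n \<omega>))" "integrable R (\<lambda>\<omega>. p (V0 \<omega>))"
    if p: "trig_poly F p" for p :: "('s \<Rightarrow> real) \<Rightarrow> real" and n
  proof -
    note [measurable] = trig_meas[OF p]
    obtain C where "\<And>x. \<bar>p x\<bar> \<le> C" using trig_poly_bounded[OF p] by auto
    then show "integrable P (\<lambda>\<omega>. p (V n \<omega>))" "integrable R (\<lambda>\<omega>. p (V0 \<omega>))"
      by (auto intro!: P.integrable_const_bound[where B=C] R.integrable_const_bound[where B=C])
  qed
  have trig_conv: "(\<lambda>n. \<integral>\<omega>. p (V n \<omega>) \<partial>P) \<longlonglongrightarrow> (\<integral>\<omega>. p (V0 \<omega>) \<partial>R)" if "trig_poly F p" for p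
    using that
  proof (induction rule: trig_poly.induct)
    case (cos a t b)
    show ?case using tendsto_mult_left[OF conv, of a t b] by simp
  next
    case (add p q)
    then show ?case using trig_int by (simp add: tendsto_add)
  qed
  have g_int: "integrable P (\<lambda>\<omega>. g (V n \<omega>))" "integrable R (\<lambda>\<omega>. g (V0 \<omega>))" for n
    using B by (auto intro!: P.integrable_const_bound[where B=B] R.integrable_const_bound[where B=B])
  have B0: "B \<ge> 0" using B[of undefined] by linarith
  \<comment> \<open>On the box the error is at most \<open>e\<close>; off it the two sup bounds give
    \<open>2 * B + e\<close>, paid only with the tail probability. The measure is general because
    the estimate serves both \<open>P\<close> and \<open>R\<close>.\<close>
  have close: "\<bar>(\<integral>\<omega>. g (U \<omega>) \<partial>N) - (\<integral>\<omega>. p (U \<omega>) \<partial>N)\<bar> \<le> e + (2 * B + e) * measure N {\<omega>\<in>space N. \<exists>s\<in>F. \<bar>U \<omega> s\<bar> > r}"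
    if N: "prob_space N" and p: "\<And>x. \<bar>p x\<bar> \<le> B + e" and e: "e > 0"
      and ap: "\<And>x. \<forall>s\<in>F. \<bar>x s\<bar> \<le> r \<Longrightarrow> \<forall>s. s \<notin> F \<longrightarrow> x s = 0 \<Longrightarrow> \<bar>g x - p x\<bar> \<le> e"
      and ig: "integrable N (\<lambda>\<omega>. g (U \<omega>))" and ip: "integrable N (\<lambda>\<omega>. p (U \<omega>))"
      and mU: "\<And>s. (\<lambda>\<omega>. U \<omega> s) \<in> borel_measurable N" and zU: "\<And>\<omega> s. s \<notin> F \<Longrightarrow> U \<omega> s = 0"
    for N :: "'c measure" and U :: "'c \<Rightarrow> 's \<Rightarrow> real" and p e r
  proof -
    interpret N: prob_space N by fact
    note [measurable] = mU
    define A where "A = {\<omega>\<in>space N. \<exists>s\<in>F. \<bar>U \<omega> s\<bar> > r}"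
    have [measurable]: "A \<in> sets N" unfolding A_def using F by measurable
    have "\<bar>(\<integral>\<omega>. g (U \<omega>) \<partial>N) - (\<integral>\<omega>. p (U \<omega>) \<partial>N)\<bar> = \<bar>\<integral>\<omega>. g (U \<omega>) - p (U \<omega>) \<partial>N\<bar>"
      using ig ip by simp
    also have "\<dots> \<le> (\<integral>\<omega>. \<bar>g (U \<omega>) - p (U \<omega>)\<bar> \<partial>N)" by (rule integral_abs_bound)
    also have "\<dots> \<le> (\<integral>\<omega>. e + (2 * B + e) * indicator A \<omega> \<partial>N)"
    proof (rule integral_mono)
      fix \<omega> assume w: "\<omega> \<in> space N"
      show "\<bar>g (U \<omega>) - p (U \<omega>)\<bar> \<le> e + (2 * B + e) * indicator A \<omega>"
      proof (cases "\<omega> \<in> A")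
        case True
        then show ?thesis using B[of "U \<omega>"] p[of "U \<omega>"] e by simp
      next
        case False
        then have "\<bar>U \<omega> s\<bar> \<le> r" if "s \<in> F" for s using w that by (force simp: A_def)
        then show ?thesis using False ap[of "U \<omega>"] zU by simp
      qed
    next
      show "integrable N (\<lambda>\<omega>. e + (2 * B + e) * indicator A \<omega>)"
        by (rule N.integrable_affine_indicator) measurable
    qed (use ig ip in auto)
    also have "\<dots> = e + (2 * B + e) * measure N A"
      by (rule N.expectation_affine_indicator) measurable
    finally show ?thesis by (simp add: A_def)
  qed
  show ?thesis
  proof (rule LIMSEQ_I)
    fix d :: real assume d: "d > 0"
    \<comment> \<open>As e \<le> 1, the error \<open>e + (2*B + e) * e\<close> is at most e (2B +
      3), hence at most d/4; three pieces of that size stay below \<open>d\<close>.\<close>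
    define e where "e = min 1 (d / (4 * (2 * B + 3)))"
    have e: "e > 0" "e \<le> 1" using d B0 by (auto simp: e_def)
    have ed: "e + (2*B + e) * e \<le> d / 4"
    proof -
      have "e + (2*B + e) * e \<le> e * (2 * B + 3)" using e by (simp add: algebra_simps)
      also have "\<dots> \<le> (d / (4 * (2 * B + 3))) * (2 * B + 3)"
        using B0 by (intro mult_right_mono) (auto simp: e_def)
      also have "\<dots> = d / 4" using B0 by (simp add: field_simps)
      finally show ?thesis .
    qed
    obtain r1 where r1: "r1 \<ge> 0" "\<forall>\<^sub>F n in sequentially. measure P {\<omega>\<in>space P. \<exists>s\<in>F. \<bar>V n \<omega> s\<bar> > r1} \<le> e" using tight e by blast
    obtain r2 where r2: "r2 \<ge> 0" "measure R {\<omega>\<in>space R. \<exists>s\<in>F. \<bar>V0 \<omega> s\<bar> > r2} \<le> e" using tight0 e by blast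
    define r where "r = max r1 r2"
    have r0: "0 \<le> r" using r1(1) by (simp add: r_def)
    obtain p where p: "trig_poly F p" "\<And>x. \<bar>p x\<bar> \<le> B + e"
      "\<And>x. \<forall>s\<in>F. \<bar>x s\<bar> \<le> r \<Longrightarrow> \<forall>s. s \<notin> F \<longrightarrow> x s = 0 \<Longrightarrow> \<bar>g x - p x\<bar> \<le> e"
      by (rule trig_poly_approx[OF F cont B r0 e(1)]) blast
    have t2: "measure R {\<omega>\<in>space R. \<exists>s\<in>F. \<bar>V0 \<omega> s\<bar> > r} \<le> e"
      by (rule order_trans[OF R.finite_measure_mono r2(2)]) (use F in \<open>auto simp: r_def\<close>)
    have t1: "\<forall>\<^sub>F n in sequentially. measure P {\<omega>\<in>space P. \<exists>s\<in>F. \<bar>V n \<omega> s\<bar> > r} \<le> e"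
      using r1(2)
    proof eventually_elim
      case (elim n)
      show ?case by (rule order_trans[OF P.finite_measure_mono elim]) (use F in \<open>auto simp: r_def\<close>)
    qed
    have c0: "\<bar>(\<integral>\<omega>. g (V0 \<omega>) \<partial>R) - (\<integral>\<omega>. p (V0 \<omega>) \<partial>R)\<bar> \<le> d/4"
    proof -
      have "\<bar>(\<integral>\<omega>. g (V0 \<omega>) \<partial>R) - (\<integral>\<omega>. p (V0 \<omega>) \<partial>R)\<bar> \<le> e + (2 * B + e) * measure R {\<omega>\<in>space R. \<exists>s\<in>F. \<bar>V0 \<omega> s\<bar> > r}"
        by (rule close) (use p e R g_int trig_int mV0 zV0 in auto)
      also have "\<dots> \<le> e + (2*B+e) * e" using t2 B0 e by (intro add_left_mono mult_left_mono) auto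
      finally show ?thesis using ed by linarith
    qed
    have "\<forall>\<^sub>F n in sequentially. \<bar>(\<integral>\<omega>. p (V n \<omega>) \<partial>P) - (\<integral>\<omega>. p (V0 \<omega>) \<partial>R)\<bar> < d/4"
      using tendstoD[OF trig_conv[OF p(1)], of "d/4"] d by (simp add: dist_real_def)
    with t1 have "\<forall>\<^sub>F n in sequentially. \<bar>(\<integral>\<omega>. g (V n \<omega>) \<partial>P) - (\<integral>\<omega>. g (V0 \<omega>) \<partial>R)\<bar> < d"
    proof eventually_elim
      case (elim n)
      have "\<bar>(\<integral>\<omega>. g (V n \<omega>) \<partial>P) - (\<integral>\<omega>. p (V n \<omega>) \<partial>P)\<bar> \<le> e + (2 * B + e) * measure P {\<omega>\<in>space P. \<exists>s\<in>F. \<bar>V n \<omega> s\<bar> > r}"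
        by (rule close) (use p e P g_int trig_int mV zV in auto)
      also have "\<dots> \<le> e + (2*B+e) * e" using elim B0 e by (intro add_left_mono mult_left_mono) auto
      finally show ?case using ed c0 elim d by linarith
    qed
    then show "\<exists>no. \<forall>n\<ge>no. norm ((\<integral>\<omega>. g (V n \<omega>) \<partial>P) - (\<integral>\<omega>. g (V0 \<omega>) \<partial>R)) < d"
      by (simp add: eventually_sequentially)
  qed
qed

section \<open>Characteristic functions of normalized sums\<close>

lemma exp_minus_quadratic:
  fixes x :: real
  assumes "0 \<le> x"
  shows "\<bar>exp (-x) - (1 - x)\<bar> \<le> x\<^sup>2"
proof -
  have "1 + x \<le> exp x" by (rule exp_ge_add_one_self)
  then have "exp (-x) \<le> 1 / (1 + x)" using assms by (simp add: exp_minus field_simps)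
  also have "\<dots> \<le> 1 - x + x\<^sup>2"
    using assms by (simp add: field_simps power2_eq_square)
  finally have "exp (-x) \<le> 1 - x + x\<^sup>2" .
  moreover have "1 - x \<le> exp (-x)" using exp_ge_add_one_self[of "-x"] by simp
  ultimately show ?thesis by (simp add: abs_le_iff)
qed

lemma exp_le_quadratic:
  fixes x :: real
  assumes "\<bar>x\<bar> \<le> 1"
  shows "exp x \<le> 1 + x + x\<^sup>2"
proof (cases "0 \<le> x")
  case True
  then show ?thesis using assms exp_bound[of x] by simp
next
  case False
  define y where "y = -x"
  have y: "0 \<le> y" using False by (simp add: y_def)
  have "1 + y \<le> exp y" by (rule exp_ge_add_one_self)
  then have "exp (-y) \<le> 1 / (1 + y)" using y by (simp add: exp_minus field_simps)
  also have "\<dots> \<le> 1 - y + y\<^sup>2"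
    using y by (simp add: field_simps power2_eq_square)
  finally show ?thesis by (simp add: y_def)
qed

lemma exp_le_linear:
  fixes x :: real
  assumes "0 \<le> x" "x \<le> 1"
  shows "exp x \<le> 1 + 2 * x"
proof -
  have "x * x \<le> x * 1" using assms by (intro mult_left_mono) auto
  then show ?thesis using exp_le_quadratic[of x] assms by (simp add: power2_eq_square)
qed

lemma iexp_quadratic:
  "cmod (exp (\<i> * complex_of_real x) - (1 + \<i> * complex_of_real x - complex_of_real (x\<^sup>2 / 2))) \<le> \<bar>x\<bar> ^ 3"
proof -
  have "(\<Sum>k\<le>2. (\<i> * complex_of_real x) ^ k / fact k) = 1 + \<i> * complex_of_real x - complex_of_real (x\<^sup>2 / 2)"
    by (simp add: numeral_2_eq_2 power2_eq_square complex_eq_iff)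
  then have "cmod (exp (\<i> * complex_of_real x) - (1 + \<i> * complex_of_real x - complex_of_real (x\<^sup>2 / 2))) \<le> \<bar>x\<bar> ^ 3 / fact 3"
    using iexp_approx1[of x 2] by (simp add: numeral_3_eq_3)
  also have "\<dots> \<le> \<bar>x\<bar> ^ 3" by (simp add: fact_numeral)
  finally show ?thesis .
qed

text \<open>A central limit theorem whose error depends on the bound \<open>K\<close> and on
  \<open>n\<close> only. This uniformity is what allows the same estimate for the random empirical
  distribution of a sample.\<close>

lemma (in prob_space) iexp_power_approx:
  assumes f[measurable]: "f \<in> borel_measurable M" and K: "\<And>x. x \<in> space M \<Longrightarrow> \<bar>f x\<bar> \<le> K"
    and mean: "expectation f = 0" and n: "n > 0"
  shows "cmod ((\<integral>x. exp (\<i> * complex_of_real (f x / sqrt (real n))) \<partial>M) ^ n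
           - complex_of_real (exp (- expectation (\<lambda>x. (f x)\<^sup>2) / 2))) \<le> (K ^ 3 + K ^ 4) / sqrt (real n)"
proof -
  define s where "s = sqrt (real n)"
  have s: "s > 0" "s\<^sup>2 = real n" using n by (auto simp: s_def)
  have s1: "s \<ge> 1" using n by (simp add: s_def)
  define v where "v = expectation (\<lambda>x. (f x)\<^sup>2)"
  have K0: "K \<ge> 0" using not_empty K by force
  have f2: "(f x)\<^sup>2 \<le> K\<^sup>2" if "x \<in> space M" for x
    using power_mono[OF K[OF that], of 2] by simp
  have intf: "integrable M f" by (rule integrable_const_bound[where B=K]) (auto simp: K)
  have intf2: "integrable M (\<lambda>x. (f x)\<^sup>2)" by (rule integrable_const_bound[where B="K\<^sup>2"]) (auto simp: f2)
  have v: "0 \<le> v" "v \<le> K\<^sup>2"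
    unfolding v_def by (auto intro!: integral_nonneg integral_le_const intf2 AE_I2 f2)
  define e where "e x = exp (\<i> * complex_of_real (f x / s))" for x
  define q where "q x = 1 + \<i> * complex_of_real (f x / s) - complex_of_real ((f x / s)\<^sup>2 / 2)" for x
  have inte: "integrable M e" unfolding e_def by (rule integrable_const_bound[where B=1]) auto
  have if1: "integrable M (\<lambda>x. complex_of_real (f x / s))" using intf by simp
  have if2: "integrable M (\<lambda>x. complex_of_real ((f x / s)\<^sup>2 / 2))" by (intro integrable_of_real) (simp add: power_divide intf2)
  have intq: "integrable M q" unfolding q_def
    by (intro Bochner_Integration.integrable_add Bochner_Integration.integrable_diff integrable_mult_right if1 if2) auto
  have Iq: "(\<integral>x. q x \<partial>M) = complex_of_real (1 - v / (2 * real n))"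
  proof -
    have a: "(\<integral>x. complex_of_real (f x / s) \<partial>M) = 0"
      unfolding integral_complex_of_real using mean by simp
    have b: "(\<integral>x. complex_of_real ((f x / s)\<^sup>2 / 2) \<partial>M) = complex_of_real (v / (2 * real n))"
      unfolding integral_complex_of_real using s(2) by (simp add: power_divide v_def mult.commute)
    have "(\<integral>x. q x \<partial>M) = (\<integral>x. 1 + \<i> * complex_of_real (f x / s) \<partial>M) - (\<integral>x. complex_of_real ((f x / s)\<^sup>2 / 2) \<partial>M)"
      unfolding q_def
      by (intro Bochner_Integration.integral_diff Bochner_Integration.integrable_add integrable_mult_right if1 if2) auto
    also have "(\<integral>x. 1 + \<i> * complex_of_real (f x / s) \<partial>M) = 1 + \<i> * (\<integral>x. complex_of_real (f x / s) \<partial>M)"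
      by (subst Bochner_Integration.integral_add) (use integrable_mult_right[OF if1, of \<i>] in \<open>simp_all add: prob_space\<close>)
    finally show ?thesis unfolding a b by simp
  qed
  have d1: "cmod ((\<integral>x. e x \<partial>M) - complex_of_real (1 - v / (2 * real n))) \<le> (K / s) ^ 3"
  proof -
    have "cmod ((\<integral>x. e x \<partial>M) - complex_of_real (1 - v / (2 * real n))) = cmod (\<integral>x. e x - q x \<partial>M)"
      using inte intq Iq by simp
    also have "\<dots> \<le> (\<integral>x. cmod (e x - q x) \<partial>M)" by (rule integral_norm_bound)
    also have "\<dots> \<le> (\<integral>x. (K / s) ^ 3 \<partial>M)"
    proof (rule integral_mono)
      show "cmod (e x - q x) \<le> (K / s) ^ 3" if "x \<in> space M" for x
      proof -
        have "cmod (e x - q x) \<le> \<bar>f x / s\<bar> ^ 3" unfolding e_def q_def by (rule iexp_quadratic)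
        also have "\<dots> \<le> (K / s) ^ 3"
          using K[OF that] s by (intro power_mono) (auto simp: abs_divide divide_right_mono)
        finally show ?thesis .
      qed
    qed (use inte intq in auto)
    finally show ?thesis by (simp add: prob_space)
  qed
  have d2: "cmod (complex_of_real (1 - v / (2 * real n)) - complex_of_real (exp (- (v / (2 * real n))))) \<le> (v / (2 * real n))\<^sup>2"
    using exp_minus_quadratic[of "v / (2 * real n)"] v
    by (simp del: of_real_diff of_real_exp add: of_real_diff[symmetric] norm_of_real abs_minus_commute)
  define w where "w = complex_of_real (exp (- (v / (2 * real n))))"
  have "w ^ n = complex_of_real (exp (- (v / (2 * real n))) ^ n)" by (simp add: w_def)
  also have "exp (- (v / (2 * real n))) ^ n = exp (- v / 2)"
    using n by (simp add: exp_of_nat_mult[symmetric])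
  finally have wn: "w ^ n = complex_of_real (exp (- v / 2))" .
  have ne: "cmod (\<integral>x. e x \<partial>M) \<le> 1"
  proof -
    have "cmod (\<integral>x. e x \<partial>M) \<le> (\<integral>x. cmod (e x) \<partial>M)" by (rule integral_norm_bound)
    also have "\<dots> = 1" by (simp add: e_def prob_space)
    finally show ?thesis .
  qed
  have nw: "cmod w \<le> 1" using v by (simp add: w_def norm_of_real del: of_real_exp)
  \<comment> \<open>For numbers in the unit disc, telescoping turns a difference of n-th powers into
    n times the difference.\<close>
  have "cmod ((\<integral>x. e x \<partial>M) ^ n - w ^ n) \<le> real n * cmod ((\<integral>x. e x \<partial>M) - w)"
    by (rule norm_power_diff[OF ne nw])
  also have "\<dots> \<le> real n * ((K / s) ^ 3 + (v / (2 * real n))\<^sup>2)"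
    using norm_diff_triangle_le[OF d1 d2] unfolding w_def by (intro mult_left_mono) auto
  \<comment> \<open>The cubic Taylor error contributes n (K/s)^3 = K^3/s, and replacing 1 - v/(2n)
    by an exponential costs v^2/(4n), where v is at most K^2.\<close>
  also have "\<dots> \<le> (K ^ 3 + K ^ 4) / s"
  proof -
    have "real n * (K / s) ^ 3 = K ^ 3 / s"
      unfolding s(2)[symmetric] using s(1) by (simp add: power_divide power2_eq_square power3_eq_cube)
    moreover have "real n * (v / (2 * real n))\<^sup>2 \<le> K ^ 4 / s"
    proof -
      have "v\<^sup>2 \<le> K ^ 4" using power_mono[OF v(2) v(1), of 2] by simp
      moreover have "real n * (v / (2 * real n))\<^sup>2 = v\<^sup>2 / (4 * s\<^sup>2)"
        unfolding s(2) using n by (simp add: power2_eq_square field_simps)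
      moreover have "v\<^sup>2 / (4 * s\<^sup>2) \<le> v\<^sup>2 / s"
        using s1 mult_mono[of 1 s s s] by (intro divide_left_mono) (auto simp: power2_eq_square)
      ultimately show ?thesis using s(1) by (smt (verit) divide_right_mono)
    qed
    ultimately show ?thesis by (simp add: distrib_left add_divide_distrib)
  qed
  finally show ?thesis using wn by (simp add: e_def s_def v_def)
qed

text \<open>The previous estimate for the uniform distribution on \<open>n\<close> points, which is
  the law of one draw given the data; the variance turns into the sample variance.\<close>

lemma avg_iexp_power_approx:
  fixes y :: "nat \<Rightarrow> real"
  assumes K: "\<And>i. i < n \<Longrightarrow> \<bar>y i\<bar> \<le> K" and mean: "(\<Sum>i<n. y i) = 0" and n: "n > 0"
  shows "cmod (((\<Sum>i<n. exp (\<i> * complex_of_real (y i / sqrt (real n)))) / of_nat n) ^ n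
           - complex_of_real (exp (- ((\<Sum>i<n. (y i)\<^sup>2) / real n) / 2))) \<le> (K ^ 3 + K ^ 4) / sqrt (real n)"
proof -
  define p where "p = pmf_of_set {..<n}"
  have ne: "{..<n} \<noteq> {}" using n by auto
  have sp: "set_pmf p = {..<n}" using ne by (simp add: p_def)
  have avg: "(\<integral>x. f x \<partial>measure_pmf p) = (1 / real n) *\<^sub>R (\<Sum>i<n. f i)"
    for f :: "nat \<Rightarrow> 'b::{banach, second_countable_topology}"
  proof -
    have "(\<integral>x. f x \<partial>measure_pmf p) = (\<Sum>a<n. pmf p a *\<^sub>R f a)"
      using sp by (intro integral_measure_pmf) auto
    also have "\<dots> = (\<Sum>a<n. (1 / real n) *\<^sub>R f a)"
      using ne by (intro sum.cong) (auto simp: p_def)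
    finally show ?thesis by (simp add: scaleR_right.sum)
  qed
  \<comment> \<open>The bound is required on the whole space of the pmf, not only on its support,
    hence the extension by 0.\<close>
  define y' where "y' i = (if i < n then y i else 0)" for i
  have y': "\<bar>y' i\<bar> \<le> K" for i using K[of i] K[of 0] n by (auto simp: y'_def)
  have "(\<integral>x. y' x \<partial>measure_pmf p) = 0" unfolding avg using mean by (simp add: y'_def cong: sum.cong_simp)
  then have "cmod ((\<integral>x. exp (\<i> * complex_of_real (y' x / sqrt (real n))) \<partial>measure_pmf p) ^ n
           - complex_of_real (exp (- (\<integral>x. (y' x)\<^sup>2 \<partial>measure_pmf p) / 2))) \<le> (K ^ 3 + K ^ 4) / sqrt (real n)"
    using y' n by (intro measure_pmf.iexp_power_approx) auto
  moreover have "(\<integral>x. exp (\<i> * complex_of_real (y' x / sqrt (real n))) \<partial>measure_pmf p)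
      = (\<Sum>i<n. exp (\<i> * complex_of_real (y i / sqrt (real n)))) / of_nat n"
    unfolding avg by (simp add: y'_def scaleR_conv_of_real cong: sum.cong_simp)
  moreover have "(\<integral>x. (y' x)\<^sup>2 \<partial>measure_pmf p) = (\<Sum>i<n. (y i)\<^sup>2) / real n"
    unfolding avg by (simp add: y'_def cong: sum.cong_simp)
  ultimately show ?thesis by simp
qed

section \<open>Resampling\<close>

text \<open>\<open>W n j l\<close> is the index of draw \<open>l\<close> in resample
  \<open>j\<close> at sample size \<open>n\<close>. Resamples are numbered from 1, so that 0 stays
  free for the data. The conditions are imposed for each \<open>n\<close> separately, since the
  result concerns laws at fixed \<open>n\<close>.\<close>

locale resampling = prob_space P for P :: "'a measure" +
  fixes Y :: "nat \<Rightarrow> 'a \<Rightarrow> 'y::topological_space"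
    and W :: "nat \<Rightarrow> nat \<Rightarrow> nat \<Rightarrow> 'a \<Rightarrow> nat" and M :: nat
  assumes iid: "indep_vars (\<lambda>_. borel) Y UNIV"
    and ident: "\<And>i. distr P borel (Y i) = distr P borel (Y 0)"
    and W_meas: "\<And>n j l. W n j l \<in> measurable P (count_space UNIV)"
    and W_unif: "\<And>n j l x. 1 \<le> j \<Longrightarrow> j \<le> M \<Longrightarrow> l < n \<Longrightarrow>
                   prob {\<omega>\<in>space P. W n j l \<omega> = x} = (if x < n then 1 / real n else 0)"
    and W_indep: "\<And>n. indep_vars (\<lambda>_. count_space UNIV)
                        (\<lambda>jl \<omega>. W n (fst jl) (snd jl) \<omega>) ({1..M} \<times> {..<n})"
    and W_data_indep: "\<And>n. indep_set
          {(\<lambda>\<omega>. \<lambda>i. Y i \<omega>) -` S \<inter> space P | S. S \<in> sets (Pi\<^sub>M UNIV (\<lambda>_. borel))}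
          {(\<lambda>\<omega>. restrict (\<lambda>jl. W n (fst jl) (snd jl) \<omega>) ({1..M} \<times> {..<n})) -` S \<inter> space P
             | S. S \<in> sets (Pi\<^sub>M ({1..M} \<times> {..<n}) (\<lambda>_. count_space UNIV))}"
begin

abbreviation data :: "'a \<Rightarrow> nat \<Rightarrow> 'y" where "data \<omega> \<equiv> (\<lambda>i. Y i \<omega>)"

definition idx :: "nat \<Rightarrow> (nat \<times> nat) set" where "idx n = {1..M} \<times> {..<n}"

text \<open>Restricted to \<open>idx n\<close> so that it is a point of the extensional product
  named in the independence hypothesis.\<close>

definition Wv :: "nat \<Rightarrow> 'a \<Rightarrow> nat \<times> nat \<Rightarrow> nat" where
  "Wv n \<omega> = restrict (\<lambda>jl. W n (fst jl) (snd jl) \<omega>) (idx n)"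

definition mean :: "('y \<Rightarrow> real) \<Rightarrow> real" where
  "mean g = expectation (\<lambda>\<omega>. g (Y 0 \<omega>))"

lemma Y_meas[measurable]: "Y i \<in> borel_measurable P"
  using iid by (auto simp: indep_vars_def)

lemma W_measurable[measurable]: "W n j l \<in> measurable P (count_space UNIV)"
  by (rule W_meas)

lemma data_measurable[measurable]: "data \<in> measurable P (Pi\<^sub>M UNIV (\<lambda>_. borel))"
  by (rule measurable_PiM_single') auto

lemma finite_idx[simp]: "finite (idx n)" by (simp add: idx_def)

lemma Wv_measurable[measurable]: "Wv n \<in> measurable P (Pi\<^sub>M (idx n) (\<lambda>_. count_space UNIV))"
  unfolding Wv_def by (rule measurable_restrict) auto

lemma Y_W_measurable[measurable]: "(\<lambda>\<omega>. Y (W n j l \<omega>) \<omega>) \<in> borel_measurable P"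
  by (rule measurable_compose_countable[OF _ W_meas]) (rule Y_meas)

lemma integral_Y_eq:
  fixes g :: "'y \<Rightarrow> 'c::{banach, second_countable_topology}"
  assumes [measurable]: "g \<in> borel_measurable borel"
  shows "(\<integral>\<omega>. g (Y i \<omega>) \<partial>P) = (\<integral>\<omega>. g (Y 0 \<omega>) \<partial>P)"
proof -
  have "(\<integral>\<omega>. g (Y i \<omega>) \<partial>P) = (\<integral>y. g y \<partial>distr P borel (Y i))" by (simp add: integral_distr)
  also have "\<dots> = (\<integral>y. g y \<partial>distr P borel (Y 0))" by (subst ident[of i]) (rule refl)
  also have "\<dots> = (\<integral>\<omega>. g (Y 0 \<omega>) \<partial>P)" by (simp add: integral_distr)
  finally show ?thesis .
qed

lemma Int_stable_vimage: "Int_stable {X -` S \<inter> space P | S. S \<in> sets N}"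
proof (rule Int_stableI)
  fix a b assume "a \<in> {X -` S \<inter> space P | S. S \<in> sets N}" "b \<in> {X -` S \<inter> space P | S. S \<in> sets N}"
  then obtain S T where "a = X -` S \<inter> space P" "b = X -` T \<inter> space P" "S \<in> sets N" "T \<in> sets N" by auto
  then show "a \<inter> b \<in> {X -` S \<inter> space P | S. S \<in> sets N}"
    by (intro CollectI exI[of _ "S \<inter> T"]) auto
qed

lemma indep_set_mono: "indep_set A B \<Longrightarrow> A' \<subseteq> A \<Longrightarrow> B' \<subseteq> B \<Longrightarrow> indep_set A' B'"
  unfolding indep_sets2_eq by blast

lemma data_Wv_indep:
  fixes f :: "(nat \<Rightarrow> 'y) \<Rightarrow> 'c::topological_space"
  assumes f: "f \<in> borel_measurable (Pi\<^sub>M UNIV (\<lambda>_. borel))"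
    and g: "g \<in> borel_measurable (Pi\<^sub>M (idx n) (\<lambda>_. count_space UNIV))"
  shows "indep_var borel (\<lambda>\<omega>. f (data \<omega>)) borel (\<lambda>\<omega>. g (Wv n \<omega>))"
  unfolding indep_var_eq
proof (intro conjI indep_set_sigma_sets Int_stable_vimage)
  show "random_variable borel (\<lambda>\<omega>. f (data \<omega>))" "random_variable borel (\<lambda>\<omega>. g (Wv n \<omega>))"
    using measurable_compose[OF data_measurable f] measurable_compose[OF Wv_measurable g] by auto
  let ?A = "{data -` S \<inter> space P | S. S \<in> sets (Pi\<^sub>M UNIV (\<lambda>_. borel))}"
  let ?B = "{Wv n -` S \<inter> space P | S. S \<in> sets (Pi\<^sub>M (idx n) (\<lambda>_. count_space UNIV))}"
  have "indep_set ?A ?B" using W_data_indep[of n] unfolding Wv_def[abs_def] idx_def .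
  moreover have "{(\<lambda>\<omega>. f (data \<omega>)) -` S \<inter> space P | S. S \<in> sets borel} \<subseteq> ?A"
  proof safe
    fix S :: "'c set" assume "S \<in> sets borel"
    then show "\<exists>S'. (\<lambda>\<omega>. f (data \<omega>)) -` S \<inter> space P = data -` S' \<inter> space P \<and> S' \<in> sets (Pi\<^sub>M UNIV (\<lambda>_. borel))"
      using measurable_sets[OF f, of S]
      by (intro exI[of _ "f -` S \<inter> space (Pi\<^sub>M UNIV (\<lambda>_. borel))"]) (auto simp: space_PiM)
  qed
  moreover have "{(\<lambda>\<omega>. g (Wv n \<omega>)) -` S \<inter> space P | S. S \<in> sets borel} \<subseteq> ?B"
  proof safe
    fix S :: "'c set" assume "S \<in> sets borel"
    then show "\<exists>S'. (\<lambda>\<omega>. g (Wv n \<omega>)) -` S \<inter> space P = Wv n -` S' \<inter> space P \<and> S' \<in> sets (Pi\<^sub>M (idx n) (\<lambda>_. count_space UNIV))"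
      using measurable_sets[OF g] measurable_space[OF Wv_measurable, of _ n]
      by (intro exI[of _ "g -` S \<inter> space (Pi\<^sub>M (idx n) (\<lambda>_. count_space UNIV))"]) auto
  qed
  ultimately show "indep_set {(\<lambda>\<omega>. f (data \<omega>)) -` S \<inter> space P | S. S \<in> sets borel}
      {(\<lambda>\<omega>. g (Wv n \<omega>)) -` S \<inter> space P | S. S \<in> sets borel}"
    by (rule indep_set_mono)
qed

lemma prob_Wv:
  assumes w: "w \<in> Pi\<^sub>E (idx n) (\<lambda>_. {..<n})"
  shows "prob {\<omega>\<in>space P. \<forall>x\<in>idx n. Wv n \<omega> x = w x} = (1 / real n) ^ (M * n)"
proof (cases "idx n = {}")
  case True
  then have "M * n = 0" by (auto simp: idx_def)
  then show ?thesis using True by (auto simp: prob_space)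
next
  case False
  have "{\<omega>\<in>space P. \<forall>x\<in>idx n. Wv n \<omega> x = w x}
      = (\<Inter>x\<in>idx n. (\<lambda>\<omega>. W n (fst x) (snd x) \<omega>) -` {w x} \<inter> space P)"
    using False by (auto simp: Wv_def)
  also have "prob \<dots> = (\<Prod>x\<in>idx n. prob ((\<lambda>\<omega>. W n (fst x) (snd x) \<omega>) -` {w x} \<inter> space P))"
    using W_indep[of n] False by (intro indep_varsD_finite) (auto simp: idx_def)
  also have "\<dots> = (\<Prod>x\<in>idx n. 1 / real n)"
  proof (rule prod.cong)
    fix x assume x: "x \<in> idx n"
    have "(\<lambda>\<omega>. W n (fst x) (snd x) \<omega>) -` {w x} \<inter> space P = {\<omega>\<in>space P. W n (fst x) (snd x) \<omega> = w x}"
      by auto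
    then show "prob ((\<lambda>\<omega>. W n (fst x) (snd x) \<omega>) -` {w x} \<inter> space P) = 1 / real n"
      using W_unif[of "fst x" "snd x" n "w x"] x w by (auto simp: idx_def PiE_iff)
  qed simp
  also have "\<dots> = (1 / real n) ^ (M * n)" by (simp add: idx_def)
  finally show ?thesis .
qed

lemma AE_W_less: "AE \<omega> in P. \<forall>x\<in>idx n. W n (fst x) (snd x) \<omega> < n"
proof -
  have "AE \<omega> in P. W n (fst x) (snd x) \<omega> < n" if x: "x \<in> idx n" for x
  proof -
    have "AE \<omega> in P. \<forall>k. k \<ge> n \<longrightarrow> W n (fst x) (snd x) \<omega> \<noteq> k"
      unfolding AE_all_countable
    proof
      fix k
      have "AE \<omega> in P. \<omega> \<notin> {\<omega>\<in>space P. W n (fst x) (snd x) \<omega> = k}" if "k \<ge> n"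
        using W_unif[of "fst x" "snd x" n k] x that by (subst prob_eq_0[symmetric]) (auto simp: idx_def)
      then show "AE \<omega> in P. k \<ge> n \<longrightarrow> W n (fst x) (snd x) \<omega> \<noteq> k"
        by (cases "k \<ge> n") auto
    qed
    then show ?thesis by eventually_elim (metis not_le)
  qed
  then show ?thesis by (subst AE_finite_all) auto
qed

text \<open>Stands in for conditioning on the data: up to a null set the resamples take finitely
  many values, every index table with the same probability, so an expectation is that of the plain
  average over all tables.\<close>

lemma resample_expectation:
  fixes h :: "(nat \<Rightarrow> 'y) \<Rightarrow> (nat \<times> nat \<Rightarrow> nat) \<Rightarrow> 'c::{real_normed_field, banach, second_countable_topology}"
  assumes hm: "\<And>w. w \<in> Pi\<^sub>E (idx n) (\<lambda>_. {..<n}) \<Longrightarrow> (\<lambda>y. h y w) \<in> borel_measurable (Pi\<^sub>M UNIV (\<lambda>_. borel))"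
    and hi: "\<And>w. w \<in> Pi\<^sub>E (idx n) (\<lambda>_. {..<n}) \<Longrightarrow> integrable P (\<lambda>\<omega>. h (data \<omega>) w)"
    and hW: "(\<lambda>\<omega>. h (data \<omega>) (Wv n \<omega>)) \<in> borel_measurable P"
  shows "(\<integral>\<omega>. h (data \<omega>) (Wv n \<omega>) \<partial>P)
       = (\<integral>\<omega>. of_real ((1 / real n) ^ (M * n)) * (\<Sum>w\<in>Pi\<^sub>E (idx n) (\<lambda>_. {..<n}). h (data \<omega>) w) \<partial>P)"
proof -
  let ?S = "Pi\<^sub>E (idx n) (\<lambda>_. {..<n})"
  have fin: "finite ?S" by (intro finite_PiE) auto
  \<comment> \<open>Indicator that the realised table is \<open>w\<close>. Almost surely exactly one
    \<open>w\<close> in \<open>?S\<close> matches, so \<open>h\<close> splits into products of a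
    data factor and an independent table factor.\<close>
  define I where "I w v = (if \<forall>x\<in>idx n. v x = w x then 1 else 0 :: 'c)" for w v :: "nat \<times> nat \<Rightarrow> nat"
  have Im[measurable]: "I w \<in> borel_measurable (Pi\<^sub>M (idx n) (\<lambda>_. count_space UNIV))" for w
    unfolding I_def by measurable
  have Ii: "integrable P (\<lambda>\<omega>. I w (Wv n \<omega>))" for w
    by (rule integrable_const_bound[where B=1]) (auto simp: I_def)
  have ind: "indep_var borel (\<lambda>\<omega>. h (data \<omega>) w) borel (\<lambda>\<omega>. I w (Wv n \<omega>))" if "w \<in> ?S" for w
    by (rule data_Wv_indep[OF hm[OF that] Im])
  have PI: "(\<integral>\<omega>. I w (Wv n \<omega>) \<partial>P) = of_real ((1 / real n) ^ (M * n))" if "w \<in> ?S" for w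
  proof -
    have "(\<integral>\<omega>. I w (Wv n \<omega>) \<partial>P) = (\<integral>\<omega>. of_real (indicator {\<omega>\<in>space P. \<forall>x\<in>idx n. Wv n \<omega> x = w x} \<omega>) \<partial>P)"
      by (intro Bochner_Integration.integral_cong) (auto simp: I_def split: split_indicator)
    also have "\<dots> = of_real (prob {\<omega>\<in>space P. \<forall>x\<in>idx n. Wv n \<omega> x = w x})"
      by (subst integral_of_real) (auto simp: Int_def conj_commute emeasure_eq_measure intro!: arg_cong[where f=prob])
    finally show ?thesis using prob_Wv[OF that] by simp
  qed
  have "(\<integral>\<omega>. h (data \<omega>) (Wv n \<omega>) \<partial>P) = (\<integral>\<omega>. (\<Sum>w\<in>?S. h (data \<omega>) w * I w (Wv n \<omega>)) \<partial>P)"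
  proof (rule integral_cong_AE)
    show "(\<lambda>\<omega>. \<Sum>w\<in>?S. h (data \<omega>) w * I w (Wv n \<omega>)) \<in> borel_measurable P"
      using hi Ii by (intro borel_measurable_sum borel_measurable_times) auto
    show "AE \<omega> in P. h (data \<omega>) (Wv n \<omega>) = (\<Sum>w\<in>?S. h (data \<omega>) w * I w (Wv n \<omega>))"
      using AE_W_less[of n]
    proof eventually_elim
      case (elim \<omega>)
      then have WS: "Wv n \<omega> \<in> ?S" by (auto simp: Wv_def PiE_iff)
      have "I w (Wv n \<omega>) = (if w = Wv n \<omega> then 1 else 0)" if "w \<in> ?S" for w
      proof -
        have "(\<forall>x\<in>idx n. Wv n \<omega> x = w x) \<longleftrightarrow> w = Wv n \<omega>"
          using PiE_ext[OF that WS] by auto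
        then show ?thesis by (simp add: I_def)
      qed
      then have "(\<Sum>w\<in>?S. h (data \<omega>) w * I w (Wv n \<omega>)) = (\<Sum>w\<in>?S. if w = Wv n \<omega> then h (data \<omega>) w else 0)"
        by (intro sum.cong) auto
      then show ?case using WS fin by simp
    qed
  qed (rule hW)
  also have "\<dots> = (\<Sum>w\<in>?S. (\<integral>\<omega>. h (data \<omega>) w * I w (Wv n \<omega>) \<partial>P))"
    by (intro Bochner_Integration.integral_sum indep_var_integrable[OF ind] hi Ii)
  also have "\<dots> = (\<Sum>w\<in>?S. (\<integral>\<omega>. h (data \<omega>) w \<partial>P) * of_real ((1 / real n) ^ (M * n)))"
    by (intro sum.cong) (auto simp: indep_var_lebesgue_integral[OF ind hi Ii] PI simp del: of_real_power of_real_divide)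
  also have "\<dots> = (\<integral>\<omega>. of_real ((1 / real n) ^ (M * n)) * (\<Sum>w\<in>?S. h (data \<omega>) w) \<partial>P)"
    using hi by (simp add: sum_distrib_left sum_distrib_right mult.commute del: of_real_power of_real_divide)
  finally show ?thesis .
qed

text \<open>Given the data the draws are i.i.d., so a product over draws averages to a power;
  algebraically this is the distributive law for a product of sums. The factor \<open>b\<close> may
  depend on the whole sample because bootstrap sums are centred at a sample mean.\<close>

lemma resample_prod:
  fixes a :: "(nat \<Rightarrow> 'y) \<Rightarrow> 'c::{real_normed_field, banach, second_countable_topology}"
    and b :: "(nat \<Rightarrow> 'y) \<Rightarrow> nat \<Rightarrow> 'y \<Rightarrow> 'c"
  assumes a[measurable]: "a \<in> borel_measurable (Pi\<^sub>M UNIV (\<lambda>_. borel))"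
    and b[measurable]: "\<And>j i. (\<lambda>y. b y j (y i)) \<in> borel_measurable (Pi\<^sub>M UNIV (\<lambda>_. borel))"
    and Ba: "\<And>y. norm (a y) \<le> Ba" and Bb: "\<And>y j x. norm (b y j x) \<le> Bb"
  shows "(\<integral>\<omega>. a (data \<omega>) * (\<Prod>j\<in>{1..M}. \<Prod>l<n. b (data \<omega>) j (Y (W n j l \<omega>) \<omega>)) \<partial>P)
       = (\<integral>\<omega>. a (data \<omega>) * (\<Prod>j\<in>{1..M}. ((\<Sum>i<n. b (data \<omega>) j (Y i \<omega>)) / of_nat n) ^ n) \<partial>P)"
proof -
  let ?S = "Pi\<^sub>E (idx n) (\<lambda>_. {..<n})"
  define h where "h y w = a y * (\<Prod>x\<in>idx n. b y (fst x) (y (w x)))" for y and w :: "nat \<times> nat \<Rightarrow> nat"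
  have hm[measurable]: "(\<lambda>y. h y w) \<in> borel_measurable (Pi\<^sub>M UNIV (\<lambda>_. borel))" for w
    unfolding h_def by measurable
  have [measurable]: "(\<lambda>\<omega>. b (data \<omega>) j (Y (W n j l \<omega>) \<omega>)) \<in> borel_measurable P" for j l
  proof (rule measurable_compose_countable[OF _ W_meas, of "\<lambda>i \<omega>. b (data \<omega>) j (Y i \<omega>)"])
    show "(\<lambda>\<omega>. b (data \<omega>) j (Y i \<omega>)) \<in> borel_measurable P" for i
      using measurable_compose[OF data_measurable b[of j i]] by simp
  qed
  have Ba0: "0 \<le> Ba" using Ba norm_ge_zero order_trans by blast
  have nh: "norm (h y w) \<le> Ba * (\<Prod>x\<in>idx n. Bb)" for y w
    unfolding h_def norm_mult prod_norm[symmetric]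
    using Bb Ba Ba0 by (intro mult_mono prod_mono) (auto intro!: prod_nonneg)
  have hi: "integrable P (\<lambda>\<omega>. h (data \<omega>) w)" for w
    using nh by (intro integrable_const_bound[where B="Ba * (\<Prod>x\<in>idx n. Bb)"]) (auto intro: measurable_compose[OF data_measurable hm])
  have e1: "a (data \<omega>) * (\<Prod>j\<in>{1..M}. \<Prod>l<n. b (data \<omega>) j (Y (W n j l \<omega>) \<omega>)) = h (data \<omega>) (Wv n \<omega>)" for \<omega>
  proof -
    have "(\<Prod>j\<in>{1..M}. \<Prod>l<n. b (data \<omega>) j (Y (W n j l \<omega>) \<omega>))
       = (\<Prod>x\<in>idx n. b (data \<omega>) (fst x) (Y (W n (fst x) (snd x) \<omega>) \<omega>))"
      unfolding idx_def by (simp add: prod.cartesian_product case_prod_beta)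
    also have "\<dots> = (\<Prod>x\<in>idx n. b (data \<omega>) (fst x) (Y (Wv n \<omega> x) \<omega>))"
      by (intro prod.cong) (auto simp: Wv_def)
    finally show ?thesis by (simp add: h_def)
  qed
  have hW: "(\<lambda>\<omega>. h (data \<omega>) (Wv n \<omega>)) \<in> borel_measurable P"
    unfolding e1[symmetric] by (intro borel_measurable_times borel_measurable_prod measurable_compose[OF data_measurable a]) measurable
  have e2: "of_real ((1 / real n) ^ (M * n)) * (\<Sum>w\<in>?S. h y w) = a y * (\<Prod>j\<in>{1..M}. ((\<Sum>i<n. b y j (y i)) / of_nat n) ^ n)" for y
  proof -
    have "(\<Sum>w\<in>?S. h y w) = a y * (\<Prod>x\<in>idx n. \<Sum>i<n. b y (fst x) (y i))"
      unfolding h_def by (subst prod_sum_PiE) (auto simp: sum_distrib_left)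
    also have "(\<Prod>x\<in>idx n. \<Sum>i<n. b y (fst x) (y i)) = (\<Prod>j\<in>{1..M}. \<Prod>l<n. \<Sum>i<n. b y j (y i))"
      unfolding prod.cartesian_product idx_def by (intro prod.cong) auto
    also have "\<dots> = (\<Prod>j\<in>{1..M}. (\<Sum>i<n. b y j (y i)) ^ n)" by simp
    finally have hs: "(\<Sum>w\<in>?S. h y w) = a y * (\<Prod>j\<in>{1..M}. (\<Sum>i<n. b y j (y i)) ^ n)" .
    have k: "of_real ((1 / real n) ^ (M * n)) = (\<Prod>j\<in>{1..M}. (1 / of_nat n :: 'c) ^ n)"
      by (simp add: power_mult[symmetric] mult.commute)
    have "(\<Prod>j\<in>{1..M}. (1 / of_nat n) ^ n) * (\<Prod>j\<in>{1..M}. (\<Sum>i<n. b y j (y i)) ^ n)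
         = (\<Prod>j\<in>{1..M}. ((\<Sum>i<n. b y j (y i)) / of_nat n) ^ n)"
      unfolding prod.distrib[symmetric] by (intro prod.cong) (simp_all add: power_divide)
    then show ?thesis unfolding hs k by (simp only: mult.left_commute)
  qed
  show ?thesis
    unfolding e1 by (subst resample_expectation[OF hm hi hW]) (simp only: e2)
qed

end

section \<open>Central limit theorem and exponential bounds for empirical and bootstrap sums\<close>

lemma abs_exp_minus_diff_le:
  fixes s v :: real
  assumes "0 \<le> s" "0 \<le> v"
  shows "\<bar>exp (-s) - exp (-v)\<bar> \<le> \<bar>s - v\<bar>"
proof -
  have *: "exp (-a) - exp (-b) \<le> b - a" if "0 \<le> a" "a \<le> b" for a b :: real
  proof -
    have "exp (-a) - exp (-b) = exp (-a) * (1 - exp (-(b - a)))"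
      by (simp add: algebra_simps exp_add[symmetric])
    also have "\<dots> \<le> 1 * (b - a)"
    proof (rule mult_mono)
      show "1 - exp (-(b - a)) \<le> b - a" using exp_ge_add_one_self[of "-(b-a)"] by linarith
    qed (use that in auto)
    finally show ?thesis by simp
  qed
  show ?thesis
    using *[of s v] *[of v s] assms by (cases "s \<le> v") (auto simp: abs_if)
qed

context resampling
begin

lemma indep_fun_Y:
  assumes "g \<in> borel_measurable borel"
  shows "indep_vars (\<lambda>_. borel) (\<lambda>i \<omega>. g (Y i \<omega>)) I"
  by (rule indep_vars_compose2[OF indep_vars_subset[OF iid subset_UNIV] assms])

lemma integrable_fun_Y:
  fixes g :: "'y \<Rightarrow> 'c::{banach, second_countable_topology}"
  assumes "g \<in> borel_measurable borel" "\<And>y. norm (g y) \<le> K"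
  shows "integrable P (\<lambda>\<omega>. g (Y i \<omega>))"
  using assms by (intro integrable_const_bound[where B=K]) auto

lemma expectation_prod_Y:
  fixes g :: "'y \<Rightarrow> 'c::{real_normed_field, banach, second_countable_topology}"
  assumes g: "g \<in> borel_measurable borel" and K: "\<And>y. norm (g y) \<le> K"
  shows "(\<integral>\<omega>. (\<Prod>i<n. g (Y i \<omega>)) \<partial>P) = (\<integral>\<omega>. g (Y 0 \<omega>) \<partial>P) ^ n"
proof -
  have "(\<integral>\<omega>. (\<Prod>i<n. g (Y i \<omega>)) \<partial>P) = (\<Prod>i<n. \<integral>\<omega>. g (Y i \<omega>) \<partial>P)"
    by (intro indep_vars_lebesgue_integral indep_fun_Y integrable_fun_Y[OF g K] g) auto
  also have "\<dots> = (\<Prod>i<n. \<integral>\<omega>. g (Y 0 \<omega>) \<partial>P)"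
    by (intro prod.cong integral_Y_eq g refl)
  finally show ?thesis by simp
qed

lemma abs_mean_le:
  assumes "g \<in> borel_measurable borel" and K: "\<And>y. \<bar>g y\<bar> \<le> K"
  shows "\<bar>mean g\<bar> \<le> K"
proof -
  have i: "integrable P (\<lambda>\<omega>. g (Y 0 \<omega>))" using assms by (intro integrable_fun_Y) auto
  have "\<bar>mean g\<bar> \<le> (\<integral>\<omega>. \<bar>g (Y 0 \<omega>)\<bar> \<partial>P)" unfolding mean_def by (rule integral_abs_bound)
  also have "\<dots> \<le> (\<integral>\<omega>. K \<partial>P)" using i K by (intro integral_mono) auto
  finally show ?thesis by (simp add: prob_space)
qed

text \<open>A law of large numbers in L1 with a rate, meant for the first two sample moments.
  Independence bounds the second moment, and \<open>\<bar>x \<omega>\<bar> \<le> s * (x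
  \<omega>)\<^sup>2 + 1 / s\<close> passes to L1 without the root of an integral.\<close>

lemma emp_mean_L1:
  assumes g[measurable]: "g \<in> borel_measurable borel" and K: "\<And>y. \<bar>g y\<bar> \<le> K" and n: "n > 0"
  shows "expectation (\<lambda>\<omega>. \<bar>(\<Sum>i<n. g (Y i \<omega>)) / real n - mean g\<bar>) \<le> (4 * K\<^sup>2 + 1) / sqrt (real n)"
proof -
  define s where "s = sqrt (real n)"
  have s: "s > 0" "s\<^sup>2 = real n" using n by (auto simp: s_def)
  define f where "f y = g y - mean g" for y
  have [measurable]: "f \<in> borel_measurable borel" unfolding f_def by measurable
  have f: "\<bar>f y\<bar> \<le> 2 * K" for y using K[of y] abs_mean_le[OF g K] by (simp add: f_def)
  have K0: "K \<ge> 0" using K[of undefined] by linarith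
  have fi: "integrable P (\<lambda>\<omega>. f (Y i \<omega>))" for i using f by (intro integrable_fun_Y) auto
  have ffi: "integrable P (\<lambda>\<omega>. f (Y i \<omega>) * f (Y j \<omega>))" for i j
  proof (rule integrable_const_bound[where B="(2*K) * (2*K)"])
    show "AE \<omega> in P. norm (f (Y i \<omega>) * f (Y j \<omega>)) \<le> (2*K) * (2*K)"
      unfolding real_norm_def abs_mult by (intro AE_I2 mult_mono f) (use K0 in auto)
  qed measurable
  have mf: "(\<integral>\<omega>. f (Y i \<omega>) \<partial>P) = 0" for i
  proof -
    have "(\<integral>\<omega>. f (Y i \<omega>) \<partial>P) = (\<integral>\<omega>. f (Y 0 \<omega>) \<partial>P)" by (rule integral_Y_eq) measurable
    also have "\<dots> = 0" unfolding f_def using integrable_fun_Y[of g K 0] K by (simp add: mean_def prob_space)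
    finally show ?thesis .
  qed
  have cov: "(\<integral>\<omega>. f (Y i \<omega>) * f (Y j \<omega>) \<partial>P) \<le> (if i = j then 4 * K\<^sup>2 else 0)" for i j
  proof (cases "i = j")
    case True
    have "(\<integral>\<omega>. f (Y i \<omega>) * f (Y j \<omega>) \<partial>P) \<le> (\<integral>\<omega>. 4 * K\<^sup>2 \<partial>P)"
      using ffi True
    proof (intro integral_mono)
      fix \<omega>
      have "\<bar>f (Y i \<omega>)\<bar> * \<bar>f (Y i \<omega>)\<bar> \<le> (2 * K) * (2 * K)" using f K0 by (intro mult_mono) auto
      then show "f (Y i \<omega>) * f (Y j \<omega>) \<le> 4 * K\<^sup>2" using True by (simp add: power2_eq_square)
    qed auto
    then show ?thesis using True by (simp add: prob_space)
  next
    case False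
    have "(\<integral>\<omega>. (\<Prod>k\<in>{i,j}. f (Y k \<omega>)) \<partial>P) = (\<Prod>k\<in>{i,j}. \<integral>\<omega>. f (Y k \<omega>) \<partial>P)"
      by (intro indep_vars_lebesgue_integral indep_fun_Y fi) auto
    then show ?thesis using False mf by simp
  qed
  define x where "x \<omega> = (\<Sum>i<n. f (Y i \<omega>)) / real n" for \<omega>
  have xe: "(\<Sum>i<n. g (Y i \<omega>)) / real n - mean g = x \<omega>" for \<omega>
    using n by (simp add: x_def f_def sum_subtractf diff_divide_distrib)
  have x2: "(x \<omega>)\<^sup>2 = (\<Sum>i<n. \<Sum>j<n. f (Y i \<omega>) * f (Y j \<omega>)) / (real n)\<^sup>2" for \<omega>
    by (simp add: x_def power_divide power2_eq_square sum_product)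
  have x2i: "integrable P (\<lambda>\<omega>. (x \<omega>)\<^sup>2)" unfolding x2 using ffi by simp
  have xi: "integrable P (\<lambda>\<omega>. x \<omega>)" unfolding x_def using fi by simp
  have "expectation (\<lambda>\<omega>. (x \<omega>)\<^sup>2) = (\<Sum>i<n. \<Sum>j<n. (\<integral>\<omega>. f (Y i \<omega>) * f (Y j \<omega>) \<partial>P)) / (real n)\<^sup>2"
    unfolding x2 using ffi by simp
  also have "\<dots> \<le> (\<Sum>i<n. \<Sum>j<n. if i = j then 4 * K\<^sup>2 else 0) / (real n)\<^sup>2"
    by (intro divide_right_mono sum_mono cov) auto
  also have "\<dots> = 4 * K\<^sup>2 / real n" using n by (simp add: power2_eq_square)
  finally have Ex2: "expectation (\<lambda>\<omega>. (x \<omega>)\<^sup>2) \<le> 4 * K\<^sup>2 / real n" .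
  have "\<bar>x \<omega>\<bar> \<le> s * (x \<omega>)\<^sup>2 + 1 / s" for \<omega>
  proof (cases "\<bar>x \<omega>\<bar> \<le> 1 / s")
    case True then show ?thesis using s by (simp add: add_increasing)
  next
    case False
    then have "1 * \<bar>x \<omega>\<bar> \<le> (s * \<bar>x \<omega>\<bar>) * \<bar>x \<omega>\<bar>"
      using s by (intro mult_right_mono) (auto simp: field_simps)
    then have "\<bar>x \<omega>\<bar> \<le> s * (x \<omega>)\<^sup>2" by (simp add: power2_eq_square mult.assoc)
    moreover have "0 \<le> 1 / s" using s by simp
    ultimately show ?thesis by linarith
  qed
  then have "expectation (\<lambda>\<omega>. \<bar>x \<omega>\<bar>) \<le> expectation (\<lambda>\<omega>. s * (x \<omega>)\<^sup>2 + 1 / s)"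
    using xi x2i by (intro integral_mono) auto
  also have "\<dots> = s * expectation (\<lambda>\<omega>. (x \<omega>)\<^sup>2) + 1 / s"
    using x2i by (simp add: prob_space)
  also have "\<dots> \<le> s * (4 * K\<^sup>2 / real n) + 1 / s" using Ex2 s by (intro add_right_mono mult_left_mono) auto
  also have "\<dots> = (4 * K\<^sup>2 + 1) / s" unfolding s(2)[symmetric] using s(1) by (simp add: power2_eq_square field_simps)
  finally show ?thesis unfolding xe by (simp add: s_def)
qed

definition emp_avg :: "nat \<Rightarrow> ('y \<Rightarrow> real) \<Rightarrow> (nat \<Rightarrow> 'y) \<Rightarrow> real" where
  "emp_avg n g y = (\<Sum>i<n. g (y i)) / real n"

definition emp_proc :: "nat \<Rightarrow> ('y \<Rightarrow> real) \<Rightarrow> 'a \<Rightarrow> real" where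
  "emp_proc n g \<omega> = (\<Sum>i<n. g (Y i \<omega>) - mean g) / sqrt (real n)"

definition boot_proc :: "nat \<Rightarrow> nat \<Rightarrow> ('y \<Rightarrow> real) \<Rightarrow> 'a \<Rightarrow> real" where
  "boot_proc n j g \<omega> = (\<Sum>l<n. g (Y (W n j l \<omega>) \<omega>) - emp_avg n g (data \<omega>)) / sqrt (real n)"

lemma emp_avg_measurable[measurable]:
  assumes [measurable]: "g \<in> borel_measurable borel"
  shows "emp_avg n g \<in> borel_measurable (Pi\<^sub>M UNIV (\<lambda>_. borel))"
  unfolding emp_avg_def by measurable

lemma emp_proc_measurable[measurable]:
  assumes [measurable]: "g \<in> borel_measurable borel"
  shows "emp_proc n g \<in> borel_measurable P"
  unfolding emp_proc_def by measurable

lemma boot_proc_measurable[measurable]: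
  assumes [measurable]: "g \<in> borel_measurable borel"
  shows "boot_proc n j g \<in> borel_measurable P"
  unfolding boot_proc_def
  by (intro borel_measurable_divide borel_measurable_sum borel_measurable_diff
      measurable_compose[OF data_measurable emp_avg_measurable] measurable_compose[OF Y_W_measurable]) measurable

lemma abs_emp_avg_le:
  assumes "\<And>y. \<bar>g y\<bar> \<le> K" "n > 0"
  shows "\<bar>emp_avg n g y\<bar> \<le> K"
proof -
  have "\<bar>\<Sum>i<n. g (y i)\<bar> \<le> (\<Sum>i<n. K)" by (intro order_trans[OF sum_abs] sum_mono assms)
  then show ?thesis using assms(2) by (simp add: emp_avg_def field_simps)
qed

text \<open>The joint characteristic function is the expectation of a data factor of modulus 1 times
  one conditional characteristic function per resample. The latter converge in L1 to constants and
  can be pulled out, which yields at once the Gaussian limits and the asymptotic independence of the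
  sample and the resamples. \<open>\<phi> 0\<close> acts on the data, \<open>\<phi> j\<close> on
  resample \<open>j\<close>.\<close>

theorem joint_clt:
  fixes \<phi> :: "nat \<Rightarrow> 'y \<Rightarrow> real"
  assumes m[measurable]: "\<And>j. \<phi> j \<in> borel_measurable borel" and K: "\<And>j y. \<bar>\<phi> j y\<bar> \<le> K"
  shows "(\<lambda>n. \<integral>\<omega>. exp (\<i> * complex_of_real (emp_proc n (\<phi> 0) \<omega> + (\<Sum>j\<in>{1..M}. boot_proc n j (\<phi> j) \<omega>))) \<partial>P)
     \<longlonglongrightarrow> complex_of_real (exp (- (\<Sum>j\<le>M. mean (\<lambda>y. (\<phi> j y)\<^sup>2) - (mean (\<phi> j))\<^sup>2) / 2))"
proof -
  have K0: "K \<ge> 0" using K[of 0 undefined] by linarith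
  define v where "v j = mean (\<lambda>y. (\<phi> j y)\<^sup>2) - (mean (\<phi> j))\<^sup>2" for j
  have K2: "\<bar>(\<phi> j y)\<^sup>2\<bar> \<le> K\<^sup>2" for j y using power_mono[OF K[of j y], of 2] by simp
  have mK: "\<bar>mean (\<phi> j)\<bar> \<le> K" for j by (rule abs_mean_le) (auto simp: K)
  have int1: "integrable P (\<lambda>\<omega>. \<phi> j (Y i \<omega>))" for i j using K by (intro integrable_fun_Y) auto
  have int2: "integrable P (\<lambda>\<omega>. (\<phi> j (Y i \<omega>))\<^sup>2)" for i j
    using integrable_fun_Y[of "\<lambda>y. (\<phi> j y)\<^sup>2" "K\<^sup>2" i] K2 by simp
  have var: "expectation (\<lambda>\<omega>. (\<phi> j (Y 0 \<omega>) - mean (\<phi> j))\<^sup>2) = v j" for j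
  proof -
    have "expectation (\<lambda>\<omega>. (\<phi> j (Y 0 \<omega>) - mean (\<phi> j))\<^sup>2)
      = expectation (\<lambda>\<omega>. ((\<phi> j (Y 0 \<omega>))\<^sup>2 + (- 2 * mean (\<phi> j)) * \<phi> j (Y 0 \<omega>)) + (mean (\<phi> j))\<^sup>2)"
      by (intro Bochner_Integration.integral_cong) (auto simp: power2_eq_square algebra_simps)
    also have "\<dots> = mean (\<lambda>y. (\<phi> j y)\<^sup>2) + (- 2 * mean (\<phi> j)) * mean (\<phi> j) + (mean (\<phi> j))\<^sup>2"
      using int1[of j 0] int2[of j 0]
      by (simp add: mean_def prob_space)
    finally show ?thesis by (simp add: v_def power2_eq_square)
  qed
  have v0: "v j \<ge> 0" for j unfolding var[symmetric] by simp
  define a where "a n y = exp (\<i> * complex_of_real ((\<Sum>i<n. \<phi> 0 (y i) - mean (\<phi> 0)) / sqrt (real n)))" for n and y :: "nat \<Rightarrow> 'y"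
  define b where "b n y j x = exp (\<i> * complex_of_real ((\<phi> j x - emp_avg n (\<phi> j) y) / sqrt (real n)))" for n j x and y :: "nat \<Rightarrow> 'y"
  \<comment> \<open>The characteristic function of bootstrap sum \<open>j\<close> given the data
    \<open>y\<close>; \<open>s n j y\<close> below is the corresponding sample variance.\<close>
  define z where "z n j y = ((\<Sum>i<n. b n y j (y i)) / of_nat n) ^ n" for n j and y :: "nat \<Rightarrow> 'y"
  define s where "s n j y = (\<Sum>i<n. (\<phi> j (y i) - emp_avg n (\<phi> j) y)\<^sup>2) / real n" for n j and y :: "nat \<Rightarrow> 'y"
  have [measurable]: "a n \<in> borel_measurable (Pi\<^sub>M UNIV (\<lambda>_. borel))" for n
    unfolding a_def by measurable
  have [measurable]: "(\<lambda>y. b n y j (y i)) \<in> borel_measurable (Pi\<^sub>M UNIV (\<lambda>_. borel))" for n j i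
    unfolding b_def by measurable
  have [measurable]: "z n j \<in> borel_measurable (Pi\<^sub>M UNIV (\<lambda>_. borel))" for n j
    unfolding z_def by measurable
  have na: "norm (a n y) = 1" for n y by (simp add: a_def del: of_real_divide of_real_sum)
  have nb: "norm (b n y j x) = 1" for n y j x by (simp add: b_def del: of_real_divide of_real_diff)
  have nz: "norm (z n j y) \<le> 1" for n j y
  proof -
    have "norm (\<Sum>i<n. b n y j (y i)) \<le> (\<Sum>i<n. 1)" by (intro order_trans[OF norm_sum] sum_mono) (simp add: nb)
    then have "norm ((\<Sum>i<n. b n y j (y i)) / of_nat n) \<le> 1"
      by (cases "n = 0") (auto simp: norm_divide divide_le_eq_1)
    then show ?thesis by (simp add: z_def norm_power power_le_one)
  qed
  have eq: "(\<integral>\<omega>. exp (\<i> * complex_of_real (emp_proc n (\<phi> 0) \<omega> + (\<Sum>j\<in>{1..M}. boot_proc n j (\<phi> j) \<omega>))) \<partial>P)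
      = (\<integral>\<omega>. a n (data \<omega>) * (\<Prod>j\<in>{1..M}. z n j (data \<omega>)) \<partial>P)" for n
  proof -
    have "exp (\<i> * complex_of_real (emp_proc n (\<phi> 0) \<omega> + (\<Sum>j\<in>{1..M}. boot_proc n j (\<phi> j) \<omega>)))
      = a n (data \<omega>) * (\<Prod>j\<in>{1..M}. \<Prod>l<n. b n (data \<omega>) j (Y (W n j l \<omega>) \<omega>))" for \<omega>
    proof -
      have "(\<Prod>l<n. b n (data \<omega>) j (Y (W n j l \<omega>) \<omega>)) = exp (\<i> * complex_of_real (boot_proc n j (\<phi> j) \<omega>))" for j
        unfolding b_def boot_proc_def
        by (subst exp_sum[symmetric]) (simp_all add: sum_distrib_left sum_divide_distrib)
      then have "(\<Prod>j\<in>{1..M}. \<Prod>l<n. b n (data \<omega>) j (Y (W n j l \<omega>) \<omega>)) = exp (\<i> * complex_of_real (\<Sum>j\<in>{1..M}. boot_proc n j (\<phi> j) \<omega>))"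
        by (simp add: exp_sum[symmetric] sum_distrib_left)
      then show ?thesis by (simp add: a_def emp_proc_def exp_add[symmetric] distrib_left)
    qed
    then show ?thesis
      unfolding z_def by (simp only:) (intro resample_prod[where Ba=1 and Bb=1]; simp add: na nb)
  qed
  define c where "c j = complex_of_real (exp (- v j / 2))" for j
  have nc: "norm (c j) \<le> 1" for j using v0[of j] by (simp add: c_def del: of_real_exp)
  define B where "B = (2*K) ^ 3 + (2*K) ^ 4"
  define B1 where "B1 = (4 * (K\<^sup>2)\<^sup>2 + 1) + 2 * K * (4 * K\<^sup>2 + 1)"
  \<comment> \<open>Deterministic in the data: for every single sample the bootstrap law is close to
    the Gaussian law with that sample's variance.\<close>
  have ns: "norm (z n j y - complex_of_real (exp (- s n j y / 2))) \<le> B / sqrt (real n)" if n: "n > 0" for n j y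
  proof -
    have "norm (z n j y - complex_of_real (exp (- s n j y / 2))) \<le> ((2*K) ^ 3 + (2*K) ^ 4) / sqrt (real n)"
      unfolding z_def b_def s_def
    proof (rule avg_iexp_power_approx[OF _ _ n])
      show "\<bar>\<phi> j (y i) - emp_avg n (\<phi> j) y\<bar> \<le> 2 * K" for i
        using K[of j "y i"] abs_emp_avg_le[of "\<phi> j" K n y, OF K n] by linarith
      show "(\<Sum>i<n. \<phi> j (y i) - emp_avg n (\<phi> j) y) = 0"
        using n by (simp add: sum_subtractf emp_avg_def)
    qed
    then show ?thesis by (simp add: B_def)
  qed
  \<comment> \<open>The sample variance is compared with the true one through sample moments of
    order 2 and 1, whose L1 errors are known.\<close>
  have sv: "\<bar>s n j y - v j\<bar> \<le> \<bar>(\<Sum>i<n. (\<phi> j (y i))\<^sup>2) / real n - mean (\<lambda>y. (\<phi> j y)\<^sup>2)\<bar>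
       + 2 * K * \<bar>(\<Sum>i<n. \<phi> j (y i)) / real n - mean (\<phi> j)\<bar>" if n: "n > 0" for n j y
  proof -
    let ?e = "emp_avg n (\<phi> j) y"
    have S: "(\<Sum>i<n. \<phi> j (y i)) = real n * ?e" using n by (simp add: emp_avg_def)
    have "(\<Sum>i<n. (\<phi> j (y i) - ?e)\<^sup>2) = (\<Sum>i<n. (\<phi> j (y i))\<^sup>2) - 2 * ?e * (\<Sum>i<n. \<phi> j (y i)) + real n * ?e\<^sup>2"
      by (simp add: power2_diff sum.distrib sum_subtractf sum_distrib_left mult_ac)
    then have se: "s n j y = (\<Sum>i<n. (\<phi> j (y i))\<^sup>2) / real n - ?e\<^sup>2"
      using n unfolding s_def S by (simp add: field_simps power2_eq_square)
    have "\<bar>?e\<^sup>2 - (mean (\<phi> j))\<^sup>2\<bar> = \<bar>?e + mean (\<phi> j)\<bar> * \<bar>?e - mean (\<phi> j)\<bar>"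
      by (simp add: power2_eq_square abs_mult[symmetric] algebra_simps)
    also have "\<dots> \<le> 2 * K * \<bar>?e - mean (\<phi> j)\<bar>"
      using abs_emp_avg_le[of "\<phi> j" K n y] K n mK[of j] by (intro mult_right_mono) auto
    finally show ?thesis unfolding se v_def by (simp add: emp_avg_def)
  qed
  have s0: "s n j y \<ge> 0" for n j y by (simp add: s_def sum_nonneg)
  have ia: "integrable P (\<lambda>\<omega>. a n (data \<omega>))" for n
    using measurable_compose[OF data_measurable, of "a n"] by (intro integrable_const_bound[where B=1]) (auto simp: na)
  have iaz: "integrable P (\<lambda>\<omega>. a n (data \<omega>) * (\<Prod>j\<in>{1..M}. z n j (data \<omega>)))" for n
    using measurable_compose[OF data_measurable, of "\<lambda>y. a n y * (\<Prod>j\<in>{1..M}. z n j y)"]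
    by (intro integrable_const_bound[where B=1]) (auto simp: na norm_mult prod_norm[symmetric] nz intro!: prod_le_1)
  \<comment> \<open>The random conditional characteristic functions are replaced by the constants
    \<open>c j\<close> at a cost of order 1 / sqrt n.\<close>
  have d1: "norm ((\<integral>\<omega>. a n (data \<omega>) * (\<Prod>j\<in>{1..M}. z n j (data \<omega>)) \<partial>P) - (\<integral>\<omega>. a n (data \<omega>) \<partial>P) * (\<Prod>j\<in>{1..M}. c j))
        \<le> real M * ((B + B1) / sqrt (real n))" if n: "n > 0" for n
  proof -
    define e1 where "e1 j \<omega> = \<bar>(\<Sum>i<n. (\<phi> j (Y i \<omega>))\<^sup>2) / real n - mean (\<lambda>y. (\<phi> j y)\<^sup>2)\<bar>" for j \<omega>
    define e2 where "e2 j \<omega> = \<bar>(\<Sum>i<n. \<phi> j (Y i \<omega>)) / real n - mean (\<phi> j)\<bar>" for j \<omega>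
    have i1: "integrable P (e1 j)" "integrable P (e2 j)" for j
      unfolding e1_def e2_def using int1 int2
      by (intro integrable_abs Bochner_Integration.integrable_diff integrable_divide Bochner_Integration.integrable_sum integrable_const; simp)+
    have E1: "expectation (e1 j) \<le> (4 * (K\<^sup>2)\<^sup>2 + 1) / sqrt (real n)" for j
      unfolding e1_def by (rule emp_mean_L1[OF _ K2 n]) measurable
    have E2: "expectation (e2 j) \<le> (4 * K\<^sup>2 + 1) / sqrt (real n)" for j
      unfolding e2_def by (rule emp_mean_L1[OF _ K n]) measurable
    have pw: "norm (a n (data \<omega>) * (\<Prod>j\<in>{1..M}. z n j (data \<omega>)) - a n (data \<omega>) * (\<Prod>j\<in>{1..M}. c j))
        \<le> (\<Sum>j\<in>{1..M}. B / sqrt (real n) + (e1 j \<omega> + 2 * K * e2 j \<omega>))" for \<omega>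
    proof -
      have "norm (a n (data \<omega>) * (\<Prod>j\<in>{1..M}. z n j (data \<omega>)) - a n (data \<omega>) * (\<Prod>j\<in>{1..M}. c j))
         = norm ((\<Prod>j\<in>{1..M}. z n j (data \<omega>)) - (\<Prod>j\<in>{1..M}. c j))"
        by (simp add: right_diff_distrib[symmetric] norm_mult na)
      also have "\<dots> \<le> (\<Sum>j\<in>{1..M}. norm (z n j (data \<omega>) - c j))"
        by (rule norm_prod_diff) (simp_all add: nz nc)
      also have "\<dots> \<le> (\<Sum>j\<in>{1..M}. B / sqrt (real n) + (e1 j \<omega> + 2 * K * e2 j \<omega>))"
      proof (rule sum_mono)
        fix j
        have "norm (complex_of_real (exp (- s n j (data \<omega>) / 2)) - c j) = \<bar>exp (- (s n j (data \<omega>) / 2)) - exp (- (v j / 2))\<bar>"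
          unfolding c_def of_real_diff[symmetric] norm_of_real by simp
        also have "\<dots> \<le> \<bar>s n j (data \<omega>) / 2 - v j / 2\<bar>"
          using s0 v0 by (intro abs_exp_minus_diff_le) auto
        also have "\<dots> \<le> \<bar>s n j (data \<omega>) - v j\<bar>" by (simp add: diff_divide_distrib[symmetric])
        also have "\<dots> \<le> e1 j \<omega> + 2 * K * e2 j \<omega>" unfolding e1_def e2_def by (rule sv[OF n])
        finally show "norm (z n j (data \<omega>) - c j) \<le> B / sqrt (real n) + (e1 j \<omega> + 2 * K * e2 j \<omega>)"
          using norm_diff_triangle_le[OF ns[OF n, of j "data \<omega>"]] by blast
      qed
      finally show ?thesis .
    qed
    have "norm ((\<integral>\<omega>. a n (data \<omega>) * (\<Prod>j\<in>{1..M}. z n j (data \<omega>)) \<partial>P) - (\<integral>\<omega>. a n (data \<omega>) \<partial>P) * (\<Prod>j\<in>{1..M}. c j))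
      = norm (\<integral>\<omega>. a n (data \<omega>) * (\<Prod>j\<in>{1..M}. z n j (data \<omega>)) - a n (data \<omega>) * (\<Prod>j\<in>{1..M}. c j) \<partial>P)"
      using iaz[of n] ia[of n] by (subst Bochner_Integration.integral_diff) auto
    also have "\<dots> \<le> (\<integral>\<omega>. norm (a n (data \<omega>) * (\<Prod>j\<in>{1..M}. z n j (data \<omega>)) - a n (data \<omega>) * (\<Prod>j\<in>{1..M}. c j)) \<partial>P)"
      by (rule integral_norm_bound)
    also have "\<dots> \<le> (\<integral>\<omega>. (\<Sum>j\<in>{1..M}. B / sqrt (real n) + (e1 j \<omega> + 2 * K * e2 j \<omega>)) \<partial>P)"
      using iaz[of n] ia[of n] i1 pw by (intro integral_mono) auto
    also have "\<dots> = (\<Sum>j\<in>{1..M}. B / sqrt (real n) + (expectation (e1 j) + 2 * K * expectation (e2 j)))"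
      using i1 by (simp add: prob_space)
    also have "\<dots> \<le> (\<Sum>j\<in>{1..M}. B / sqrt (real n) + ((4 * (K\<^sup>2)\<^sup>2 + 1) / sqrt (real n) + 2 * K * ((4 * K\<^sup>2 + 1) / sqrt (real n))))"
      using E1 E2 K0 by (intro sum_mono add_left_mono add_mono mult_left_mono) auto
    also have "\<dots> = real M * ((B + B1) / sqrt (real n))"
      by (simp add: B1_def add_divide_distrib distrib_left)
    finally show ?thesis .
  qed
  have d2: "norm ((\<integral>\<omega>. a n (data \<omega>) \<partial>P) - c 0) \<le> B / sqrt (real n)" if n: "n > 0" for n
  proof -
    have "(\<integral>\<omega>. a n (data \<omega>) \<partial>P) = (\<integral>\<omega>. (\<Prod>i<n. exp (\<i> * complex_of_real ((\<phi> 0 (Y i \<omega>) - mean (\<phi> 0)) / sqrt (real n)))) \<partial>P)"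
      unfolding a_def by (intro Bochner_Integration.integral_cong) (simp_all add: exp_sum[symmetric] sum_distrib_left sum_divide_distrib)
    also have "\<dots> = (\<integral>\<omega>. exp (\<i> * complex_of_real ((\<phi> 0 (Y 0 \<omega>) - mean (\<phi> 0)) / sqrt (real n))) \<partial>P) ^ n"
      by (rule expectation_prod_Y[of "\<lambda>y. exp (\<i> * complex_of_real ((\<phi> 0 y - mean (\<phi> 0)) / sqrt (real n)))" 1])
         (auto simp del: of_real_divide of_real_diff)
    finally have "(\<integral>\<omega>. a n (data \<omega>) \<partial>P) = (\<integral>\<omega>. exp (\<i> * complex_of_real ((\<phi> 0 (Y 0 \<omega>) - mean (\<phi> 0)) / sqrt (real n))) \<partial>P) ^ n" .
    moreover have "norm ((\<integral>\<omega>. exp (\<i> * complex_of_real ((\<phi> 0 (Y 0 \<omega>) - mean (\<phi> 0)) / sqrt (real n))) \<partial>P) ^ n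
        - complex_of_real (exp (- expectation (\<lambda>\<omega>. (\<phi> 0 (Y 0 \<omega>) - mean (\<phi> 0))\<^sup>2) / 2))) \<le> ((2*K)^3 + (2*K)^4) / sqrt (real n)"
    proof (rule iexp_power_approx[OF _ _ _ n])
      show "\<bar>\<phi> 0 (Y 0 x) - mean (\<phi> 0)\<bar> \<le> 2 * K" for x using K[of 0 "Y 0 x"] mK[of 0] by linarith
      show "expectation (\<lambda>\<omega>. \<phi> 0 (Y 0 \<omega>) - mean (\<phi> 0)) = 0"
        using int1[of 0 0] by (simp add: mean_def prob_space)
    qed measurable
    ultimately show ?thesis by (simp add: var c_def B_def)
  qed
  have prodc: "c 0 * (\<Prod>j\<in>{1..M}. c j) = complex_of_real (exp (- (\<Sum>j\<le>M. v j) / 2))"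
  proof -
    have "{..M} = insert 0 {1..M}" by auto
    then have "c 0 * (\<Prod>j\<in>{1..M}. c j) = (\<Prod>j\<le>M. c j)" by simp
    also have "\<dots> = complex_of_real (\<Prod>j\<le>M. exp (- v j / 2))" by (simp add: c_def)
    also have "(\<Prod>j\<le>M. exp (- v j / 2)) = exp (- (\<Sum>j\<le>M. v j) / 2)"
      by (simp add: exp_sum[symmetric] sum_negf sum_divide_distrib)
    finally show ?thesis .
  qed
  have bound: "norm ((\<integral>\<omega>. a n (data \<omega>) * (\<Prod>j\<in>{1..M}. z n j (data \<omega>)) \<partial>P) - complex_of_real (exp (- (\<Sum>j\<le>M. v j) / 2)))
      \<le> (real M * (B + B1) + B) * (1 / sqrt (real n))" if n: "n > 0" for n
  proof -
    have "norm ((\<integral>\<omega>. a n (data \<omega>) \<partial>P) * (\<Prod>j\<in>{1..M}. c j) - c 0 * (\<Prod>j\<in>{1..M}. c j)) \<le> B / sqrt (real n) * 1"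
      unfolding left_diff_distrib[symmetric] norm_mult
      by (intro mult_mono d2[OF n]) (auto simp: prod_norm[symmetric] nc intro!: prod_le_1 prod_nonneg order_trans[OF norm_ge_zero d2[OF n]])
    from norm_diff_triangle_le[OF d1[OF n] this] show ?thesis
      unfolding prodc by (simp add: algebra_simps add_divide_distrib)
  qed
  have "(\<lambda>n. (\<integral>\<omega>. a n (data \<omega>) * (\<Prod>j\<in>{1..M}. z n j (data \<omega>)) \<partial>P) - complex_of_real (exp (- (\<Sum>j\<le>M. v j) / 2))) \<longlonglongrightarrow> 0"
  proof (rule Lim_null_comparison)
    show "\<forall>\<^sub>F n in sequentially. norm ((\<integral>\<omega>. a n (data \<omega>) * (\<Prod>j\<in>{1..M}. z n j (data \<omega>)) \<partial>P) - complex_of_real (exp (- (\<Sum>j\<le>M. v j) / 2)))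
      \<le> (real M * (B + B1) + B) * (1 / sqrt (real n))"
      using eventually_gt_at_top[of 0] by eventually_elim (rule bound)
    have "(\<lambda>n. 1 / sqrt (real n)) \<longlonglongrightarrow> 0"
      by (intro tendsto_divide_0[OF tendsto_const] filterlim_at_top_imp_at_infinity filterlim_compose[OF sqrt_at_top] filterlim_real_sequentially)
    then show "(\<lambda>n. (real M * (B + B1) + B) * (1 / sqrt (real n))) \<longlonglongrightarrow> 0"
      by (rule tendsto_mult_right_zero)
  qed
  then show ?thesis unfolding eq v_def by (rule LIM_zero_cancel)
qed

text \<open>Bernstein-type bound: the second moment of an indicator equals its mean, so indicators
  of rare events have small exponential moments, and increments over short links are of this kind.
  The restriction on \<open>l\<close> keeps each exponent in [-1, 1], where \<open>exp\<close> lies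
  below a quadratic. The factor 2 is slack that gives this bound the same form as the bootstrap
  one.\<close>

lemma exp_bound_emp_proc:
  assumes f[measurable]: "f \<in> borel_measurable borel" and f01: "\<And>y. f y = 0 \<or> f y = 1"
    and l: "\<bar>l\<bar> \<le> sqrt (real n)" and n: "n > 0"
  shows "integrable P (\<lambda>\<omega>. exp (l * emp_proc n f \<omega>))"
    and "expectation (\<lambda>\<omega>. exp (l * emp_proc n f \<omega>)) \<le> exp (2 * l\<^sup>2 * mean f)"
proof -
  define s where "s = sqrt (real n)"
  have s: "s > 0" "s\<^sup>2 = real n" using n by (auto simp: s_def)
  have fb: "\<bar>f y\<bar> \<le> 1" "0 \<le> f y" "f y * f y = f y" for y using f01[of y] by auto
  have fi: "integrable P (\<lambda>\<omega>. f (Y i \<omega>))" for i using fb by (intro integrable_fun_Y[of f 1]) auto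
  have mu: "0 \<le> mean f" "mean f \<le> 1"
    using abs_mean_le[OF f fb(1)] fb(2) by (auto simp: mean_def)
  have d: "\<bar>f y - mean f\<bar> \<le> 1" for y using mu f01[of y] by auto
  define g where "g y = exp (l * (f y - mean f) / s)" for y
  have [measurable]: "g \<in> borel_measurable borel" unfolding g_def by measurable
  have x1: "\<bar>l * (f y - mean f) / s\<bar> \<le> 1" for y
  proof -
    have "\<bar>l\<bar> * \<bar>f y - mean f\<bar> \<le> s * 1" using l d by (intro mult_mono) (auto simp: s_def)
    then show ?thesis using s by (simp add: abs_mult abs_divide)
  qed
  have g: "norm (g y) \<le> exp 1" for y using abs_le_D1[OF x1[of y]] by (simp add: g_def)
  have eq: "exp (l * emp_proc n f \<omega>) = (\<Prod>i<n. g (Y i \<omega>))" for \<omega>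
    unfolding g_def emp_proc_def s_def[symmetric]
    by (subst exp_sum[symmetric]) (simp_all add: sum_distrib_left sum_divide_distrib)
  show "integrable P (\<lambda>\<omega>. exp (l * emp_proc n f \<omega>))"
    unfolding eq by (intro indep_vars_integrable indep_fun_Y integrable_fun_Y[OF _ g]) auto
  have "expectation (\<lambda>\<omega>. g (Y 0 \<omega>)) \<le> expectation (\<lambda>\<omega>. 1 + l * (f (Y 0 \<omega>) - mean f) / s + (l / s)\<^sup>2 * (f (Y 0 \<omega>) + (mean f)\<^sup>2 - 2 * mean f * f (Y 0 \<omega>)))"
  proof (rule integral_mono)
    show "integrable P (\<lambda>\<omega>. g (Y 0 \<omega>))" by (rule integrable_fun_Y[OF _ g]) measurable
    fix \<omega>
    have "g (Y 0 \<omega>) \<le> 1 + l * (f (Y 0 \<omega>) - mean f) / s + (l * (f (Y 0 \<omega>) - mean f) / s)\<^sup>2"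
      unfolding g_def by (rule exp_le_quadratic[OF x1])
    also have "(l * (f (Y 0 \<omega>) - mean f) / s)\<^sup>2 = (l / s)\<^sup>2 * (f (Y 0 \<omega>) * f (Y 0 \<omega>) + (mean f)\<^sup>2 - 2 * mean f * f (Y 0 \<omega>))"
      by (simp add: power_divide power_mult_distrib) (simp add: power2_eq_square algebra_simps)
    finally show "g (Y 0 \<omega>) \<le> 1 + l * (f (Y 0 \<omega>) - mean f) / s + (l / s)\<^sup>2 * (f (Y 0 \<omega>) + (mean f)\<^sup>2 - 2 * mean f * f (Y 0 \<omega>))"
      unfolding fb(3) .
  qed (use fi in simp)
  also have "\<dots> = 1 + (l / s)\<^sup>2 * (mean f - (mean f)\<^sup>2)"
    using fi[of 0] by (simp add: prob_space mean_def[symmetric] power2_eq_square)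
  also have "\<dots> \<le> 1 + 2 * l\<^sup>2 * mean f / real n"
  proof -
    have "(l / s)\<^sup>2 * (mean f - (mean f)\<^sup>2) \<le> (l / s)\<^sup>2 * (2 * mean f)"
      using mu(1) zero_le_power2[of "mean f"] by (intro mult_left_mono) (linarith | simp)+
    then show ?thesis by (simp add: power_divide s(2) mult_ac)
  qed
  also have "\<dots> \<le> exp (2 * l\<^sup>2 * mean f / real n)" by (rule exp_ge_add_one_self)
  finally have "expectation (\<lambda>\<omega>. g (Y 0 \<omega>)) ^ n \<le> exp (2 * l\<^sup>2 * mean f / real n) ^ n"
    by (intro power_mono) (auto simp: g_def intro!: integral_nonneg)
  also have "\<dots> = exp (2 * l\<^sup>2 * mean f)" using n by (simp add: exp_of_nat_mult[symmetric])
  finally show "expectation (\<lambda>\<omega>. exp (l * emp_proc n f \<omega>)) \<le> exp (2 * l\<^sup>2 * mean f)"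
    unfolding eq by (subst expectation_prod_Y[OF _ g]) auto
qed

text \<open>Given the data the same argument yields the exponential of l^2 times the sample mean of
  \<open>f\<close>. That sample mean is itself a sum over independent points, and bounding its
  exponential moment through \<open>exp x \<le> 1 + 2 * x\<close> on [0, 1] costs the factor
  2.\<close>

lemma exp_bound_boot_proc:
  assumes f[measurable]: "f \<in> borel_measurable borel" and f01: "\<And>y. f y = 0 \<or> f y = 1"
    and l: "\<bar>l\<bar> \<le> sqrt (real n)" and n: "n > 0" and j: "1 \<le> j" "j \<le> M"
  shows "integrable P (\<lambda>\<omega>. exp (l * boot_proc n j f \<omega>))"
    and "expectation (\<lambda>\<omega>. exp (l * boot_proc n j f \<omega>)) \<le> exp (2 * l\<^sup>2 * mean f)"
proof -
  define s where "s = sqrt (real n)"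
  have s: "s > 0" "s\<^sup>2 = real n" using n by (auto simp: s_def)
  have fb: "\<bar>f y\<bar> \<le> 1" "0 \<le> f y" "f y * f y = f y" for y using f01[of y] by auto
  have fi: "integrable P (\<lambda>\<omega>. f (Y i \<omega>))" for i using fb by (intro integrable_fun_Y[of f 1]) auto
  have mu: "0 \<le> emp_avg n f y" "emp_avg n f y \<le> 1" for y
    using abs_emp_avg_le[of f 1 n y] fb(1) n fb(2) by (auto simp: emp_avg_def sum_nonneg)
  have d: "\<bar>f x - emp_avg n f y\<bar> \<le> 1" for x y using mu[of y] f01[of x] by auto
  \<comment> \<open>Only resample \<open>j\<close> carries a factor; the others are set to 1 so that
    \<open>resample_prod\<close> applies.\<close>
  define b where "b y k x = (if k = j then exp (l * (f x - emp_avg n f y) / s) else 1)" for y and k :: nat and x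
  have x1: "\<bar>l * (f x - emp_avg n f y) / s\<bar> \<le> 1" for x y
  proof -
    have "\<bar>l\<bar> * \<bar>f x - emp_avg n f y\<bar> \<le> s * 1" using l d by (intro mult_mono) (auto simp: s_def)
    then show ?thesis using s by (simp add: abs_mult abs_divide)
  qed
  have nb: "norm (b y k x) \<le> exp 1" for y k x using abs_le_D1[OF x1[of x y]] by (simp add: b_def)
  have [measurable]: "(\<lambda>y. b y k (y i)) \<in> borel_measurable (Pi\<^sub>M UNIV (\<lambda>_. borel))" for k i
    unfolding b_def by measurable
  have bm: "\<bar>boot_proc n j f \<omega>\<bar> \<le> s" for \<omega>
  proof -
    have "\<bar>\<Sum>l<n. f (Y (W n j l \<omega>) \<omega>) - emp_avg n f (data \<omega>)\<bar> \<le> (\<Sum>l<n. 1)"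
      by (intro order_trans[OF sum_abs] sum_mono d)
    then show ?thesis unfolding boot_proc_def s_def[symmetric] using s by (simp add: s(2)[symmetric] field_simps power2_eq_square)
  qed
  show "integrable P (\<lambda>\<omega>. exp (l * boot_proc n j f \<omega>))"
  proof (rule integrable_const_bound[where B="exp (\<bar>l\<bar> * s)"])
    show "AE \<omega> in P. norm (exp (l * boot_proc n j f \<omega>)) \<le> exp (\<bar>l\<bar> * s)"
    proof (rule AE_I2)
      fix \<omega>
      have "l * boot_proc n j f \<omega> \<le> \<bar>l\<bar> * \<bar>boot_proc n j f \<omega>\<bar>" by (simp add: abs_mult[symmetric])
      also have "\<dots> \<le> \<bar>l\<bar> * s" using bm by (intro mult_left_mono) auto
      finally show "norm (exp (l * boot_proc n j f \<omega>)) \<le> exp (\<bar>l\<bar> * s)" by simp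
    qed
  qed measurable
  have one: "(\<Prod>k\<in>{1..M}. if k = j then c else 1) = c" for c :: real using j by simp
  have eq: "exp (l * boot_proc n j f \<omega>) = 1 * (\<Prod>k\<in>{1..M}. \<Prod>i<n. b (data \<omega>) k (Y (W n k i \<omega>) \<omega>))" for \<omega>
  proof -
    have "exp (l * boot_proc n j f \<omega>) = (\<Prod>i<n. exp (l * (f (Y (W n j i \<omega>) \<omega>) - emp_avg n f (data \<omega>)) / s))"
      unfolding boot_proc_def s_def[symmetric]
      by (subst exp_sum[symmetric]) (simp_all add: sum_distrib_left sum_divide_distrib)
    moreover have "(\<Prod>i<n. b (data \<omega>) k (Y (W n k i \<omega>) \<omega>)) = (if k = j then \<Prod>i<n. exp (l * (f (Y (W n j i \<omega>) \<omega>) - emp_avg n f (data \<omega>)) / s) else 1)" for k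
      by (simp add: b_def)
    ultimately show ?thesis by (simp only: one)
  qed
  define A where "A y = (\<Sum>i<n. exp (l * (f (y i) - emp_avg n f y) / s)) / real n" for y
  have Am[measurable]: "A \<in> borel_measurable (Pi\<^sub>M UNIV (\<lambda>_. borel))" unfolding A_def by measurable
  have A0: "0 \<le> A y" for y by (simp add: A_def sum_nonneg)
  have Ab: "A y ^ n \<le> exp (l\<^sup>2 * emp_avg n f y)" for y
  proof -
    let ?m = "emp_avg n f y"
    have S: "(\<Sum>i<n. f (y i)) = real n * ?m" using n by (simp add: emp_avg_def)
    have "(\<Sum>i<n. exp (l * (f (y i) - ?m) / s)) \<le> (\<Sum>i<n. 1 + (l / s) * (f (y i) - ?m) + (l / s)\<^sup>2 * (f (y i) + ?m\<^sup>2 - 2 * ?m * f (y i)))"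
    proof (rule sum_mono)
      fix i
      have "exp (l * (f (y i) - ?m) / s) \<le> 1 + l * (f (y i) - ?m) / s + (l * (f (y i) - ?m) / s)\<^sup>2"
        by (rule exp_le_quadratic[OF x1])
      also have "(l * (f (y i) - ?m) / s)\<^sup>2 = (l / s)\<^sup>2 * (f (y i) * f (y i) + ?m\<^sup>2 - 2 * ?m * f (y i))"
        by (simp add: power_divide power_mult_distrib) (simp add: power2_eq_square algebra_simps)
      finally show "exp (l * (f (y i) - ?m) / s) \<le> 1 + (l / s) * (f (y i) - ?m) + (l / s)\<^sup>2 * (f (y i) + ?m\<^sup>2 - 2 * ?m * f (y i))"
        unfolding fb(3) by simp
    qed
    also have "\<dots> = real n + (l / s) * ((\<Sum>i<n. f (y i)) - real n * ?m) + (l / s)\<^sup>2 * ((\<Sum>i<n. f (y i)) + real n * ?m\<^sup>2 - 2 * ?m * (\<Sum>i<n. f (y i)))"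
    proof -
      have "(\<Sum>i<n. 1 + c * (f (y i) - m) + d * (f (y i) + m2 - k * f (y i)))
         = real n + c * ((\<Sum>i<n. f (y i)) - real n * m) + d * ((\<Sum>i<n. f (y i)) + real n * m2 - k * (\<Sum>i<n. f (y i)))"
        for c d m m2 k :: real
        by (simp add: sum.distrib sum_subtractf sum_distrib_left[symmetric])
      then show ?thesis .
    qed
    also have "\<dots> = real n * (1 + (l / s)\<^sup>2 * (?m - ?m\<^sup>2))"
      unfolding S by (simp add: power2_eq_square algebra_simps)
    finally have "A y \<le> 1 + (l / s)\<^sup>2 * (?m - ?m\<^sup>2)"
      using n by (simp add: A_def field_simps)
    also have "\<dots> \<le> 1 + (l / s)\<^sup>2 * ?m" by (intro add_left_mono mult_left_mono) auto
    also have "\<dots> \<le> exp ((l / s)\<^sup>2 * ?m)" by (rule exp_ge_add_one_self)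
    finally have "A y ^ n \<le> exp ((l / s)\<^sup>2 * ?m) ^ n" using A0 by (intro power_mono)
    also have "\<dots> = exp (l\<^sup>2 * ?m)" using n by (simp add: exp_of_nat_mult[symmetric] power_divide s(2))
    finally show ?thesis .
  qed
  \<comment> \<open>Contribution of a single observation to the exponential of the sample mean, so
    that independence of the data can be used a second time.\<close>
  define g where "g y = exp (l\<^sup>2 * f y / real n)" for y
  have [measurable]: "g \<in> borel_measurable borel" unfolding g_def by measurable
  have l2: "l\<^sup>2 / real n \<le> 1"
  proof -
    have "l\<^sup>2 \<le> s\<^sup>2" using power_mono[OF l, of 2] by (simp add: s_def)
    then show ?thesis using s n by simp
  qed
  have x2: "0 \<le> l\<^sup>2 * f y / real n" "l\<^sup>2 * f y / real n \<le> 1" for y using l2 f01[of y] by auto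
  have g: "norm (g y) \<le> exp 1" for y using x2[of y] by (simp add: g_def)
  have ge: "exp (l\<^sup>2 * emp_avg n f (data \<omega>)) = (\<Prod>i<n. g (Y i \<omega>))" for \<omega>
    unfolding g_def emp_avg_def by (subst exp_sum[symmetric]) (simp_all add: sum_distrib_left sum_divide_distrib)
  have Ai: "integrable P (\<lambda>\<omega>. exp (l\<^sup>2 * emp_avg n f (data \<omega>)))"
    unfolding ge by (intro indep_vars_integrable indep_fun_Y integrable_fun_Y[OF _ g]) auto
  have "expectation (\<lambda>\<omega>. exp (l * boot_proc n j f \<omega>))
      = expectation (\<lambda>\<omega>. 1 * (\<Prod>k\<in>{1..M}. ((\<Sum>i<n. b (data \<omega>) k (Y i \<omega>)) / of_nat n) ^ n))"
    unfolding eq by (rule resample_prod[where Ba=1, OF _ _ _ nb]) auto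
  also have "\<dots> = expectation (\<lambda>\<omega>. A (data \<omega>) ^ n)"
  proof (rule Bochner_Integration.integral_cong[OF refl])
    fix \<omega>
    have "((\<Sum>i<n. b (data \<omega>) k (Y i \<omega>)) / of_nat n) ^ n = (if k = j then A (data \<omega>) ^ n else 1)" for k
      using n by (simp add: b_def A_def)
    then show "1 * (\<Prod>k\<in>{1..M}. ((\<Sum>i<n. b (data \<omega>) k (Y i \<omega>)) / of_nat n) ^ n) = A (data \<omega>) ^ n"
      by (simp only: one)
  qed
  also have "\<dots> \<le> expectation (\<lambda>\<omega>. exp (l\<^sup>2 * emp_avg n f (data \<omega>)))"
    using Ab A0 by (intro integral_mono Ai Bochner_Integration.integrable_bound[OF Ai])
      (auto intro!: borel_measurable_power measurable_compose[OF data_measurable Am])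
  also have "\<dots> = expectation (\<lambda>\<omega>. g (Y 0 \<omega>)) ^ n"
    unfolding ge by (rule expectation_prod_Y[OF _ g]) measurable
  also have "\<dots> \<le> exp (2 * l\<^sup>2 * mean f / real n) ^ n"
  proof (rule power_mono)
    have "expectation (\<lambda>\<omega>. g (Y 0 \<omega>)) \<le> expectation (\<lambda>\<omega>. 1 + 2 * (l\<^sup>2 * f (Y 0 \<omega>) / real n))"
      using fi by (intro integral_mono integrable_fun_Y[OF _ g]) (auto simp: g_def simp del: times_divide_eq_right intro!: exp_le_linear x2)
    also have "\<dots> = 1 + 2 * l\<^sup>2 * mean f / real n" using fi[of 0] by (simp add: prob_space mean_def)
    also have "\<dots> \<le> exp (2 * l\<^sup>2 * mean f / real n)" by (rule exp_ge_add_one_self)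
    finally show "expectation (\<lambda>\<omega>. g (Y 0 \<omega>)) \<le> exp (2 * l\<^sup>2 * mean f / real n)" .
  qed (auto simp: g_def intro!: integral_nonneg)
  also have "\<dots> = exp (2 * l\<^sup>2 * mean f)" using n by (simp add: exp_of_nat_mult[symmetric])
  finally show "expectation (\<lambda>\<omega>. exp (l * boot_proc n j f \<omega>)) \<le> exp (2 * l\<^sup>2 * mean f)" .
qed

end

lemma (in prob_space) two_sided_chernoff:
  assumes [measurable]: "S \<in> borel_measurable M" and l: "l > 0"
    and i: "integrable M (\<lambda>\<omega>. exp (l * S \<omega>))" "integrable M (\<lambda>\<omega>. exp (- l * S \<omega>))"
    and b: "expectation (\<lambda>\<omega>. exp (l * S \<omega>)) \<le> C" "expectation (\<lambda>\<omega>. exp (- l * S \<omega>)) \<le> C"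
  shows "prob {\<omega>\<in>space M. \<bar>S \<omega>\<bar> > t} \<le> 2 * C * exp (- l * t)"
proof -
  have *: "prob {\<omega>\<in>space M. T \<omega> \<ge> t} \<le> C * exp (- l * t)"
    if [measurable]: "T \<in> borel_measurable M" and "integrable M (\<lambda>\<omega>. exp (l * T \<omega>))" "expectation (\<lambda>\<omega>. exp (l * T \<omega>)) \<le> C" for T
  proof -
    have "prob {\<omega>\<in>space M. T \<omega> \<ge> t} = prob {\<omega>\<in>space M. exp (l * T \<omega>) \<ge> exp (l * t)}" using l by simp
    also have "\<dots> \<le> expectation (\<lambda>\<omega>. exp (l * T \<omega>)) / exp (l * t)"
      using that(2) by (intro integral_Markov_inequality_measure[of _ _ "{}"]) auto
    also have "\<dots> \<le> C / exp (l * t)" using that by (intro divide_right_mono) auto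
    finally show ?thesis by (simp add: exp_minus divide_inverse)
  qed
  have "prob {\<omega>\<in>space M. \<bar>S \<omega>\<bar> > t} \<le> prob ({\<omega>\<in>space M. S \<omega> \<ge> t} \<union> {\<omega>\<in>space M. - S \<omega> \<ge> t})"
    by (intro finite_measure_mono) auto
  also have "\<dots> \<le> prob {\<omega>\<in>space M. S \<omega> \<ge> t} + prob {\<omega>\<in>space M. - S \<omega> \<ge> t}"
    by (intro measure_Un_le) measurable
  also have "\<dots> \<le> C * exp (- l * t) + C * exp (- l * t)"
    using *[of S] *[of "\<lambda>\<omega>. - S \<omega>"] i b by (intro add_mono) auto
  finally show ?thesis by simp
qed

lemma (in resampling) tail_emp_proc:
  assumes f: "f \<in> borel_measurable borel" and f01: "\<And>y. f y = 0 \<or> f y = 1"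
    and l: "0 < l" "l \<le> sqrt (real n)"
  shows "prob {\<omega>\<in>space P. \<bar>emp_proc n f \<omega>\<bar> > t} \<le> 2 * exp (2 * l\<^sup>2 * mean f) * exp (- l * t)"
proof -
  have n: "n > 0" using l by (cases n) auto
  show ?thesis
    using exp_bound_emp_proc[OF f f01, of l n] exp_bound_emp_proc[OF f f01, of "-l" n] l n f
    by (intro two_sided_chernoff) auto
qed

lemma (in resampling) tail_boot_proc:
  assumes f: "f \<in> borel_measurable borel" and f01: "\<And>y. f y = 0 \<or> f y = 1"
    and l: "0 < l" "l \<le> sqrt (real n)" and j: "1 \<le> j" "j \<le> M"
  shows "prob {\<omega>\<in>space P. \<bar>boot_proc n j f \<omega>\<bar> > t} \<le> 2 * exp (2 * l\<^sup>2 * mean f) * exp (- l * t)"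
proof -
  have n: "n > 0" using l by (cases n) auto
  show ?thesis
    using exp_bound_boot_proc[OF f f01, of l n j] exp_bound_boot_proc[OF f f01, of "-l" n j] l n f j
    by (intro two_sided_chernoff) auto
qed

section \<open>Conditional copulas\<close>

lemma eventually_const_over_sqrt_le:
  fixes c e :: real
  assumes "e > 0"
  shows "\<forall>\<^sub>F n in sequentially. c / sqrt (real n) \<le> e"
proof -
  have "(\<lambda>n. c / sqrt (real n)) \<longlonglongrightarrow> 0"
    by (intro tendsto_divide_0[OF tendsto_const] filterlim_at_top_imp_at_infinity
        filterlim_compose[OF sqrt_at_top] filterlim_real_sequentially)
  then show ?thesis using order_tendstoD(2)[of _ 0 sequentially e] assms
    by (metis (mono_tags, lifting) eventually_mono less_imp_le)
qed

section \<open>Points of the cube and the first-order expansion\<close>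

lemma onevec_nth[simp]: "onevec $ k = 1"
  by (simp add: onevec_def)

lemma vupd_nth[simp]: "vupd u i t $ k = (if k = i then t else u $ k)"
  by (simp add: vupd_def)

lemma vupd_self[simp]: "vupd u i (u $ i) = u"
  by (simp add: vec_eq_iff)

lemma vupd_vupd[simp]: "vupd (vupd u i s) i t = vupd u i t"
  by (simp add: vec_eq_iff)

lemma cube_nth: "u \<in> cube \<Longrightarrow> 0 \<le> u $ k \<and> u $ k \<le> 1"
  by (simp add: cube_def)

lemma vupd_in_cube: "u \<in> cube \<Longrightarrow> t \<in> {0..1} \<Longrightarrow> vupd u i t \<in> cube"
  by (simp add: cube_def)

lemma onevec_in_cube[simp]: "onevec \<in> cube"
  by (simp add: cube_def)

lemma zero_in_cube[simp]: "0 \<in> cube"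
  by (simp add: cube_def)

lemma compact_cube: "compact (cube :: (real^'p) set)"
proof -
  have "cube = cbox (0::real^'p) 1" by (auto simp: cube_def mem_box_cart)
  then show ?thesis using compact_cbox by metis
qed

text \<open>Move from \<open>u\<close> to \<open>v\<close> one coordinate at a time inside the
  closed cube and use the mean value inequality in each; uniform continuity of the partial
  derivatives on the compact cube makes \<open>d\<close> independent of the point.\<close>

lemma C1_expansion:
  fixes C :: "real^'p \<Rightarrow> real"
  assumes C1: "C1_on_cube C" and e: "e > 0"
  shows "\<exists>d>0. \<forall>u\<in>cube. \<forall>v\<in>cube. (\<forall>k. \<bar>v $ k - u $ k\<bar> \<le> d) \<longrightarrow>
     \<bar>C v - C u - (\<Sum>k\<in>UNIV. cube_partial C k u * (v $ k - u $ k))\<bar> \<le> e * (\<Sum>k\<in>UNIV. \<bar>v $ k - u $ k\<bar>)"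
proof -
  have uc: "uniformly_continuous_on cube (cube_partial C k)" for k
    using C1 by (intro compact_uniformly_continuous compact_cube) (simp add: C1_on_cube_def)
  have "\<forall>k. \<exists>d>0. \<forall>u\<in>cube. \<forall>v\<in>cube. dist v u < d \<longrightarrow> dist (cube_partial C k v) (cube_partial C k u) < e"
    using uc e unfolding uniformly_continuous_on_def by blast
  then obtain dd where dd: "\<And>k. dd k > 0"
    "\<And>k u v. u \<in> cube \<Longrightarrow> v \<in> cube \<Longrightarrow> dist v u < dd k \<Longrightarrow> dist (cube_partial C k v) (cube_partial C k u) < e"
    by metis
  define d0 where "d0 = Min (range dd)"
  have d0: "d0 > 0" "\<And>k. d0 \<le> dd k" unfolding d0_def using dd(1) by auto
  \<comment> \<open>Closeness is measured per coordinate, continuity in the Euclidean norm. The norm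
    is at most the sum of the coordinate distances, here at most d0 / 2.\<close>
  define d where "d = d0 / (2 * real CARD('p))"
  have d: "d > 0" using d0 by (simp add: d_def)
  have distd: "dist v u < d0" if "\<forall>k. \<bar>v $ k - u $ k\<bar> \<le> d" for u v :: "real^'p"
  proof -
    have "dist v u \<le> (\<Sum>k\<in>UNIV. \<bar>(v - u) $ k\<bar>)" unfolding dist_norm by (rule norm_le_l1_cart)
    also have "\<dots> \<le> (\<Sum>k\<in>(UNIV::'p set). d)" using that by (intro sum_mono) simp
    also have "\<dots> = d0 / 2" by (simp add: d_def)
    finally show ?thesis using d0 by linarith
  qed
  show ?thesis
  proof (intro exI[of _ d] conjI ballI impI d)
    fix u v :: "real^'p" assume u: "u \<in> cube" and v: "v \<in> cube" and uv: "\<forall>k. \<bar>v $ k - u $ k\<bar> \<le> d"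
    \<comment> \<open>Hybrid points, with the coordinates in \<open>S\<close> already moved to
      \<open>v\<close>; they stay in the cube because it is a product.\<close>
    define w where "w S = (\<chi> k. if k \<in> S then v $ k else u $ k)" for S :: "'p set"
    have "\<bar>C (w S) - C u - (\<Sum>k\<in>S. cube_partial C k u * (v $ k - u $ k))\<bar> \<le> e * (\<Sum>k\<in>S. \<bar>v $ k - u $ k\<bar>)"
      if "finite S" for S using that
    proof (induction S rule: finite_induct)
      case empty
      have "w {} = u" by (simp add: w_def vec_eq_iff)
      then show ?case by simp
    next
      case (insert i S)
      have wc: "w S \<in> cube" using u v by (simp add: w_def cube_def)
      have wi: "w S $ i = u $ i" using insert by (simp add: w_def)
      have wI: "w (insert i S) = vupd (w S) i (v $ i)" by (simp add: vec_eq_iff w_def)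
      define I where "I = {min (u $ i) (v $ i)..max (u $ i) (v $ i)}"
      have I: "I \<subseteq> {0..1}" using cube_nth[OF u, of i] cube_nth[OF v, of i] by (auto simp: I_def)
      \<comment> \<open>Subtracting the linear term leaves a function whose derivative is an
        oscillation of the partial derivative, hence at most \<open>e\<close> in absolute
        value.\<close>
      define g where "g t = C (vupd (w S) i t) - cube_partial C i u * t" for t
      have "norm (g (v $ i) - g (u $ i)) \<le> e * norm (v $ i - u $ i)"
      proof (rule field_differentiable_bound[where S=I and f'="\<lambda>t. cube_partial C i (vupd (w S) i t) - cube_partial C i u"])
        show "convex I" by (simp add: I_def)
        fix t assume t: "t \<in> I"
        have tc: "vupd (w S) i t \<in> cube" using t I by (intro vupd_in_cube wc) auto
        have "((\<lambda>t'. C (vupd (w S) i t')) has_real_derivative cube_partial C i (vupd (w S) i t)) (at t within {0..1})"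
          using C1[unfolded C1_on_cube_def] tc by (auto dest!: spec[of _ i] bspec[OF _ tc])
        then have "((\<lambda>t'. C (vupd (w S) i t')) has_real_derivative cube_partial C i (vupd (w S) i t)) (at t within I)"
          by (rule DERIV_subset[OF _ I])
        then show "(g has_field_derivative cube_partial C i (vupd (w S) i t) - cube_partial C i u) (at t within I)"
          unfolding g_def by (auto intro!: derivative_eq_intros)
        have "\<forall>k. \<bar>vupd (w S) i t $ k - u $ k\<bar> \<le> d"
          using uv d t by (auto simp: w_def I_def min_def max_def abs_le_iff split: if_splits) (smt (verit) uv)+
        then have "dist (vupd (w S) i t) u < dd i" using distd d0(2)[of i] by (metis order_less_le_trans)
        from dd(2)[OF u tc this] show "norm (cube_partial C i (vupd (w S) i t) - cube_partial C i u) \<le> e"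
          by (simp add: dist_real_def)
      qed (auto simp: I_def)
      moreover have "g (v $ i) - g (u $ i) = C (w (insert i S)) - C (w S) - cube_partial C i u * (v $ i - u $ i)"
        unfolding wI g_def using vupd_self[of "w S" i] wi by (simp add: algebra_simps)
      ultimately show ?case using insert by (simp add: distrib_left)
    qed
    from this[of UNIV] show "\<bar>C v - C u - (\<Sum>k\<in>UNIV. cube_partial C k u * (v $ k - u $ k))\<bar> \<le> e * (\<Sum>k\<in>UNIV. \<bar>v $ k - u $ k\<bar>)"
      by (simp add: w_def)
  qed
qed

lemma cube_partial_bounded:
  fixes C :: "real^'p \<Rightarrow> real"
  assumes C1: "C1_on_cube C"
  obtains B where "B \<ge> 0" "\<And>k u. u \<in> cube \<Longrightarrow> \<bar>cube_partial C k u\<bar> \<le> B"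
proof -
  have "\<forall>k. \<exists>B. \<forall>u\<in>cube. \<bar>cube_partial C k u\<bar> \<le> B"
  proof
    fix k
    have "compact (cube_partial C k ` cube)"
      using C1 by (intro compact_continuous_image compact_cube) (simp add: C1_on_cube_def)
    then show "\<exists>B. \<forall>u\<in>cube. \<bar>cube_partial C k u\<bar> \<le> B"
      using compact_imp_bounded bounded_iff by (metis image_eqI real_norm_def)
  qed
  then obtain B where B: "\<And>k u. u \<in> cube \<Longrightarrow> \<bar>cube_partial C k u\<bar> \<le> B k" by metis
  have B0: "B k \<ge> 0" for k using B[OF zero_in_cube, of k] by linarith
  show ?thesis
  proof (rule that[of "\<Sum>k\<in>UNIV. B k"])
    show "\<bar>cube_partial C k u\<bar> \<le> (\<Sum>k\<in>UNIV. B k)" if "u \<in> cube" for k u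
      using B[OF that, of k] member_le_sum[of k UNIV B] B0 by force
  qed (simp add: B0 sum_nonneg)
qed

text \<open>A single conditioning set. Several sets interact only through the covariance of the
  limit, so the delta method can be carried out set by set.\<close>

locale cond_copula = prob_space Q for Q :: "((real^'p) \<times> 'z::euclidean_space) measure" +
  fixes A :: "'z set"
  assumes sets_Q: "sets Q = sets borel" and A_borel: "A \<in> sets borel"
    and A_pos: "pA Q A > 0"
    and margins_cont: "\<And>k. continuous_on UNIV (condF Q A k)"
    and C1: "C1_on_cube (condcop Q A)"
begin

abbreviation "p \<equiv> pA Q A"

lemma space_Q[simp]: "space Q = UNIV"
  using sets_eq_imp_space_eq[OF sets_Q] by simp

lemma measurable_Q_borel: "measurable Q N = measurable borel N"
  by (rule measurable_cong_sets[OF sets_Q refl])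

lemma fst_nth_measurable[measurable]: "(\<lambda>xz. fst xz $ k) \<in> borel_measurable (borel :: ((real^'p) \<times> 'z) measure)"
  by (intro borel_measurable_continuous_onI continuous_intros)

lemma snd_measurable[measurable]: "(\<lambda>xz. snd xz) \<in> borel_measurable (borel :: ((real^'p) \<times> 'z) measure)"
  by (intro borel_measurable_continuous_onI continuous_intros)

lemma snd_A_measurable[measurable]: "Measurable.pred borel (\<lambda>xz::(real^'p) \<times> 'z. snd xz \<in> A)"
  using A_borel by measurable

lemma condF_measurable[measurable]: "condF Q A k \<in> borel_measurable borel"
  by (rule borel_measurable_continuous_onI[OF margins_cont])

lemma UA_measurable[measurable]: "(\<lambda>xz. UA Q A (fst xz) $ k) \<in> borel_measurable (borel :: ((real^'p) \<times> 'z) measure)"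
  unfolding UA_def by (simp, measurable)

lemma sets_Collect_Q: "Measurable.pred borel R \<Longrightarrow> {xz. R xz} \<in> sets Q"
  unfolding sets_Q using pred_sets2[of UNIV] by (simp add: pred_def)

lemma condF_mono: "s \<le> t \<Longrightarrow> condF Q A k s \<le> condF Q A k t"
  unfolding condF_def
  by (intro divide_right_mono finite_measure_mono sets_Collect_Q) (use A_pos in \<open>auto, measurable\<close>)

lemma condF_bounds: "0 \<le> condF Q A k t" "condF Q A k t \<le> 1"
proof -
  show "0 \<le> condF Q A k t" using A_pos by (simp add: condF_def)
  have "measure Q {xz. fst xz $ k \<le> t \<and> snd xz \<in> A} \<le> p"
    unfolding pA_def by (intro finite_measure_mono sets_Collect_Q) (auto, measurable)
  then show "condF Q A k t \<le> 1" using A_pos by (simp add: condF_def)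
qed

lemma UA_cube: "UA Q A x \<in> cube"
  using condF_bounds by (simp add: cube_def UA_def)

lemma condF_at_top: "\<exists>t. condF Q A k t > s" if "s < 1" for s
proof -
  have "(\<lambda>n. measure Q {xz. fst xz $ k \<le> real n \<and> snd xz \<in> A}) \<longlonglongrightarrow> measure Q (\<Union>n. {xz. fst xz $ k \<le> real n \<and> snd xz \<in> A})"
    by (intro finite_Lim_measure_incseq) (auto simp: incseq_def intro!: sets_Collect_Q, measurable)
  also have "(\<Union>n. {xz. fst xz $ k \<le> real n \<and> snd xz \<in> A}) = {xz. snd xz \<in> A}"
    using real_arch_simple by auto
  finally have "(\<lambda>n. condF Q A k (real n)) \<longlonglongrightarrow> p / p"
    unfolding condF_def pA_def by (intro tendsto_divide tendsto_const) (use A_pos in \<open>auto simp: pA_def\<close>)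
  then have "(\<lambda>n. condF Q A k (real n)) \<longlonglongrightarrow> 1" using A_pos by simp
  from order_tendstoD(1)[OF this that] show ?thesis
    using eventually_sequentially by (metis order_refl)
qed

lemma condF_at_bot: "\<exists>t. condF Q A k t < s" if "s > 0" for s
proof -
  have "(\<lambda>n. measure Q {xz. fst xz $ k \<le> - real n \<and> snd xz \<in> A}) \<longlonglongrightarrow> measure Q (\<Inter>n. {xz. fst xz $ k \<le> - real n \<and> snd xz \<in> A})"
    by (intro finite_Lim_measure_decseq) (auto simp: decseq_def intro!: sets_Collect_Q, measurable)
  also have "(\<Inter>n. {xz. fst xz $ k \<le> - real n \<and> snd xz \<in> A}) = {}"
  proof -
    have False if "\<forall>n. fst xz $ k \<le> - real n" for xz :: "(real^'p) \<times> 'z"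
      using reals_Archimedean2[of "- (fst xz $ k)"] that by (metis less_minus_iff minus_minus not_le)
    then show ?thesis by auto
  qed
  finally have "(\<lambda>n. condF Q A k (- real n)) \<longlonglongrightarrow> 0 / p"
    unfolding condF_def by (intro tendsto_divide tendsto_const) (use A_pos in auto)
  then have "(\<lambda>n. condF Q A k (- real n)) \<longlonglongrightarrow> 0" by simp
  from order_tendstoD(2)[OF this that] show ?thesis
    using eventually_sequentially by (metis order_refl)
qed

text \<open>Probability integral transform for a margin that may have flat pieces, so that no
  inverse is at hand. The sublevel set of a continuous monotone function is empty, a half-line
  ending where the value is \<open>t\<close>, or the whole line; the extreme cases force
  \<open>t\<close> to be 0 or 1.\<close>

lemma uniform_margin:
  assumes t: "t \<in> {0..1}"
  shows "measure Q {xz. condF Q A k (fst xz $ k) \<le> t \<and> snd xz \<in> A} = p * t"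
proof -
  let ?F = "condF Q A k"
  define S where "S = {x. ?F x \<le> t}"
  have clS: "closed S" unfolding S_def
    by (intro closed_Collect_le margins_cont continuous_on_const)
  consider "S = {}" | "S \<noteq> {}" "bdd_above S" | "\<not> bdd_above S" by metis
  then show ?thesis
  proof cases
    case 1
    then have F: "?F x > t" for x by (auto simp: S_def not_le)
    then have t0: "t = 0" using condF_at_bot[of t k] t by (metis atLeastAtMost_iff less_eq_real_def not_less_iff_gr_or_eq)
    have e: "{xz. ?F (fst xz $ k) \<le> t \<and> snd xz \<in> A} = {}" using F by (auto simp: not_le)
    show ?thesis unfolding e by (simp add: t0)
  next
    case 2
    define q where "q = Sup S"
    have qS: "q \<in> S" unfolding q_def using closed_contains_Sup[OF 2 clS] .
    have S_eq: "x \<in> S \<longleftrightarrow> x \<le> q" for x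
    proof
      show "x \<in> S \<Longrightarrow> x \<le> q" unfolding q_def using 2 by (intro cSup_upper)
      show "x \<le> q \<Longrightarrow> x \<in> S" using condF_mono[of x q k] qS by (auto simp: S_def)
    qed
    \<comment> \<open>By continuity, a value below \<open>t\<close> at the right end would let the
      sublevel set continue beyond \<open>q\<close>.\<close>
    have "?F q = t"
    proof (rule ccontr)
      assume "?F q \<noteq> t"
      then have l: "?F q < t" using qS by (simp add: S_def)
      have "isCont ?F q" using margins_cont by (simp add: continuous_on_eq_continuous_at)
      then have "(?F \<longlongrightarrow> ?F q) (at_right q)" by (simp add: isCont_def filterlim_at_split)
      from order_tendstoD(2)[OF this l] have "eventually (\<lambda>x. x > q \<and> ?F x < t) (at_right q)"
        using eventually_at_right_less[of q] by (auto elim: eventually_elim2)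
      then obtain x where "x > q" "?F x < t" using eventually_happens' trivial_limit_at_right_real by blast
      then show False using S_eq[of x] by (simp add: S_def)
    qed
    moreover have "{xz. ?F (fst xz $ k) \<le> t \<and> snd xz \<in> A} = {xz. fst xz $ k \<le> q \<and> snd xz \<in> A}"
      using S_eq by (auto simp: S_def)
    ultimately show ?thesis using A_pos by (simp add: condF_def field_simps)
  next
    case 3
    have F: "?F x \<le> t" for x
    proof -
      obtain y where "y \<in> S" "y > x" using 3 unfolding bdd_above_def by (meson not_le)
      then show ?thesis using condF_mono[of x y k] by (auto simp: S_def)
    qed
    then have "t = 1" using condF_at_top[of t k] t by (metis atLeastAtMost_iff not_le order_less_le)
    moreover have "{xz. ?F (fst xz $ k) \<le> t \<and> snd xz \<in> A} = {xz. snd xz \<in> A}" using F by auto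
    ultimately show ?thesis by (simp add: pA_def)
  qed
qed

definition orth :: "real^'p \<Rightarrow> (real^'p) \<times> 'z \<Rightarrow> real" where
  "orth u xz = of_bool ((\<forall>k. UA Q A (fst xz) $ k \<le> u $ k) \<and> snd xz \<in> A)"

lemma orth_measurable[measurable]: "orth u \<in> borel_measurable borel"
  unfolding orth_def by measurable

lemma orth_01: "orth u y = 0 \<or> orth u y = 1"
  unfolding orth_def of_bool_def by (simp split: if_split)

lemma orth_mono: "(\<And>k. u $ k \<le> v $ k) \<Longrightarrow> orth u y \<le> orth v y"
  unfolding orth_def by (force intro: order_trans)

lemma integral_of_bool:
  assumes "Measurable.pred borel R"
  shows "(\<integral>y. of_bool (R y) \<partial>Q) = measure Q {y. R y}"
proof -
  have "(\<integral>y. of_bool (R y) \<partial>Q) = (\<integral>y. indicator {y. R y} y \<partial>Q)"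
    by (intro Bochner_Integration.integral_cong) (auto split: split_indicator)
  also have "\<dots> = measure Q {y. R y}" by simp
  finally show ?thesis .
qed

lemma integral_orth: "(\<integral>y. orth u y \<partial>Q) = Dfun Q A u"
  unfolding orth_def Dfun_def by (rule integral_of_bool) measurable

lemma integrable_bounded_Q:
  fixes g :: "(real^'p) \<times> 'z \<Rightarrow> real"
  assumes "g \<in> borel_measurable borel" "\<And>y. \<bar>g y\<bar> \<le> B"
  shows "integrable Q g"
  using assms by (intro integrable_const_bound[where B=B]) (auto simp: measurable_Q_borel)

lemma integrable_orth: "integrable Q (orth u)"
  by (rule integrable_bounded_Q[where B=1]) (auto simp: orth_def)

lemma Dfun_margin: "t \<in> {0..1} \<Longrightarrow> Dfun Q A (vupd onevec k t) = p * t"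
proof -
  assume t: "t \<in> {0..1}"
  have "(\<forall>l. UA Q A x $ l \<le> vupd onevec k t $ l) \<longleftrightarrow> condF Q A k (x $ k) \<le> t" for x
    using condF_bounds by (auto simp: UA_def)
  then show ?thesis unfolding Dfun_def using uniform_margin[OF t] by simp
qed

lemma Dfun_onevec: "Dfun Q A onevec = p"
  using Dfun_margin[of 1 undefined] vupd_self[of onevec undefined]
  by (metis atLeastAtMost_iff mult.right_neutral onevec_nth order_refl zero_le_one)

lemma Dfun_mono: "(\<And>k. u $ k \<le> v $ k) \<Longrightarrow> Dfun Q A u \<le> Dfun Q A v"
  unfolding integral_orth[symmetric] by (intro integral_mono integrable_orth orth_mono)

lemma Dfun_bounds: "0 \<le> Dfun Q A u" "u \<in> cube \<Longrightarrow> Dfun Q A u \<le> p"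
  using Dfun_mono[of u onevec] by (auto simp: Dfun_onevec cube_nth) (simp add: Dfun_def)

lemma p_le_1: "p \<le> 1"
  by (simp add: pA_def)

text \<open>A point in the larger orthant but not in the smaller one lies in a coordinate slab
  between \<open>u\<close> and \<open>v\<close>, and the uniform margins give a slab mass
  proportional to its width. This Lipschitz property in the 1-norm drives both the chaining and the
  continuity of the covariance.\<close>

lemma Dfun_increment:
  assumes u: "u \<in> cube" and v: "v \<in> cube" and le: "\<And>k. u $ k \<le> v $ k"
  shows "Dfun Q A v - Dfun Q A u \<le> (\<Sum>k\<in>UNIV. v $ k - u $ k)"
proof -
  have pw: "orth v y - orth u y \<le> (\<Sum>k\<in>UNIV. orth (vupd onevec k (v $ k)) y - orth (vupd onevec k (u $ k)) y)" for y
  proof -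
    have nn: "0 \<le> orth (vupd onevec k (v $ k)) y - orth (vupd onevec k (u $ k)) y" for k
      using orth_mono[of "vupd onevec k (u $ k)" "vupd onevec k (v $ k)" y] le by simp
    show ?thesis
    proof (cases "orth v y - orth u y > 0")
      case True
      then have vy: "\<forall>k. UA Q A (fst y) $ k \<le> v $ k" "snd y \<in> A" and "\<not> (\<forall>k. UA Q A (fst y) $ k \<le> u $ k)"
        by (auto simp: orth_def of_bool_def split: if_splits)
      then obtain k where k: "\<not> UA Q A (fst y) $ k \<le> u $ k" by auto
      have "orth (vupd onevec k (v $ k)) y = 1"
        using vy UA_cube[of "fst y"] by (auto simp: orth_def cube_nth)
      moreover have "orth (vupd onevec k (u $ k)) y = 0" using k by (auto simp: orth_def)
      ultimately have "1 \<le> orth (vupd onevec k (v $ k)) y - orth (vupd onevec k (u $ k)) y" by simp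
      also have "\<dots> \<le> (\<Sum>k\<in>UNIV. orth (vupd onevec k (v $ k)) y - orth (vupd onevec k (u $ k)) y)"
        by (rule member_le_sum) (use nn in auto)
      finally show ?thesis using orth_01[of v y] orth_01[of u y] by auto
    qed (use nn in \<open>force intro!: order_trans[OF _ sum_nonneg]\<close>)
  qed
  have "Dfun Q A v - Dfun Q A u = (\<integral>y. orth v y - orth u y \<partial>Q)"
    by (simp add: integral_orth integrable_orth)
  also have "\<dots> \<le> (\<integral>y. (\<Sum>k\<in>UNIV. orth (vupd onevec k (v $ k)) y - orth (vupd onevec k (u $ k)) y) \<partial>Q)"
    by (intro integral_mono pw Bochner_Integration.integrable_sum Bochner_Integration.integrable_diff integrable_orth)
  also have "\<dots> = (\<Sum>k\<in>UNIV. p * (v $ k - u $ k))"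
    using cube_nth[OF u] cube_nth[OF v] by (simp add: integral_orth integrable_orth Dfun_margin right_diff_distrib)
  also have "\<dots> \<le> (\<Sum>k\<in>UNIV. v $ k - u $ k)"
    using le p_le_1 A_pos by (intro sum_mono mult_left_le_one_le) auto
  finally show ?thesis .
qed

text \<open>The limit formula differentiates \<open>Dfun\<close> while the smoothness hypothesis
  concerns \<open>condcop\<close>. The derivative is unique even on the faces, since no point of
  [0, 1] is isolated in it.\<close>

lemma cube_partial_Dfun:
  assumes u: "u \<in> cube"
  shows "cube_partial (Dfun Q A) i u = p * cube_partial (condcop Q A) i u"
proof -
  have d: "((\<lambda>t. condcop Q A (vupd u i t)) has_real_derivative cube_partial (condcop Q A) i u) (at (u $ i) within {0..1})"
    using C1 u by (simp add: C1_on_cube_def)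
  have "(\<lambda>t. Dfun Q A (vupd u i t)) = (\<lambda>t. p * condcop Q A (vupd u i t))"
    using A_pos by (simp add: condcop_def)
  then have D: "((\<lambda>t. Dfun Q A (vupd u i t)) has_real_derivative p * cube_partial (condcop Q A) i u) (at (u $ i) within {0..1})"
    using DERIV_cmult[OF d, of p] by simp
  have nb: "at (u $ i) within {0..1::real} \<noteq> bot"
    using cube_nth[OF u, of i] by (simp add: trivial_limit_within islimpt_Icc)
  show ?thesis unfolding cube_partial_def[of "Dfun Q A"]
  proof (rule the_equality)
    show "((\<lambda>t. Dfun Q A (vupd u i t)) has_real_derivative p * cube_partial (condcop Q A) i u) (at (u $ i) within {0..1})"
      by (rule D)
    fix d' assume "((\<lambda>t. Dfun Q A (vupd u i t)) has_real_derivative d') (at (u $ i) within {0..1})"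
    then show "d' = p * cube_partial (condcop Q A) i u"
      using D nb unfolding has_real_derivative_iff_has_vector_derivative by (intro vector_derivative_unique_within)
  qed
qed

end

section \<open>The delta method\<close>

lemma card_eq_sum_of_bool:
  fixes n :: nat
  shows "real (card {i. i < n \<and> R i}) = (\<Sum>i<n. of_bool (R i))"
proof -
  have "real (card {i. i < n \<and> R i}) = (\<Sum>i\<in>{i\<in>{..<n}. R i}. 1)" by simp
  also have "\<dots> = (\<Sum>i<n. if R i then 1 else 0)" by (rule sum.inter_filter) simp
  finally show ?thesis by (simp only: of_bool_def)
qed

section \<open>Quantiles of step functions\<close>

lemma empirical_quantile:
  fixes x :: "nat \<Rightarrow> real" and I :: "nat \<Rightarrow> bool"
  assumes c: "c = (\<Sum>i<n. of_bool (I i))" "c > 0" and u: "0 < u" "u \<le> (1::real)"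
  obtains q where "gen_inv (\<lambda>t. (\<Sum>i<n. of_bool (x i \<le> t \<and> I i)) / c) u = ereal q"
    "u * c \<le> (\<Sum>i<n. of_bool (x i \<le> q \<and> I i))" "(\<Sum>i<n. of_bool (x i < q \<and> I i)) \<le> u * c"
proof -
  define N :: "real \<Rightarrow> real" where "N t = (\<Sum>i<n. of_bool (x i \<le> t \<and> I i))" for t
  have mono: "N s \<le> N t" if "s \<le> t" for s t
    unfolding N_def using that by (intro sum_mono) (auto simp: of_bool_def)
  define T where "T = {t. u * c \<le> N t}"
  \<comment> \<open>A bound for all observations: the set \<open>T\<close> contains \<open>b\<close>
    and stays above \<open>- b - 1\<close>, so its infimum is a real number.\<close>
  define b where "b = (\<Sum>i<n. \<bar>x i\<bar>)"
  have xb: "\<bar>x i\<bar> \<le> b" if "i < n" for i unfolding b_def using that by (intro member_le_sum) auto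
  have Nb: "N b = c" unfolding N_def c(1) using xb by (intro sum.cong) (auto simp: abs_le_iff)
  have bT: "b \<in> T" using Nb u c(2) by (simp add: T_def mult_left_le_one_le)
  have lb: "- b - 1 \<le> t" if "t \<in> T" for t
  proof (rule ccontr)
    assume "\<not> - b - 1 \<le> t"
    then have "N t = 0" unfolding N_def using xb by (intro sum.neutral) (force simp: abs_le_iff)
    then show False using that u c(2) by (simp add: T_def mult_le_0_iff)
  qed
  have bdd: "bdd_below T" using lb by (rule bdd_belowI)
  define q where "q = Inf T"
  \<comment> \<open>Right continuity of the count: there are finitely many observations, so none
    lies in a short interval to the right of \<open>q\<close>. Hence the infimum is
    attained.\<close>
  have "\<forall>\<^sub>F t in at_right q. \<forall>i\<in>{..<n}. x i \<le> t \<longleftrightarrow> x i \<le> q"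
  proof (rule eventually_ball_finite)
    show "\<forall>i\<in>{..<n}. \<forall>\<^sub>F t in at_right q. x i \<le> t \<longleftrightarrow> x i \<le> q"
    proof
      fix i
      show "\<forall>\<^sub>F t in at_right q. x i \<le> t \<longleftrightarrow> x i \<le> q"
      proof (cases "x i \<le> q")
        case True
        then show ?thesis using eventually_at_right_less[of q] by (auto elim: eventually_mono)
      next
        case False
        then have "\<forall>\<^sub>F t in at_right q. t < x i" by (intro order_tendstoD(2)[OF tendsto_ident_at]) simp
        then show ?thesis using False by (auto elim: eventually_mono)
      qed
    qed
  qed simp
  then have "\<forall>\<^sub>F t in at_right q. (\<forall>i\<in>{..<n}. x i \<le> t \<longleftrightarrow> x i \<le> q) \<and> t > q"
    using eventually_at_right_less[of q] by eventually_elim auto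
  then obtain t where t: "t > q" "\<And>i. i < n \<Longrightarrow> x i \<le> t \<longleftrightarrow> x i \<le> q"
    using eventually_happens'[OF trivial_limit_at_right_real] by blast
  have Nt: "N t = N q" unfolding N_def using t(2) by (intro sum.cong) auto
  obtain t0 where "t0 \<in> T" "t0 < t" using t(1) bT cInf_lessD[of T t] unfolding q_def by auto
  then have qT: "q \<in> T" using mono[of t0 t] Nt by (simp add: T_def)
  \<comment> \<open>Just to the left of \<open>q\<close> the weak count equals the strict count at
    \<open>q\<close>; such points lie below the infimum, so the count there does not exceed
    \<open>u * c\<close>.\<close>
  have "\<forall>\<^sub>F t in at_left q. \<forall>i\<in>{..<n}. x i \<le> t \<longleftrightarrow> x i < q"
  proof (rule eventually_ball_finite)
    show "\<forall>i\<in>{..<n}. \<forall>\<^sub>F t in at_left q. x i \<le> t \<longleftrightarrow> x i < q"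
    proof
      fix i
      show "\<forall>\<^sub>F t in at_left q. x i \<le> t \<longleftrightarrow> x i < q"
      proof (cases "x i < q")
        case False
        have "\<forall>\<^sub>F t in at_left q. t < q" by (simp add: eventually_at_filter)
        then show ?thesis using False by (auto elim: eventually_mono)
      next
        case True
        then have "\<forall>\<^sub>F t in at_left q. x i < t" by (intro order_tendstoD(1)[OF tendsto_ident_at])
        then show ?thesis using True by (auto elim: eventually_mono)
      qed
    qed
  qed simp
  moreover have "\<forall>\<^sub>F t in at_left q. t < q" by (simp add: eventually_at_filter)
  ultimately have "\<forall>\<^sub>F t in at_left q. (\<forall>i\<in>{..<n}. x i \<le> t \<longleftrightarrow> x i < q) \<and> t < q"
    by eventually_elim auto
  then obtain s where s: "s < q" "\<And>i. i < n \<Longrightarrow> x i \<le> s \<longleftrightarrow> x i < q"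
    using eventually_happens'[OF trivial_limit_at_left_real] by blast
  have "s \<notin> T" using s(1) cInf_lower[OF _ bdd, of s] unfolding q_def by auto
  then have Ns: "N s \<le> u * c" by (simp add: T_def)
  show ?thesis
  proof
    show "u * c \<le> (\<Sum>i<n. of_bool (x i \<le> q \<and> I i))" using qT by (simp add: T_def N_def)
    have "(\<Sum>i<n. of_bool (x i < q \<and> I i)) = N s" unfolding N_def using s(2) by (intro sum.cong) auto
    then show "(\<Sum>i<n. of_bool (x i < q \<and> I i)) \<le> u * c" using Ns by simp
    have T: "u \<le> N t / c \<longleftrightarrow> t \<in> T" for t using c(2) by (simp add: T_def field_simps)
    have "Inf {ereal t |t. u \<le> N t / c} = ereal q"
    proof (rule antisym)
      show "Inf {ereal t |t. u \<le> N t / c} \<le> ereal q" using qT T by (intro Inf_lower) auto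
      show "ereal q \<le> Inf {ereal t |t. u \<le> N t / c}"
        unfolding T using cInf_lower[OF _ bdd] by (intro Inf_greatest) (auto simp: q_def)
    qed
    then show "gen_inv (\<lambda>t. (\<Sum>i<n. of_bool (x i \<le> t \<and> I i)) / c) u = ereal q"
      by (simp add: gen_inv_def N_def)
  qed
qed

text \<open>Level 0 admits every real number, so no observation lies below its quantile. This is why
  \<open>Hn\<close> is later required to vanish on the lower faces.\<close>

lemma gen_inv_0:
  assumes "\<And>t. 0 \<le> F t"
  shows "gen_inv F 0 = - \<infinity>"
proof -
  have "gen_inv F 0 \<le> ereal t" for t unfolding gen_inv_def using assms by (intro Inf_lower) auto
  then show ?thesis by (rule ereal_bot)
qed

section \<open>Copula processes in terms of orthant counts\<close>

context cond_copula
begin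

text \<open>Empirical counterpart of \<open>Dfun\<close> on the copula scale, for an arbitrary
  sequence \<open>xs\<close>; its normalised version \<open>Gn\<close> is centred at
  \<open>Dfun\<close> even when \<open>xs\<close> is a resample.\<close>

definition Hn :: "nat \<Rightarrow> (nat \<Rightarrow> (real^'p) \<times> 'z) \<Rightarrow> real^'p \<Rightarrow> real" where
  "Hn n xs u = (\<Sum>i<n. orth u (xs i)) / real n"

definition Gn :: "nat \<Rightarrow> (nat \<Rightarrow> (real^'p) \<times> 'z) \<Rightarrow> real^'p \<Rightarrow> real" where
  "Gn n xs u = sqrt (real n) * (Hn n xs u - Dfun Q A u)"

text \<open>Mass of a tie at level \<open>t\<close> of margin \<open>k\<close>, measured after the
  transformation by \<open>condF\<close>; a flat piece of \<open>condF\<close> can merge distinct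
  observations.\<close>

definition jump :: "nat \<Rightarrow> (nat \<Rightarrow> (real^'p) \<times> 'z) \<Rightarrow> 'p \<Rightarrow> real \<Rightarrow> real" where
  "jump n xs k t = (\<Sum>i<n. of_bool (condF Q A k (fst (xs i) $ k) = t \<and> snd (xs i) \<in> A)) / real n"

lemma UA_nth: "UA Q A x $ k = condF Q A k (x $ k)"
  by (simp add: UA_def)

lemma orth_margin: "orth (vupd onevec k t) y = of_bool (condF Q A k (fst y $ k) \<le> t \<and> snd y \<in> A)"
proof -
  have "(\<forall>l. UA Q A (fst y) $ l \<le> vupd onevec k t $ l) \<longleftrightarrow> condF Q A k (fst y $ k) \<le> t"
    using condF_bounds by (auto simp: UA_nth)
  then show ?thesis by (simp add: orth_def)
qed

lemma Hn_margin: "Hn n xs (vupd onevec k t) = (\<Sum>i<n. of_bool (condF Q A k (fst (xs i) $ k) \<le> t \<and> snd (xs i) \<in> A)) / real n"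
  by (simp add: Hn_def orth_margin)

lemma orth_onevec: "orth onevec y = of_bool (snd y \<in> A)"
  using condF_bounds by (simp add: orth_def UA_nth)

lemma Hn_onevec: "Hn n xs onevec = (\<Sum>i<n. of_bool (snd (xs i) \<in> A)) / real n"
  by (simp add: Hn_def orth_onevec)

lemma phat_eq: "phat n xs A = Hn n xs onevec"
  by (simp add: phat_def Hn_onevec card_eq_sum_of_bool)

lemma Hn_mono: "(\<And>k. u $ k \<le> v $ k) \<Longrightarrow> Hn n xs u \<le> Hn n xs v"
  unfolding Hn_def by (intro divide_right_mono sum_mono orth_mono) auto

text \<open>Transfers quantiles to the copula scale: \<open>v $ k\<close> is \<open>condF\<close> at
  the empirical quantile, or 0 at level 0, so that \<open>Cbar\<close> becomes \<open>Hn\<close> at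
  a data-dependent point. Observations exactly at the level \<open>v $ k\<close> may fall on either
  side of the quantile, and their mass is bounded by \<open>J\<close> in each margin.\<close>

lemma cbar_quantile:
  assumes n: "n > 0" and ph: "Hn n xs onevec > 0"
    and z: "\<And>k. Hn n xs (vupd onevec k 0) = 0" and u: "u \<in> cube"
    and J: "\<And>k t. t \<in> {0..1} \<Longrightarrow> jump n xs k t \<le> J"
  obtains v where "v \<in> cube" "\<And>k. \<bar>Hn n xs (vupd onevec k (v $ k)) - u $ k * Hn n xs onevec\<bar> \<le> J"
    "\<bar>Cbar n xs A u * Hn n xs onevec - Hn n xs v\<bar> \<le> real CARD('p) * J"
proof -
  define c where "c = real n * Hn n xs onevec"
  have c: "c = (\<Sum>i<n. of_bool (snd (xs i) \<in> A))" "c > 0"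
    using n ph by (simp_all add: c_def) (simp add: Hn_onevec)
  let ?F = "\<lambda>k t. condF Q A k t"
  let ?x = "\<lambda>i k. fst (xs i) $ k"
  have Fn: "Fn n xs A k = (\<lambda>t. (\<Sum>i<n. of_bool (?x i k \<le> t \<and> snd (xs i) \<in> A)) / c)" for k
    by (rule ext) (simp add: Fn_def card_eq_sum_of_bool phat_eq c_def)
  have J0: "0 \<le> J"
  proof -
    have "0 \<le> jump n xs k 0" for k by (simp add: jump_def sum_nonneg)
    then show ?thesis using J[of 0] by (meson atLeastAtMost_iff order_refl order_trans zero_le_one)
  qed
  \<comment> \<open>One margin at a time. Besides the mass at the level \<open>t\<close>, the claim
    says that lying below the quantile and having \<open>?F k y \<le> t\<close> can differ only
    where \<open>?F k y = t\<close>.\<close>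
  have "\<exists>t. t \<in> {0..1} \<and> \<bar>Hn n xs (vupd onevec k t) - u $ k * Hn n xs onevec\<bar> \<le> J \<and>
      (\<forall>y. ereal y \<le> gen_inv (Fn n xs A k) (u $ k) \<longrightarrow> ?F k y \<le> t) \<and>
      (\<forall>y. \<not> ereal y \<le> gen_inv (Fn n xs A k) (u $ k) \<longrightarrow> ?F k y \<le> t \<longrightarrow> ?F k y = t)" for k
  proof (cases "u $ k = 0")
    case True
    have "gen_inv (Fn n xs A k) 0 = -\<infinity>"
      unfolding Fn using c(2) by (intro gen_inv_0 divide_nonneg_pos sum_nonneg) auto
    then show ?thesis using True z[of k] J0 condF_bounds(1)[of k]
      by (intro exI[of _ 0]) (auto intro: antisym)
  next
    case False
    then have uk: "0 < u $ k" "u $ k \<le> 1" using cube_nth[OF u, of k] by auto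
    obtain q where q: "gen_inv (Fn n xs A k) (u $ k) = ereal q"
      "u $ k * c \<le> (\<Sum>i<n. of_bool (?x i k \<le> q \<and> snd (xs i) \<in> A))"
      "(\<Sum>i<n. of_bool (?x i k < q \<and> snd (xs i) \<in> A)) \<le> u $ k * c"
      using empirical_quantile[OF c uk, of "\<lambda>i. ?x i k"] unfolding Fn by blast
    define t where "t = ?F k q"
    have "(\<Sum>i<n. of_bool (?x i k \<le> q \<and> snd (xs i) \<in> A)) \<le> (\<Sum>i<n. of_bool (?F k (?x i k) \<le> t \<and> snd (xs i) \<in> A) :: real)"
      using condF_mono[of _ q k] by (intro sum_mono) (auto simp: of_bool_def t_def)
    then have 1: "u $ k * c \<le> real n * Hn n xs (vupd onevec k t)"
      using q(2) n by (simp add: Hn_margin)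
    have "(\<Sum>i<n. of_bool (?F k (?x i k) \<le> t \<and> snd (xs i) \<in> A))
        \<le> (\<Sum>i<n. of_bool (?x i k < q \<and> snd (xs i) \<in> A) + of_bool (?F k (?x i k) = t \<and> snd (xs i) \<in> A) :: real)"
    proof (rule sum_mono)
      fix i
      have "?F k (?x i k) \<le> t \<Longrightarrow> \<not> ?x i k < q \<Longrightarrow> ?F k (?x i k) = t"
        using condF_mono[of q "?x i k" k] by (simp add: t_def)
      then show "of_bool (?F k (?x i k) \<le> t \<and> snd (xs i) \<in> A)
          \<le> of_bool (?x i k < q \<and> snd (xs i) \<in> A) + (of_bool (?F k (?x i k) = t \<and> snd (xs i) \<in> A) :: real)"
        by (auto simp: of_bool_def)
    qed
    then have 2: "real n * Hn n xs (vupd onevec k t) \<le> u $ k * c + real n * jump n xs k t"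
      using q(3) n by (simp add: Hn_margin sum.distrib jump_def)
    have tb: "t \<in> {0..1}" using condF_bounds by (simp add: t_def)
    have 3: "real n * (u $ k * Hn n xs onevec) \<le> real n * Hn n xs (vupd onevec k t)"
      "real n * Hn n xs (vupd onevec k t) \<le> real n * (u $ k * Hn n xs onevec + jump n xs k t)"
      using 1 2 by (auto simp: c_def algebra_simps)
    then have "u $ k * Hn n xs onevec \<le> Hn n xs (vupd onevec k t)"
      "Hn n xs (vupd onevec k t) \<le> u $ k * Hn n xs onevec + jump n xs k t"
      using n by (simp_all only: mult_le_cancel_left_pos of_nat_0_less_iff)
    then have "\<bar>Hn n xs (vupd onevec k t) - u $ k * Hn n xs onevec\<bar> \<le> J" using J[OF tb, of k] by linarith
    moreover have "\<forall>y. ereal y \<le> ereal q \<longrightarrow> ?F k y \<le> t" using condF_mono by (simp add: t_def)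
    moreover have "\<forall>y. \<not> ereal y \<le> ereal q \<longrightarrow> ?F k y \<le> t \<longrightarrow> ?F k y = t"
      using condF_mono[of q _ k] by (auto simp: t_def intro!: antisym)
    ultimately show ?thesis unfolding q(1) using tb by blast
  qed
  then obtain w where w: "\<And>k. w k \<in> {0..1}" "\<And>k. \<bar>Hn n xs (vupd onevec k (w k)) - u $ k * Hn n xs onevec\<bar> \<le> J"
      "\<And>k y. ereal y \<le> gen_inv (Fn n xs A k) (u $ k) \<Longrightarrow> ?F k y \<le> w k"
      "\<And>k y. \<not> ereal y \<le> gen_inv (Fn n xs A k) (u $ k) \<Longrightarrow> ?F k y \<le> w k \<Longrightarrow> ?F k y = w k"
    by metis
  define v where "v = (\<chi> k. w k)"
  show ?thesis
  proof
    show "v \<in> cube" using w(1) by (simp add: v_def cube_def)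
    show "\<bar>Hn n xs (vupd onevec k (v $ k)) - u $ k * Hn n xs onevec\<bar> \<le> J" for k
      using w(2) by (simp add: v_def)
    define B where "B i \<longleftrightarrow> (\<forall>k. ereal (?x i k) \<le> gen_inv (Fn n xs A k) (u $ k)) \<and> snd (xs i) \<in> A" for i
    have "Cbar n xs A u * Hn n xs onevec = (\<Sum>i<n. of_bool (B i)) / real n"
      using ph n by (simp add: Cbar_def card_eq_sum_of_bool phat_eq B_def)
    then have eq: "Hn n xs v - Cbar n xs A u * Hn n xs onevec = (\<Sum>i<n. orth v (xs i) - of_bool (B i)) / real n"
      by (simp add: Hn_def sum_subtractf diff_divide_distrib)
    have lo: "0 \<le> orth v (xs i) - of_bool (B i)" for i
      using w(3)[of "?x i _"] by (auto simp: orth_def B_def of_bool_def v_def UA_nth)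
    have hi: "orth v (xs i) - of_bool (B i) \<le> (\<Sum>k\<in>UNIV. of_bool (?F k (?x i k) = w k \<and> snd (xs i) \<in> A))" for i
    proof (cases "orth v (xs i) = 1 \<and> \<not> B i")
      case True
      then have a: "snd (xs i) \<in> A" "\<And>k. ?F k (?x i k) \<le> w k"
        by (auto simp: orth_def of_bool_def v_def UA_nth split: if_splits)
      then obtain k where "\<not> ereal (?x i k) \<le> gen_inv (Fn n xs A k) (u $ k)" using True by (auto simp: B_def)
      then have "?F k (?x i k) = w k" using w(4) a by blast
      then have "1 \<le> (of_bool (?F k (?x i k) = w k \<and> snd (xs i) \<in> A) :: real)" using a by simp
      also have "\<dots> \<le> (\<Sum>k\<in>UNIV. of_bool (?F k (?x i k) = w k \<and> snd (xs i) \<in> A))"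
        by (rule member_le_sum[of k UNIV "\<lambda>k. of_bool (?F k (?x i k) = w k \<and> snd (xs i) \<in> A) :: real"]) auto
      finally show ?thesis using True by simp
    next
      case False
      then have "orth v (xs i) - of_bool (B i) \<le> 0" using orth_01[of v "xs i"] by auto
      then show ?thesis by (rule order_trans) (simp add: sum_nonneg)
    qed
    have "(\<Sum>i<n. orth v (xs i) - of_bool (B i)) \<le> (\<Sum>i<n. \<Sum>k\<in>UNIV. of_bool (?F k (?x i k) = w k \<and> snd (xs i) \<in> A))"
      by (intro sum_mono hi)
    also have "\<dots> = (\<Sum>k\<in>UNIV. real n * jump n xs k (w k))"
      using n by (subst sum.swap) (simp add: jump_def)
    also have "\<dots> \<le> (\<Sum>k\<in>(UNIV::'p set). real n * J)" using J w(1) by (intro sum_mono mult_left_mono) auto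
    finally have "(\<Sum>i<n. orth v (xs i) - of_bool (B i)) \<le> real n * (real CARD('p) * J)" by (simp add: mult_ac)
    then have "Hn n xs v - Cbar n xs A u * Hn n xs onevec \<le> real CARD('p) * J"
      unfolding eq using n by (simp add: field_simps)
    moreover have "0 \<le> Hn n xs v - Cbar n xs A u * Hn n xs onevec"
      unfolding eq using lo by (intro divide_nonneg_nonneg sum_nonneg) auto
    ultimately show "\<bar>Cbar n xs A u * Hn n xs onevec - Hn n xs v\<bar> \<le> real CARD('p) * J" by linarith
  qed
qed

text \<open>A tie sits in an interval of length at most 1/n, whose mass is an increment of
  \<open>Gn\<close> divided by sqrt n plus the population mass. So the modulus of continuity
  controls ties, including those created by resampling.\<close>

lemma jump_bound:
  assumes n: "n > 0" "1 / real n \<le> \<delta>" and e0: "0 \<le> \<eta>" and t: "t \<in> {0..1}"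
    and z: "\<And>k. Hn n xs (vupd onevec k 0) = 0"
    and md: "\<And>u v. u \<in> cube \<Longrightarrow> v \<in> cube \<Longrightarrow> (\<forall>k. \<bar>u $ k - v $ k\<bar> \<le> \<delta>) \<Longrightarrow> \<bar>Gn n xs u - Gn n xs v\<bar> \<le> \<eta>"
  shows "jump n xs k t \<le> \<eta> / sqrt (real n) + 1 / real n"
proof (cases "t = 0")
  case True
  have "jump n xs k 0 \<le> Hn n xs (vupd onevec k 0)"
    unfolding jump_def Hn_margin by (intro divide_right_mono sum_mono) (auto simp: of_bool_def)
  then show ?thesis using z e0 True by (simp add: order_trans[of _ 0])
next
  case False
  define r where "r = 1 / real n"
  have r: "r > 0" using n by (simp add: r_def)
  \<comment> \<open>Strictly below \<open>t\<close>, so that the tie is not counted at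
    \<open>s\<close>; the truncation at 0 keeps the point in the cube.\<close>
  define s where "s = max 0 (t - r)"
  have "s < t" "s \<in> {0..1}" "t - s \<le> r" using False t r by (auto simp: s_def)
  then have s: "s < t" "s \<in> {0..1}" "t - s \<le> 1 / real n" by (auto simp: r_def)
  let ?u = "vupd onevec k t" and ?v = "vupd onevec k s"
  have "jump n xs k t + Hn n xs ?v \<le> Hn n xs ?u"
    unfolding jump_def Hn_margin add_divide_distrib[symmetric] sum.distrib[symmetric]
    using s by (intro divide_right_mono sum_mono) (auto simp: of_bool_def)
  also have "Hn n xs ?u - Hn n xs ?v = (Gn n xs ?u - Gn n xs ?v) / sqrt (real n) + p * (t - s)"
    using n s t by (simp add: Gn_def Dfun_margin field_simps)
  then have "Hn n xs ?u = Hn n xs ?v + ((Gn n xs ?u - Gn n xs ?v) / sqrt (real n) + p * (t - s))" by simp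
  finally have j: "jump n xs k t \<le> (Gn n xs ?u - Gn n xs ?v) / sqrt (real n) + p * (t - s)" by simp
  have "\<bar>Gn n xs ?u - Gn n xs ?v\<bar> \<le> \<eta>"
    using s t n(2) by (intro md vupd_in_cube) auto
  then have "(Gn n xs ?u - Gn n xs ?v) / sqrt (real n) \<le> \<eta> / sqrt (real n)" by (intro divide_right_mono) auto
  moreover have "p * (t - s) \<le> 1 * (1 / real n)" using s p_le_1 A_pos by (intro mult_mono) auto
  ultimately show ?thesis using j by simp
qed

lemma Cinf_formula_eq:
  assumes u: "u \<in> cube"
  shows "p * Cinf_formula Q A B u = B u
     - (\<Sum>k\<in>UNIV. cube_partial (condcop Q A) k u * (B (vupd onevec k (u $ k)) - u $ k * B onevec))
     - condcop Q A u * B onevec"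
  using A_pos unfolding Cinf_formula_def cube_partial_Dfun[OF u] condcop_def
  by (simp add: right_diff_distrib sum_distrib_left power2_eq_square)

lemma condcop_bounds: "u \<in> cube \<Longrightarrow> 0 \<le> condcop Q A u \<and> condcop Q A u \<le> 1"
  using Dfun_bounds[of u] A_pos by (simp add: condcop_def)

definition dbound :: real where
  "dbound = (SOME B. B \<ge> 0 \<and> (\<forall>k. \<forall>u\<in>cube. \<bar>cube_partial (condcop Q A) k u\<bar> \<le> B))"

lemma dbound: "dbound \<ge> 0" "u \<in> cube \<Longrightarrow> \<bar>cube_partial (condcop Q A) k u\<bar> \<le> dbound"
proof -
  have "\<exists>B. B \<ge> 0 \<and> (\<forall>k. \<forall>u\<in>cube. \<bar>cube_partial (condcop Q A) k u\<bar> \<le> B)"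
    using cube_partial_bounded[OF C1] by metis
  from someI_ex[OF this] show "dbound \<ge> 0" "u \<in> cube \<Longrightarrow> \<bar>cube_partial (condcop Q A) k u\<bar> \<le> dbound"
    unfolding dbound_def by auto
qed

text \<open>Bound for the limit formula as a linear operator in the sup norm: weight 1 for the path
  at \<open>u\<close>, at most 1 for the copula term, and twice \<open>dbound\<close> for each of
  the \<open>CARD('p)\<close> derivative terms, all divided by \<open>p\<close>.\<close>

definition lipC :: real where "lipC = (2 + 2 * real CARD('p) * dbound) / p"

lemma lipC_nonneg: "lipC \<ge> 0"
  using dbound(1) A_pos by (simp add: lipC_def)

lemma Cinf_formula_bound:
  assumes u: "u \<in> cube" and K: "\<And>v. v \<in> cube \<Longrightarrow> \<bar>B v\<bar> \<le> K"
  shows "\<bar>Cinf_formula Q A B u\<bar> \<le> lipC * K"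
proof -
  have K0: "0 \<le> K" using K[OF zero_in_cube] by linarith
  have "\<bar>cube_partial (condcop Q A) k u * (B (vupd onevec k (u $ k)) - u $ k * B onevec)\<bar> \<le> dbound * (2 * K)" for k
  proof -
    have "\<bar>u $ k * B onevec\<bar> \<le> 1 * K" unfolding abs_mult using cube_nth[OF u] K by (intro mult_mono) auto
    moreover have "\<bar>B (vupd onevec k (u $ k))\<bar> \<le> K" using cube_nth[OF u] by (intro K vupd_in_cube) auto
    ultimately have "\<bar>B (vupd onevec k (u $ k)) - u $ k * B onevec\<bar> \<le> 2 * K" by linarith
    then show ?thesis unfolding abs_mult using dbound u by (intro mult_mono) auto
  qed
  then have "\<bar>\<Sum>k\<in>UNIV. cube_partial (condcop Q A) k u * (B (vupd onevec k (u $ k)) - u $ k * B onevec)\<bar>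
      \<le> (\<Sum>k\<in>(UNIV::'p set). dbound * (2 * K))"
    by (intro order_trans[OF sum_abs] sum_mono)
  moreover have "\<bar>condcop Q A u * B onevec\<bar> \<le> 1 * K"
    unfolding abs_mult using condcop_bounds[OF u] K by (intro mult_mono) auto
  moreover have "\<bar>B u\<bar> \<le> K" by (rule K[OF u])
  ultimately have "\<bar>p * Cinf_formula Q A B u\<bar> \<le> 2 * K + real CARD('p) * (dbound * (2 * K))"
    unfolding Cinf_formula_eq[OF u] by simp
  then have "p * \<bar>Cinf_formula Q A B u\<bar> \<le> (2 + 2 * real CARD('p) * dbound) * K"
    using A_pos by (simp add: abs_mult algebra_simps)
  then show ?thesis using A_pos by (simp add: lipC_def field_simps)
qed

lemma Cinf_formula_diff: "Cinf_formula Q A B u - Cinf_formula Q A B' u = Cinf_formula Q A (\<lambda>v. B v - B' v) u"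
proof -
  have "(\<Sum>i\<in>UNIV. cube_partial (Dfun Q A) i u / p\<^sup>2 * ((B (vupd onevec i (u $ i)) - B' (vupd onevec i (u $ i))) - u $ i * (B onevec - B' onevec)))
    = (\<Sum>i\<in>UNIV. cube_partial (Dfun Q A) i u / p\<^sup>2 * (B (vupd onevec i (u $ i)) - u $ i * B onevec))
      - (\<Sum>i\<in>UNIV. cube_partial (Dfun Q A) i u / p\<^sup>2 * (B' (vupd onevec i (u $ i)) - u $ i * B' onevec))"
    unfolding sum_subtractf[symmetric]
  proof (intro sum.cong refl)
    fix i
    show "c * ((b - b') - w * (o1 - o2)) = c * (b - w * o1) - c * (b' - w * o2)" for c b b' w o1 o2 :: real
      by (simp add: algebra_simps)
  qed
  then show ?thesis unfolding Cinf_formula_def by (simp only: diff_divide_distrib right_diff_distrib)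
qed

text \<open>Multiplying by the random proportion \<open>ph\<close> makes the problem additive:
  \<open>R\<close> splits into ties (\<open>X1\<close>), the increment of \<open>Gn\<close> from
  \<open>u\<close> to \<open>v\<close> (\<open>X2\<close>), the Taylor error of the copula
  (\<open>X3\<close>), and the effect of evaluating the margins at \<open>v\<close> instead of
  \<open>u\<close> (\<open>X4\<close>). Dividing by \<open>ph\<close> instead of \<open>p\<close>
  costs one more term of order 1 / sqrt n.\<close>

lemma delta_remainder:
  assumes n: "n > 0" and u: "u \<in> cube" and K: "\<And>u. u \<in> cube \<Longrightarrow> \<bar>Gn n xs u\<bar> \<le> K"
    and md: "\<And>u v. u \<in> cube \<Longrightarrow> v \<in> cube \<Longrightarrow> (\<forall>k. \<bar>u $ k - v $ k\<bar> \<le> \<delta>) \<Longrightarrow> \<bar>Gn n xs u - Gn n xs v\<bar> \<le> \<eta>"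
    and z: "\<And>k. Hn n xs (vupd onevec k 0) = 0"
    and ex: "\<And>u v. u \<in> cube \<Longrightarrow> v \<in> cube \<Longrightarrow> (\<forall>k. \<bar>v $ k - u $ k\<bar> \<le> d) \<Longrightarrow>
      \<bar>condcop Q A v - condcop Q A u - (\<Sum>k\<in>UNIV. cube_partial (condcop Q A) k u * (v $ k - u $ k))\<bar>
        \<le> e0 * (\<Sum>k\<in>UNIV. \<bar>v $ k - u $ k\<bar>)"
    and e0: "0 \<le> e0" and \<eta>: "0 \<le> \<eta>" "\<eta> \<le> 1"
    and n1: "K / sqrt (real n) \<le> p / 2" and n2: "1 / real n \<le> \<delta>"
    and n3: "(2 * K + 2) / p / sqrt (real n) \<le> \<delta>" "(2 * K + 2) / p / sqrt (real n) \<le> d"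
  shows "\<bar>sqrt (real n) * (Cbar n xs A u - condcop Q A u) - Cinf_formula Q A (Gn n xs) u\<bar>
    \<le> 2 / p * ((\<eta> * (1 + real CARD('p) + 2 * real CARD('p) * dbound) + e0 * real CARD('p) * (2 * K + 2))
        + (real CARD('p) * (1 + dbound) + K * (lipC * K)) / sqrt (real n))"
proof -
  define s where "s = sqrt (real n)"
  have s: "s > 0" "s * s = real n" "s \<ge> 1" using n by (auto simp: s_def)
  define J where "J = \<eta> / s + 1 / real n"
  have sJ: "s * J = \<eta> + 1 / s" using s(1) unfolding J_def s(2)[symmetric] by (simp add: field_simps)
  have s1: "1 / s \<le> 1" using s by simp
  let ?G = "Gn n xs" and ?H = "Hn n xs" and ?C = "condcop Q A" and ?c = "real CARD('p)"
  let ?dC = "cube_partial (condcop Q A)"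
  have HG: "s * ?H w = ?G w + s * Dfun Q A w" for w by (simp add: Gn_def s_def right_diff_distrib)
  define ph where "ph = ?H onevec"
  have sph: "s * ph = ?G onevec + s * p" using HG[of onevec] by (simp add: ph_def Dfun_onevec)
  have K0: "0 \<le> K" using K[OF zero_in_cube] by linarith
  have ph2: "ph \<ge> p / 2"
  proof -
    have "ph = ?G onevec / s + p" using sph s(1) by (simp add: field_simps)
    moreover have "\<bar>?G onevec / s\<bar> \<le> K / s" using K[OF onevec_in_cube] s(1) by (simp add: abs_divide divide_right_mono)
    ultimately show ?thesis using n1 unfolding s_def[symmetric] by linarith
  qed
  then have ph0: "ph > 0" using A_pos by linarith
  have J: "jump n xs k t \<le> J" if "t \<in> {0..1}" for k t
    unfolding J_def s_def by (rule jump_bound[OF n n2 \<eta>(1) that z md])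
  obtain v where v: "v \<in> cube" and v1: "\<And>k. \<bar>?H (vupd onevec k (v $ k)) - u $ k * ph\<bar> \<le> J"
    and v2: "\<bar>Cbar n xs A u * ph - ?H v\<bar> \<le> ?c * J"
    using cbar_quantile[OF n ph0[unfolded ph_def] z u J] unfolding ph_def by metis
  define e where "e k = s * (?H (vupd onevec k (v $ k)) - u $ k * ph)" for k
  have ek: "\<bar>e k\<bar> \<le> \<eta> + 1 / s" for k
    unfolding e_def abs_mult sJ[symmetric] using v1[of k] s(1) by (simp add: mult_left_mono)
  \<comment> \<open>Rescaled displacement of the transformed quantile. The next identity solves the
    quantile equation for it in terms of \<open>?G\<close>, as in a Bahadur representation.\<close>
  define x where "x k = s * (p * (v $ k - u $ k))" for k
  have xk: "x k = u $ k * ?G onevec - ?G (vupd onevec k (v $ k)) + e k" for k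
  proof -
    have "s * ?H (vupd onevec k (v $ k)) = ?G (vupd onevec k (v $ k)) + s * (p * v $ k)"
      using HG[of "vupd onevec k (v $ k)"] cube_nth[OF v, of k] by (simp add: Dfun_margin)
    moreover have "u $ k * (s * ph) = u $ k * (?G onevec + s * p)" by (simp only: sph)
    ultimately show ?thesis by (simp add: x_def e_def algebra_simps)
  qed
  have xb: "\<bar>x k\<bar> \<le> 2 * K + 2" for k
  proof -
    have "\<bar>u $ k * ?G onevec\<bar> \<le> 1 * K" unfolding abs_mult using cube_nth[OF u] K[OF onevec_in_cube] by (intro mult_mono) auto
    moreover have "\<bar>?G (vupd onevec k (v $ k))\<bar> \<le> K" using cube_nth[OF v] by (intro K vupd_in_cube) auto
    ultimately show ?thesis unfolding xk using ek[of k] s1 \<eta> by linarith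
  qed
  have dv: "\<bar>v $ k - u $ k\<bar> \<le> (2 * K + 2) / p / s" for k
  proof -
    have "s * p * \<bar>v $ k - u $ k\<bar> \<le> 2 * K + 2" using xb[of k] s(1) A_pos by (simp add: x_def abs_mult mult.assoc)
    then show ?thesis using s(1) A_pos by (simp add: field_simps)
  qed
  have dv1: "\<forall>k. \<bar>v $ k - u $ k\<bar> \<le> d" "\<forall>k. \<bar>v $ k - u $ k\<bar> \<le> \<delta>"
    using dv n3 unfolding s_def[symmetric] by (auto intro: order_trans)
  define X1 where "X1 = s * (Cbar n xs A u * ph - ?H v)"
  have X1: "\<bar>X1\<bar> \<le> ?c * (\<eta> + 1 / s)"
    unfolding X1_def abs_mult sJ[symmetric] using v2 s(1) by (simp add: mult_left_mono mult.left_commute)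
  define X2 where "X2 = ?G v - ?G u"
  have X2: "\<bar>X2\<bar> \<le> \<eta>" unfolding X2_def using dv1(2) by (intro md v u)
  define X3 where "X3 = s * (p * (?C v - ?C u - (\<Sum>k\<in>UNIV. ?dC k u * (v $ k - u $ k))))"
  have X3: "\<bar>X3\<bar> \<le> e0 * ?c * (2 * K + 2)"
  proof -
    have "\<bar>X3\<bar> \<le> s * (p * (e0 * (\<Sum>k\<in>UNIV. \<bar>v $ k - u $ k\<bar>)))"
      unfolding X3_def abs_mult using ex[OF u v dv1(1)] s(1) A_pos by (simp add: mult_left_mono)
    also have "\<dots> = e0 * (\<Sum>k\<in>UNIV. \<bar>x k\<bar>)"
      using s(1) A_pos by (simp add: x_def abs_mult sum_distrib_left mult_ac)
    also have "\<dots> \<le> e0 * (\<Sum>k\<in>(UNIV::'p set). 2 * K + 2)" by (intro mult_left_mono e0 sum_mono xb)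
    finally show ?thesis by (simp add: mult_ac)
  qed
  define X4 where "X4 k = ?G (vupd onevec k (u $ k)) - ?G (vupd onevec k (v $ k)) + e k" for k
  have X4: "\<bar>X4 k\<bar> \<le> 2 * \<eta> + 1 / s" for k
  proof -
    have "\<bar>?G (vupd onevec k (u $ k)) - ?G (vupd onevec k (v $ k))\<bar> \<le> \<eta>"
      using dv1(2) cube_nth[OF u] cube_nth[OF v] order_trans[OF zero_le_divide_iff[THEN iffD2] n2, of ] n
      by (intro md vupd_in_cube) (auto simp: abs_minus_commute intro: order_trans[OF _ n2])
    then show ?thesis unfolding X4_def using ek[of k] by linarith
  qed
  have sumX4: "\<bar>\<Sum>k\<in>UNIV. ?dC k u * X4 k\<bar> \<le> ?c * (dbound * (2 * \<eta> + 1 / s))"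
  proof -
    have "\<bar>\<Sum>k\<in>UNIV. ?dC k u * X4 k\<bar> \<le> (\<Sum>k\<in>(UNIV::'p set). dbound * (2 * \<eta> + 1 / s))"
      using X4 dbound u by (intro order_trans[OF sum_abs] sum_mono) (auto simp: abs_mult intro!: mult_mono)
    then show ?thesis by simp
  qed
  define R where "R = s * ph * (Cbar n xs A u - ?C u) - p * Cinf_formula Q A ?G u"
  have Req: "R = X1 + X2 + X3 + (\<Sum>k\<in>UNIV. ?dC k u * X4 k)"
  proof -
    have DC: "Dfun Q A w = p * ?C w" for w using A_pos by (simp add: condcop_def)
    have a: "s * ph * Cbar n xs A u = X1 + ?G v + s * (p * ?C v)"
      using HG[of v] unfolding DC by (simp add: X1_def algebra_simps)
    have b: "s * ph * ?C u = s * (p * ?C u) + ?C u * ?G onevec"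
      unfolding sph by (simp add: algebra_simps)
    have c: "s * (p * ?C v) - s * (p * ?C u) = X3 + (\<Sum>k\<in>UNIV. ?dC k u * x k)"
      unfolding X3_def x_def by (simp add: right_diff_distrib sum_distrib_left mult_ac)
    have d: "(\<Sum>k\<in>UNIV. ?dC k u * x k) = (\<Sum>k\<in>UNIV. ?dC k u * X4 k)
        - (\<Sum>k\<in>UNIV. ?dC k u * (?G (vupd onevec k (u $ k)) - u $ k * ?G onevec))"
      unfolding xk X4_def sum_subtractf[symmetric] by (intro sum.cong refl) (simp add: algebra_simps)
    have "R = s * ph * Cbar n xs A u - s * ph * ?C u - (?G u
       - (\<Sum>k\<in>UNIV. ?dC k u * (?G (vupd onevec k (u $ k)) - u $ k * ?G onevec)) - ?C u * ?G onevec)"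
      unfolding R_def Cinf_formula_eq[OF u] by (simp only: right_diff_distrib[of "s * ph"])
    then show ?thesis unfolding a b X2_def using c d by linarith
  qed
  have Rb: "\<bar>R\<bar> \<le> (\<eta> * (1 + ?c + 2 * ?c * dbound) + e0 * ?c * (2 * K + 2)) + ?c * (1 + dbound) / s"
  proof -
    have "\<bar>R\<bar> \<le> ?c * (\<eta> + 1 / s) + \<eta> + e0 * ?c * (2 * K + 2) + ?c * (dbound * (2 * \<eta> + 1 / s))"
      unfolding Req using X1 X2 X3 sumX4 by linarith
    also have "\<dots> = (\<eta> * (1 + ?c + 2 * ?c * dbound) + e0 * ?c * (2 * K + 2)) + ?c * (1 + dbound) / s"
      by (simp add: algebra_simps add_divide_distrib)
    finally show ?thesis .
  qed
  let ?P = "Cinf_formula Q A ?G u"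
  have P: "\<bar>?P\<bar> \<le> lipC * K" by (rule Cinf_formula_bound[OF u K])
  \<comment> \<open>As \<open>ph - p\<close> equals \<open>?G onevec / s\<close>, the change of
    denominator multiplies a bounded quantity by 1 / s.\<close>
  have fin: "s * (Cbar n xs A u - ?C u) - ?P = (R - ?G onevec * ?P / s) / ph"
  proof -
    have "(s * (Cbar n xs A u - ?C u) - ?P) * ph = R - (ph - p) * ?P" by (simp add: R_def algebra_simps)
    also have "ph - p = ?G onevec / s" using sph s(1) by (simp add: field_simps)
    finally show ?thesis using ph0 by (simp add: field_simps)
  qed
  have "\<bar>R - ?G onevec * ?P / s\<bar> \<le> \<bar>R\<bar> + K * (lipC * K) / s"
  proof -
    have "\<bar>?G onevec * ?P\<bar> \<le> K * (lipC * K)"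
      unfolding abs_mult using K[OF onevec_in_cube] P K0 by (intro mult_mono) auto
    then have "\<bar>?G onevec * ?P / s\<bar> \<le> K * (lipC * K) / s" using s(1) by (simp add: abs_divide divide_right_mono)
    then show ?thesis by linarith
  qed
  then have "\<bar>R - ?G onevec * ?P / s\<bar> / ph \<le> (\<bar>R\<bar> + K * (lipC * K) / s) / (p / 2)"
    using ph2 A_pos ph0 by (intro frac_le) auto
  also have "\<dots> = 2 / p * (\<bar>R\<bar> + K * (lipC * K) / s)" using A_pos by (simp add: field_simps)
  also have "\<dots> \<le> 2 / p * (((\<eta> * (1 + ?c + 2 * ?c * dbound) + e0 * ?c * (2 * K + 2)) + ?c * (1 + dbound) / s) + K * (lipC * K) / s)"
    using Rb A_pos by (intro mult_left_mono add_right_mono) auto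
  finally show ?thesis unfolding s_def[symmetric] fin abs_divide using ph0 by (simp add: add_divide_distrib add_ac)
qed

text \<open>The order of quantifiers matters: \<open>\<eta>\<close> depends on \<open>e\<close> and
  \<open>K\<close>, the scale \<open>\<delta>\<close> on which it is attained is free, and the
  conclusion holds for all sequences \<open>xs\<close> at once, so that random samples can be
  inserted without any measurability question.\<close>

theorem delta_method:
  assumes e: "e > 0"
  shows "\<exists>\<eta>>0. \<forall>\<delta>>0. \<forall>\<^sub>F n in sequentially. \<forall>xs.
     (\<forall>u\<in>cube. \<bar>Gn n xs u\<bar> \<le> K) \<longrightarrow>
     (\<forall>u\<in>cube. \<forall>v\<in>cube. (\<forall>k. \<bar>u $ k - v $ k\<bar> \<le> \<delta>) \<longrightarrow> \<bar>Gn n xs u - Gn n xs v\<bar> \<le> \<eta>) \<longrightarrow>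
     (\<forall>k. Hn n xs (vupd onevec k 0) = 0) \<longrightarrow>
     (\<forall>u\<in>cube. \<bar>sqrt (real n) * (Cbar n xs A u - condcop Q A u) - Cinf_formula Q A (Gn n xs) u\<bar> \<le> e)"
proof (cases "K \<ge> 0")
  case False
  have "\<not> (\<forall>u\<in>cube. \<bar>Gn n xs u\<bar> \<le> K)" for n xs
    using False zero_in_cube by (meson abs_ge_zero order_trans)
  then show ?thesis by (intro exI[of _ 1] conjI allI impI always_eventually) (blast | simp)+
next
  case K0: True
  let ?c = "real CARD('p)"
  define c1 where "c1 = 1 + ?c + 2 * ?c * dbound"
  have c1: "c1 > 0" using dbound(1) by (simp add: c1_def add_pos_nonneg)
  \<comment> \<open>Each of the three groups of errors will be at most p e / 8; the prefactor 2 / p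
    leaves 3 e / 4.\<close>
  define \<eta> where "\<eta> = min 1 (p * e / (8 * c1))"
  have \<eta>: "\<eta> > 0" "\<eta> \<le> 1" "\<eta> * c1 \<le> p * e / 8"
  proof -
    show "\<eta> > 0" "\<eta> \<le> 1" using A_pos e c1 by (auto simp: \<eta>_def)
    have "\<eta> * c1 \<le> p * e / (8 * c1) * c1" using c1 by (intro mult_right_mono) (auto simp: \<eta>_def)
    then show "\<eta> * c1 \<le> p * e / 8" using c1 by simp
  qed
  define cK where "cK = ?c * (2 * K + 2)"
  define e0 where "e0 = p * e / (8 * cK)"
  have cK: "cK > 0" using K0 by (simp add: cK_def)
  have ee: "e0 * cK = p * e / 8" using cK by (simp add: e0_def)
  have e0: "e0 > 0" "e0 * ?c * (2 * K + 2) = p * e / 8"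
    using A_pos e cK by (simp add: e0_def) (simp only: ee[symmetric] cK_def mult.assoc)
  obtain d where d: "d > 0" "\<And>u v. u \<in> cube \<Longrightarrow> v \<in> cube \<Longrightarrow> (\<forall>k. \<bar>v $ k - u $ k\<bar> \<le> d) \<Longrightarrow>
      \<bar>condcop Q A v - condcop Q A u - (\<Sum>k\<in>UNIV. cube_partial (condcop Q A) k u * (v $ k - u $ k))\<bar>
        \<le> e0 * (\<Sum>k\<in>UNIV. \<bar>v $ k - u $ k\<bar>)"
    using C1_expansion[OF C1 e0(1)] by blast
  show ?thesis
  proof (intro exI[of _ \<eta>] conjI allI impI \<eta>(1))
    fix \<delta> :: real assume \<delta>: "\<delta> > 0"
    have p8: "p * e / 8 > 0" "p / 2 > 0" using A_pos e by simp_all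
    have ev_n: "\<forall>\<^sub>F n in sequentially. 1 / real n \<le> \<delta>"
      using eventually_ge_at_top[of "nat \<lceil>1 / \<delta>\<rceil> + 1"]
    proof eventually_elim
      case (elim n)
      then have "1 / \<delta> \<le> real n" "n > 0" by linarith+
      then show ?case using \<delta> by (simp add: field_simps)
    qed
    show "\<forall>\<^sub>F n in sequentially. \<forall>xs.
     (\<forall>u\<in>cube. \<bar>Gn n xs u\<bar> \<le> K) \<longrightarrow>
     (\<forall>u\<in>cube. \<forall>v\<in>cube. (\<forall>k. \<bar>u $ k - v $ k\<bar> \<le> \<delta>) \<longrightarrow> \<bar>Gn n xs u - Gn n xs v\<bar> \<le> \<eta>) \<longrightarrow>
     (\<forall>k. Hn n xs (vupd onevec k 0) = 0) \<longrightarrow>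
     (\<forall>u\<in>cube. \<bar>sqrt (real n) * (Cbar n xs A u - condcop Q A u) - Cinf_formula Q A (Gn n xs) u\<bar> \<le> e)"
      using ev_n eventually_gt_at_top[of 0]
        eventually_const_over_sqrt_le[OF p8(2), of K] eventually_const_over_sqrt_le[OF \<delta>, of "(2 * K + 2) / p"]
        eventually_const_over_sqrt_le[OF d(1), of "(2 * K + 2) / p"]
        eventually_const_over_sqrt_le[OF p8(1), of "?c * (1 + dbound) + K * (lipC * K)"]
    proof eventually_elim
      case (elim n)
      show ?case
      proof (intro allI impI ballI)
      fix xs :: "nat \<Rightarrow> (real^'p) \<times> 'z" and u :: "real^'p" assume h: "\<forall>u\<in>cube. \<bar>Gn n xs u\<bar> \<le> K"
        "\<forall>u\<in>cube. \<forall>v\<in>cube. (\<forall>k. \<bar>u $ k - v $ k\<bar> \<le> \<delta>) \<longrightarrow> \<bar>Gn n xs u - Gn n xs v\<bar> \<le> \<eta>"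
        "\<forall>k. Hn n xs (vupd onevec k 0) = 0" "u \<in> cube"
      have "\<bar>sqrt (real n) * (Cbar n xs A u - condcop Q A u) - Cinf_formula Q A (Gn n xs) u\<bar>
        \<le> 2 / p * ((\<eta> * (1 + ?c + 2 * ?c * dbound) + e0 * ?c * (2 * K + 2))
        + (?c * (1 + dbound) + K * (lipC * K)) / sqrt (real n))"
        using elim h A_pos \<eta> e0(1) d(2) by (intro delta_remainder[of n u xs K \<delta> \<eta> d e0]) auto
      also have "\<dots> \<le> 2 / p * ((p * e / 8 + p * e / 8) + p * e / 8)"
        using elim A_pos \<eta>(3) e0(2) unfolding c1_def by (intro mult_left_mono add_mono) auto
      also have "\<dots> \<le> e" using A_pos e by (simp add: field_simps)
      finally show "\<bar>sqrt (real n) * (Cbar n xs A u - condcop Q A u) - Cinf_formula Q A (Gn n xs) u\<bar> \<le> e" .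
      qed
    qed
  qed
qed

end

section \<open>Dyadic chaining\<close>

text \<open>Grid points are coded by vectors of natural numbers because the Cramer--Wold theorem
  asks for a countable index type.\<close>

definition pt :: "nat \<Rightarrow> nat^'p \<Rightarrow> real^'p" where
  "pt N c = (\<chi> i. real (c $ i) / 2 ^ N)"

definition flr :: "nat \<Rightarrow> real^'p \<Rightarrow> nat^'p" where
  "flr N u = (\<chi> i. nat \<lfloor>2 ^ N * u $ i\<rfloor>)"

definition prj :: "nat \<Rightarrow> real^'p \<Rightarrow> real^'p" where
  "prj N u = pt N (flr N u)"

definition cgrid :: "nat \<Rightarrow> (nat^'p) set" where
  "cgrid N = {c. \<forall>i. c $ i \<le> 2 ^ N}"

definition grid :: "nat \<Rightarrow> (real^'p) set" where
  "grid N = pt N ` cgrid N"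

text \<open>Only ordered pairs are linked: the difference of two nested orthant indicators is again
  an indicator, as the exponential bounds require.\<close>

definition links :: "nat \<Rightarrow> ((real^'p) \<times> (real^'p)) set" where
  "links N = {(a, b). a \<in> grid N \<and> b \<in> grid N \<and> (\<forall>i. a $ i \<le> b $ i \<and> b $ i \<le> a $ i + 1 / 2 ^ N)}"

lemma finite_cgrid[simp]: "finite (cgrid N :: (nat^'p) set)"
  and card_cgrid: "card (cgrid N :: (nat^'p) set) \<le> (2 ^ N + 1) ^ CARD('p)"
proof -
  let ?S = "Pi\<^sub>E (UNIV :: 'p set) (\<lambda>_. {..2 ^ N :: nat})"
  have sub: "(cgrid N :: (nat^'p) set) \<subseteq> (\<lambda>f. \<chi> i. f i) ` ?S"
  proof
    fix c :: "nat^'p" assume "c \<in> cgrid N"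
    then show "c \<in> (\<lambda>f. \<chi> i. f i) ` ?S"
      by (intro image_eqI[of _ _ "\<lambda>i. c $ i"]) (auto simp: cgrid_def vec_eq_iff PiE_iff)
  qed
  have fin: "finite ?S" by (intro finite_PiE) auto
  show "finite (cgrid N :: (nat^'p) set)" using finite_subset[OF sub] fin by simp
  have "card (cgrid N :: (nat^'p) set) \<le> card ?S"
    using card_mono[OF _ sub] card_image_le[OF fin, of "\<lambda>f. \<chi> i. f i"] fin by (meson finite_imageI order_trans)
  then show "card (cgrid N :: (nat^'p) set) \<le> (2 ^ N + 1) ^ CARD('p)" by (simp add: card_PiE)
qed

lemma finite_grid[simp]: "finite (grid N)" by (simp add: grid_def)

lemma grid_cube: "a \<in> grid N \<Longrightarrow> a \<in> cube"
  by (auto simp: grid_def cgrid_def cube_def pt_def)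

lemma links_cube: "(a, b) \<in> links N \<Longrightarrow> a \<in> cube \<and> b \<in> cube"
  by (auto simp: links_def grid_cube)

lemma finite_links[simp]: "finite (links N :: ((real^'p) \<times> (real^'p)) set)"
  and card_links: "card (links N :: ((real^'p) \<times> (real^'p)) set) \<le> (2 ^ N + 1) ^ (2 * CARD('p))"
proof -
  have sub: "(links N :: ((real^'p) \<times> (real^'p)) set) \<subseteq> grid N \<times> grid N" by (auto simp: links_def)
  then show "finite (links N :: ((real^'p) \<times> (real^'p)) set)" by (rule finite_subset) simp
  have g: "card (grid N :: (real^'p) set) \<le> (2 ^ N + 1) ^ CARD('p)"
    unfolding grid_def by (rule order_trans[OF card_image_le card_cgrid]) simp
  have "card (links N :: ((real^'p) \<times> (real^'p)) set) \<le> card ((grid N :: (real^'p) set) \<times> (grid N :: (real^'p) set))"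
    by (intro card_mono sub) simp
  also have "\<dots> \<le> (2 ^ N + 1) ^ CARD('p) * (2 ^ N + 1) ^ CARD('p)"
    unfolding card_cartesian_product by (intro mult_mono g) auto
  finally show "card (links N :: ((real^'p) \<times> (real^'p)) set) \<le> (2 ^ N + 1) ^ (2 * CARD('p))"
    by (simp add: mult_2 power_add)
qed

lemma prj_nth: "u \<in> cube \<Longrightarrow> prj N u $ i = of_int \<lfloor>2 ^ N * u $ i\<rfloor> / 2 ^ N"
  using cube_nth[of u i] by (simp add: prj_def pt_def flr_def)

lemma flr_cgrid: "u \<in> cube \<Longrightarrow> flr N u \<in> cgrid N"
proof -
  assume u: "u \<in> cube"
  have "nat \<lfloor>2 ^ N * u $ i\<rfloor> \<le> 2 ^ N" for i
  proof -
    have "2 ^ N * u $ i \<le> 2 ^ N * 1" using cube_nth[OF u, of i] by (intro mult_left_mono) auto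
    then have "\<lfloor>2 ^ N * u $ i\<rfloor> \<le> \<lfloor>2 ^ N :: real\<rfloor>" by (intro floor_mono) simp
    also have "\<dots> = 2 ^ N" by (metis floor_of_int of_int_numeral of_int_power)
    finally show ?thesis by (simp add: nat_le_iff)
  qed
  then show ?thesis by (simp add: cgrid_def flr_def)
qed

lemma prj_grid: "u \<in> cube \<Longrightarrow> prj N u \<in> grid N"
  by (simp add: prj_def grid_def flr_cgrid)

lemma prj_cube: "u \<in> cube \<Longrightarrow> prj N u \<in> cube"
  using grid_cube prj_grid by blast

lemma prj_le: "u \<in> cube \<Longrightarrow> prj N u $ i \<le> u $ i" "u \<in> cube \<Longrightarrow> u $ i \<le> prj N u $ i + 1 / 2 ^ N"
proof -
  assume u: "u \<in> cube"
  have "of_int \<lfloor>2 ^ N * u $ i\<rfloor> \<le> 2 ^ N * u $ i" "2 ^ N * u $ i \<le> of_int \<lfloor>2 ^ N * u $ i\<rfloor> + 1"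
    by linarith+
  then show "prj N u $ i \<le> u $ i" "u $ i \<le> prj N u $ i + 1 / 2 ^ N"
    unfolding prj_nth[OF u] by (simp_all add: field_simps)
qed

lemma grid_Suc: "a \<in> grid N \<Longrightarrow> a \<in> grid (Suc N)"
proof -
  assume "a \<in> grid N"
  then obtain c where c: "c \<in> cgrid N" "a = pt N c" by (auto simp: grid_def)
  have "a = pt (Suc N) (\<chi> i. 2 * c $ i)" by (simp add: c pt_def vec_eq_iff)
  moreover have "(\<chi> i. 2 * c $ i) \<in> cgrid (Suc N)" using c by (simp add: cgrid_def)
  ultimately show ?thesis by (auto simp: grid_def)
qed

lemma grid_mono: "N \<le> N' \<Longrightarrow> a \<in> grid N \<Longrightarrow> a \<in> grid N'"
  by (induction N' rule: dec_induct) (auto intro: grid_Suc)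

text \<open>Halving the mesh moves a rounded-down coordinate by 0 or one step of the finer grid, so
  successive projections form ordered links.\<close>

lemma prj_link_Suc: "u \<in> cube \<Longrightarrow> (prj N u, prj (Suc N) u) \<in> links (Suc N)"
proof -
  assume u: "u \<in> cube"
  have "prj N u $ i \<le> prj (Suc N) u $ i \<and> prj (Suc N) u $ i \<le> prj N u $ i + 1 / 2 ^ Suc N" for i
  proof -
    define x where "x = 2 ^ N * u $ i"
    have "2 * \<lfloor>x\<rfloor> \<le> \<lfloor>2 * x\<rfloor>" "\<lfloor>2 * x\<rfloor> \<le> 2 * \<lfloor>x\<rfloor> + 1" by linarith+
    then have "2 * real_of_int \<lfloor>x\<rfloor> \<le> of_int \<lfloor>2 * x\<rfloor>" "of_int \<lfloor>2 * x\<rfloor> \<le> 2 * real_of_int \<lfloor>x\<rfloor> + 1" by linarith+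
    then show ?thesis unfolding prj_nth[OF u] by (simp add: x_def mult.assoc field_simps)
  qed
  then show ?thesis using u by (auto simp: links_def intro: grid_Suc prj_grid)
qed

lemma prj_grid_id:
  assumes "a \<in> grid N" "N \<le> N'"
  shows "prj N' a = a"
proof -
  have "a \<in> grid N'" by (rule grid_mono[OF assms(2,1)])
  then obtain c where c: "a = pt N' c" by (auto simp: grid_def)
  have "2 ^ N' * a $ i = of_int (int (c $ i))" for i by (simp add: c pt_def)
  then have "flr N' a = c" by (simp add: flr_def vec_eq_iff)
  then show ?thesis by (simp add: prj_def c)
qed

text \<open>Projections of two close points need not be comparable; their componentwise minimum is
  linked to both.\<close>

lemma prj_meet_links:
  assumes u: "u \<in> cube" and v: "v \<in> cube" and d: "\<And>i. \<bar>u $ i - v $ i\<bar> \<le> 1 / 2 ^ N"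
  obtains w where "(w, prj N u) \<in> links N" "(w, prj N v) \<in> links N"
proof -
  define w where "w = pt N (\<chi> i. min (flr N u $ i) (flr N v $ i))"
  have wg: "w \<in> grid N"
    using flr_cgrid[OF u, of N] by (auto simp: w_def grid_def cgrid_def min_le_iff_disj)
  have wi: "w $ i = min (prj N u $ i) (prj N v $ i)" for i
    by (auto simp: w_def prj_def pt_def min_def divide_right_mono divide_le_cancel)
  have "\<bar>prj N u $ i - prj N v $ i\<bar> \<le> 1 / 2 ^ N" for i
  proof -
    define x y where "x = 2 ^ N * u $ i" and "y = 2 ^ N * v $ i"
    have "\<bar>x - y\<bar> = 2 ^ N * \<bar>u $ i - v $ i\<bar>" by (simp add: x_def y_def right_diff_distrib[symmetric] abs_mult)
    also have "\<dots> \<le> 2 ^ N * (1 / 2 ^ N)" by (intro mult_left_mono d) simp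
    finally have "\<bar>x - y\<bar> \<le> 1" by simp
    then have "\<lfloor>x\<rfloor> \<le> \<lfloor>y\<rfloor> + 1" "\<lfloor>y\<rfloor> \<le> \<lfloor>x\<rfloor> + 1" by linarith+
    then have "\<bar>real_of_int \<lfloor>x\<rfloor> - of_int \<lfloor>y\<rfloor>\<bar> \<le> 1" by linarith
    then show ?thesis unfolding prj_nth[OF u] prj_nth[OF v] x_def y_def
      by (simp add: diff_divide_distrib[symmetric] abs_divide divide_right_mono)
  qed
  note * = this
  have "prj N u $ i \<le> prj N v $ i + 1 / 2 ^ N" "prj N v $ i \<le> prj N u $ i + 1 / 2 ^ N" for i
    using *[of i] by (auto simp: abs_le_iff)
  then have "(w, prj N u) \<in> links N" "(w, prj N v) \<in> links N"
    using wg prj_grid[OF u] prj_grid[OF v] by (auto simp: links_def wi min_def)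
  then show ?thesis by (rule that)
qed

text \<open>Rounding up completes a bracket of \<open>u\<close> by two grid points, for the
  monotonicity argument at the finest level.\<close>

lemma prj_upper_link:
  assumes u: "u \<in> cube"
  obtains b where "(prj N u, b) \<in> links N" "\<And>i. u $ i \<le> b $ i"
proof -
  define b where "b = pt N (\<chi> i. nat \<lceil>2 ^ N * u $ i\<rceil>)"
  have bi: "b $ i = of_int \<lceil>2 ^ N * u $ i\<rceil> / 2 ^ N" for i
    using cube_nth[OF u, of i] by (simp add: b_def pt_def)
  have "nat \<lceil>2 ^ N * u $ i\<rceil> \<le> 2 ^ N" for i
  proof -
    have "2 ^ N * u $ i \<le> 2 ^ N * 1" using cube_nth[OF u, of i] by (intro mult_left_mono) auto
    then have "\<lceil>2 ^ N * u $ i\<rceil> \<le> 2 ^ N" by (simp add: ceiling_le_iff)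
    then show ?thesis by (simp add: nat_le_iff)
  qed
  then have bg: "b \<in> grid N" by (auto simp: grid_def cgrid_def b_def)
  have "prj N u $ i \<le> b $ i \<and> b $ i \<le> prj N u $ i + 1 / 2 ^ N \<and> u $ i \<le> b $ i" for i
  proof -
    define x where "x = 2 ^ N * u $ i"
    have "\<lfloor>x\<rfloor> \<le> \<lceil>x\<rceil>" "\<lceil>x\<rceil> \<le> \<lfloor>x\<rfloor> + 1" by linarith+
    then have "real_of_int \<lfloor>x\<rfloor> \<le> of_int \<lceil>x\<rceil>" "real_of_int \<lceil>x\<rceil> \<le> of_int \<lfloor>x\<rfloor> + 1" "x \<le> of_int \<lceil>x\<rceil>" by linarith+
    then show ?thesis unfolding bi prj_nth[OF u] by (simp add: x_def field_simps)
  qed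
  then show ?thesis using that[of b] bg prj_grid[OF u] by (auto simp: links_def)
qed

text \<open>The chaining scale: \<open>\<rho>\<^sup>4 = 2\<close>, so increments over links of mesh \<open>2\<^sup>-\<^sup>r\<close> have standard
  deviation of order \<open>\<rho>\<^sup>-\<^sup>2\<^sup>r\<close> and are compared with the summable thresholds \<open>\<rho>\<^sup>-\<^sup>r\<close>.\<close>

definition \<rho> :: real where "\<rho> = sqrt (sqrt 2)"

lemma rho_gt_1: "\<rho> > 1" by (simp add: \<rho>_def)

lemma rho_pow4: "\<rho> ^ 4 = 2"
proof -
  have "\<rho> ^ 4 = (\<rho>\<^sup>2)\<^sup>2" by simp
  then show ?thesis by (simp add: \<rho>_def)
qed

text \<open>Tail of the geometric series: the sum of 1 / \<rho>^r over r > N.\<close>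

definition \<tau> :: "nat \<Rightarrow> real" where "\<tau> N = 1 / ((\<rho> - 1) * \<rho> ^ N)"

lemma tau_nonneg: "0 \<le> \<tau> N" using rho_gt_1 by (simp add: \<tau>_def)

lemma tau_Suc: "\<tau> N - \<tau> (Suc N) = 1 / \<rho> ^ Suc N"
proof -
  have r: "\<rho> - 1 \<noteq> 0" "\<rho> \<noteq> 0" using rho_gt_1 by auto
  have "\<tau> N = \<rho> * \<tau> (Suc N)" using r by (simp add: \<tau>_def)
  then have "\<tau> N - \<tau> (Suc N) = (\<rho> - 1) * \<tau> (Suc N)" by (simp add: algebra_simps)
  also have "\<dots> = 1 / \<rho> ^ Suc N" using r by (simp add: \<tau>_def)
  finally show ?thesis .
qed

lemma inverse_rho_tendsto: "(\<lambda>N. 1 / \<rho> ^ N) \<longlonglongrightarrow> 0"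
proof -
  have "(\<lambda>N. (1 / \<rho>) ^ N) \<longlonglongrightarrow> 0" using rho_gt_1 by (intro LIMSEQ_power_zero) simp
  then show ?thesis by (simp add: power_divide)
qed

lemma tau_tendsto: "\<tau> \<longlonglongrightarrow> 0"
proof -
  have "(\<lambda>N. 1 / (\<rho> - 1) * (1 / \<rho> ^ N)) \<longlonglongrightarrow> 0" by (intro tendsto_mult_right_zero inverse_rho_tendsto)
  then show ?thesis by (simp add: \<tau>_def[abs_def])
qed

text \<open>The factor \<open>q\<close> is present because a resampled process is a sum of two
  processes that are chained with factor 1, hence is chained with factor 2.\<close>

definition chained :: "real \<Rightarrow> nat \<Rightarrow> nat \<Rightarrow> (real^'p \<Rightarrow> real) \<Rightarrow> bool" where
  "chained q N0 N1 G \<longleftrightarrow> (\<forall>r\<in>{N0..N1}. \<forall>(a, b)\<in>links r. \<bar>G b - G a\<bar> \<le> q / \<rho> ^ r)"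

lemma chainedD: "chained q N0 N1 G \<Longrightarrow> N0 \<le> r \<Longrightarrow> r \<le> N1 \<Longrightarrow> (a, b) \<in> links r \<Longrightarrow> \<bar>G b - G a\<bar> \<le> q / \<rho> ^ r"
  by (auto simp: chained_def)

lemma not_chained_iff:
  "\<not> chained q N0 N1 G \<longleftrightarrow> (\<exists>r\<in>{N0..N1}. \<exists>(a, b)\<in>links r. \<bar>G b - G a\<bar> > q / \<rho> ^ r)"
  by (simp add: chained_def case_prod_beta not_le)

lemma chained_add:
  fixes G G' :: "real^'p \<Rightarrow> real"
  assumes "chained q N0 N1 G" "chained q' N0 N1 G'"
  shows "chained (q + q') N0 N1 (\<lambda>u. G u + G' u)"
  unfolding chained_def
proof (intro ballI, clarify)
  fix r and a b :: "real^'p" assume r: "r \<in> {N0..N1}" "(a, b) \<in> links r"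
  have "\<bar>G b - G a\<bar> \<le> q / \<rho> ^ r" "\<bar>G' b - G' a\<bar> \<le> q' / \<rho> ^ r"
    using assms r by (auto intro: chainedD)
  then show "\<bar>G b + G' b - (G a + G' a)\<bar> \<le> (q + q') / \<rho> ^ r" by (simp add: add_divide_distrib)
qed

lemma chained_prj:
  assumes ch: "chained q N0 N1 G" and N: "N0 \<le> N" "N \<le> N'" "N' \<le> N1" and u: "u \<in> cube"
  shows "\<bar>G (prj N' u) - G (prj N u)\<bar> \<le> q * (\<tau> N - \<tau> N')"
  using N(2,3)
proof (induction N' rule: dec_induct)
  case base
  show ?case by simp
next
  case (step r)
  have "\<bar>G (prj (Suc r) u) - G (prj r u)\<bar> \<le> q / \<rho> ^ Suc r"
    using step N(1) by (intro chainedD[OF ch] prj_link_Suc u) auto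
  moreover have "q / \<rho> ^ Suc r = q * (\<tau> r - \<tau> (Suc r))" by (simp add: tau_Suc)
  moreover have "\<bar>G (prj r u) - G (prj N u)\<bar> \<le> q * (\<tau> N - \<tau> r)" using step by simp
  moreover have "q * (\<tau> N - \<tau> (Suc r)) = q * (\<tau> N - \<tau> r) + q * (\<tau> r - \<tau> (Suc r))" by (simp add: algebra_simps)
  ultimately show ?case by linarith
qed

lemma chained_prj_le:
  assumes "chained q N0 N1 G" "q \<ge> 0" "N0 \<le> N" "N \<le> N'" "N' \<le> N1" "u \<in> cube"
  shows "\<bar>G (prj N' u) - G (prj N u)\<bar> \<le> q * \<tau> N"
proof -
  have "q * (\<tau> N - \<tau> N') \<le> q * \<tau> N" using assms(2) tau_nonneg by (intro mult_left_mono) auto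
  then show ?thesis using chained_prj[OF assms(1,3,4,5,6)] by linarith
qed

lemma power_div_fact_le_exp:
  fixes x :: real
  assumes "0 \<le> x"
  shows "x ^ n / fact n \<le> exp x"
proof -
  have "(\<Sum>i\<in>{n}. inverse (fact i) * x ^ i) \<le> (\<Sum>i. inverse (fact i) * x ^ i)"
    using assms summable_exp[of x] by (intro sum_le_suminf) auto
  also have "\<dots> = exp x" by (simp add: exp_def scaleR_conv_of_real)
  finally show ?thesis by (simp add: divide_inverse mult.commute)
qed

definition link_const :: "'p::finite itself \<Rightarrow> real" where
  "link_const _ = 4 ^ CARD('p) * fact (4 * (2 * CARD('p) + 1))"

text \<open>The number of links is bounded by a polynomial in \<rho>^r, and
  \<open>exp (- (\<rho> ^ r))\<close> beats every power. The exponent \<open>k\<close> is chosen so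
  that \<open>(\<rho> ^ r) ^ k\<close> exceeds that bound by a factor 2^r up to a constant, which
  makes the sum over the levels geometric.\<close>

lemma link_weight:
  "real (card (links r :: ((real^'p) \<times> (real^'p)) set)) * exp (- (\<rho> ^ r)) \<le> link_const TYPE('p) * (1 / 2) ^ r"
proof -
  define k where "k = 4 * (2 * CARD('p) + 1)"
  have "(\<rho> ^ r) ^ k = (\<rho> ^ 4) ^ (r * (2 * CARD('p) + 1))" by (simp add: k_def power_mult[symmetric] algebra_simps)
  then have rk: "(\<rho> ^ r) ^ k = 2 ^ (r * (2 * CARD('p) + 1))" by (simp only: rho_pow4)
  have "(\<rho> ^ r) ^ k / fact k \<le> exp (\<rho> ^ r)" using rho_gt_1 by (intro power_div_fact_le_exp) auto
  then have "2 ^ (r * (2 * CARD('p) + 1)) * exp (- (\<rho> ^ r)) \<le> fact k"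
    unfolding rk by (simp add: exp_minus field_simps)
  then have 1: "exp (- (\<rho> ^ r)) \<le> fact k / 2 ^ (r * (2 * CARD('p) + 1))" by (simp add: field_simps)
  have "real (card (links r :: ((real^'p) \<times> (real^'p)) set)) \<le> real ((2 ^ r + 1) ^ (2 * CARD('p)))"
    using card_links[of r, where 'p='p] by (simp only: of_nat_le_iff)
  also have "\<dots> = (2 ^ r + 1) ^ (2 * CARD('p))" by (simp add: add.commute)
  also have "\<dots> \<le> (2 * 2 ^ r) ^ (2 * CARD('p))" by (rule power_mono) auto
  finally have "real (card (links r :: ((real^'p) \<times> (real^'p)) set)) * exp (- (\<rho> ^ r))
      \<le> (2 * 2 ^ r) ^ (2 * CARD('p)) * (fact k / 2 ^ (r * (2 * CARD('p) + 1)))"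
    using 1 by (intro mult_mono) auto
  also have "\<dots> = link_const TYPE('p) * (1 / 2) ^ r"
  proof -
    have "(2 * 2 ^ r :: real) ^ (2 * CARD('p)) = 4 ^ CARD('p) * 2 ^ (r * (2 * CARD('p)))"
      by (simp add: power_mult_distrib power_mult[symmetric]) (simp add: power_mult)
    moreover have "(2::real) ^ (r * (2 * CARD('p) + 1)) = 2 ^ (r * (2 * CARD('p))) * 2 ^ r"
      by (simp add: power_add[symmetric])
    ultimately show ?thesis by (simp add: link_const_def k_def power_divide)
  qed
  finally show ?thesis .
qed

lemma link_const_pos: "link_const TYPE('p::finite) > 0"
  by (simp add: link_const_def)

lemma (in prob_space) link_union_bound:
  fixes S :: "'a \<Rightarrow> real^'p \<Rightarrow> real"
  assumes m[measurable]: "\<And>u. u \<in> cube \<Longrightarrow> (\<lambda>\<omega>. S \<omega> u) \<in> borel_measurable M"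
    and tail: "\<And>a b. (a, b) \<in> links r \<Longrightarrow> prob {\<omega>\<in>space M. \<bar>S \<omega> b - S \<omega> a\<bar> > 1 / \<rho> ^ r} \<le> c * exp (- (\<rho> ^ r))"
    and c: "c \<ge> 0"
  shows "{\<omega>\<in>space M. \<exists>(a, b)\<in>links r. \<bar>S \<omega> b - S \<omega> a\<bar> > 1 / \<rho> ^ r} \<in> events" (is "?B \<in> _")
    and "prob {\<omega>\<in>space M. \<exists>(a, b)\<in>links r. \<bar>S \<omega> b - S \<omega> a\<bar> > 1 / \<rho> ^ r} \<le> c * link_const TYPE('p) * (1 / 2) ^ r"
proof -
  define E where "E ab = {\<omega>\<in>space M. \<bar>S \<omega> (snd ab) - S \<omega> (fst ab)\<bar> > 1 / \<rho> ^ r}" for ab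
  have E: "E ab \<in> events" if ab: "ab \<in> links r" for ab
  proof -
    have [measurable]: "(\<lambda>\<omega>. S \<omega> (snd ab)) \<in> borel_measurable M" "(\<lambda>\<omega>. S \<omega> (fst ab)) \<in> borel_measurable M"
      using links_cube[of "fst ab" "snd ab" r] ab by (auto intro: m)
    show ?thesis unfolding E_def by measurable
  qed
  have B: "?B = (\<Union>ab\<in>links r. E ab)" by (auto simp: E_def)
  show "?B \<in> events" unfolding B using E by (intro sets.finite_UN) auto
  have "prob ?B \<le> (\<Sum>ab\<in>links r. prob (E ab))"
    unfolding B using E by (intro measure_UNION_le) auto
  also have "\<dots> \<le> (\<Sum>ab\<in>(links r :: ((real^'p) \<times> (real^'p)) set). c * exp (- (\<rho> ^ r)))"
    using tail by (intro sum_mono) (auto simp: E_def)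
  also have "\<dots> = c * (real (card (links r :: ((real^'p) \<times> (real^'p)) set)) * exp (- (\<rho> ^ r)))" by simp
  also have "\<dots> \<le> c * (link_const TYPE('p) * (1 / 2) ^ r)" by (intro mult_left_mono link_weight c)
  finally show "prob ?B \<le> c * link_const TYPE('p) * (1 / 2) ^ r" by (simp add: mult_ac)
qed

lemma sum_half_powers_le: "(\<Sum>r\<in>{N0..N1}. (1 / 2 :: real) ^ r) \<le> 2 * (1 / 2) ^ N0"
proof (cases "N0 \<le> N1")
  case True
  then have "(\<Sum>r\<in>{N0..N1}. (1 / 2 :: real) ^ r) = 2 * (1 / 2) ^ N0 - (1 / 2) ^ N1"
    by (induction N1 rule: dec_induct) (auto simp: sum.cl_ivl_Suc)
  then show ?thesis by simp
qed simp

text \<open>The bound does not involve the last level \<open>N1\<close>, which may therefore grow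
  with the sample size.\<close>

lemma (in prob_space) not_chained_bound:
  fixes S :: "'a \<Rightarrow> real^'p \<Rightarrow> real"
  assumes m: "\<And>u. u \<in> cube \<Longrightarrow> (\<lambda>\<omega>. S \<omega> u) \<in> borel_measurable M"
    and tail: "\<And>r a b. N0 \<le> r \<Longrightarrow> r \<le> N1 \<Longrightarrow> (a, b) \<in> links r \<Longrightarrow>
        prob {\<omega>\<in>space M. \<bar>S \<omega> b - S \<omega> a\<bar> > 1 / \<rho> ^ r} \<le> c * exp (- (\<rho> ^ r))"
    and c: "c \<ge> 0"
  shows "{\<omega>\<in>space M. \<not> chained 1 N0 N1 (S \<omega>)} \<in> events" (is "?B \<in> _")
    and "prob {\<omega>\<in>space M. \<not> chained 1 N0 N1 (S \<omega>)} \<le> 2 * c * link_const TYPE('p) * (1 / 2) ^ N0"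
proof -
  define E where "E r = {\<omega>\<in>space M. \<exists>(a, b)\<in>links r. \<bar>S \<omega> b - S \<omega> a\<bar> > 1 / \<rho> ^ r}" for r
  have E: "E r \<in> events" "prob (E r) \<le> c * link_const TYPE('p) * (1 / 2) ^ r" if "r \<in> {N0..N1}" for r
    unfolding E_def using that by (intro link_union_bound[where c=c] m tail c; simp)+
  have B: "?B = (\<Union>r\<in>{N0..N1}. E r)"
    unfolding not_chained_iff E_def by blast
  show "?B \<in> events" unfolding B using E by (intro sets.finite_UN) auto
  have "prob ?B \<le> (\<Sum>r\<in>{N0..N1}. prob (E r))"
    unfolding B using E by (intro measure_UNION_le) auto
  also have "\<dots> \<le> (\<Sum>r\<in>{N0..N1}. c * link_const TYPE('p) * (1 / 2) ^ r)" by (intro sum_mono E)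
  also have "\<dots> = c * link_const TYPE('p) * (\<Sum>r\<in>{N0..N1}. (1 / 2) ^ r)" by (simp add: sum_distrib_left)
  also have "\<dots> \<le> c * link_const TYPE('p) * (2 * (1 / 2) ^ N0)"
    using c link_const_pos[where 'p='p] by (intro mult_left_mono sum_half_powers_le) auto
  finally show "prob ?B \<le> 2 * c * link_const TYPE('p) * (1 / 2) ^ N0" by (simp add: mult_ac)
qed

text \<open>Integer part of the binary logarithm. It is the last level at which the Chernoff
  parameter \<rho>^(2r), whose square is 2^r, does not exceed sqrt n.\<close>

definition lg :: "nat \<Rightarrow> nat" where "lg n = (SOME N. 2 ^ N \<le> n \<and> n < 2 ^ (N + 1))"

lemma lg: assumes "n > 0" shows "2 ^ lg n \<le> n" "n < 2 ^ (lg n + 1)"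
proof -
  have "\<exists>N. 2 ^ N \<le> n \<and> n < 2 ^ (N + 1)" using ex_power_ivl1[of 2 n] assms by auto
  from someI_ex[OF this] show "2 ^ lg n \<le> n" "n < 2 ^ (lg n + 1)" by (auto simp: lg_def)
qed

lemma lg_at_top: "filterlim lg at_top sequentially"
  unfolding filterlim_at_top
proof
  fix N
  show "\<forall>\<^sub>F n in sequentially. N \<le> lg n"
    using eventually_ge_at_top[of "2 ^ N"]
  proof eventually_elim
    case (elim n)
    moreover have "(0::nat) < 2 ^ N" by simp
    ultimately have "n > 0" by linarith
    then have "(2::nat) ^ N < 2 ^ (lg n + 1)" using elim lg(2)[of n] by linarith
    then show ?case by (simp only: power_strict_increasing_iff)
  qed
qed

text \<open>Chaining stops at a mesh of about \<open>1/n\<close>; this is what it leaves over.\<close>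

definition small :: "real \<Rightarrow> real \<Rightarrow> nat \<Rightarrow> real" where
  "small d q n = q / \<rho> ^ lg n + 2 * d / sqrt (real n)"

lemma small_tendsto: "small d q \<longlonglongrightarrow> 0"
proof -
  have "(\<lambda>n. q * (1 / \<rho> ^ lg n)) \<longlonglongrightarrow> 0"
    by (intro tendsto_mult_right_zero filterlim_compose[OF inverse_rho_tendsto lg_at_top])
  moreover have "(\<lambda>n. 2 * d / sqrt (real n)) \<longlonglongrightarrow> 0"
    by (intro tendsto_divide_0[OF tendsto_const] filterlim_at_top_imp_at_infinity
        filterlim_compose[OF sqrt_at_top] filterlim_real_sequentially)
  ultimately show ?thesis unfolding small_def[abs_def] using tendsto_add by fastforce
qed

section \<open>Increments of the centred orthant process down to scale zero\<close>

context cond_copula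
begin

text \<open>At the finest level \<open>u\<close> is bracketed by \<open>prj L u\<close> and
  \<open>b\<close>. Both \<open>Hn\<close> and \<open>Dfun\<close> are monotone, so
  \<open>Gn\<close> at \<open>u\<close> is trapped between its values at the brackets up to the
  population mass between them.\<close>

lemma Gn_prj:
  assumes n: "n > 0" and ch: "chained q N0 (lg n) (Gn n xs)" and q: "q \<ge> 0"
    and N: "N0 \<le> N" "N \<le> lg n" and u: "u \<in> cube"
  shows "\<bar>Gn n xs u - Gn n xs (prj N u)\<bar> \<le> q * \<tau> N + small (real CARD('p)) q n"
proof -
  define L where "L = lg n"
  define s where "s = sqrt (real n)"
  have s: "s > 0" "s * s = real n" using n by (auto simp: s_def)
  obtain b where b: "(prj L u, b) \<in> links L" "\<And>i. u $ i \<le> b $ i" using prj_upper_link[OF u] by blast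
  have a: "\<And>i. prj L u $ i \<le> u $ i" using prj_le(1)[OF u] by blast
  have bc: "b \<in> cube" "prj L u \<in> cube" using links_cube[OF b(1)] by auto
  have dD: "Dfun Q A b - Dfun Q A (prj L u) \<le> real CARD('p) / 2 ^ L"
  proof -
    have "Dfun Q A b - Dfun Q A (prj L u) \<le> (\<Sum>k\<in>UNIV. b $ k - prj L u $ k)"
      using b(1) by (intro Dfun_increment bc) (auto simp: links_def)
    also have "\<dots> \<le> (\<Sum>k\<in>(UNIV::'p set). 1 / 2 ^ L)" using b(1) by (intro sum_mono) (auto simp: links_def algebra_simps)
    finally show ?thesis by simp
  qed
  have sm: "s * (Dfun Q A b - Dfun Q A (prj L u)) \<le> 2 * real CARD('p) / s"
  proof -
    \<comment> \<open>This makes the mass \<open>CARD('p) / 2 ^ L\<close>, magnified by sqrt n,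
      still of order 1 / sqrt n.\<close>
    have "real n < 2 ^ (L + 1)" using lg(2)[OF n] unfolding L_def by (metis of_nat_less_iff of_nat_numeral of_nat_power)
    then have h: "s * s \<le> 2 * 2 ^ L" using s by simp
    have "s * (Dfun Q A b - Dfun Q A (prj L u)) \<le> s * (real CARD('p) / 2 ^ L)" using dD s by (intro mult_left_mono) auto
    also have "\<dots> \<le> 2 * real CARD('p) / s"
    proof -
      have "(s * s) * real CARD('p) \<le> (2 * 2 ^ L) * real CARD('p)" using h by (intro mult_right_mono) auto
      then show ?thesis using s by (simp add: field_simps)
    qed
    finally show ?thesis .
  qed
  have up: "Gn n xs u \<le> Gn n xs b + s * (Dfun Q A b - Dfun Q A (prj L u))"
  proof -
    have "s * Hn n xs u \<le> s * Hn n xs b" "s * Dfun Q A (prj L u) \<le> s * Dfun Q A u"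
      using s Hn_mono[of u b n xs] b(2) Dfun_mono[of "prj L u" u] a by (auto intro: mult_left_mono)
    then show ?thesis by (simp add: Gn_def s_def[symmetric] right_diff_distrib)
  qed
  have lo: "Gn n xs (prj L u) - s * (Dfun Q A b - Dfun Q A (prj L u)) \<le> Gn n xs u"
  proof -
    have "s * Hn n xs (prj L u) \<le> s * Hn n xs u" "s * Dfun Q A u \<le> s * Dfun Q A b"
      using s Hn_mono[of "prj L u" u n xs] b(2) Dfun_mono[of u b] a by (auto intro: mult_left_mono)
    then show ?thesis by (simp add: Gn_def s_def[symmetric] right_diff_distrib)
  qed
  have "\<bar>Gn n xs b - Gn n xs (prj L u)\<bar> \<le> q / \<rho> ^ L"
    using N unfolding L_def by (intro chainedD[OF ch] b(1)[unfolded L_def]) auto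
  then have "\<bar>Gn n xs u - Gn n xs (prj L u)\<bar> \<le> q / \<rho> ^ L + 2 * real CARD('p) / s"
    using up lo sm Dfun_mono[of "prj L u" b] order_trans[OF a b(2)] by linarith
  moreover have "\<bar>Gn n xs (prj L u) - Gn n xs (prj N u)\<bar> \<le> q * \<tau> N"
    using N unfolding L_def by (intro chained_prj_le[OF ch q] u) auto
  ultimately show ?thesis unfolding small_def L_def s_def by linarith
qed

lemma Gn_modulus:
  assumes n: "n > 0" and ch: "chained q N0 (lg n) (Gn n xs)" and q: "q \<ge> 0"
    and N: "N0 \<le> N" "N \<le> lg n" and u: "u \<in> cube" and v: "v \<in> cube"
    and d: "\<And>i. \<bar>u $ i - v $ i\<bar> \<le> 1 / 2 ^ N"
  shows "\<bar>Gn n xs u - Gn n xs v\<bar> \<le> 2 * (q * \<tau> N + small (real CARD('p)) q n) + 2 * (q / \<rho> ^ N)"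
proof -
  obtain w where w: "(w, prj N u) \<in> links N" "(w, prj N v) \<in> links N"
    using prj_meet_links[OF u v d] by blast
  define e where "e = q / \<rho> ^ N"
  have "\<bar>Gn n xs (prj N u) - Gn n xs w\<bar> \<le> e" "\<bar>Gn n xs (prj N v) - Gn n xs w\<bar> \<le> e"
    unfolding e_def using w N by (auto intro: chainedD[OF ch])
  moreover define t where "t = q * \<tau> N + small (real CARD('p)) q n"
  ultimately show ?thesis unfolding e_def[symmetric] t_def[symmetric]
    using Gn_prj[OF n ch q N u] Gn_prj[OF n ch q N v] unfolding t_def[symmetric] by linarith
qed

end

section \<open>The Gaussian limit\<close>

lemma std_normal_mgf:
  "integrable std_normal_distribution (\<lambda>x. exp (t * x))"
  "(\<integral>x. exp (t * x) \<partial>std_normal_distribution) = exp (t\<^sup>2 / 2)"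
proof -
  have eq: "std_normal_density x * exp (t * x) = exp (t\<^sup>2 / 2) * normal_density t 1 x" for x
    by (simp add: normal_density_def mult_exp_exp power2_eq_square field_simps)
  have i: "integrable lborel (\<lambda>x. std_normal_density x * exp (t * x))"
    unfolding eq by (intro integrable_mult_right integrable_normal_density) simp
  then show "integrable std_normal_distribution (\<lambda>x. exp (t * x))"
    by (subst integrable_density) auto
  have "(\<integral>x. exp (t * x) \<partial>std_normal_distribution) = (\<integral>x. std_normal_density x * exp (t * x) \<partial>lborel)"
    by (subst integral_density) auto
  also have "\<dots> = exp (t\<^sup>2 / 2)" unfolding eq by (simp add: integral_normal_density)
  finally show "(\<integral>x. exp (t * x) \<partial>std_normal_distribution) = exp (t\<^sup>2 / 2)" .
qed

text \<open>The coordinate (j, l) is the l-th standard normal of copy \<open>j\<close>; independent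
  copies of the limit are functions of disjoint blocks.\<close>

definition noise :: "(nat \<times> nat \<Rightarrow> real) measure" where
  "noise = Pi\<^sub>M UNIV (\<lambda>_. std_normal_distribution)"

interpretation noise: prob_space noise
  unfolding noise_def by (rule prob_space_PiM) (rule real_distribution.axioms(1)[OF real_dist_normal_dist])

lemma sets_std_normal[simp, measurable_cong]: "sets std_normal_distribution = sets borel"
  by simp

lemma sets_noise[measurable_cong]: "sets noise = sets (Pi\<^sub>M UNIV (\<lambda>_. borel))"
  unfolding noise_def by (rule sets_PiM_cong) auto

lemma noise_coord_distr: "distr noise borel (\<lambda>\<omega>. \<omega> s) = std_normal_distribution"
proof -
  have "distr noise borel (\<lambda>\<omega>. \<omega> s) = distr noise std_normal_distribution (\<lambda>\<omega>. \<omega> s)"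
    by (rule distr_cong) auto
  also have "\<dots> = std_normal_distribution"
    unfolding noise_def
    by (rule distr_PiM_component) (auto intro: real_distribution.axioms(1)[OF real_dist_normal_dist])
  finally show ?thesis .
qed

lemma noise_coord_measurable[measurable]: "(\<lambda>\<omega>. \<omega> s) \<in> borel_measurable noise"
  by measurable

lemma noise_indep: "noise.indep_vars (\<lambda>_. borel) (\<lambda>s \<omega>. \<omega> s) UNIV"
proof (subst noise.indep_vars_iff_distr_eq_PiM)
  have "distr noise (Pi\<^sub>M UNIV (\<lambda>_. borel)) (\<lambda>\<omega>. \<omega>) = noise"
    by (rule distr_id2) (simp add: sets_noise)
  also have "noise = (\<Pi>\<^sub>M s\<in>UNIV. distr noise borel (\<lambda>\<omega>. \<omega> s))"
    by (simp only: noise_coord_distr) (simp only: noise_def)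
  finally show "distr noise (Pi\<^sub>M UNIV (\<lambda>_. borel)) (\<lambda>x. \<lambda>i\<in>UNIV. x i) = (\<Pi>\<^sub>M s\<in>UNIV. distr noise borel (\<lambda>\<omega>. \<omega> s))"
    by (simp add: restrict_UNIV)
qed auto

lemma noise_linear_char:
  assumes J: "finite J"
  shows "(\<integral>\<omega>. exp (\<i> * complex_of_real (\<Sum>s\<in>J. a s * \<omega> s)) \<partial>noise) = complex_of_real (exp (- (\<Sum>s\<in>J. (a s)\<^sup>2) / 2))"
proof -
  have ind: "noise.indep_vars (\<lambda>_. borel) (\<lambda>s \<omega>. exp (\<i> * complex_of_real (a s * \<omega> s))) J"
    by (rule noise.indep_vars_compose2[OF noise.indep_vars_subset[OF noise_indep subset_UNIV],
        of _ "\<lambda>s x. exp (\<i> * complex_of_real (a s * x))"]) measurable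
  have "(\<integral>\<omega>. exp (\<i> * complex_of_real (\<Sum>s\<in>J. a s * \<omega> s)) \<partial>noise) = (\<integral>\<omega>. (\<Prod>s\<in>J. exp (\<i> * complex_of_real (a s * \<omega> s))) \<partial>noise)"
    by (simp add: exp_sum[symmetric] J sum_distrib_left)
  also have "\<dots> = (\<Prod>s\<in>J. \<integral>\<omega>. exp (\<i> * complex_of_real (a s * \<omega> s)) \<partial>noise)"
    by (rule noise.indep_vars_lebesgue_integral[OF J ind]) (intro noise.integrable_const_bound[where B=1]; simp del: of_real_mult)
  also have "\<dots> = (\<Prod>s\<in>J. complex_of_real (exp (- (a s)\<^sup>2 / 2)))"
  proof (rule prod.cong[OF refl])
    fix s
    have "(\<integral>\<omega>. exp (\<i> * complex_of_real (a s * \<omega> s)) \<partial>noise) = (\<integral>x. exp (\<i> * complex_of_real (a s * x)) \<partial>distr noise borel (\<lambda>\<omega>. \<omega> s))"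
      by (subst integral_distr) auto
    also have "\<dots> = char std_normal_distribution (a s)"
      unfolding noise_coord_distr by (simp add: char_def)
    finally show "(\<integral>\<omega>. exp (\<i> * complex_of_real (a s * \<omega> s)) \<partial>noise) = complex_of_real (exp (- (a s)\<^sup>2 / 2))"
      by (simp add: char_std_normal_distribution)
  qed
  also have "\<dots> = complex_of_real (\<Prod>s\<in>J. exp (- (a s)\<^sup>2 / 2))" by simp
  also have "(\<Prod>s\<in>J. exp (- (a s)\<^sup>2 / 2)) = exp (- (\<Sum>s\<in>J. (a s)\<^sup>2) / 2)"
    by (simp add: exp_sum[symmetric] J sum_negf sum_divide_distrib)
  finally show ?thesis .
qed

lemma noise_linear_mgf:
  assumes J: "finite J"
  shows "integrable noise (\<lambda>\<omega>. exp (l * (\<Sum>s\<in>J. a s * \<omega> s)))"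
    and "(\<integral>\<omega>. exp (l * (\<Sum>s\<in>J. a s * \<omega> s)) \<partial>noise) = exp (l\<^sup>2 / 2 * (\<Sum>s\<in>J. (a s)\<^sup>2))"
proof -
  have ind: "noise.indep_vars (\<lambda>_. borel) (\<lambda>s \<omega>. exp ((l * a s) * \<omega> s)) J"
    by (rule noise.indep_vars_compose2[OF noise.indep_vars_subset[OF noise_indep subset_UNIV],
        of _ "\<lambda>s x. exp ((l * a s) * x)"]) measurable
  have eq: "exp (l * (\<Sum>s\<in>J. a s * \<omega> s)) = (\<Prod>s\<in>J. exp ((l * a s) * \<omega> s))" for \<omega>
    by (simp add: exp_sum[symmetric] J sum_distrib_left mult.assoc)
  have i: "integrable noise (\<lambda>\<omega>. exp ((l * a s) * \<omega> s))" for s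
    using std_normal_mgf(1)[of "l * a s"] unfolding noise_coord_distr[of s, symmetric]
    by (subst (asm) integrable_distr_eq) auto
  have e: "(\<integral>\<omega>. exp ((l * a s) * \<omega> s) \<partial>noise) = exp ((l * a s)\<^sup>2 / 2)" for s
  proof -
    have "(\<integral>\<omega>. exp ((l * a s) * \<omega> s) \<partial>noise) = (\<integral>x. exp ((l * a s) * x) \<partial>distr noise borel (\<lambda>\<omega>. \<omega> s))"
      by (subst integral_distr) auto
    then show ?thesis unfolding noise_coord_distr std_normal_mgf .
  qed
  show "integrable noise (\<lambda>\<omega>. exp (l * (\<Sum>s\<in>J. a s * \<omega> s)))"
    unfolding eq by (rule noise.indep_vars_integrable[OF J ind i])
  have "(\<integral>\<omega>. exp (l * (\<Sum>s\<in>J. a s * \<omega> s)) \<partial>noise) = (\<Prod>s\<in>J. exp ((l * a s)\<^sup>2 / 2))"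
    unfolding eq by (subst noise.indep_vars_lebesgue_integral[OF J ind i]) (simp only: e)
  also have "\<dots> = exp (l\<^sup>2 / 2 * (\<Sum>s\<in>J. (a s)\<^sup>2))"
    by (simp add: exp_sum[symmetric] J sum_distrib_left power_mult_distrib)
  finally show "(\<integral>\<omega>. exp (l * (\<Sum>s\<in>J. a s * \<omega> s)) \<partial>noise) = exp (l\<^sup>2 / 2 * (\<Sum>s\<in>J. (a s)\<^sup>2))" .
qed

definition dyadics :: "(real^'p) set" where "dyadics = (\<Union>N. grid N)"

text \<open>What the construction of the limit uses: nested 0-1 functions whose means are Lipschitz
  along the order. The limit is a Brownian bridge indexed by these functions, for several families
  \<open>k\<close> jointly.\<close>

locale brownian_limit = prob_space Q for Q :: "'y measure" +
  fixes f :: "nat \<Rightarrow> real^'p \<Rightarrow> 'y \<Rightarrow> real" and m :: nat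
  assumes f_meas[measurable]: "\<And>k u. f k u \<in> borel_measurable Q"
    and f_01: "\<And>k u y. f k u y = 0 \<or> f k u y = 1"
    and f_mono: "\<And>k u v y. (\<And>i. u $ i \<le> v $ i) \<Longrightarrow> f k u y \<le> f k v y"
    and f_incr: "\<And>k u v. u \<in> cube \<Longrightarrow> v \<in> cube \<Longrightarrow> (\<And>i. u $ i \<le> v $ i) \<Longrightarrow>
        (\<integral>y. f k v y - f k u y \<partial>Q) \<le> (\<Sum>i\<in>UNIV. v $ i - u $ i)"
begin

abbreviation ff :: "nat \<times> (real^'p) \<Rightarrow> 'y \<Rightarrow> real" where "ff s \<equiv> f (fst s) (snd s)"

definition cov :: "nat \<times> (real^'p) \<Rightarrow> nat \<times> (real^'p) \<Rightarrow> real" where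
  "cov s s' = (\<integral>y. ff s y * ff s' y \<partial>Q) - (\<integral>y. ff s y \<partial>Q) * (\<integral>y. ff s' y \<partial>Q)"

lemma f_bound: "\<bar>f k u y\<bar> \<le> 1" "0 \<le> f k u y"
  using f_01[of k u y] by auto

lemma f_integrable: "integrable Q (f k u)"
  using f_bound by (intro integrable_const_bound[where B=1]) auto

lemma ff_integrable: "integrable Q (\<lambda>y. ff s y * ff s' y)"
  using f_bound by (intro integrable_const_bound[where B=1]) (auto simp: abs_mult mult_le_one)

text \<open>The form is the variance of a linear combination of indicators: this gives positive
  semidefiniteness for the factorization and bounds the variance of an increment by a mean. The map
  \<open>g\<close> allows repeated points, which arise when distinct points share a
  projection.\<close>

lemma cov_quadratic_form:
  fixes g :: "'i \<Rightarrow> nat \<times> (real^'p)"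
  assumes F: "finite F"
  shows "(\<Sum>s\<in>F. \<Sum>s'\<in>F. c s * c s' * cov (g s) (g s'))
     = (\<integral>y. (\<Sum>s\<in>F. c s * ff (g s) y)\<^sup>2 \<partial>Q) - (\<integral>y. (\<Sum>s\<in>F. c s * ff (g s) y) \<partial>Q)\<^sup>2"
proof -
  have "(\<integral>y. (\<Sum>s\<in>F. c s * ff (g s) y)\<^sup>2 \<partial>Q) = (\<integral>y. (\<Sum>s\<in>F. \<Sum>s'\<in>F. (c s * c s') * (ff (g s) y * ff (g s') y)) \<partial>Q)"
    by (simp add: power2_eq_square sum_product mult_ac)
  also have "\<dots> = (\<Sum>s\<in>F. \<Sum>s'\<in>F. (c s * c s') * (\<integral>y. ff (g s) y * ff (g s') y \<partial>Q))"
    using ff_integrable by simp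
  finally have 1: "(\<integral>y. (\<Sum>s\<in>F. c s * ff (g s) y)\<^sup>2 \<partial>Q) = (\<Sum>s\<in>F. \<Sum>s'\<in>F. (c s * c s') * (\<integral>y. ff (g s) y * ff (g s') y \<partial>Q))" .
  have "(\<integral>y. (\<Sum>s\<in>F. c s * ff (g s) y) \<partial>Q) = (\<Sum>s\<in>F. c s * (\<integral>y. ff (g s) y \<partial>Q))"
    using f_integrable by simp
  then have 2: "(\<integral>y. (\<Sum>s\<in>F. c s * ff (g s) y) \<partial>Q)\<^sup>2 = (\<Sum>s\<in>F. \<Sum>s'\<in>F. (c s * c s') * ((\<integral>y. ff (g s) y \<partial>Q) * (\<integral>y. ff (g s') y \<partial>Q)))"
    by (simp add: power2_eq_square sum_product mult_ac)
  show ?thesis unfolding 1 2 cov_def by (simp add: right_diff_distrib sum_subtractf)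
qed

lemma variance_nonneg:
  fixes h :: "'y \<Rightarrow> real"
  assumes "integrable Q h" "integrable Q (\<lambda>y. (h y)\<^sup>2)"
  shows "(\<integral>y. h y \<partial>Q)\<^sup>2 \<le> (\<integral>y. (h y)\<^sup>2 \<partial>Q)"
proof -
  have "0 \<le> (\<integral>y. (h y - (\<integral>y. h y \<partial>Q))\<^sup>2 \<partial>Q)" by (rule integral_nonneg_AE) simp
  also have "\<dots> = (\<integral>y. (h y)\<^sup>2 \<partial>Q) - (\<integral>y. h y \<partial>Q)\<^sup>2" using assms by (rule variance_eq)
  finally show ?thesis by simp
qed

lemma cov_sym: "cov s s' = cov s' s"
  by (simp add: cov_def mult.commute)

lemma lin_integrable:
  assumes F: "finite F"
  shows "integrable Q (\<lambda>y. \<Sum>s\<in>F. c s * ff (g s) y)" "integrable Q (\<lambda>y. (\<Sum>s\<in>F. c s * ff (g s) y)\<^sup>2)"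
proof -
  show "integrable Q (\<lambda>y. \<Sum>s\<in>F. c s * ff (g s) y)" using f_integrable by simp
  have "(\<lambda>y. (\<Sum>s\<in>F. c s * ff (g s) y)\<^sup>2) = (\<lambda>y. \<Sum>s\<in>F. \<Sum>s'\<in>F. (c s * c s') * (ff (g s) y * ff (g s') y))"
    by (simp add: power2_eq_square sum_product mult_ac)
  then show "integrable Q (\<lambda>y. (\<Sum>s\<in>F. c s * ff (g s) y)\<^sup>2)" using ff_integrable by simp
qed

definition idx_set :: "(nat \<times> (real^'p)) set" where "idx_set = UNIV \<times> dyadics"

definition kern :: "nat \<Rightarrow> nat \<Rightarrow> real" where
  "kern r s = cov (from_nat_into idx_set r) (from_nat_into idx_set s)"

lemma countable_idx_set: "countable idx_set"
  unfolding idx_set_def dyadics_def by (intro countable_SIGMA countable_UN) (auto intro: countable_finite)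

lemma psd_kern: "psd_kernel kern"
  unfolding psd_kernel_def
proof (intro conjI allI impI)
  show "kern r s = kern s r" for r s by (simp add: kern_def cov_sym)
  show "0 \<le> (\<Sum>r\<in>S. \<Sum>s\<in>S. c r * c s * kern r s)" if "finite S" for S c
    unfolding kern_def cov_quadratic_form[OF that] using variance_nonneg[OF lin_integrable[OF that]] by simp
qed

text \<open>A row of the triangular factor applied to the normals. Triangularity makes it a finite
  sum, so no convergence question arises at dyadic points.\<close>

definition raw :: "(nat \<Rightarrow> real) \<Rightarrow> nat \<times> (real^'p) \<Rightarrow> real" where
  "raw x s = (\<Sum>l\<le>to_nat_on idx_set s. chol kern (to_nat_on idx_set s) l * x l)"

lemma raw_extend:
  assumes "to_nat_on idx_set s < L"
  shows "raw x s = (\<Sum>l<L. chol kern (to_nat_on idx_set s) l * x l)"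
  unfolding raw_def by (rule sum.mono_neutral_left) (use assms chol_eq_0[OF psd_kern] in auto)

text \<open>Finitely many points lie below a common row bound \<open>L\<close>, so a combination of
  their values, also across copies, is a linear form in finitely many independent normals;
  \<open>cholesky\<close> identifies its variance.\<close>

lemma raw_linear_combination:
  fixes g :: "'i \<Rightarrow> nat \<times> (real^'p)" and c :: "'k \<Rightarrow> 'i \<Rightarrow> real"
  assumes F: "finite F" and g: "\<And>s. s \<in> F \<Longrightarrow> g s \<in> idx_set" and J: "finite J"
  obtains L a where
    "\<And>\<omega>. (\<Sum>j\<in>J. \<Sum>s\<in>F. c j s * raw (\<lambda>l. \<omega> (j, l)) (g s)) = (\<Sum>t\<in>J \<times> {..<L}. a t * \<omega> t)"
    "(\<Sum>t\<in>J \<times> {..<L}. (a t)\<^sup>2) = (\<Sum>j\<in>J. \<Sum>s\<in>F. \<Sum>s'\<in>F. c j s * c j s' * cov (g s) (g s'))"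
proof -
  define r where "r s = to_nat_on idx_set (g s)" for s
  define L where "L = Suc (\<Sum>s\<in>F. r s)"
  have rL: "r s < L" if "s \<in> F" for s
    unfolding L_def using member_le_sum[OF that, of r] F by (simp add: less_Suc_eq_le)
  have kr: "kern (r s) (r s') = cov (g s) (g s')" if "s \<in> F" "s' \<in> F" for s s'
    unfolding kern_def r_def using that g countable_idx_set by simp
  define a where "a t = (\<Sum>s\<in>F. c (fst t) s * chol kern (r s) (snd t))" for t
  show ?thesis
  proof (rule that[of a L])
    fix \<omega> :: "'k \<times> nat \<Rightarrow> real"
    have "(\<Sum>s\<in>F. c j s * raw (\<lambda>l. \<omega> (j, l)) (g s)) = (\<Sum>l<L. a (j, l) * \<omega> (j, l))" for j
    proof -
      have "(\<Sum>s\<in>F. c j s * raw (\<lambda>l. \<omega> (j, l)) (g s)) = (\<Sum>s\<in>F. \<Sum>l<L. c j s * (chol kern (r s) l * \<omega> (j, l)))"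
        using rL by (intro sum.cong refl) (simp add: raw_extend[of _ L] r_def sum_distrib_left)
      also have "\<dots> = (\<Sum>l<L. \<Sum>s\<in>F. c j s * (chol kern (r s) l * \<omega> (j, l)))" by (rule sum.swap)
      also have "\<dots> = (\<Sum>l<L. a (j, l) * \<omega> (j, l))" by (simp add: a_def sum_distrib_right mult.assoc)
      finally show ?thesis .
    qed
    then show "(\<Sum>j\<in>J. \<Sum>s\<in>F. c j s * raw (\<lambda>l. \<omega> (j, l)) (g s)) = (\<Sum>t\<in>J \<times> {..<L}. a t * \<omega> t)"
      by (simp add: sum.cartesian_product)
  next
    have "(\<Sum>l<L. (a (j, l))\<^sup>2) = (\<Sum>s\<in>F. \<Sum>s'\<in>F. c j s * c j s' * cov (g s) (g s'))" for j
    proof -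
      have "(\<Sum>l<L. (a (j, l))\<^sup>2) = (\<Sum>l<L. \<Sum>s\<in>F. \<Sum>s'\<in>F. (c j s * c j s') * (chol kern (r s) l * chol kern (r s') l))"
        by (simp add: a_def power2_eq_square sum_product mult_ac)
      also have "\<dots> = (\<Sum>s\<in>F. \<Sum>l<L. \<Sum>s'\<in>F. (c j s * c j s') * (chol kern (r s) l * chol kern (r s') l))"
        by (rule sum.swap)
      also have "\<dots> = (\<Sum>s\<in>F. \<Sum>s'\<in>F. \<Sum>l<L. (c j s * c j s') * (chol kern (r s) l * chol kern (r s') l))"
        by (intro sum.cong refl sum.swap)
      also have "\<dots> = (\<Sum>s\<in>F. \<Sum>s'\<in>F. (c j s * c j s') * (\<Sum>l<L. chol kern (r s) l * chol kern (r s') l))"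
        by (simp add: sum_distrib_left)
      also have "\<dots> = (\<Sum>s\<in>F. \<Sum>s'\<in>F. c j s * c j s' * cov (g s) (g s'))"
        using rL kr by (intro sum.cong refl) (simp add: cholesky[OF psd_kern])
      finally show ?thesis .
    qed
    then show "(\<Sum>t\<in>J \<times> {..<L}. (a t)\<^sup>2) = (\<Sum>j\<in>J. \<Sum>s\<in>F. \<Sum>s'\<in>F. c j s * c j s' * cov (g s) (g s'))"
      by (simp add: sum.cartesian_product' )
  qed
qed

lemma raw_joint_char:
  fixes g :: "'i \<Rightarrow> nat \<times> (real^'p)"
  assumes F: "finite F" and g: "\<And>s. s \<in> F \<Longrightarrow> g s \<in> idx_set" and J: "finite J"
  shows "(\<integral>\<omega>. exp (\<i> * complex_of_real (\<Sum>j\<in>J. \<Sum>s\<in>F. c j s * raw (\<lambda>l. \<omega> (j, l)) (g s))) \<partial>noise)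
    = complex_of_real (exp (- (\<Sum>j\<in>J. \<Sum>s\<in>F. \<Sum>s'\<in>F. c j s * c j s' * cov (g s) (g s')) / 2))"
proof -
  obtain L a where a:
    "\<And>\<omega>. (\<Sum>j\<in>J. \<Sum>s\<in>F. c j s * raw (\<lambda>l. \<omega> (j, l)) (g s)) = (\<Sum>t\<in>J \<times> {..<L}. a t * \<omega> t)"
    "(\<Sum>t\<in>J \<times> {..<L}. (a t)\<^sup>2) = (\<Sum>j\<in>J. \<Sum>s\<in>F. \<Sum>s'\<in>F. c j s * c j s' * cov (g s) (g s'))"
    by (rule raw_linear_combination[OF F g J, where c=c]) blast+
  show ?thesis unfolding a(1) a(2)[symmetric] by (rule noise_linear_char) (simp add: J)
qed

lemma raw_measurable[measurable]: "(\<lambda>x. raw x s) \<in> borel_measurable (Pi\<^sub>M UNIV (\<lambda>_. borel))"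
  unfolding raw_def by measurable

lemma copy_measurable[measurable]: "(\<lambda>\<omega> l. \<omega> (j, l)) \<in> measurable noise (Pi\<^sub>M UNIV (\<lambda>_. borel))"
  by (rule measurable_PiM_single') auto

lemma raw_copy_measurable[measurable]: "(\<lambda>\<omega>. raw (\<lambda>l. \<omega> (j, l)) s) \<in> borel_measurable noise"
  by (rule measurable_compose[OF copy_measurable raw_measurable])

text \<open>Weaker than the Gaussian tail but of the same shape as \<open>tail_emp_proc\<close>, so
  that the same union bound over links applies.\<close>

lemma raw_tail:
  assumes F: "finite F" and g: "\<And>s. s \<in> F \<Longrightarrow> g s \<in> idx_set" and l: "l > 0"
    and v: "(\<Sum>s\<in>F. \<Sum>s'\<in>F. c s * c s' * cov (g s) (g s')) \<le> v"
  shows "noise.prob {\<omega>\<in>space noise. \<bar>\<Sum>s\<in>F. c s * raw (\<lambda>l. \<omega> (j, l)) (g s)\<bar> > t} \<le> 2 * exp (2 * l\<^sup>2 * v) * exp (- l * t)"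
proof -
  obtain L a where a:
    "\<And>\<omega>. (\<Sum>j\<in>{j}. \<Sum>s\<in>F. c s * raw (\<lambda>l. \<omega> (j, l)) (g s)) = (\<Sum>t\<in>{j} \<times> {..<L}. a t * \<omega> t)"
    "(\<Sum>t\<in>{j} \<times> {..<L}. (a t)\<^sup>2) = (\<Sum>j\<in>{j}. \<Sum>s\<in>F. \<Sum>s'\<in>F. c s * c s' * cov (g s) (g s'))"
    by (rule raw_linear_combination[where J="{j}" and c="\<lambda>j s. c s", OF F g finite.insertI[OF finite.emptyI]]) blast+
  have a1: "(\<Sum>s\<in>F. c s * raw (\<lambda>l. \<omega> (j, l)) (g s)) = (\<Sum>t\<in>{j} \<times> {..<L}. a t * \<omega> t)" for \<omega>
    using a(1)[of \<omega>] by simp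
  have a2: "(\<Sum>t\<in>{j} \<times> {..<L}. (a t)\<^sup>2) \<le> v" using a(2) v by simp
  have v0: "0 \<le> v" using order_trans[OF sum_nonneg a2] by simp
  have e: "exp (l'\<^sup>2 / 2 * (\<Sum>t\<in>{j} \<times> {..<L}. (a t)\<^sup>2)) \<le> exp (2 * l\<^sup>2 * v)" if "l'\<^sup>2 = l\<^sup>2" for l'
  proof -
    have "l\<^sup>2 / 2 * (\<Sum>t\<in>{j} \<times> {..<L}. (a t)\<^sup>2) \<le> l\<^sup>2 / 2 * v" using a2 by (intro mult_left_mono) auto
    also have "\<dots> \<le> 2 * l\<^sup>2 * v" using v0 by (intro mult_right_mono) auto
    finally show ?thesis using that by simp
  qed
  have fin: "finite ({j} \<times> {..<L})" by simp
  show ?thesis unfolding a1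
    using noise_linear_mgf[OF fin, of l a] noise_linear_mgf[OF fin, of "-l" a] e[of l] e[of "-l"] l
    by (intro noise.two_sided_chernoff) auto
qed

lemma raw_link_tail:
  assumes ab: "(a, b) \<in> links r"
  shows "noise.prob {\<omega>\<in>space noise. \<bar>raw (\<lambda>l. \<omega> (j, l)) (k, b) - raw (\<lambda>l. \<omega> (j, l)) (k, a)\<bar> > 1 / \<rho> ^ r}
     \<le> 2 * exp (2 * real CARD('p)) * exp (- (\<rho> ^ r))"
proof -
  have abc: "a \<in> cube" "b \<in> cube" using links_cube[OF ab] by auto
  have le: "a $ i \<le> b $ i" "b $ i - a $ i \<le> 1 / 2 ^ r" for i using ab by (auto simp: links_def algebra_simps)
  define g where "g i = (k, if i then b else a)" for i
  define c where "c i = (if i then 1 else -1 :: real)" for i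
  have g: "g i \<in> idx_set" for i using ab by (auto simp: g_def idx_set_def dyadics_def links_def)
  have h: "(\<Sum>i\<in>UNIV. c i * ff (g i) y) = f k b y - f k a y" for y by (simp add: UNIV_bool c_def g_def)
  have "(\<Sum>s\<in>UNIV. \<Sum>s'\<in>UNIV. c s * c s' * cov (g s) (g s')) \<le> (\<integral>y. (f k b y - f k a y)\<^sup>2 \<partial>Q)"
    unfolding cov_quadratic_form[OF finite] h by simp
  also have "\<dots> = (\<integral>y. f k b y - f k a y \<partial>Q)"
  proof (rule Bochner_Integration.integral_cong[OF refl])
    fix y show "(f k b y - f k a y)\<^sup>2 = f k b y - f k a y"
      using f_01[of k a y] f_01[of k b y] f_mono[of a b k y] le(1) by auto
  qed
  also have "\<dots> \<le> (\<Sum>i\<in>UNIV. b $ i - a $ i)" by (intro f_incr abc le)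
  also have "\<dots> \<le> (\<Sum>i\<in>(UNIV::'p set). 1 / 2 ^ r)" by (intro sum_mono le)
  finally have v: "(\<Sum>s\<in>UNIV. \<Sum>s'\<in>UNIV. c s * c s' * cov (g s) (g s')) \<le> real CARD('p) / 2 ^ r" by simp
  \<comment> \<open>The Chernoff parameter is \<rho>^(2r): its square 2^r balances the variance
    bound \<open>CARD('p) / 2 ^ r\<close>, and against the threshold 1 / \<rho>^r it leaves the
    exponent \<rho>^r.\<close>
  have l2: "(\<rho> ^ (2 * r))\<^sup>2 = 2 ^ r"
  proof -
    have "(\<rho> ^ (2 * r))\<^sup>2 = (\<rho> ^ 4) ^ r" by (simp add: power_mult[symmetric] mult_ac)
    then show ?thesis by (simp only: rho_pow4)
  qed
  have "noise.prob {\<omega>\<in>space noise. \<bar>\<Sum>s\<in>UNIV. c s * raw (\<lambda>l. \<omega> (j, l)) (g s)\<bar> > 1 / \<rho> ^ r}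
     \<le> 2 * exp (2 * (\<rho> ^ (2 * r))\<^sup>2 * (real CARD('p) / 2 ^ r)) * exp (- (\<rho> ^ (2 * r)) * (1 / \<rho> ^ r))"
    using rho_gt_1 by (intro raw_tail g v) auto
  moreover have "\<rho> ^ (2 * r) * (1 / \<rho> ^ r) = \<rho> ^ r" using rho_gt_1 by (simp add: mult_2 power_add)
  moreover have "2 * (\<rho> ^ (2 * r))\<^sup>2 * (real CARD('p) / 2 ^ r) = 2 * real CARD('p)" unfolding l2 by simp
  moreover have "(\<Sum>s\<in>UNIV. c s * raw (\<lambda>l. \<omega> (j, l)) (g s)) = raw (\<lambda>l. \<omega> (j, l)) (k, b) - raw (\<lambda>l. \<omega> (j, l)) (k, a)" for \<omega>
    by (simp add: UNIV_bool c_def g_def)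
  ultimately show ?thesis by simp
qed

section \<open>Extension from dyadic points to the cube\<close>

definition good :: "(nat \<Rightarrow> real) \<Rightarrow> bool" where
  "good x \<longleftrightarrow> (\<exists>N0. \<forall>k<m. \<forall>N1. chained 1 N0 N1 (\<lambda>u. raw x (k, u)))"

text \<open>Set to 0 off the good event, so that every path, not just almost every one, is a uniform
  limit of its dyadic projections.\<close>

definition path :: "(nat \<Rightarrow> real) \<Rightarrow> nat \<times> (real^'p) \<Rightarrow> real" where
  "path x s = (if good x \<and> fst s < m \<and> snd s \<in> cube then lim (\<lambda>N. raw x (fst s, prj N (snd s))) else 0)"

lemma good_measurable[measurable]: "Measurable.pred (Pi\<^sub>M UNIV (\<lambda>_. borel)) good"
proof -
  have "good = (\<lambda>x. \<exists>N0. \<forall>k\<in>{..<m}. \<forall>N1. \<forall>r\<in>{N0..N1}. \<forall>ab\<in>links r. \<bar>raw x (k, snd ab) - raw x (k, fst ab)\<bar> \<le> 1 / \<rho> ^ r)"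
    by (simp add: good_def[abs_def] chained_def case_prod_beta fun_eq_iff Ball_def)
  moreover have "Measurable.pred (Pi\<^sub>M UNIV (\<lambda>_. borel)) (\<lambda>x. \<exists>N0. \<forall>k\<in>{..<m}. \<forall>N1. \<forall>r\<in>{N0..N1}. \<forall>ab\<in>links r. \<bar>raw x (k, snd ab) - raw x (k, fst ab)\<bar> \<le> 1 / \<rho> ^ r)"
    by (intro pred_intros_countable pred_intros_finite finite_links finite_lessThan finite_atLeastAtMost) measurable
  ultimately show ?thesis by simp
qed

lemma path_measurable[measurable]: "(\<lambda>x. path x s) \<in> borel_measurable (Pi\<^sub>M UNIV (\<lambda>_. borel))"
  unfolding path_def by measurable

text \<open>Chaining makes the projected values Cauchy with the explicit rate \<tau>, uniformly in
  \<open>u\<close>.\<close>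

lemma path_raw:
  assumes x: "good x" and k: "k < m"
  shows "\<exists>N0. \<forall>N\<ge>N0. \<forall>u\<in>cube. \<bar>path x (k, u) - raw x (k, prj N u)\<bar> \<le> \<tau> N"
proof -
  obtain N0 where N0: "\<And>N1. chained 1 N0 N1 (\<lambda>u. raw x (k, u))" using x k by (auto simp: good_def)
  show ?thesis
  proof (intro exI[of _ N0] allI impI ballI)
    fix N u assume N: "N0 \<le> N" and u: "u \<in> (cube :: (real^'p) set)"
    have d: "\<bar>raw x (k, prj N2 u) - raw x (k, prj N1 u)\<bar> \<le> \<tau> N1" if "N0 \<le> N1" "N1 \<le> N2" for N1 N2
      using chained_prj_le[OF N0 _ that order_refl u] by simp
    have "Cauchy (\<lambda>N. raw x (k, prj N u))"
    proof (rule metric_CauchyI)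
      fix e :: real assume e: "e > 0"
      have "\<forall>\<^sub>F N in sequentially. \<tau> N < e / 2" using order_tendstoD(2)[OF tau_tendsto, of "e/2"] e by simp
      then obtain N1 where N1: "\<And>N. N \<ge> N1 \<Longrightarrow> \<tau> N < e / 2" by (auto simp: eventually_sequentially)
      define n0 where "n0 = max N0 N1"
      have "\<bar>raw x (k, prj N' u) - raw x (k, prj n0 u)\<bar> < e / 2" if "N' \<ge> n0" for N'
        using d[of n0 N'] N1[of n0] that by (force simp: n0_def)
      then have "\<forall>a\<ge>n0. \<forall>b\<ge>n0. dist (raw x (k, prj a u)) (raw x (k, prj b u)) < e"
        unfolding dist_real_def by (smt (verit) field_sum_of_halves)
      then show "\<exists>M. \<forall>a\<ge>M. \<forall>b\<ge>M. dist (raw x (k, prj a u)) (raw x (k, prj b u)) < e" by blast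
    qed
    then have "(\<lambda>N. raw x (k, prj N u)) \<longlonglongrightarrow> lim (\<lambda>N. raw x (k, prj N u))"
      by (simp add: Cauchy_convergent_iff convergent_LIMSEQ_iff)
    then have L: "(\<lambda>N. raw x (k, prj N u)) \<longlonglongrightarrow> path x (k, u)" using x k u by (simp add: path_def)
    have "(\<lambda>N'. \<bar>raw x (k, prj N' u) - raw x (k, prj N u)\<bar>) \<longlonglongrightarrow> \<bar>path x (k, u) - raw x (k, prj N u)\<bar>"
      by (intro tendsto_intros L)
    then show "\<bar>path x (k, u) - raw x (k, prj N u)\<bar> \<le> \<tau> N"
      by (rule LIMSEQ_le_const2) (use d N in blast)
  qed
qed

lemma path_tendsto:
  assumes x: "good x" and k: "k < m" and u: "u \<in> cube"
  shows "(\<lambda>N. raw x (k, prj N u)) \<longlonglongrightarrow> path x (k, u)"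
proof -
  obtain N0 where "\<And>N. N \<ge> N0 \<Longrightarrow> \<bar>path x (k, u) - raw x (k, prj N u)\<bar> \<le> \<tau> N" using path_raw[OF x k] u by blast
  then have "\<forall>\<^sub>F N in sequentially. norm (raw x (k, prj N u) - path x (k, u)) \<le> \<tau> N"
    by (auto simp: eventually_sequentially abs_minus_commute)
  from Lim_null_comparison[OF this tau_tendsto] show ?thesis by (rule LIM_zero_cancel)
qed

lemma path_grid:
  assumes x: "good x" and k: "k < m" and u: "u \<in> grid N"
  shows "path x (k, u) = raw x (k, u)"
proof -
  have "\<forall>\<^sub>F N' in sequentially. raw x (k, prj N' u) = raw x (k, u)"
    using eventually_ge_at_top[of N] by eventually_elim (simp add: prj_grid_id[OF u])
  then have "(\<lambda>N. raw x (k, prj N u)) \<longlonglongrightarrow> raw x (k, u)" by (rule tendsto_eventually)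
  then show ?thesis using path_tendsto[OF x k grid_cube[OF u]] LIMSEQ_unique by blast
qed

text \<open>Borel--Cantelli over the levels, since the link bounds are summable; the finitely many
  families \<open>k < m\<close> then share one starting level.\<close>

lemma AE_good: "AE \<omega> in noise. good (\<lambda>l. \<omega> (j, l))"
proof -
  have "AE \<omega> in noise. \<forall>\<^sub>F r in sequentially. \<forall>(a, b)\<in>links r. \<bar>raw (\<lambda>l. \<omega> (j, l)) (k, b) - raw (\<lambda>l. \<omega> (j, l)) (k, a)\<bar> \<le> 1 / \<rho> ^ r" for k
  proof -
    define E where "E r = {\<omega>\<in>space noise. \<exists>(a, b)\<in>links r. \<bar>raw (\<lambda>l. \<omega> (j, l)) (k, b) - raw (\<lambda>l. \<omega> (j, l)) (k, a)\<bar> > 1 / \<rho> ^ r}" for r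
    have E: "E r \<in> noise.events" "noise.prob (E r) \<le> 2 * exp (2 * real CARD('p)) * link_const TYPE('p) * (1 / 2) ^ r" for r
      unfolding E_def
      using noise.link_union_bound[of "\<lambda>\<omega> u. raw (\<lambda>l. \<omega> (j, l)) (k, u)" r "2 * exp (2 * real CARD('p))"] raw_link_tail[where j=j and k=k]
      by auto
    have "summable (\<lambda>r. noise.prob (E r))"
    proof (rule summable_comparison_test'[of _ 0])
      show "summable (\<lambda>r. 2 * exp (2 * real CARD('p)) * link_const TYPE('p) * (1 / 2 :: real) ^ r)"
        by (intro summable_mult summable_geometric) simp
      show "norm (noise.prob (E r)) \<le> 2 * exp (2 * real CARD('p)) * link_const TYPE('p) * (1 / 2 :: real) ^ r" for r
        using E(2)[of r] by simp
    qed
    then have "AE \<omega> in noise. \<forall>\<^sub>F r in sequentially. \<omega> \<in> space noise - E r"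
      by (intro borel_cantelli_AE1 E) (auto simp: noise.emeasure_eq_measure)
    then show ?thesis
    proof eventually_elim
      case (elim \<omega>)
      then show ?case by eventually_elim (auto simp: E_def not_less)
    qed
  qed
  then have "AE \<omega> in noise. \<forall>k. \<forall>\<^sub>F r in sequentially. \<forall>(a, b)\<in>links r. \<bar>raw (\<lambda>l. \<omega> (j, l)) (k, b) - raw (\<lambda>l. \<omega> (j, l)) (k, a)\<bar> \<le> 1 / \<rho> ^ r"
    unfolding AE_all_countable by blast
  then show ?thesis
  proof eventually_elim
    case (elim \<omega>)
    have "\<forall>\<^sub>F r in sequentially. \<forall>k\<in>{..<m}. \<forall>(a, b)\<in>links r. \<bar>raw (\<lambda>l. \<omega> (j, l)) (k, b) - raw (\<lambda>l. \<omega> (j, l)) (k, a)\<bar> \<le> 1 / \<rho> ^ r"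
      using elim by (intro eventually_ball_finite) auto
    then obtain N0 where "\<And>r. r \<ge> N0 \<Longrightarrow> \<forall>k\<in>{..<m}. \<forall>(a, b)\<in>links r. \<bar>raw (\<lambda>l. \<omega> (j, l)) (k, b) - raw (\<lambda>l. \<omega> (j, l)) (k, a)\<bar> \<le> 1 / \<rho> ^ r"
      by (auto simp: eventually_sequentially)
    then show ?case unfolding good_def chained_def by (intro exI[of _ N0]) auto
  qed
qed

text \<open>By \<open>f_incr\<close> the indicators at the projections converge in L1, and for
  products of 0-1 functions the L1 errors add.\<close>

lemma cov_prj_tendsto:
  assumes u: "u \<in> cube" and v: "v \<in> cube"
  shows "(\<lambda>N. cov (k, prj N u) (k', prj N v)) \<longlonglongrightarrow> cov (k, u) (k', v)"
proof -
  define d where "d N = real CARD('p) / 2 ^ N" for N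
  have "(\<lambda>N. real CARD('p) * (1 / 2) ^ N) \<longlonglongrightarrow> 0" by (intro tendsto_mult_right_zero LIMSEQ_power_zero) simp
  then have d0: "d \<longlonglongrightarrow> 0" by (simp add: d_def[abs_def] power_divide)
  have fd: "(\<integral>y. \<bar>f k u y - f k (prj N u) y\<bar> \<partial>Q) \<le> d N" if u: "u \<in> cube" for k N u
  proof -
    have le: "f k (prj N u) y \<le> f k u y" for y by (intro f_mono prj_le u)
    have "(\<integral>y. \<bar>f k u y - f k (prj N u) y\<bar> \<partial>Q) = (\<integral>y. f k u y - f k (prj N u) y \<partial>Q)"
      using le by (intro Bochner_Integration.integral_cong) (auto simp: abs_if not_less)
    also have "\<dots> \<le> (\<Sum>i\<in>UNIV. u $ i - prj N u $ i)" by (intro f_incr prj_cube u prj_le)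
    also have "\<dots> \<le> (\<Sum>i\<in>(UNIV::'p set). 1 / 2 ^ N)"
      using prj_le(2)[OF u, of _ N] by (intro sum_mono) (simp add: algebra_simps)
    finally show ?thesis by (simp add: d_def)
  qed
  have conv1: "(\<lambda>N. \<integral>y. f k (prj N u) y \<partial>Q) \<longlonglongrightarrow> (\<integral>y. f k u y \<partial>Q)" if u: "u \<in> cube" for k u
  proof -
    have "norm ((\<integral>y. f k (prj N u) y \<partial>Q) - (\<integral>y. f k u y \<partial>Q)) \<le> d N" for N
    proof -
      have "norm ((\<integral>y. f k (prj N u) y \<partial>Q) - (\<integral>y. f k u y \<partial>Q)) = \<bar>\<integral>y. f k u y - f k (prj N u) y \<partial>Q\<bar>"
        using f_integrable by (simp add: abs_minus_commute)
      also have "\<dots> \<le> (\<integral>y. \<bar>f k u y - f k (prj N u) y\<bar> \<partial>Q)" by (rule integral_abs_bound)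
      finally show ?thesis using fd[OF u, of k N] by linarith
    qed
    then have "\<forall>\<^sub>F N in sequentially. norm ((\<integral>y. f k (prj N u) y \<partial>Q) - (\<integral>y. f k u y \<partial>Q)) \<le> d N" by simp
    from Lim_null_comparison[OF this d0] show ?thesis by (rule LIM_zero_cancel)
  qed
  have conv2: "(\<lambda>N. \<integral>y. f k (prj N u) y * f k' (prj N v) y \<partial>Q) \<longlonglongrightarrow> (\<integral>y. f k u y * f k' v y \<partial>Q)"
  proof -
    have "norm ((\<integral>y. f k (prj N u) y * f k' (prj N v) y \<partial>Q) - (\<integral>y. f k u y * f k' v y \<partial>Q)) \<le> d N + d N" for N
    proof -
      have i: "integrable Q (\<lambda>y. \<bar>f k u y - f k (prj N u) y\<bar>)" for k u using f_integrable by simp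
      have "norm ((\<integral>y. f k (prj N u) y * f k' (prj N v) y \<partial>Q) - (\<integral>y. f k u y * f k' v y \<partial>Q))
        = \<bar>\<integral>y. f k (prj N u) y * f k' (prj N v) y - f k u y * f k' v y \<partial>Q\<bar>"
        using ff_integrable[of "(k, _)" "(k', _)"] by simp
      also have "\<dots> \<le> (\<integral>y. \<bar>f k (prj N u) y * f k' (prj N v) y - f k u y * f k' v y\<bar> \<partial>Q)" by (rule integral_abs_bound)
      also have "\<dots> \<le> (\<integral>y. \<bar>f k u y - f k (prj N u) y\<bar> + \<bar>f k' v y - f k' (prj N v) y\<bar> \<partial>Q)"
      proof (rule integral_mono)
        fix y
        show "\<bar>f k (prj N u) y * f k' (prj N v) y - f k u y * f k' v y\<bar> \<le> \<bar>f k u y - f k (prj N u) y\<bar> + \<bar>f k' v y - f k' (prj N v) y\<bar>"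
          using f_01[of k "prj N u" y] f_01[of k' "prj N v" y] f_01[of k u y] f_01[of k' v y] by auto
      qed (use i ff_integrable[of "(k, _)" "(k', _)"] in auto)
      also have "\<dots> \<le> d N + d N" using i fd[OF u, of k N] fd[OF v, of k' N] by simp
      finally show ?thesis .
    qed
    then have ev: "\<forall>\<^sub>F N in sequentially. norm ((\<integral>y. f k (prj N u) y * f k' (prj N v) y \<partial>Q) - (\<integral>y. f k u y * f k' v y \<partial>Q)) \<le> d N + d N"
      by simp
    have "(\<lambda>N. d N + d N) \<longlonglongrightarrow> 0" using tendsto_add[OF d0 d0] by simp
    from Lim_null_comparison[OF ev this] show ?thesis by (rule LIM_zero_cancel)
  qed
  show ?thesis unfolding cov_def using conv2 conv1[OF u, of k] conv1[OF v, of k'] by (auto intro!: tendsto_intros)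
qed

text \<open>The characteristic function at the projections is explicit and converges in two ways:
  through the covariances, and by dominated convergence along almost every path.\<close>

theorem path_gaussian:
  assumes F: "finite F" "F \<subseteq> {..<m} \<times> cube"
  shows "(\<integral>\<omega>. exp (\<i> * complex_of_real (\<theta> * (\<Sum>s\<in>F. c s * path (\<lambda>l. \<omega> (j, l)) s))) \<partial>noise)
    = complex_of_real (exp (- (\<theta>\<^sup>2 / 2) * (\<Sum>s\<in>F. \<Sum>s'\<in>F. c s * c s' * cov s s')))"
proof (rule LIMSEQ_unique)
  let ?g = "\<lambda>N s. (fst s, prj N (snd s))"
  let ?I = "\<lambda>N. \<integral>\<omega>. exp (\<i> * complex_of_real (\<theta> * (\<Sum>s\<in>F. c s * raw (\<lambda>l. \<omega> (j, l)) (?g N s)))) \<partial>noise"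
  have g: "?g N s \<in> idx_set" if "s \<in> F" for N s
  proof -
    have "snd s \<in> cube" using that F(2) by auto
    then show ?thesis using prj_grid[of "snd s" N] by (auto simp: idx_set_def dyadics_def)
  qed
  have I: "?I N = complex_of_real (exp (- (\<theta>\<^sup>2 / 2) * (\<Sum>s\<in>F. \<Sum>s'\<in>F. c s * c s' * cov (?g N s) (?g N s'))))" for N
  proof -
    have e1: "\<theta> * (\<Sum>s\<in>F. c s * raw (\<lambda>l. \<omega> (j, l)) (?g N s)) = (\<Sum>j\<in>{j}. \<Sum>s\<in>F. (\<theta> * c s) * raw (\<lambda>l. \<omega> (j, l)) (?g N s))" for \<omega>
      by (simp add: sum_distrib_left mult.assoc)
    have e2: "(\<Sum>j\<in>{j}. \<Sum>s\<in>F. \<Sum>s'\<in>F. (\<theta> * c s) * (\<theta> * c s') * cov (?g N s) (?g N s')) = \<theta>\<^sup>2 * (\<Sum>s\<in>F. \<Sum>s'\<in>F. c s * c s' * cov (?g N s) (?g N s'))"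
      by (simp add: sum_distrib_left power2_eq_square mult_ac)
    have "?I N = complex_of_real (exp (- (\<Sum>j\<in>{j}. \<Sum>s\<in>F. \<Sum>s'\<in>F. (\<theta> * c s) * (\<theta> * c s') * cov (?g N s) (?g N s')) / 2))"
      unfolding e1 by (rule raw_joint_char[OF F(1) g]) simp_all
    then show ?thesis unfolding e2 by (simp add: mult.commute)
  qed
  show "?I \<longlonglongrightarrow> complex_of_real (exp (- (\<theta>\<^sup>2 / 2) * (\<Sum>s\<in>F. \<Sum>s'\<in>F. c s * c s' * cov s s')))"
    unfolding I
  proof (intro tendsto_of_real tendsto_exp tendsto_mult_left tendsto_sum)
    fix s s' assume "s \<in> F" "s' \<in> F"
    moreover from this have "snd s \<in> cube" "snd s' \<in> cube" using F(2) by auto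
    ultimately show "(\<lambda>N. cov (?g N s) (?g N s')) \<longlonglongrightarrow> cov s s'"
      using F(2) cov_prj_tendsto[of "snd s" "snd s'" "fst s" "fst s'"] by auto
  qed
  show "?I \<longlonglongrightarrow> (\<integral>\<omega>. exp (\<i> * complex_of_real (\<theta> * (\<Sum>s\<in>F. c s * path (\<lambda>l. \<omega> (j, l)) s))) \<partial>noise)"
  proof (rule integral_dominated_convergence[where w="\<lambda>_. 1"])
    show "AE \<omega> in noise. (\<lambda>N. exp (\<i> * complex_of_real (\<theta> * (\<Sum>s\<in>F. c s * raw (\<lambda>l. \<omega> (j, l)) (?g N s)))))
        \<longlonglongrightarrow> exp (\<i> * complex_of_real (\<theta> * (\<Sum>s\<in>F. c s * path (\<lambda>l. \<omega> (j, l)) s)))"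
      using AE_good[of j]
    proof eventually_elim
      case (elim \<omega>)
      have "(\<lambda>N. raw (\<lambda>l. \<omega> (j, l)) (?g N s)) \<longlonglongrightarrow> path (\<lambda>l. \<omega> (j, l)) s" if "s \<in> F" for s
        using path_tendsto[OF elim, of "fst s" "snd s"] F(2) that by auto
      then show ?case by (intro tendsto_intros)
    qed
    show "(\<lambda>\<omega>. exp (\<i> * complex_of_real (\<theta> * (\<Sum>s\<in>F. c s * path (\<lambda>l. \<omega> (j, l)) s)))) \<in> borel_measurable noise"
      using measurable_compose[OF copy_measurable path_measurable] by simp
  qed (auto simp del: of_real_mult of_real_sum)
qed

end

section \<open>Weak convergence in the space of bounded functions\<close>

lemma linf_dist_le:
  assumes "T \<noteq> {}" "I \<noteq> {}" "\<And>t i. t \<in> T \<Longrightarrow> i \<in> I \<Longrightarrow> \<bar>f t i - g t i\<bar> \<le> c"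
  shows "linf_dist T I f g \<le> c"
  unfolding linf_dist_def using assms by (intro cSUP_least) auto

lemma linf_dist_ge:
  assumes f: "f \<in> linf_space T I" and g: "g \<in> linf_space T I" and t: "t \<in> T" and i: "i \<in> I"
  shows "\<bar>f t i - g t i\<bar> \<le> linf_dist T I f g"
proof -
  obtain B C where B: "\<And>t i. t \<in> T \<Longrightarrow> i \<in> I \<Longrightarrow> \<bar>f t i\<bar> \<le> B" and C: "\<And>t i. t \<in> T \<Longrightarrow> i \<in> I \<Longrightarrow> \<bar>g t i\<bar> \<le> C"
    using f g by (force simp: linf_space_def)
  have bd: "\<bar>f t i - g t i\<bar> \<le> B + C" if "t \<in> T" "i \<in> I" for t i
    using B[OF that] C[OF that] by linarith
  have inner: "bdd_above ((\<lambda>i. \<bar>f t i - g t i\<bar>) ` I)" if "t \<in> T" for t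
    using bd[OF that] by (auto intro!: bdd_aboveI[of _ "B + C"])
  have "\<bar>f t i - g t i\<bar> \<le> (SUP i\<in>I. \<bar>f t i - g t i\<bar>)" by (rule cSUP_upper[OF i inner[OF t]])
  also have "\<dots> \<le> linf_dist T I f g"
    unfolding linf_dist_def
  proof (rule cSUP_upper[OF t])
    have "(SUP i\<in>I. \<bar>f t i - g t i\<bar>) \<le> B + C" if "t \<in> T" for t
      using bd[OF that] i by (intro cSUP_least) auto
    then show "bdd_above ((\<lambda>t. SUP i\<in>I. \<bar>f t i - g t i\<bar>) ` T)" by (auto intro!: bdd_aboveI[of _ "B + C"])
  qed
  finally show ?thesis .
qed

locale linf =
  fixes T :: "'t set" and I :: "'i set"
  assumes T: "T \<noteq> {}" and I: "I \<noteq> {}"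
begin

abbreviation "E \<equiv> linf_space T I"
abbreviation "d \<equiv> linf_dist T I"

lemma d_nonneg: "f \<in> E \<Longrightarrow> g \<in> E \<Longrightarrow> 0 \<le> d f g"
proof -
  assume fg: "f \<in> E" "g \<in> E"
  obtain t i where "t \<in> T" "i \<in> I" using T I by auto
  from linf_dist_ge[OF fg this] show ?thesis by linarith
qed

lemma d_self: "f \<in> E \<Longrightarrow> d f f = 0"
  using linf_dist_le[OF T I, of f f 0] d_nonneg[of f f] by force

lemma d_commute: "d f g = d g f"
  by (simp add: linf_dist_def abs_minus_commute)

lemma d_triangle: "f \<in> E \<Longrightarrow> g \<in> E \<Longrightarrow> h \<in> E \<Longrightarrow> d f h \<le> d f g + d g h"
proof (rule linf_dist_le[OF T I])
  fix t i assume "f \<in> E" "g \<in> E" "h \<in> E" "t \<in> T" "i \<in> I"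
  then have "\<bar>f t i - g t i\<bar> \<le> d f g" "\<bar>g t i - h t i\<bar> \<le> d g h" by (auto intro: linf_dist_ge)
  then show "\<bar>f t i - h t i\<bar> \<le> d f g + d g h" by linarith
qed

lemma zero_in_E: "(\<lambda>_ _. 0) \<in> E"
  by (auto simp: linf_space_def)

definition lipschitz :: "real \<Rightarrow> (('t \<Rightarrow> 'i \<Rightarrow> real) \<Rightarrow> real) \<Rightarrow> bool" where
  "lipschitz L h \<longleftrightarrow> (\<forall>f\<in>E. \<forall>g\<in>E. \<bar>h f - h g\<bar> \<le> L * d f g)"

text \<open>Sup-convolution with the metric: for bounded \<open>h\<close> and L \<ge> 0, the
  smallest function above \<open>h\<close> with Lipschitz constant \<open>L\<close>.\<close>

definition env :: "(('t \<Rightarrow> 'i \<Rightarrow> real) \<Rightarrow> real) \<Rightarrow> real \<Rightarrow> ('t \<Rightarrow> 'i \<Rightarrow> real) \<Rightarrow> real" where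
  "env h L f = (SUP g\<in>E. h g - L * d f g)"

lemma env_props:
  assumes B: "\<And>f. f \<in> E \<Longrightarrow> \<bar>h f\<bar> \<le> B" and L: "L \<ge> 0"
  shows "f \<in> E \<Longrightarrow> h f \<le> env h L f" "f \<in> E \<Longrightarrow> \<bar>env h L f\<bar> \<le> B" "lipschitz L (env h L)"
proof -
  have up: "h g - L * d f g \<le> B" if "f \<in> E" "g \<in> E" for f g
    using B[OF that(2)] mult_nonneg_nonneg[OF L d_nonneg[OF that]] by linarith
  have bdd: "bdd_above ((\<lambda>g. h g - L * d f g) ` E)" if "f \<in> E" for f
    using up[OF that] by (auto intro!: bdd_aboveI[of _ B])
  show a: "h f \<le> env h L f" if f: "f \<in> E" for f
    unfolding env_def using cSUP_upper[OF f bdd[OF f]] d_self[OF f] by simp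
  show "\<bar>env h L f\<bar> \<le> B" if f: "f \<in> E"
  proof -
    have "env h L f \<le> B" unfolding env_def using up[OF f] zero_in_E by (intro cSUP_least) auto
    then show ?thesis using a[OF f] B[OF f] by linarith
  qed
  have half: "env h L f \<le> env h L g + L * d f g" if f: "f \<in> E" and g: "g \<in> E" for f g
    unfolding env_def[of h L f]
  proof (rule cSUP_least)
    fix k assume k: "k \<in> E"
    have "h k - L * d g k \<le> env h L g" unfolding env_def by (rule cSUP_upper[OF k bdd[OF g]])
    moreover have "L * d g k \<le> L * (d f g + d f k)"
      using d_triangle[OF g f k] d_commute[of g f] L by (intro mult_left_mono) auto
    ultimately show "h k - L * d f k \<le> env h L g + L * d f g" by (simp add: algebra_simps)
  qed (use zero_in_E in auto)
  show "lipschitz L (env h L)"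
    unfolding lipschitz_def using half d_commute by (smt (verit))
qed

lemma env_tendsto:
  assumes h: "linf_cont_bdd T I h" and f: "f \<in> E"
  shows "(\<lambda>n. env h (real n) f) \<longlonglongrightarrow> h f"
proof (rule LIMSEQ_I)
  obtain B where B: "\<And>f. f \<in> E \<Longrightarrow> \<bar>h f\<bar> \<le> B" using h unfolding linf_cont_bdd_def by blast
  have B0: "B \<ge> 0" using B[OF f] by linarith
  fix e :: real assume e: "e > 0"
  then obtain r where r: "r > 0" "\<And>g. g \<in> E \<Longrightarrow> d f g < r \<Longrightarrow> \<bar>h g - h f\<bar> < e / 2"
    using h f unfolding linf_cont_bdd_def by (metis half_gt_zero)
  show "\<exists>no. \<forall>n\<ge>no. norm (env h (real n) f - h f) < e"
  \<comment> \<open>Beyond distance \<open>r\<close> the penalty outweighs the oscillation 2B of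
    \<open>h\<close>; within that distance continuity gives e / 2.\<close>
  proof (intro exI[of _ "nat \<lceil>2 * B / r\<rceil>"] allI impI)
    fix n assume "n \<ge> nat \<lceil>2 * B / r\<rceil>"
    then have "2 * B / r \<le> real n" by linarith
    then have nB: "2 * B \<le> real n * r" using r(1) by (simp add: field_simps)
    have "env h (real n) f \<le> h f + e / 2"
      unfolding env_def
    proof (rule cSUP_least)
      fix g assume g: "g \<in> E"
      show "h g - real n * d f g \<le> h f + e / 2"
      proof (cases "d f g < r")
        case True
        have "\<bar>h g - h f\<bar> < e / 2" by (rule r(2)[OF g True])
        moreover have "0 \<le> real n * d f g" using d_nonneg[OF f g] by simp
        ultimately show ?thesis by linarith
      next
        case False
        then have "real n * r \<le> real n * d f g" by (intro mult_left_mono) auto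
        then show ?thesis using nB B[OF f] B[OF g] e by linarith
      qed
    qed (use zero_in_E in auto)
    moreover have "h f \<le> env h (real n) f" by (rule env_props(1)[OF B _ f]) auto
    ultimately show "norm (env h (real n) f - h f) < e" using e by (simp add: abs_if)
  qed
qed

text \<open>Only an upper bound for Lipschitz test functions has to be checked: a bounded continuous
  function is the decreasing limit of its Lipschitz envelopes, and the lower bound is the upper bound
  for the negated function.\<close>

theorem weak_conv_linfI:
  assumes P: "prob_space P" and R: "prob_space R"
    and X: "\<And>n \<omega>. \<omega> \<in> space P \<Longrightarrow> X n \<omega> \<in> E"
    and L: "L \<in> measurable R (linf_borel T I)" and LE: "\<And>\<omega>. \<omega> \<in> space R \<Longrightarrow> L \<omega> \<in> E"
    and meas: "\<And>h c B. lipschitz c h \<Longrightarrow> c \<ge> 0 \<Longrightarrow> (\<And>f. f \<in> E \<Longrightarrow> \<bar>h f\<bar> \<le> B) \<Longrightarrow> (\<lambda>\<omega>. h (L \<omega>)) \<in> borel_measurable R"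
    and lip: "\<And>h c B e. lipschitz c h \<Longrightarrow> c \<ge> 0 \<Longrightarrow> (\<And>f. f \<in> E \<Longrightarrow> \<bar>h f\<bar> \<le> B) \<Longrightarrow> e > 0 \<Longrightarrow>
       \<forall>\<^sub>F n in sequentially. \<exists>g. integrable P g \<and> (\<forall>\<omega>\<in>space P. h (X n \<omega>) \<le> g \<omega>) \<and>
          integral\<^sup>L P g \<le> (\<integral>\<omega>. h (L \<omega>) \<partial>R) + e"
  shows "weak_conv_linf T I P X R L"
proof -
  interpret P: prob_space P by fact
  interpret R: prob_space R by fact
  have upper: "\<forall>\<^sub>F n in sequentially. \<exists>g. integrable P g \<and> (\<forall>\<omega>\<in>space P. h (X n \<omega>) \<le> g \<omega>) \<and>
          integral\<^sup>L P g \<le> (\<integral>\<omega>. h (L \<omega>) \<partial>R) + e" if h: "linf_cont_bdd T I h" and e: "e > 0" for h e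
  proof -
    obtain B where B: "\<And>f. f \<in> E \<Longrightarrow> \<bar>h f\<bar> \<le> B" using h unfolding linf_cont_bdd_def by blast
    have envp: "lipschitz (real k) (env h (real k))" "\<And>f. f \<in> E \<Longrightarrow> \<bar>env h (real k) f\<bar> \<le> B" "\<And>f. f \<in> E \<Longrightarrow> h f \<le> env h (real k) f" for k
      using env_props[where L="real k", OF B] by auto
    have me: "(\<lambda>\<omega>. env h (real k) (L \<omega>)) \<in> borel_measurable R" for k
      by (rule meas[OF envp(1) _ envp(2)]) auto
    have "(\<lambda>k. \<integral>\<omega>. env h (real k) (L \<omega>) \<partial>R) \<longlonglongrightarrow> (\<integral>\<omega>. h (L \<omega>) \<partial>R)"
    proof (rule integral_dominated_convergence[where w="\<lambda>_. B"])
      show "(\<lambda>\<omega>. h (L \<omega>)) \<in> borel_measurable R"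
        by (rule borel_measurable_LIMSEQ_real[OF _ me]) (rule env_tendsto[OF h LE])
      show "AE \<omega> in R. (\<lambda>k. env h (real k) (L \<omega>)) \<longlonglongrightarrow> h (L \<omega>)"
        by (intro AE_I2 env_tendsto[OF h] LE)
      show "AE \<omega> in R. norm (env h (real k) (L \<omega>)) \<le> B" for k
        using envp(2) LE by (intro AE_I2) auto
    qed (auto intro: me)
    then have "\<forall>\<^sub>F k in sequentially. (\<integral>\<omega>. env h (real k) (L \<omega>) \<partial>R) < (\<integral>\<omega>. h (L \<omega>) \<partial>R) + e / 2"
      using e by (intro order_tendstoD(2)) auto
    then obtain k where k: "(\<integral>\<omega>. env h (real k) (L \<omega>) \<partial>R) < (\<integral>\<omega>. h (L \<omega>) \<partial>R) + e / 2"
      by (auto simp: eventually_sequentially)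
    have e2: "e / 2 > 0" using e by simp
    have "\<forall>\<^sub>F n in sequentially. \<exists>g. integrable P g \<and> (\<forall>\<omega>\<in>space P. env h (real k) (X n \<omega>) \<le> g \<omega>) \<and>
          integral\<^sup>L P g \<le> (\<integral>\<omega>. env h (real k) (L \<omega>) \<partial>R) + e / 2"
      by (rule lip[OF envp(1)[of k] of_nat_0_le_iff _ e2]) (rule envp(2))
    then show ?thesis
    proof eventually_elim
      case (elim n)
      then obtain g where g: "integrable P g" "\<And>\<omega>. \<omega> \<in> space P \<Longrightarrow> env h (real k) (X n \<omega>) \<le> g \<omega>"
        "integral\<^sup>L P g \<le> (\<integral>\<omega>. env h (real k) (L \<omega>) \<partial>R) + e / 2" by blast
      have "\<forall>\<omega>\<in>space P. h (X n \<omega>) \<le> g \<omega>" using g(2) envp(3)[OF X] by (meson order_trans)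
      then show ?case using g k by (intro exI[of _ g]) auto
    qed
  qed
  have "(\<lambda>n. outer_exp P (\<lambda>\<omega>. h (X n \<omega>))) \<longlonglongrightarrow> (\<integral>\<omega>. h (L \<omega>) \<partial>R)" if h: "linf_cont_bdd T I h" for h
  proof (rule LIMSEQ_I)
    fix e :: real assume e: "e > 0"
    then have e2: "e / 2 > 0" by simp
    obtain B where B: "\<And>f. f \<in> E \<Longrightarrow> \<bar>h f\<bar> \<le> B" using h unfolding linf_cont_bdd_def by blast
    have h': "linf_cont_bdd T I (\<lambda>f. - h f)"
      using h unfolding linf_cont_bdd_def by (simp add: abs_minus_commute)
    have "\<forall>\<^sub>F n in sequentially. \<bar>outer_exp P (\<lambda>\<omega>. h (X n \<omega>)) - (\<integral>\<omega>. h (L \<omega>) \<partial>R)\<bar> < e"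
      using upper[OF h e2] upper[OF h' e2]
    proof eventually_elim
      case (elim n)
      define S where "S = {integral\<^sup>L P g |g. g \<in> borel_measurable P \<and> integrable P g \<and> (\<forall>\<omega>\<in>space P. h (X n \<omega>) \<le> g \<omega>)}"
      obtain g where g: "integrable P g" "\<forall>\<omega>\<in>space P. h (X n \<omega>) \<le> g \<omega>" "integral\<^sup>L P g \<le> (\<integral>\<omega>. h (L \<omega>) \<partial>R) + e / 2"
        using elim(1) by blast
      obtain g' where g': "integrable P g'" "\<forall>\<omega>\<in>space P. - h (X n \<omega>) \<le> g' \<omega>" "integral\<^sup>L P g' \<le> (\<integral>\<omega>. - h (L \<omega>) \<partial>R) + e / 2"
        using elim(2) by blast
      \<comment> \<open>A majorant of \<open>h\<close> and one of \<open>- h\<close> add up to a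
        nonnegative function, so every competitor in the outer expectation has integral at least
        \<open>- integral\<^sup>L P g'\<close>.\<close>
      have lb: "- integral\<^sup>L P g' \<le> s" if s: "s \<in> S" for s
      proof -
        obtain k where k: "s = integral\<^sup>L P k" "integrable P k" "\<forall>\<omega>\<in>space P. h (X n \<omega>) \<le> k \<omega>" using s by (auto simp: S_def)
        have "0 \<le> (\<integral>\<omega>. k \<omega> + g' \<omega> \<partial>P)"
          using k(3) g'(2) by (intro integral_nonneg_AE AE_I2) (smt (verit))
        then show ?thesis using k g' by simp
      qed
      have gS: "integral\<^sup>L P g \<in> S" using g by (auto simp: S_def)
      have "Inf S \<le> integral\<^sup>L P g" by (rule cInf_lower[OF gS]) (rule bdd_belowI[OF lb])
      moreover have "- integral\<^sup>L P g' \<le> Inf S" using gS lb by (intro cInf_greatest) auto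
      moreover have "(\<integral>\<omega>. - h (L \<omega>) \<partial>R) = - (\<integral>\<omega>. h (L \<omega>) \<partial>R)" by simp
      moreover have "outer_exp P (\<lambda>\<omega>. h (X n \<omega>)) = Inf S" by (simp add: outer_exp_def S_def)
      ultimately show ?case using g(3) g'(3) e by (simp add: abs_if)
    qed
    then show "\<exists>no. \<forall>n\<ge>no. norm (outer_exp P (\<lambda>\<omega>. h (X n \<omega>)) - (\<integral>\<omega>. h (L \<omega>) \<partial>R)) < e"
      by (auto simp: eventually_sequentially)
  qed
  then show ?thesis unfolding weak_conv_linf_def using X L by blast
qed

text \<open>Needs no separability: the limit in the sup distance lies in the open set
  \<open>U\<close> exactly when the approximants eventually stay in one of countably many open sets
  of points deep inside \<open>U\<close>.\<close>

lemma linf_borel_limit: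
  assumes Xn: "\<And>n U. linf_open T I U \<Longrightarrow> {\<omega>\<in>space R. X n \<omega> \<in> U} \<in> sets R"
    and XE: "\<And>n \<omega>. \<omega> \<in> space R \<Longrightarrow> X n \<omega> \<in> E" and LE: "\<And>\<omega>. \<omega> \<in> space R \<Longrightarrow> L \<omega> \<in> E"
    and conv: "\<And>\<omega>. \<omega> \<in> space R \<Longrightarrow> (\<lambda>n. d (X n \<omega>) (L \<omega>)) \<longlonglongrightarrow> 0"
  shows "L \<in> measurable R (linf_borel T I)"
  unfolding linf_borel_def
proof (rule measurable_measure_of)
  show "{U. linf_open T I U} \<subseteq> Pow E" by (auto simp: linf_open_def)
  show "L \<in> space R \<rightarrow> E" using LE by auto
  fix U assume "U \<in> {U. linf_open T I U}"
  then have U: "linf_open T I U" by simp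
  \<comment> \<open>Points with a ball of radius strictly larger than \<open>r\<close> inside
    \<open>U\<close>; the strict inequality is what makes \<open>G r\<close> open.\<close>
  define G where "G r = {f\<in>E. \<exists>s>r. \<forall>g\<in>E. d f g < s \<longrightarrow> g \<in> U}" for r
  have G: "linf_open T I (G r)" for r
    unfolding linf_open_def
  proof (intro conjI ballI)
    show "G r \<subseteq> E" by (auto simp: G_def)
    fix f assume "f \<in> G r"
    then obtain s where f: "f \<in> E" and s: "s > r" "\<And>g. g \<in> E \<Longrightarrow> d f g < s \<Longrightarrow> g \<in> U" by (auto simp: G_def)
    show "\<exists>e>0. \<forall>g\<in>E. d f g < e \<longrightarrow> g \<in> G r"
    proof (intro exI[of _ "(s - r) / 2"] conjI ballI impI)
      show "0 < (s - r) / 2" using s by simp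
      fix g assume g: "g \<in> E" "d f g < (s - r) / 2"
      have "k \<in> U" if "k \<in> E" "d g k < (s + r) / 2" for k
        using s(2)[OF that(1)] d_triangle[OF f g(1) that(1)] g(2) that(2) by (simp add: field_simps)
      then show "g \<in> G r" using g(1) s(1) by (auto simp: G_def intro!: exI[of _ "(s + r) / 2"])
    qed
  qed
  have eq: "L -` U \<inter> space R = {\<omega>\<in>space R. \<exists>k::nat. \<exists>N. \<forall>n. n \<ge> N \<longrightarrow> X n \<omega> \<in> G (1 / real (Suc k))}"
  proof (intro set_eqI iffI)
    fix \<omega> assume "\<omega> \<in> L -` U \<inter> space R"
    then have w: "\<omega> \<in> space R" "L \<omega> \<in> U" by auto
    then obtain e where e: "e > 0" "\<And>g. g \<in> E \<Longrightarrow> d (L \<omega>) g < e \<Longrightarrow> g \<in> U" using U by (auto simp: linf_open_def)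
    obtain k :: nat where k: "1 / real (Suc k) < e / 3" using e(1) nat_approx_posE[of "e/3"] by auto
    have "\<forall>\<^sub>F n in sequentially. d (X n \<omega>) (L \<omega>) < e / 3" using order_tendstoD(2)[OF conv[OF w(1)], of "e/3"] e(1) by simp
    then obtain N where N: "\<And>n. n \<ge> N \<Longrightarrow> d (X n \<omega>) (L \<omega>) < e / 3" by (auto simp: eventually_sequentially)
    have "X n \<omega> \<in> G (1 / real (Suc k))" if "n \<ge> N" for n
    proof -
      have "g \<in> U" if g: "g \<in> E" "d (X n \<omega>) g < 2 * e / 3" for g
        using e(2)[OF g(1)] d_triangle[OF LE[OF w(1)] XE[OF w(1), of n] g(1)] d_commute[of "L \<omega>" "X n \<omega>"] N[OF \<open>n \<ge> N\<close>] g(2) by linarith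
      then show ?thesis unfolding G_def using XE[OF w(1)] k e(1) by (intro CollectI conjI exI[of _ "2 * e / 3"]) auto
    qed
    then show "\<omega> \<in> {\<omega>\<in>space R. \<exists>k::nat. \<exists>N. \<forall>n. n \<ge> N \<longrightarrow> X n \<omega> \<in> G (1 / real (Suc k))}" using w by blast
  next
    fix \<omega> assume "\<omega> \<in> {\<omega>\<in>space R. \<exists>k::nat. \<exists>N. \<forall>n. n \<ge> N \<longrightarrow> X n \<omega> \<in> G (1 / real (Suc k))}"
    then obtain k N where w: "\<omega> \<in> space R" and N: "\<And>n. n \<ge> N \<Longrightarrow> X n \<omega> \<in> G (1 / real (Suc k))" by blast
    have "\<forall>\<^sub>F n in sequentially. d (X n \<omega>) (L \<omega>) < 1 / real (Suc k)" by (rule order_tendstoD(2)[OF conv[OF w]]) simp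
    then obtain N' where N': "\<And>n. n \<ge> N' \<Longrightarrow> d (X n \<omega>) (L \<omega>) < 1 / real (Suc k)" by (auto simp: eventually_sequentially)
    have "X (max N N') \<omega> \<in> G (1 / real (Suc k))" "d (X (max N N') \<omega>) (L \<omega>) < 1 / real (Suc k)" using N N' by auto
    then have "L \<omega> \<in> U" using LE[OF w] unfolding G_def by auto
    then show "\<omega> \<in> L -` U \<inter> space R" using w by simp
  qed
  have "{\<omega>\<in>space R. \<exists>k::nat. \<exists>N. \<forall>n. n \<ge> N \<longrightarrow> X n \<omega> \<in> G (1 / real (Suc k))} \<in> sets R"
    by (intro sets.sets_Collect_countable_Ex sets.sets_Collect_countable_All sets.sets_Collect_imp sets.sets_Collect_const Xn G)
  then show "L -` U \<inter> space R \<in> sets R" unfolding eq .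
qed

end

lemma (in prob_space) finite_family_tight:
  fixes V :: "'a \<Rightarrow> 's \<Rightarrow> real"
  assumes F: "finite F" and [measurable]: "\<And>s. (\<lambda>\<omega>. V \<omega> s) \<in> borel_measurable M" and e: "e > 0"
  shows "\<exists>r\<ge>0. prob {\<omega>\<in>space M. \<exists>s\<in>F. \<bar>V \<omega> s\<bar> > r} \<le> e"
proof -
  define A where "A n = {\<omega>\<in>space M. \<exists>s\<in>F. \<bar>V \<omega> s\<bar> > real n}" for n :: nat
  have "(\<lambda>n. prob (A n)) \<longlonglongrightarrow> prob (\<Inter>n. A n)"
  proof (rule finite_Lim_measure_decseq)
    show "range A \<subseteq> events" unfolding A_def using F by auto
    show "decseq A" unfolding decseq_def
    proof (intro allI impI subsetI)
      fix k n \<omega> assume kn: "k \<le> n" and "\<omega> \<in> A n"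
      then obtain s where s: "s \<in> F" "\<bar>V \<omega> s\<bar> > real n" "\<omega> \<in> space M" by (auto simp: A_def)
      have "real k < \<bar>V \<omega> s\<bar>" using kn s(2) by linarith
      then show "\<omega> \<in> A k" using s by (auto simp: A_def)
    qed
  qed
  also have "(\<Inter>n. A n) = {}"
  proof -
    have False if "\<forall>n. \<exists>s\<in>F. \<bar>V \<omega> s\<bar> > real n" for \<omega>
    proof -
      obtain n :: nat where n: "(\<Sum>s\<in>F. \<bar>V \<omega> s\<bar>) \<le> real n" using real_arch_simple by blast
      then have "\<bar>V \<omega> s\<bar> \<le> real n" if "s \<in> F" for s using member_le_sum[OF that, of "\<lambda>s. \<bar>V \<omega> s\<bar>"] F by force
      then show False using that by (meson not_le)
    qed
    then show ?thesis by (auto simp: A_def)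
  qed
  finally have "(\<lambda>n. prob (A n)) \<longlonglongrightarrow> 0" by simp
  then have "\<forall>\<^sub>F n in sequentially. prob (A n) < e" using e by (intro order_tendstoD(2))
  then obtain n where "prob (A n) < e" by (auto simp: eventually_sequentially)
  then show ?thesis by (intro exI[of _ "real n"]) (auto simp: A_def)
qed

section \<open>Uniform approximation of the copula processes\<close>

lemma chained_mono: "chained q N0 N1 G \<Longrightarrow> q \<le> q' \<Longrightarrow> chained q' N0 N1 G"
  unfolding chained_def case_prod_beta using rho_gt_1
  by (meson divide_right_mono order_trans zero_le_power less_imp_le zero_less_one)

text \<open>Reduces the hypotheses of the delta method to finitely many grid values: chaining from
  level \<open>N1\<close> supplies both the uniform bound and the modulus. The chaining factor 2
  covers resamples.\<close>

lemma (in cond_copula) chained_delta_method: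
  assumes e: "e > 0"
  shows "\<forall>\<^sub>F n in sequentially. \<forall>xs. chained 2 N1 (lg n) (Gn n xs) \<longrightarrow> (\<forall>a\<in>grid N1. \<bar>Gn n xs a\<bar> \<le> K) \<longrightarrow>
     (\<forall>k. Hn n xs (vupd onevec k 0) = 0) \<longrightarrow>
     (\<forall>u\<in>cube. \<bar>sqrt (real n) * (Cbar n xs A u - condcop Q A u) - Cinf_formula Q A (Gn n xs) u\<bar> \<le> e)"
proof -
  let ?sm = "small (real CARD('p)) 2"
  \<comment> \<open>The bound on the grid, plus the chaining sum from \<open>N1\<close> on, plus 1
    for what is left below the finest level.\<close>
  define Kb where "Kb = K + 2 * \<tau> N1 + 1"
  obtain \<eta> where \<eta>: "\<eta> > 0" "\<forall>\<delta>>0. \<forall>\<^sub>F n in sequentially. \<forall>xs.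
     (\<forall>u\<in>cube. \<bar>Gn n xs u\<bar> \<le> Kb) \<longrightarrow>
     (\<forall>u\<in>cube. \<forall>v\<in>cube. (\<forall>k. \<bar>u $ k - v $ k\<bar> \<le> \<delta>) \<longrightarrow> \<bar>Gn n xs u - Gn n xs v\<bar> \<le> \<eta>) \<longrightarrow>
     (\<forall>k. Hn n xs (vupd onevec k 0) = 0) \<longrightarrow>
     (\<forall>u\<in>cube. \<bar>sqrt (real n) * (Cbar n xs A u - condcop Q A u) - Cinf_formula Q A (Gn n xs) u\<bar> \<le> e)"
    using delta_method[OF e, of Kb] by (elim exE conjE)
  have "(\<lambda>N. 4 * \<tau> N + 4 * (1 / \<rho> ^ N)) \<longlonglongrightarrow> 4 * 0 + 4 * 0"
    by (intro tendsto_intros tau_tendsto inverse_rho_tendsto)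
  then have "\<forall>\<^sub>F N in sequentially. 4 * \<tau> N + 4 * (1 / \<rho> ^ N) < \<eta> / 2" using \<eta>(1) by (intro order_tendstoD(2)) auto
  then obtain N' where N': "\<And>N. N \<ge> N' \<Longrightarrow> 4 * \<tau> N + 4 * (1 / \<rho> ^ N) < \<eta> / 2" by (auto simp: eventually_sequentially)
  define N2 where "N2 = max N1 N'"
  have N2: "N1 \<le> N2" "4 * \<tau> N2 + 4 * (1 / \<rho> ^ N2) < \<eta> / 2" using N' by (auto simp: N2_def)
  have \<delta>: "(1::real) / 2 ^ N2 > 0" by simp
  have "\<forall>\<^sub>F n in sequentially. ?sm n < min 1 (\<eta> / 4)" using \<eta>(1) by (intro order_tendstoD(2)[OF small_tendsto]) auto
  moreover have "\<forall>\<^sub>F n in sequentially. N2 \<le> lg n" using lg_at_top by (auto simp: filterlim_at_top)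
  moreover note eventually_gt_at_top[of 0] \<eta>(2)[rule_format, OF \<delta>]
  ultimately show ?thesis
  proof eventually_elim
    case (elim n)
    show ?case
    proof (intro allI impI)
      fix xs assume ch: "chained 2 N1 (lg n) (Gn n xs)" and K: "\<forall>a\<in>grid N1. \<bar>Gn n xs a\<bar> \<le> K"
        and z: "\<forall>k. Hn n xs (vupd onevec k 0) = 0"
      have 1: "\<forall>u\<in>cube. \<bar>Gn n xs u\<bar> \<le> Kb"
      proof
        fix u :: "real^'p" assume u: "u \<in> cube"
        have "\<bar>Gn n xs u - Gn n xs (prj N1 u)\<bar> \<le> 2 * \<tau> N1 + ?sm n"
          using elim N2 by (intro Gn_prj[OF _ ch] u) auto
        moreover have "\<bar>Gn n xs (prj N1 u)\<bar> \<le> K" using K prj_grid[OF u] by blast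
        ultimately show "\<bar>Gn n xs u\<bar> \<le> Kb" using elim(1) unfolding Kb_def by (simp add: abs_if split: if_splits)
      qed
      have 2: "\<forall>u\<in>cube. \<forall>v\<in>cube. (\<forall>k. \<bar>u $ k - v $ k\<bar> \<le> 1 / 2 ^ N2) \<longrightarrow> \<bar>Gn n xs u - Gn n xs v\<bar> \<le> \<eta>"
      proof (intro ballI impI)
        fix u v :: "real^'p" assume uv: "u \<in> cube" "v \<in> cube" "\<forall>k. \<bar>u $ k - v $ k\<bar> \<le> 1 / 2 ^ N2"
        have "\<bar>Gn n xs u - Gn n xs v\<bar> \<le> 2 * (2 * \<tau> N2 + ?sm n) + 2 * (2 / \<rho> ^ N2)"
          using elim N2 uv by (intro Gn_modulus[OF _ ch]) auto
        also have "\<dots> = (4 * \<tau> N2 + 4 * (1 / \<rho> ^ N2)) + 2 * ?sm n" by simp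
        also have "\<dots> \<le> \<eta>" using N2(2) elim(1) by simp
        finally show "\<bar>Gn n xs u - Gn n xs v\<bar> \<le> \<eta>" .
      qed
      show "\<forall>u\<in>cube. \<bar>sqrt (real n) * (Cbar n xs A u - condcop Q A u) - Cinf_formula Q A (Gn n xs) u\<bar> \<le> e"
        using elim(4) 1 2 z by blast
    qed
  qed
qed

text \<open>Serves the boundedness of the paths for fixed \<open>n\<close>, including samples
  without a point in \<open>A\<close>, where both sides are 0 by x / 0 = 0.\<close>

lemma abs_Cbar_le: "\<bar>Cbar n xs A u\<bar> \<le> \<bar>real n / (real n * phat n xs A)\<bar>"
proof -
  have "card {i. i < n \<and> (\<forall>k. ereal (fst (xs i) $ k) \<le> gen_inv (Fn n xs A k) (u $ k)) \<and> snd (xs i) \<in> A} \<le> card {..<n}"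
    by (intro card_mono) auto
  then show ?thesis unfolding Cbar_def abs_divide by (intro divide_right_mono) auto
qed

lemma (in prob_space) indep_vars_distr:
  assumes T: "T \<in> measurable M N" and X: "\<And>i. X i \<in> measurable N (M' i)" and I: "I \<noteq> {}"
    and ind: "indep_vars M' (\<lambda>i \<omega>. X i (T \<omega>)) I"
  shows "prob_space.indep_vars (distr M N T) M' X I"
proof -
  interpret D: prob_space "distr M N T" by (rule prob_space_distr[OF T])
  have XT: "(\<lambda>\<omega>. X i (T \<omega>)) \<in> measurable M (M' i)" for i using measurable_compose[OF T X] .
  have rX: "(\<lambda>x. \<lambda>i\<in>I. X i x) \<in> measurable N (Pi\<^sub>M I M')" using X by (intro measurable_restrict)
  have X': "X i \<in> measurable (distr M N T) (M' i)" for i using X[of i] by simp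
  have "distr (distr M N T) (Pi\<^sub>M I M') (\<lambda>x. \<lambda>i\<in>I. X i x) = distr M (Pi\<^sub>M I M') (\<lambda>\<omega>. \<lambda>i\<in>I. X i (T \<omega>))"
    using rX T by (subst distr_distr) (auto simp: comp_def)
  also have "\<dots> = (\<Pi>\<^sub>M i\<in>I. distr M (M' i) (\<lambda>\<omega>. X i (T \<omega>)))"
    using indep_vars_iff_distr_eq_PiM[where M'=M' and X="\<lambda>i \<omega>. X i (T \<omega>)", OF I XT] ind by blast
  also have "\<dots> = (\<Pi>\<^sub>M i\<in>I. distr (distr M N T) (M' i) (X i))"
    using X T by (intro PiM_cong refl) (subst distr_distr, auto simp: comp_def)
  finally show ?thesis using D.indep_vars_iff_distr_eq_PiM[where M'=M' and X=X, OF I X'] by blast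
qed

lemma normalized_sum:
  fixes x :: "nat \<Rightarrow> real"
  assumes "n > 0"
  shows "(\<Sum>i<n. x i - c) / sqrt (real n) = sqrt (real n) * ((\<Sum>i<n. x i) / real n - c)"
proof -
  define s where "s = sqrt (real n)"
  have s: "s > 0" "real n = s * s" using assms by (auto simp: s_def)
  show ?thesis unfolding s_def[symmetric] sum_subtractf using s(1) by (simp add: s(2) field_simps)
qed

section \<open>The sample and its resamples for several conditioning sets\<close>

locale boot_copula = resampling P "\<lambda>i \<omega>. (X i \<omega>, Z i \<omega>)" W M
  for P :: "'a measure" and X :: "nat \<Rightarrow> 'a \<Rightarrow> real^'p" and Z :: "nat \<Rightarrow> 'a \<Rightarrow> 'z::euclidean_space"
    and W :: "nat \<Rightarrow> nat \<Rightarrow> nat \<Rightarrow> 'a \<Rightarrow> nat" and M :: nat +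
  fixes A :: "nat \<Rightarrow> 'z set" and m :: nat
  assumes A_borel: "\<And>k. k < m \<Longrightarrow> A k \<in> sets borel"
    and A_pos: "\<And>k. k < m \<Longrightarrow> pA (law P X Z) (A k) > 0"
    and margins_cont: "\<And>k i. k < m \<Longrightarrow> continuous_on UNIV (condF (law P X Z) (A k) i)"
    and C1: "\<And>k. k < m \<Longrightarrow> C1_on_cube (condcop (law P X Z) (A k))"
begin

definition Q :: "((real^'p) \<times> 'z) measure" where "Q = law P X Z"

text \<open>Set to 0 from \<open>m\<close> on, so that the assumptions of
  \<open>brownian_limit\<close> hold for every \<open>k\<close>.\<close>

definition f :: "nat \<Rightarrow> real^'p \<Rightarrow> (real^'p) \<times> 'z \<Rightarrow> real" where
  "f k u = (if k < m then cond_copula.orth Q (A k) u else (\<lambda>_. 0))"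

lemma Q_distr: "Q = distr P borel (\<lambda>\<omega>. (X 0 \<omega>, Z 0 \<omega>))"
  by (simp add: Q_def law_def)

lemma sets_Q: "sets Q = sets borel" by (simp add: Q_distr)

lemma prob_space_Q: "prob_space Q"
  unfolding Q_distr by (rule prob_space_distr) (rule Y_meas)

lemma cc: "k < m \<Longrightarrow> cond_copula Q (A k)"
  unfolding cond_copula_def cond_copula_axioms_def
  using prob_space_Q sets_Q A_borel A_pos margins_cont C1 by (auto simp: Q_def)

lemma f_measurable[measurable]: "f k u \<in> borel_measurable borel"
  unfolding f_def using cond_copula.orth_measurable[OF cc] by auto

lemma f_01: "f k u y = 0 \<or> f k u y = 1"
  unfolding f_def using cond_copula.orth_01[OF cc] by auto

lemma f_abs: "\<bar>f k u y\<bar> \<le> 1"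
  using f_01[of k u y] by auto

lemma f_mono: "(\<And>i. u $ i \<le> v $ i) \<Longrightarrow> f k u y \<le> f k v y"
  unfolding f_def using cond_copula.orth_mono[OF cc] by auto

lemma mean_eq: "g \<in> borel_measurable borel \<Longrightarrow> mean g = (\<integral>y. g y \<partial>Q)"
  unfolding mean_def Q_distr using Y_meas by (subst integral_distr) auto

lemma mean_f: "k < m \<Longrightarrow> mean (f k u) = Dfun Q (A k) u"
  using mean_eq[OF f_measurable[of k u]] cond_copula.integral_orth[OF cc, of k u] by (simp add: f_def)

lemma f_incr:
  assumes "u \<in> cube" "v \<in> cube" "\<And>i. u $ i \<le> v $ i"
  shows "(\<integral>y. f k v y - f k u y \<partial>Q) \<le> (\<Sum>i\<in>UNIV. v $ i - u $ i)"
proof (cases "k < m")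
  case True
  interpret c: cond_copula Q "A k" by (rule cc[OF True])
  show ?thesis using True c.Dfun_increment[OF assms] by (simp add: f_def c.integral_orth c.integrable_orth)
qed (use assms in \<open>auto simp: f_def intro!: sum_nonneg\<close>)

sublocale bl: brownian_limit Q f m
proof -
  interpret q: prob_space Q by (rule prob_space_Q)
  show "brownian_limit Q f"
    by unfold_locales
       (use f_01 f_mono f_incr f_measurable in \<open>auto simp: measurable_cong_sets[OF sets_Q refl]\<close>)
qed

lemma cov_eq_Bcov:
  assumes "k < m" "k' < m"
  shows "bl.cov (k, u) (k', v) = Bcov Q (A k) (A k') u v"
proof -
  interpret c: cond_copula Q "A k" by (rule cc[OF assms(1)])
  interpret c': cond_copula Q "A k'" by (rule cc[OF assms(2)])
  have "(\<integral>y. f k u y * f k' v y \<partial>Q) = (\<integral>y. of_bool ((\<forall>i. UA Q (A k) (fst y) $ i \<le> u $ i) \<and> (\<forall>i. UA Q (A k') (fst y) $ i \<le> v $ i) \<and> snd y \<in> A k \<inter> A k') \<partial>Q)"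
    using assms by (intro Bochner_Integration.integral_cong refl) (auto simp: f_def c.orth_def c'.orth_def)
  also have "\<dots> = measure Q {y. (\<forall>i. UA Q (A k) (fst y) $ i \<le> u $ i) \<and> (\<forall>i. UA Q (A k') (fst y) $ i \<le> v $ i) \<and> snd y \<in> A k \<inter> A k'}"
    by (rule c.integral_of_bool) (simp, measurable)
  finally show ?thesis using assms
    by (simp add: bl.cov_def Bcov_def f_def c.integral_orth c'.integral_orth)
qed

text \<open>Empirical and bootstrap processes on the index set of the limit paths, so that the same
  map \<open>Lproc\<close> applies to both.\<close>

definition xe :: "nat \<Rightarrow> 'a \<Rightarrow> nat \<times> nat \<times> (real^'p) \<Rightarrow> real" where
  "xe n \<omega> = (\<lambda>(j, k, u). if j = 0 then emp_proc n (f k u) \<omega> else boot_proc n j (f k u) \<omega>)"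

lemma xe_measurable[measurable]: "(\<lambda>\<omega>. xe n \<omega> s) \<in> borel_measurable P"
  by (cases s) (auto simp: xe_def)

lemma xe_diff:
  "xe n \<omega> (j, k, v) - xe n \<omega> (j, k, u) = (if j = 0 then emp_proc n (\<lambda>y. f k v y - f k u y) \<omega> else boot_proc n j (\<lambda>y. f k v y - f k u y) \<omega>)"
proof -
  have m: "mean (\<lambda>y. f k v y - f k u y) = mean (f k v) - mean (f k u)"
    unfolding mean_def by (intro Bochner_Integration.integral_diff integrable_fun_Y[where K=1]) (auto simp: f_abs)
  have lin: "(\<Sum>i<n. x i - c) / s - (\<Sum>i<n. y i - d) / s = (\<Sum>i<n. (x i - y i) - (c - d)) / s"
    for x y :: "nat \<Rightarrow> real" and c d s
    unfolding sum_subtractf diff_divide_distrib[symmetric] sum_constant by (simp add: algebra_simps)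
  have e: "emp_avg n (\<lambda>y. f k v y - f k u y) z = emp_avg n (f k v) z - emp_avg n (f k u) z" for z
    by (simp add: emp_avg_def sum_subtractf diff_divide_distrib)
  show ?thesis
    unfolding xe_def emp_proc_def boot_proc_def m e by (simp only: prod.case lin if_cancel split: if_split) simp
qed

lemma Gn_data:
  assumes k: "k < m" and n: "n > 0"
  shows "cond_copula.Gn Q (A k) n (data \<omega>) u = xe n \<omega> (0, k, u)"
proof -
  interpret c: cond_copula Q "A k" by (rule cc[OF k])
  show ?thesis using k unfolding c.Gn_def c.Hn_def xe_def emp_proc_def mean_f[OF k, symmetric] normalized_sum[OF n]
    by (simp add: f_def)
qed

text \<open>The sample mean cancels between the two summands, which turns a resample centred at
  \<open>Dfun\<close> into the sum of the sample process and the bootstrap process.\<close>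

lemma Gn_resample:
  assumes k: "k < m" and n: "n > 0" and j: "j \<noteq> 0"
  shows "cond_copula.Gn Q (A k) n (\<lambda>l. data \<omega> (W n j l \<omega>)) u = xe n \<omega> (0, k, u) + xe n \<omega> (j, k, u)"
proof -
  interpret c: cond_copula Q "A k" by (rule cc[OF k])
  show ?thesis using k j unfolding c.Gn_def c.Hn_def xe_def emp_proc_def boot_proc_def emp_avg_def mean_f[OF k, symmetric] normalized_sum[OF n]
    by (simp add: f_def right_diff_distrib)
qed

lemma xe_tail:
  assumes j: "j \<le> M" and l: "0 < l" "l \<le> sqrt (real n)" and g: "g \<in> borel_measurable borel" "\<And>y. g y = 0 \<or> g y = 1"
  shows "prob {\<omega>\<in>space P. \<bar>if j = 0 then emp_proc n g \<omega> else boot_proc n j g \<omega>\<bar> > t} \<le> 2 * exp (2 * l\<^sup>2 * mean g) * exp (- l * t)"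
  using tail_emp_proc[OF g l, of t] tail_boot_proc[OF g l, of j t] j by (cases "j = 0") auto

lemma xe_link_tail:
  assumes j: "j \<le> M" and ab: "(a, b) \<in> links r" and r: "r \<le> lg n" and n: "n > 0"
  shows "prob {\<omega>\<in>space P. \<bar>xe n \<omega> (j, k, b) - xe n \<omega> (j, k, a)\<bar> > 1 / \<rho> ^ r} \<le> 2 * exp (2 * real CARD('p)) * exp (- (\<rho> ^ r))"
proof -
  have abc: "a \<in> cube" "b \<in> cube" using links_cube[OF ab] by auto
  have le: "a $ i \<le> b $ i" "b $ i - a $ i \<le> 1 / 2 ^ r" for i using ab by (auto simp: links_def algebra_simps)
  define g where "g y = f k b y - f k a y" for y
  have gm: "g \<in> borel_measurable borel" unfolding g_def by measurable
  have g01: "g y = 0 \<or> g y = 1" for y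
    using f_01[of k a y] f_01[of k b y] f_mono[of a b k y] le(1) by (auto simp: g_def)
  have "mean g = (\<integral>y. f k b y - f k a y \<partial>Q)" using mean_eq[OF gm] by (simp add: g_def)
  also have "\<dots> \<le> (\<Sum>i\<in>UNIV. b $ i - a $ i)" by (intro f_incr abc le)
  also have "\<dots> \<le> (\<Sum>i\<in>(UNIV::'p set). 1 / 2 ^ r)" by (intro sum_mono le)
  finally have mg: "mean g \<le> real CARD('p) / 2 ^ r" by simp
  \<comment> \<open>The same parameter as for the Gaussian limit; r \<le> lg n makes it admissible,
    because l^2 = 2^r \<le> n.\<close>
  define l where "l = \<rho> ^ (2 * r)"
  have l2: "l\<^sup>2 = 2 ^ r"
  proof -
    have "l\<^sup>2 = (\<rho> ^ 4) ^ r" by (simp add: l_def power_mult[symmetric] mult_ac)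
    then show ?thesis by (simp only: rho_pow4)
  qed
  have l0: "l > 0" using rho_gt_1 by (simp add: l_def)
  have "(2::nat) ^ r \<le> 2 ^ lg n" using r by (intro power_increasing) auto
  then have "(2::nat) ^ r \<le> n" using lg(1)[OF n] by linarith
  then have "l\<^sup>2 \<le> real n" unfolding l2 by (metis of_nat_le_iff of_nat_numeral of_nat_power)
  then have ln: "l \<le> sqrt (real n)" by (rule real_le_rsqrt)
  have lr: "l * (1 / \<rho> ^ r) = \<rho> ^ r" using rho_gt_1 by (simp add: l_def mult_2 power_add)
  have "prob {\<omega>\<in>space P. \<bar>xe n \<omega> (j, k, b) - xe n \<omega> (j, k, a)\<bar> > 1 / \<rho> ^ r} \<le> 2 * exp (2 * l\<^sup>2 * mean g) * exp (- l * (1 / \<rho> ^ r))"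
    unfolding xe_diff g_def[symmetric] by (rule xe_tail[OF j l0 ln gm g01])
  also have "\<dots> \<le> 2 * exp (2 * real CARD('p)) * exp (- (\<rho> ^ r))"
  proof (intro mult_mono)
    have "2 * l\<^sup>2 * mean g \<le> 2 * 2 ^ r * (real CARD('p) / 2 ^ r)" unfolding l2 using mg by (intro mult_left_mono) auto
    then show "exp (2 * l\<^sup>2 * mean g) \<le> exp (2 * real CARD('p))" by simp
    show "exp (- l * (1 / \<rho> ^ r)) \<le> exp (- (\<rho> ^ r))" using lr by simp
  qed auto
  finally show ?thesis .
qed

lemma xe_point_tail:
  assumes j: "j \<le> M" and n: "n > 0"
  shows "prob {\<omega>\<in>space P. \<bar>xe n \<omega> (j, k, a)\<bar> > t} \<le> 2 * exp 2 * exp (- t)"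
proof -
  have "mean (f k a) \<le> 1" using abs_mean_le[OF f_measurable f_abs, of k a] by linarith
  then have e: "2 * exp (2 * 1\<^sup>2 * mean (f k a)) * exp (- 1 * t) \<le> 2 * exp 2 * exp (- t)" by simp
  have "prob {\<omega>\<in>space P. \<bar>if j = 0 then emp_proc n (f k a) \<omega> else boot_proc n j (f k a) \<omega>\<bar> > t} \<le> 2 * exp (2 * 1\<^sup>2 * mean (f k a)) * exp (- 1 * t)"
    using n by (intro xe_tail j f_measurable f_01) auto
  moreover have "xe n \<omega> (j, k, a) = (if j = 0 then emp_proc n (f k a) \<omega> else boot_proc n j (f k a) \<omega>)" for \<omega>
    by (simp add: xe_def)
  ultimately show ?thesis using e by (simp only:)
qed

text \<open>Off this event the pathwise estimates apply to all copies and sets simultaneously: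
  chaining from level \<open>N1\<close>, and bounded values on the starting grid.\<close>

definition bad :: "nat \<Rightarrow> nat \<Rightarrow> real \<Rightarrow> 'a set" where
  "bad n N1 K = {\<omega>\<in>space P. \<exists>j\<in>{..M}. \<exists>k\<in>{..<m}. \<not> chained 1 N1 (lg n) (\<lambda>u. xe n \<omega> (j, k, u)) \<or>
      (\<exists>a\<in>grid N1. \<bar>xe n \<omega> (j, k, a)\<bar> > K)}"

definition bad_bound :: "nat \<Rightarrow> real \<Rightarrow> real" where
  "bad_bound N1 K = real (Suc M) * real m * (4 * exp (2 * real CARD('p)) * link_const TYPE('p) * (1 / 2) ^ N1
      + real (card (grid N1 :: (real^'p) set)) * (2 * exp 2 * exp (- K)))"

lemma bad_prob:
  assumes n: "n > 0"
  shows "bad n N1 K \<in> events" "prob (bad n N1 K) \<le> bad_bound N1 K"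
proof -
  define B1 where "B1 j k = {\<omega>\<in>space P. \<not> chained 1 N1 (lg n) (\<lambda>u. xe n \<omega> (j, k, u))}" for j k
  define B2 where "B2 j k = (\<Union>a\<in>grid N1. {\<omega>\<in>space P. \<bar>xe n \<omega> (j, k, a)\<bar> > K})" for j k
  have B1: "B1 j k \<in> events" "prob (B1 j k) \<le> 2 * (2 * exp (2 * real CARD('p))) * link_const TYPE('p) * (1 / 2) ^ N1" if "j \<le> M" for j k
    unfolding B1_def using that n by (intro not_chained_bound[where c="2 * exp (2 * real CARD('p))"] xe_link_tail; simp)+
  have B2: "B2 j k \<in> events" "prob (B2 j k) \<le> real (card (grid N1 :: (real^'p) set)) * (2 * exp 2 * exp (- K))" if "j \<le> M" for j k
  proof -
    show "B2 j k \<in> events" unfolding B2_def by (intro sets.finite_UN) auto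
    have "prob (B2 j k) \<le> (\<Sum>a\<in>grid N1. prob {\<omega>\<in>space P. \<bar>xe n \<omega> (j, k, a)\<bar> > K})"
      unfolding B2_def by (intro measure_UNION_le) auto
    also have "\<dots> \<le> (\<Sum>a\<in>(grid N1 :: (real^'p) set). 2 * exp 2 * exp (- K))" by (intro sum_mono xe_point_tail that n)
    finally show "prob (B2 j k) \<le> real (card (grid N1 :: (real^'p) set)) * (2 * exp 2 * exp (- K))" by simp
  qed
  have eq: "bad n N1 K = (\<Union>jk\<in>{..M} \<times> {..<m}. B1 (fst jk) (snd jk) \<union> B2 (fst jk) (snd jk))"
    unfolding bad_def B1_def B2_def by force
  show "bad n N1 K \<in> events" unfolding eq using B1 B2 by (intro sets.finite_UN) auto
  have "prob (bad n N1 K) \<le> (\<Sum>jk\<in>{..M} \<times> {..<m}. prob (B1 (fst jk) (snd jk) \<union> B2 (fst jk) (snd jk)))"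
    unfolding eq using B1 B2 by (intro measure_UNION_le) auto
  also have "\<dots> \<le> (\<Sum>jk\<in>{..M} \<times> {..<m}. 4 * exp (2 * real CARD('p)) * link_const TYPE('p) * (1 / 2) ^ N1
      + real (card (grid N1 :: (real^'p) set)) * (2 * exp 2 * exp (- K)))"
  proof (rule sum_mono)
    fix jk assume "jk \<in> {..M} \<times> {..<m}"
    then have j: "fst jk \<le> M" by auto
    show "prob (B1 (fst jk) (snd jk) \<union> B2 (fst jk) (snd jk)) \<le> 4 * exp (2 * real CARD('p)) * link_const TYPE('p) * (1 / 2) ^ N1
      + real (card (grid N1 :: (real^'p) set)) * (2 * exp 2 * exp (- K))"
      using measure_Un_le[OF B1(1)[OF j] B2(1)[OF j], of "snd jk" "snd jk"] B1(2)[OF j, of "snd jk"] B2(2)[OF j, of "snd jk"] by simp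
  qed
  also have "\<dots> = bad_bound N1 K" by (simp add: bad_bound_def card_cartesian_product distrib_right)
  finally show "prob (bad n N1 K) \<le> bad_bound N1 K" .
qed

text \<open>The level \<open>N1\<close> is chosen first, for the chaining part, and \<open>K\<close>
  afterwards, since the number of starting points depends on \<open>N1\<close>.\<close>

lemma bad_bound_small:
  assumes e: "e > 0"
  obtains N1 K where "bad_bound N1 K \<le> e"
proof -
  define c where "c = 4 * exp (2 * real CARD('p)) * link_const TYPE('p)"
  define a where "a = real (Suc M) * real m"
  have "(\<lambda>N. a * (c * (1 / 2) ^ N)) \<longlonglongrightarrow> 0"
    by (intro tendsto_mult_right_zero LIMSEQ_power_zero) simp
  then have "\<forall>\<^sub>F N in sequentially. a * (c * (1 / 2) ^ N) < e / 2" using e by (intro order_tendstoD(2)) auto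
  then obtain N1 where N1: "a * (c * (1 / 2) ^ N1) < e / 2" by (auto simp: eventually_sequentially)
  define b where "b = a * (real (card (grid N1 :: (real^'p) set)) * (2 * exp 2))"
  have "((\<lambda>K::real. exp (- K)) \<longlongrightarrow> 0) at_top"
    by (intro filterlim_compose[OF exp_at_bot] filterlim_uminus_at_bot_at_top)
  then have "((\<lambda>K. b * exp (- K)) \<longlongrightarrow> 0) at_top" by (rule tendsto_mult_right_zero)
  then have "\<forall>\<^sub>F K in at_top. b * exp (- K) < e / 2" using e by (intro order_tendstoD(2)) auto
  then obtain K where K: "b * exp (- K) < e / 2" by (auto simp: eventually_at_top_linorder)
  have "bad_bound N1 K = a * (c * (1 / 2) ^ N1) + b * exp (- K)"
    unfolding bad_bound_def a_def[symmetric] c_def[symmetric] b_def by (simp add: algebra_simps)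
  then show ?thesis using that[of N1 K] N1 K by linarith
qed

text \<open>Some observation lies on a lower face of the copula scale. The union over all indices
  \<open>l\<close> covers every resample as well.\<close>

definition null_set :: "'a set" where
  "null_set = {\<omega>\<in>space P. \<exists>k\<in>{..<m}. \<exists>i\<in>UNIV. \<exists>l. f k (vupd onevec i 0) (X l \<omega>, Z l \<omega>) \<noteq> 0}"

lemma null_set: "null_set \<in> events" "prob null_set = 0"
proof -
  show ev: "null_set \<in> events"
    unfolding null_set_def
    by (intro sets.sets_Collect_finite_Ex sets.sets_Collect_countable_Ex finite_lessThan finite)
       (use measurable_compose[OF Y_meas f_measurable] in measurable)
  have "AE \<omega> in P. f k (vupd onevec i 0) (X l \<omega>, Z l \<omega>) = 0" if k: "k < m" for k i l
  proof -
    interpret c: cond_copula Q "A k" by (rule cc[OF k])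
    let ?g = "f k (vupd onevec i 0)"
    have "(\<integral>\<omega>. ?g (X l \<omega>, Z l \<omega>) \<partial>P) = mean ?g" unfolding mean_def by (rule integral_Y_eq) measurable
    also have "\<dots> = 0" using mean_f[OF k] c.Dfun_margin[of 0 i] by simp
    finally have z: "(\<integral>\<omega>. ?g (X l \<omega>, Z l \<omega>) \<partial>P) = 0" .
    have "integrable P (\<lambda>\<omega>. ?g (X l \<omega>, Z l \<omega>))"
      by (rule integrable_fun_Y[OF f_measurable, where K=1]) (simp add: f_abs)
    moreover have "AE \<omega> in P. 0 \<le> ?g (X l \<omega>, Z l \<omega>)" using f_01[of k "vupd onevec i 0"] by (intro AE_I2) (metis order_refl zero_le_one)
    ultimately show ?thesis using integral_nonneg_eq_0_iff_AE z by blast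
  qed
  then have "AE \<omega> in P. \<forall>k\<in>{..<m}. \<forall>i\<in>UNIV. \<forall>l. f k (vupd onevec i 0) (X l \<omega>, Z l \<omega>) = 0"
    by (intro AE_finite_allI) (auto simp: AE_all_countable)
  then have "AE \<omega> in P. \<omega> \<notin> null_set" by eventually_elim (auto simp: null_set_def)
  then show "prob null_set = 0" using prob_eq_0[OF ev] by blast
qed

abbreviation "TT \<equiv> Tset M m :: (nat \<Rightarrow> nat \<Rightarrow> real^'p) set"
abbreviation "II \<equiv> {..M} \<times> {..<m}"

lemma TT_nth: "vu \<in> TT \<Longrightarrow> j \<le> M \<Longrightarrow> k < m \<Longrightarrow> vu j k \<in> cube"
  unfolding Tset_def by (auto dest!: spec[of _ j] spec[of _ k])

text \<open>Bracketing applies to processes of the form \<open>Gn\<close>. The bootstrap process is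
  a difference of two of these, hence the outer factor 2.\<close>

lemma xe_prj:
  assumes n: "n > 0" and w: "\<omega> \<in> space P - bad n N1 K" and N: "N1 \<le> N" "N \<le> lg n"
    and j: "j \<le> M" and k: "k < m" and u: "u \<in> cube"
  shows "\<bar>xe n \<omega> (j, k, u) - xe n \<omega> (j, k, prj N u)\<bar> \<le> 2 * (2 * \<tau> N + small (real CARD('p)) 2 n)"
proof -
  interpret c: cond_copula Q "A k" by (rule cc[OF k])
  have ch: "chained 1 N1 (lg n) (\<lambda>u. xe n \<omega> (j, k, u))" if "j \<le> M" for j
    using w k that unfolding bad_def by auto
  have "\<bar>c.Gn n (data \<omega>) u - c.Gn n (data \<omega>) (prj N u)\<bar> \<le> 2 * \<tau> N + small (real CARD('p)) 2 n"
  proof (rule c.Gn_prj[OF n _ _ N u])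
    show "chained 2 N1 (lg n) (c.Gn n (data \<omega>))"
      using chained_mono[OF ch[of 0], of 2] by (simp add: Gn_data[OF k n, abs_def])
  qed simp
  then have d0: "\<bar>xe n \<omega> (0, k, u) - xe n \<omega> (0, k, prj N u)\<bar> \<le> 2 * \<tau> N + small (real CARD('p)) 2 n"
    by (simp only: Gn_data[OF k n])
  show ?thesis
  proof (cases "j = 0")
    case True
    have "a \<le> b \<Longrightarrow> 0 \<le> a \<Longrightarrow> a \<le> 2 * b" for a b :: real by linarith
    then show ?thesis unfolding True using d0 abs_ge_zero by blast
  next
    case False
    have "\<bar>c.Gn n (\<lambda>l. data \<omega> (W n j l \<omega>)) u - c.Gn n (\<lambda>l. data \<omega> (W n j l \<omega>)) (prj N u)\<bar> \<le> 2 * \<tau> N + small (real CARD('p)) 2 n"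
    proof (rule c.Gn_prj[OF n _ _ N u])
      show "chained 2 N1 (lg n) (c.Gn n (\<lambda>l. data \<omega> (W n j l \<omega>)))"
        using chained_add[OF ch[of 0] ch[OF j]] by (simp add: Gn_resample[OF k n False, abs_def])
    qed simp
    then have d1: "\<bar>(xe n \<omega> (0, k, u) + xe n \<omega> (j, k, u)) - (xe n \<omega> (0, k, prj N u) + xe n \<omega> (j, k, prj N u))\<bar> \<le> 2 * \<tau> N + small (real CARD('p)) 2 n"
      unfolding Gn_resample[OF k n False] .
    have "\<bar>a - b\<bar> \<le> c \<Longrightarrow> \<bar>(a + a') - (b + b')\<bar> \<le> c \<Longrightarrow> \<bar>a' - b'\<bar> \<le> 2 * c" for a b a' b' c :: real by linarith
    from this[OF d0 d1] show ?thesis .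
  qed
qed

lemma Eproc_approx:
  assumes e: "e > 0"
  shows "\<forall>\<^sub>F n in sequentially. \<forall>\<omega>\<in>space P - bad n N1 K - null_set. \<forall>t\<in>TT. \<forall>i\<in>II.
     \<bar>Eproc Q A M m X Z W n \<omega> t i - Lproc Q A M m (xe n \<omega>) t i\<bar> \<le> e"
proof -
  have e2: "e / 2 > 0" using e by simp
  have "\<forall>\<^sub>F n in sequentially. \<forall>k\<in>{..<m}. \<forall>xs. chained 2 N1 (lg n) (cond_copula.Gn Q (A k) n xs) \<longrightarrow> (\<forall>a\<in>grid N1. \<bar>cond_copula.Gn Q (A k) n xs a\<bar> \<le> 2 * \<bar>K\<bar>) \<longrightarrow>
     (\<forall>i. cond_copula.Hn Q (A k) n xs (vupd onevec i 0) = 0) \<longrightarrow>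
     (\<forall>u\<in>cube. \<bar>sqrt (real n) * (Cbar n xs (A k) u - condcop Q (A k) u) - Cinf_formula Q (A k) (cond_copula.Gn Q (A k) n xs) u\<bar> \<le> e / 2)"
    using cond_copula.chained_delta_method[OF cc e2] by (intro eventually_ball_finite) auto
  then show ?thesis using eventually_gt_at_top[of 0]
  proof eventually_elim
    case (elim n)
    show ?case
    proof (intro ballI)
      fix \<omega> t i assume w: "\<omega> \<in> space P - bad n N1 K - null_set" and t: "t \<in> TT" and "i \<in> II"
      then obtain j k where i: "i = (j, k)" and j: "j \<le> M" and k: "k < m" by auto
      interpret c: cond_copula Q "A k" by (rule cc[OF k])
      note n = elim(2)
      have ch: "chained 1 N1 (lg n) (\<lambda>u. xe n \<omega> (j, k, u))" and gr: "\<And>a. a \<in> grid N1 \<Longrightarrow> \<bar>xe n \<omega> (j, k, a)\<bar> \<le> K" if "j \<le> M" for j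
        using w k that unfolding bad_def by (auto simp: not_less)
      have z: "c.orth (vupd onevec i 0) (data \<omega> l) = 0" for i l
        using w k unfolding null_set_def by (auto simp: f_def)
      have D: "\<forall>u\<in>cube. \<bar>sqrt (real n) * (Cbar n (data \<omega>) (A k) u - condcop Q (A k) u) - Cinf_formula Q (A k) (c.Gn n (data \<omega>)) u\<bar> \<le> e / 2"
      proof -
        have "chained 2 N1 (lg n) (c.Gn n (data \<omega>))"
          using chained_mono[OF ch[of 0], of 2] by (simp add: Gn_data[OF k n, abs_def])
        moreover have "\<forall>a\<in>grid N1. \<bar>c.Gn n (data \<omega>) a\<bar> \<le> 2 * \<bar>K\<bar>"
          unfolding Gn_data[OF k n] using gr[of 0] by (force intro: order_trans)
        moreover have "\<forall>i. c.Hn n (data \<omega>) (vupd onevec i 0) = 0" by (simp add: c.Hn_def z)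
        ultimately show ?thesis using elim(1) k by blast
      qed
      have CG: "Cinf_formula Q (A k) (c.Gn n (data \<omega>)) = Cinf_formula Q (A k) (\<lambda>u. xe n \<omega> (0, k, u))"
        by (simp add: Gn_data[OF k n, abs_def])
      have u: "t j k \<in> cube" by (rule TT_nth[OF t j k])
      show "\<bar>Eproc Q A M m X Z W n \<omega> t i - Lproc Q A M m (xe n \<omega>) t i\<bar> \<le> e"
      proof (cases "j = 0")
        case True
        then show ?thesis using D[rule_format, OF u] CG t j k e
          by (simp add: i Eproc_def Lproc_def sample_def)
      next
        case False
        let ?ys = "\<lambda>l. data \<omega> (W n j l \<omega>)"
        have "chained 2 N1 (lg n) (c.Gn n ?ys)"
          using chained_add[OF ch[of 0] ch[OF j]] by (simp add: Gn_resample[OF k n False, abs_def])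
        moreover have "\<forall>a\<in>grid N1. \<bar>c.Gn n ?ys a\<bar> \<le> 2 * \<bar>K\<bar>"
        proof
          fix a :: "real^'p" assume "a \<in> grid N1"
          then have "\<bar>xe n \<omega> (0, k, a)\<bar> \<le> K" "\<bar>xe n \<omega> (j, k, a)\<bar> \<le> K" using gr[of 0] gr[OF j] by auto
          then show "\<bar>c.Gn n ?ys a\<bar> \<le> 2 * \<bar>K\<bar>" unfolding Gn_resample[OF k n False] by linarith
        qed
        moreover have "\<forall>i. c.Hn n ?ys (vupd onevec i 0) = 0" by (simp add: c.Hn_def z)
        ultimately have D': "\<forall>u\<in>cube. \<bar>sqrt (real n) * (Cbar n ?ys (A k) u - condcop Q (A k) u) - Cinf_formula Q (A k) (c.Gn n ?ys) u\<bar> \<le> e / 2"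
          using elim(1) k by blast
        \<comment> \<open>The limit formula is linear in the path, so the sample part drops out of
          the difference; the copula cancels likewise.\<close>
        have "Cinf_formula Q (A k) (c.Gn n ?ys) (t j k) - Cinf_formula Q (A k) (c.Gn n (data \<omega>)) (t j k) = Cinf_formula Q (A k) (\<lambda>u. xe n \<omega> (j, k, u)) (t j k)"
          unfolding c.Cinf_formula_diff by (simp add: Gn_resample[OF k n False] Gn_data[OF k n])
        moreover have "\<bar>sqrt (real n) * (Cbar n ?ys (A k) (t j k) - condcop Q (A k) (t j k)) - Cinf_formula Q (A k) (c.Gn n ?ys) (t j k)\<bar> \<le> e / 2"
          "\<bar>sqrt (real n) * (Cbar n (data \<omega>) (A k) (t j k) - condcop Q (A k) (t j k)) - Cinf_formula Q (A k) (c.Gn n (data \<omega>)) (t j k)\<bar> \<le> e / 2"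
          using D D' u by blast+
        ultimately have "\<bar>sqrt (real n) * (Cbar n ?ys (A k) (t j k) - Cbar n (data \<omega>) (A k) (t j k)) - Cinf_formula Q (A k) (\<lambda>u. xe n \<omega> (j, k, u)) (t j k)\<bar> \<le> e"
          unfolding right_diff_distrib by linarith
        then show ?thesis using t j k False by (simp add: i Eproc_def Lproc_def sample_def)
      qed
    qed
  qed
qed

end

section \<open>The limit measure\<close>

context boot_copula
begin

definition Lam :: real where "Lam = (\<Sum>k<m. cond_copula.lipC Q (A k))"

lemma lipC_le_Lam: "k < m \<Longrightarrow> cond_copula.lipC Q (A k) \<le> Lam"
  unfolding Lam_def using cond_copula.lipC_nonneg[OF cc] by (intro member_le_sum) auto

lemma Lam_nonneg: "0 \<le> Lam"
  unfolding Lam_def using cond_copula.lipC_nonneg[OF cc] by (intro sum_nonneg) auto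

lemma Lproc_lip:
  assumes x: "\<And>j k u. j \<le> M \<Longrightarrow> k < m \<Longrightarrow> u \<in> cube \<Longrightarrow> \<bar>x (j, k, u) - x' (j, k, u)\<bar> \<le> c" and c: "0 \<le> c"
  shows "\<bar>Lproc Q A M m x t i - Lproc Q A M m x' t i\<bar> \<le> Lam * c"
proof (cases "t \<in> TT \<and> i \<in> II")
  case True
  then obtain j k where i: "i = (j, k)" "j \<le> M" "k < m" and t: "t \<in> TT" by auto
  interpret c: cond_copula Q "A k" by (rule cc[OF i(3)])
  have "\<bar>Lproc Q A M m x t i - Lproc Q A M m x' t i\<bar> = \<bar>Cinf_formula Q (A k) (\<lambda>u. x (j, k, u) - x' (j, k, u)) (t j k)\<bar>"
    using i t by (simp add: Lproc_def c.Cinf_formula_diff)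
  also have "\<dots> \<le> c.lipC * c" by (rule c.Cinf_formula_bound[OF TT_nth[OF t i(2,3)]]) (rule x[OF i(2,3)])
  also have "\<dots> \<le> Lam * c" by (intro mult_right_mono lipC_le_Lam i c)
  finally show ?thesis .
next
  case False
  then have "Lproc Q A M m x t i = 0" "Lproc Q A M m x' t i = 0" by (auto simp: Lproc_def split: prod.splits)
  then show ?thesis using Lam_nonneg c by simp
qed

lemma Lproc_zero: "Lproc Q A M m (\<lambda>_. 0) t i = 0"
  by (auto simp: Lproc_def Cinf_formula_def split: prod.splits)

lemma Lproc_space:
  assumes x: "\<And>j k u. j \<le> M \<Longrightarrow> k < m \<Longrightarrow> u \<in> cube \<Longrightarrow> \<bar>x (j, k, u)\<bar> \<le> c"
  shows "Lproc Q A M m x \<in> linf_space TT II"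
  unfolding linf_space_def
proof (intro CollectI conjI allI impI)
  show "Lproc Q A M m x t i = 0" if "t \<notin> TT \<or> i \<notin> II" for t i
    using that by (auto simp: Lproc_def split: prod.splits)
  have "\<bar>Lproc Q A M m x t i\<bar> \<le> Lam * \<bar>c\<bar>" for t i
  proof -
    have "\<bar>Lproc Q A M m x t i - Lproc Q A M m (\<lambda>_. 0) t i\<bar> \<le> Lam * \<bar>c\<bar>"
    proof (rule Lproc_lip)
      fix j k u assume "j \<le> M" "k < m" "u \<in> (cube :: (real^'p) set)"
      from x[OF this] show "\<bar>x (j, k, u) - 0\<bar> \<le> \<bar>c\<bar>" by linarith
    qed simp
    then show ?thesis by (simp add: Lproc_zero)
  qed
  then show "\<exists>B. \<forall>t\<in>TT. \<forall>i\<in>II. \<bar>Lproc Q A M m x t i\<bar> \<le> B" by blast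
qed

lemma Eproc_space: "Eproc Q A M m X Z W n \<omega> \<in> linf_space TT II"
  unfolding linf_space_def
proof (intro CollectI conjI allI impI)
  show "Eproc Q A M m X Z W n \<omega> t i = 0" if "t \<notin> TT \<or> i \<notin> II" for t i
    using that by (auto simp: Eproc_def split: prod.splits)
  define b where "b k = \<bar>real n / (real n * phat n (sample X Z \<omega>) (A k))\<bar>" for k
  define b' where "b' j k = \<bar>real n / (real n * phat n (\<lambda>l. sample X Z \<omega> (W n j l \<omega>)) (A k))\<bar>" for j k
  define B where "B i = sqrt (real n) * (b (snd i) + 1 + b' (fst i) (snd i))" for i
  have b0: "0 \<le> b k" "0 \<le> b' j k" for j k by (simp_all add: b_def b'_def)
  have B0: "0 \<le> B i" for i using b0 by (simp add: B_def add_nonneg_nonneg)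
  have "\<bar>Eproc Q A M m X Z W n \<omega> t i\<bar> \<le> B i" if t: "t \<in> TT" and i: "i \<in> II" for t i
  proof -
    obtain j k where i': "i = (j, k)" "j \<le> M" "k < m" using i by auto
    interpret c: cond_copula Q "A k" by (rule cc[OF i'(3)])
    have C: "\<bar>condcop Q (A k) (t 0 k)\<bar> \<le> 1" using c.condcop_bounds[OF TT_nth[OF t _ i'(3), of 0]] by auto
    have C1: "\<bar>Cbar n (sample X Z \<omega>) (A k) u\<bar> \<le> b k" for u unfolding b_def by (rule abs_Cbar_le)
    have C2: "\<bar>Cbar n (\<lambda>l. sample X Z \<omega> (W n j l \<omega>)) (A k) u\<bar> \<le> b' j k" for u unfolding b'_def by (rule abs_Cbar_le)
    show ?thesis
    proof (cases "j = 0")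
      case True
      have "\<bar>Cbar n (sample X Z \<omega>) (A k) (t 0 k) - condcop Q (A k) (t 0 k)\<bar> \<le> b k + 1 + b' j k"
        using C C1[of "t 0 k"] b0(2)[of j k] by linarith
      then show ?thesis using t i' True by (simp add: Eproc_def B_def abs_mult mult_left_mono)
    next
      case False
      have "\<bar>Cbar n (\<lambda>l. sample X Z \<omega> (W n j l \<omega>)) (A k) (t j k) - Cbar n (sample X Z \<omega>) (A k) (t j k)\<bar> \<le> b k + 1 + b' j k"
        using C1[of "t j k"] C2[of "t j k"] by linarith
      then show ?thesis using t i' False by (simp add: Eproc_def B_def abs_mult mult_left_mono)
    qed
  qed
  moreover have "B i \<le> (\<Sum>i\<in>II. B i)" if "i \<in> II" for i using that B0 by (intro member_le_sum) auto
  ultimately show "\<exists>B. \<forall>t\<in>TT. \<forall>i\<in>II. \<bar>Eproc Q A M m X Z W n \<omega> t i\<bar> \<le> B" by (meson order_trans)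
qed

text \<open>A condition on uncountably many coordinates, so it is imposed by restricting the space
  instead of being asserted almost surely. On \<open>Sp\<close>, for every path,
  \<open>Lproc\<close> is bounded and is a uniform limit of maps that depend on finitely many
  coordinates.\<close>

definition Sp :: "(nat \<times> nat \<times> (real^'p) \<Rightarrow> real) set" where
  "Sp = {w. \<forall>j\<le>M. \<forall>k<m. \<forall>e>0. \<exists>N0. \<forall>N\<ge>N0. \<forall>u\<in>cube. \<bar>w (j, k, u) - w (j, k, prj N u)\<bar> \<le> e}"

definition Mpath :: "(nat \<times> nat \<times> (real^'p) \<Rightarrow> real) measure" where
  "Mpath = restrict_space (Pi\<^sub>M UNIV (\<lambda>_. borel)) Sp"

definition Tm :: "(nat \<times> nat \<Rightarrow> real) \<Rightarrow> nat \<times> nat \<times> (real^'p) \<Rightarrow> real" where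
  "Tm \<omega> = (\<lambda>(j, k, u). if j \<le> M then bl.path (\<lambda>l. \<omega> (j, l)) (k, u) else 0)"

definition LQ :: "(nat \<times> nat \<times> (real^'p) \<Rightarrow> real) measure" where
  "LQ = distr noise Mpath Tm"

lemma Tm_Sp: "Tm \<omega> \<in> Sp"
  unfolding Sp_def
proof (intro CollectI allI impI)
  fix j k and e :: real assume j: "j \<le> M" and k: "k < m" and e: "e > 0"
  let ?x = "\<lambda>l. \<omega> (j, l)"
  show "\<exists>N0. \<forall>N\<ge>N0. \<forall>u\<in>cube. \<bar>Tm \<omega> (j, k, u) - Tm \<omega> (j, k, prj N u)\<bar> \<le> e"
  proof (cases "bl.good ?x")
    case True
    obtain N0 where N0: "\<And>N u. N \<ge> N0 \<Longrightarrow> u \<in> cube \<Longrightarrow> \<bar>bl.path ?x (k, u) - bl.raw ?x (k, prj N u)\<bar> \<le> \<tau> N"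
      using bl.path_raw[OF True k] by blast
    have "\<forall>\<^sub>F N in sequentially. \<tau> N < e" using order_tendstoD(2)[OF tau_tendsto e] .
    then obtain N1 where N1: "\<And>N. N \<ge> N1 \<Longrightarrow> \<tau> N < e" by (auto simp: eventually_sequentially)
    show ?thesis
    proof (intro exI[of _ "max N0 N1"] allI impI ballI)
      fix N u assume N: "max N0 N1 \<le> N" and u: "u \<in> (cube :: (real^'p) set)"
      have "bl.path ?x (k, prj N u) = bl.raw ?x (k, prj N u)" by (rule bl.path_grid[OF True k prj_grid[OF u]])
      then show "\<bar>Tm \<omega> (j, k, u) - Tm \<omega> (j, k, prj N u)\<bar> \<le> e"
        using N0[of N u] N1[of N] N u j by (simp add: Tm_def)
    qed
  next
    case False
    then show ?thesis using e by (simp add: Tm_def bl.path_def)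
  qed
qed

lemma space_Mpath: "space Mpath = Sp"
  by (simp add: Mpath_def space_restrict_space space_PiM)

lemma Tm_measurable[measurable]: "Tm \<in> measurable noise Mpath"
  unfolding Mpath_def
proof (rule measurable_restrict_space2)
  show "Tm \<in> space noise \<rightarrow> Sp" using Tm_Sp by auto
  show "Tm \<in> measurable noise (Pi\<^sub>M UNIV (\<lambda>_. borel))"
  proof (rule measurable_PiM_single')
    fix s :: "nat \<times> nat \<times> (real^'p)"
    obtain j k u where s: "s = (j, k, u)" by (cases s)
    show "(\<lambda>\<omega>. Tm \<omega> s) \<in> borel_measurable noise"
      using measurable_compose[OF bl.copy_measurable bl.path_measurable, of j "(k, u)"] by (simp add: s Tm_def)
  qed auto
qed

lemma prob_space_LQ: "prob_space LQ"
  unfolding LQ_def by (rule noise.prob_space_distr) measurable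

lemma space_LQ: "space LQ = Sp" by (simp add: LQ_def space_Mpath)

lemma coord_Mpath[measurable]: "(\<lambda>w. w s) \<in> borel_measurable Mpath"
  unfolding Mpath_def by (rule measurable_restrict_space1) measurable

lemma coord_LQ[measurable]: "(\<lambda>w. w s) \<in> borel_measurable LQ"
  unfolding LQ_def by simp

lemma LQ_gaussian:
  assumes j: "j \<le> M"
  shows "centered_gaussian_family LQ ({..<m} \<times> cube) (\<lambda>ku \<omega>. \<omega> (j, fst ku, snd ku))
     (\<lambda>ku kv. Bcov Q (A (fst ku)) (A (fst kv)) (snd ku) (snd kv))"
  unfolding centered_gaussian_family_def
proof (intro conjI ballI allI impI)
  show "(\<lambda>\<omega>. \<omega> (j, fst s, snd s)) \<in> borel_measurable LQ" for s by (rule coord_LQ)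
  fix F :: "(nat \<times> (real^'p)) set" and c :: "nat \<times> (real^'p) \<Rightarrow> real" and \<theta> assume F: "finite F" "F \<subseteq> {..<m} \<times> cube"
  have lin: "(\<lambda>w. \<Sum>s\<in>F. c s * w (j, fst s, snd s)) \<in> borel_measurable Mpath" by measurable
  have "char (distr LQ borel (\<lambda>w. \<Sum>s\<in>F. c s * w (j, fst s, snd s))) \<theta>
      = (\<integral>\<omega>. exp (\<i> * complex_of_real (\<theta> * (\<Sum>s\<in>F. c s * Tm \<omega> (j, fst s, snd s)))) \<partial>noise)"
    unfolding char_def LQ_def using lin
    by (subst integral_distr) (simp_all, subst integral_distr, auto)
  also have "\<dots> = (\<integral>\<omega>. exp (\<i> * complex_of_real (\<theta> * (\<Sum>s\<in>F. c s * bl.path (\<lambda>l. \<omega> (j, l)) s))) \<partial>noise)"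
    using j by (simp add: Tm_def)
  also have "\<dots> = complex_of_real (exp (- (\<theta>\<^sup>2 / 2) * (\<Sum>s\<in>F. \<Sum>s'\<in>F. c s * c s' * bl.cov s s')))"
    by (rule bl.path_gaussian[OF F])
  also have "(\<Sum>s\<in>F. \<Sum>s'\<in>F. c s * c s' * bl.cov s s')
      = (\<Sum>s\<in>F. \<Sum>s'\<in>F. c s * c s' * Bcov Q (A (fst s)) (A (fst s')) (snd s) (snd s'))"
  proof (intro sum.cong refl)
    fix s s' assume "s \<in> F" "s' \<in> F"
    then have "fst s < m" "fst s' < m" using F(2) by auto
    then show "c s * c s' * bl.cov s s' = c s * c s' * Bcov Q (A (fst s)) (A (fst s')) (snd s) (snd s')"
      using cov_eq_Bcov[of "fst s" "fst s'" "snd s" "snd s'"] by simp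
  qed
  finally show "char (distr LQ borel (\<lambda>w. \<Sum>s\<in>F. c s * w (j, fst s, snd s))) \<theta>
    = complex_of_real (exp (- (\<theta>\<^sup>2 / 2) * (\<Sum>s\<in>F. \<Sum>s'\<in>F. c s * c s' * Bcov Q (A (fst s)) (A (fst s')) (snd s) (snd s'))))" .
qed

text \<open>Distinct copies read disjoint rows of \<open>noise\<close>; independence of the rows
  passes through the path construction and then to the image measure.\<close>

lemma LQ_indep:
  "prob_space.indep_vars LQ (\<lambda>_. Pi\<^sub>M UNIV (\<lambda>_. borel)) (\<lambda>j \<omega>. \<lambda>ku. \<omega> (j, fst ku, snd ku)) {..M}"
proof -
  let ?K = "\<lambda>j. {j} \<times> (UNIV :: nat set)"
  have r: "noise.indep_vars (\<lambda>j. Pi\<^sub>M (?K j) (\<lambda>_. borel)) (\<lambda>j \<omega>. restrict (\<lambda>i. \<omega> i) (?K j)) {..M}"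
    by (rule noise.indep_vars_restrict[OF noise_indep]) (auto simp: disjoint_family_on_def)
  have c: "(\<lambda>x l. x (j, l)) \<in> measurable (Pi\<^sub>M (?K j) (\<lambda>_. borel :: real measure)) (Pi\<^sub>M UNIV (\<lambda>_. borel))" for j :: nat
    by (rule measurable_PiM_single') auto
  have "noise.indep_vars (\<lambda>_. Pi\<^sub>M UNIV (\<lambda>_. borel)) (\<lambda>j \<omega>. (\<lambda>ku. bl.path (\<lambda>l. restrict (\<lambda>i. \<omega> i) (?K j) (j, l)) ku)) {..M}"
  proof (rule noise.indep_vars_compose2[OF r, where Y="\<lambda>j x ku. bl.path (\<lambda>l. x (j, l)) ku"])
    show "(\<lambda>x ku. bl.path (\<lambda>l. x (j, l)) ku) \<in> measurable (Pi\<^sub>M (?K j) (\<lambda>_. borel)) (Pi\<^sub>M UNIV (\<lambda>_. borel))" for j :: nat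
      using measurable_compose[OF c bl.path_measurable] by (intro measurable_PiM_single') auto
  qed
  then have ind: "noise.indep_vars (\<lambda>_. Pi\<^sub>M UNIV (\<lambda>_. borel)) (\<lambda>j \<omega>. (\<lambda>ku. Tm \<omega> (j, fst ku, snd ku))) {..M}"
    by (rule noise.indep_vars_cong[THEN iffD1, rotated -1]) (auto simp: Tm_def)
  have c': "(\<lambda>\<omega> ku. \<omega> (i, fst ku, snd ku)) \<in> measurable Mpath (Pi\<^sub>M UNIV (\<lambda>_. borel))" for i
    by (rule measurable_PiM_single') auto
  show ?thesis unfolding LQ_def
    by (rule noise.indep_vars_distr[where X="\<lambda>j w ku. w (j, fst ku, snd ku)", OF Tm_measurable c' _ ind]) simp
qed

lemma Sp_uniform:
  assumes w: "w \<in> Sp" and e: "e > 0"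
  shows "\<forall>\<^sub>F N in sequentially. \<forall>j\<in>{..M}. \<forall>k\<in>{..<m}. \<forall>u\<in>cube. \<bar>w (j, k, u) - w (j, k, prj N u)\<bar> \<le> e"
proof -
  have 1: "\<forall>\<^sub>F N in sequentially. \<forall>u\<in>cube. \<bar>w (j, k, u) - w (j, k, prj N u)\<bar> \<le> e" if "j \<le> M" "k < m" for j k
    using w e that unfolding Sp_def eventually_sequentially by blast
  have "\<forall>\<^sub>F N in sequentially. \<forall>k\<in>{..<m}. \<forall>u\<in>cube. \<bar>w (j, k, u) - w (j, k, prj N u)\<bar> \<le> e" if "j \<le> M" for j
    by (rule eventually_ball_finite) (use 1 that in auto)
  then show ?thesis by (intro eventually_ball_finite[of "{..M}"]) auto
qed

text \<open>A single approximation level with error 1 reduces boundedness to finitely many grid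
  values.\<close>

lemma Sp_bounded:
  assumes w: "w \<in> Sp"
  obtains c where "\<And>j k u. j \<le> M \<Longrightarrow> k < m \<Longrightarrow> u \<in> cube \<Longrightarrow> \<bar>w (j, k, u)\<bar> \<le> c"
proof -
  obtain N where N: "\<forall>j\<in>{..M}. \<forall>k\<in>{..<m}. \<forall>u\<in>cube. \<bar>w (j, k, u) - w (j, k, prj N u)\<bar> \<le> 1"
    using eventually_happens'[OF _ Sp_uniform[OF w, of 1]] by auto
  define S where "S = {..M} \<times> {..<m} \<times> (grid N :: (real^'p) set)"
  have S: "finite S" by (simp add: S_def)
  show ?thesis
  proof (rule that[of "(\<Sum>s\<in>S. \<bar>w s\<bar>) + 1"])
    fix j k u assume h: "j \<le> M" "k < m" "u \<in> (cube :: (real^'p) set)"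
    have "\<bar>w (j, k, prj N u)\<bar> \<le> (\<Sum>s\<in>S. \<bar>w s\<bar>)"
      using h prj_grid[of u N] S by (intro member_le_sum[of _ S "\<lambda>s. \<bar>w s\<bar>"]) (auto simp: S_def)
    moreover have "\<bar>w (j, k, u) - w (j, k, prj N u)\<bar> \<le> 1" using N h by auto
    ultimately show "\<bar>w (j, k, u)\<bar> \<le> (\<Sum>s\<in>S. \<bar>w s\<bar>) + 1" by linarith
  qed
qed

section \<open>Discretisation at finitely many points\<close>

definition Fin :: "nat \<Rightarrow> (nat \<times> nat \<times> (nat^'p)) set" where
  "Fin N = {..M} \<times> {..<m} \<times> cgrid N"

text \<open>Padded with 0 outside \<open>Fin N\<close>, since the Cramer--Wold theorem works with
  functions on the whole index type that vanish off a finite set.\<close>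

definition Vn :: "nat \<Rightarrow> (nat \<times> nat \<times> (real^'p) \<Rightarrow> real) \<Rightarrow> nat \<times> nat \<times> (nat^'p) \<Rightarrow> real" where
  "Vn N x s = (if s \<in> Fin N then x (fst s, fst (snd s), pt N (snd (snd s))) else 0)"

definition dis :: "nat \<Rightarrow> (nat \<times> nat \<times> (nat^'p) \<Rightarrow> real) \<Rightarrow> nat \<times> nat \<times> (real^'p) \<Rightarrow> real" where
  "dis N y = (\<lambda>(j, k, u). y (j, k, flr N u))"

text \<open>For \<open>y = Vn N x\<close> this is \<open>Lproc\<close> at the step path that freezes
  \<open>x\<close> at its projections. Being a Lipschitz map of finitely many reals, it links the
  sup norm with finite-dimensional convergence.\<close>

definition LN :: "nat \<Rightarrow> (nat \<times> nat \<times> (nat^'p) \<Rightarrow> real) \<Rightarrow> (nat \<Rightarrow> nat \<Rightarrow> real^'p) \<Rightarrow> nat \<times> nat \<Rightarrow> real" where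
  "LN N y = Lproc Q A M m (dis N y)"

lemma finite_Fin[simp]: "finite (Fin N)" by (simp add: Fin_def)

lemma dis_Vn: "j \<le> M \<Longrightarrow> k < m \<Longrightarrow> u \<in> cube \<Longrightarrow> dis N (Vn N x) (j, k, u) = x (j, k, prj N u)"
  by (simp add: dis_def Vn_def Fin_def flr_cgrid prj_def)

lemma LN_lip: "\<bar>LN N y t i - LN N y' t i\<bar> \<le> Lam * (\<Sum>s\<in>Fin N. \<bar>y s - y' s\<bar>)"
  unfolding LN_def
proof (rule Lproc_lip)
  fix j k u assume "j \<le> M" "k < m" "u \<in> (cube :: (real^'p) set)"
  then have "(j, k, flr N u) \<in> Fin N" by (simp add: Fin_def flr_cgrid)
  then show "\<bar>dis N y (j, k, u) - dis N y' (j, k, u)\<bar> \<le> (\<Sum>s\<in>Fin N. \<bar>y s - y' s\<bar>)"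
    unfolding dis_def by (simp add: member_le_sum[of _ "Fin N" "\<lambda>s. \<bar>y s - y' s\<bar>"])
qed (simp add: sum_nonneg)

lemma LN_space: "LN N y \<in> linf_space TT II"
  unfolding LN_def
proof (rule Lproc_space)
  fix j k u assume "j \<le> M" "k < m" "u \<in> (cube :: (real^'p) set)"
  then have "(j, k, flr N u) \<in> Fin N" by (simp add: Fin_def flr_cgrid)
  then show "\<bar>dis N y (j, k, u)\<bar> \<le> (\<Sum>s\<in>Fin N. \<bar>y s\<bar>)"
    unfolding dis_def by (simp add: member_le_sum[of _ "Fin N" "\<lambda>s. \<bar>y s\<bar>"])
qed

lemma LN_Vn_close:
  assumes "\<And>j k u. j \<le> M \<Longrightarrow> k < m \<Longrightarrow> u \<in> cube \<Longrightarrow> \<bar>x (j, k, u) - x (j, k, prj N u)\<bar> \<le> c" "0 \<le> c"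
  shows "\<bar>Lproc Q A M m x t i - LN N (Vn N x) t i\<bar> \<le> Lam * c"
  unfolding LN_def using assms by (intro Lproc_lip) (auto simp: dis_Vn)

lemma TT_ne: "TT \<noteq> {}"
proof -
  have "(\<lambda>_ _. 0) \<in> TT" by (simp add: Tset_def)
  then show ?thesis by auto
qed

lemma Vn_measurable[measurable]: "(\<And>s. (\<lambda>\<omega>. x \<omega> s) \<in> borel_measurable N') \<Longrightarrow> (\<lambda>\<omega>. Vn N (x \<omega>) s) \<in> borel_measurable N'"
  by (cases "s \<in> Fin N") (auto simp: Vn_def)

lemma Lproc_xe_space: "w \<in> Sp \<Longrightarrow> Lproc Q A M m w \<in> linf_space TT II"
proof -
  assume w: "w \<in> Sp"
  obtain c where c: "\<And>j k u. j \<le> M \<Longrightarrow> k < m \<Longrightarrow> u \<in> cube \<Longrightarrow> \<bar>w (j, k, u)\<bar> \<le> c"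
    by (rule Sp_bounded[OF w]) blast
  show ?thesis by (rule Lproc_space[where x=w and c=c]) (rule c)
qed

text \<open>By linearity a combination of values of \<open>xe\<close> with the same \<open>j\<close>
  is the same process at one bounded function, which is the input of \<open>joint_clt\<close>. The
  value 0 for j > M keeps one bound for all \<open>j\<close>.\<close>

definition phi :: "(nat \<times> nat \<times> (nat^'p) \<Rightarrow> real) \<Rightarrow> nat \<Rightarrow> nat \<Rightarrow> (real^'p) \<times> 'z \<Rightarrow> real" where
  "phi t N j y = (if j \<le> M then \<Sum>g\<in>{..<m} \<times> cgrid N. t (j, g) * f (fst g) (pt N (snd g)) y else 0)"

lemma phi_measurable[measurable]: "phi t N j \<in> borel_measurable borel"
  unfolding phi_def by measurable

lemma phi_bound: "\<bar>phi t N j y\<bar> \<le> (\<Sum>j\<le>M. \<Sum>g\<in>{..<m} \<times> cgrid N. \<bar>t (j, g)\<bar>)"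
proof (cases "j \<le> M")
  case True
  have "\<bar>phi t N j y\<bar> \<le> (\<Sum>g\<in>{..<m} \<times> cgrid N. \<bar>t (j, g)\<bar> * 1)"
    unfolding phi_def using True by (auto simp: abs_mult f_abs intro!: order_trans[OF sum_abs] sum_mono mult_left_le)
  also have "\<dots> \<le> (\<Sum>j\<le>M. \<Sum>g\<in>{..<m} \<times> cgrid N. \<bar>t (j, g)\<bar>)"
    using True member_le_sum[of j "{..M}" "\<lambda>j. \<Sum>g\<in>{..<m} \<times> cgrid N. \<bar>t (j, g)\<bar>"] by (simp add: sum_nonneg)
  finally show ?thesis .
qed (simp add: phi_def sum_nonneg)

lemma xe_linear:
  assumes j: "j \<le> M"
  shows "(\<Sum>g\<in>{..<m} \<times> cgrid N. t (j, g) * xe n \<omega> (j, fst g, pt N (snd g)))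
     = (if j = 0 then emp_proc n (phi t N j) \<omega> else boot_proc n j (phi t N j) \<omega>)"
proof -
  let ?G = "{..<m} \<times> (cgrid N :: (nat^'p) set)"
  have pj: "phi t N j = (\<lambda>y. \<Sum>g\<in>?G. t (j, g) * f (fst g) (pt N (snd g)) y)" using j by (simp add: phi_def fun_eq_iff)
  have "integrable P (\<lambda>\<omega>. f k u (X i \<omega>, Z i \<omega>))" for k u i
    by (rule integrable_fun_Y[OF f_measurable, where K=1]) (simp add: f_abs)
  then have mean: "mean (phi t N j) = (\<Sum>g\<in>?G. t (j, g) * mean (f (fst g) (pt N (snd g))))"
    unfolding mean_def pj by simp
  have avg: "emp_avg n (phi t N j) z = (\<Sum>g\<in>?G. t (j, g) * emp_avg n (f (fst g) (pt N (snd g))) z)" for z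
    unfolding emp_avg_def pj by (subst sum.swap) (simp add: sum_distrib_left sum_divide_distrib)
  have lin: "(\<Sum>i<n. (\<Sum>g\<in>?G. c g * a g i) - (\<Sum>g\<in>?G. c g * b g)) / s = (\<Sum>g\<in>?G. c g * ((\<Sum>i<n. a g i - b g) / s))"
    for c b :: "nat \<times> (nat^'p) \<Rightarrow> real" and a s
  proof -
    have "(\<Sum>i<n. (\<Sum>g\<in>?G. c g * a g i) - (\<Sum>g\<in>?G. c g * b g)) = (\<Sum>i<n. \<Sum>g\<in>?G. c g * (a g i - b g))"
      by (simp add: sum_subtractf right_diff_distrib)
    also have "\<dots> = (\<Sum>g\<in>?G. c g * (\<Sum>i<n. a g i - b g))" by (subst sum.swap) (simp add: sum_distrib_left)
    finally have E: "(\<Sum>i<n. (\<Sum>g\<in>?G. c g * a g i) - (\<Sum>g\<in>?G. c g * b g)) = (\<Sum>g\<in>?G. c g * (\<Sum>i<n. a g i - b g))" .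
    show ?thesis unfolding E sum_divide_distrib[of "\<lambda>g. c g * (\<Sum>i<n. a g i - b g)"] by (simp only: times_divide_eq_right)
  qed
  show ?thesis
  proof (cases "j = 0")
    case True
    then show ?thesis unfolding emp_proc_def mean unfolding pj xe_def
      by (simp add: lin emp_proc_def del: sum_subtractf)
  next
    case False
    then show ?thesis unfolding boot_proc_def avg unfolding pj xe_def
      by (simp add: lin boot_proc_def del: sum_subtractf)
  qed
qed

lemma Fin_sum: "(\<Sum>s\<in>Fin N. t s * Vn N x s) = (\<Sum>j\<le>M. \<Sum>g\<in>{..<m} \<times> cgrid N. t (j, g) * x (j, fst g, pt N (snd g)))"
proof -
  have "(\<Sum>s\<in>Fin N. t s * Vn N x s) = (\<Sum>s\<in>{..M} \<times> ({..<m} \<times> cgrid N). t (fst s, snd s) * x (fst s, fst (snd s), pt N (snd (snd s))))"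
    unfolding Fin_def by (intro sum.cong) (auto simp: Vn_def Fin_def)
  then show ?thesis by (simp add: sum.cartesian_product case_prod_beta)
qed

text \<open>The limit on the left comes from \<open>joint_clt\<close>, the right side from the
  independent normals; the variances agree because both are the quadratic form of
  \<open>bl.cov\<close>.\<close>

lemma char_limit:
  "(\<lambda>n. \<integral>\<omega>. exp (\<i> * complex_of_real (\<Sum>s\<in>Fin N. t s * Vn N (xe n \<omega>) s)) \<partial>P)
     \<longlonglongrightarrow> (\<integral>w. exp (\<i> * complex_of_real (\<Sum>s\<in>Fin N. t s * Vn N w s)) \<partial>LQ)"
proof -
  let ?G = "{..<m} \<times> (cgrid N :: (nat^'p) set)"
  let ?\<gamma> = "\<lambda>g :: nat \<times> (nat^'p). (fst g, pt N (snd g) :: real^'p)"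
  have M0: "{..M} = insert 0 {1..M}" by auto
  have lin: "(\<Sum>s\<in>Fin N. t s * Vn N (xe n \<omega>) s) = emp_proc n (phi t N 0) \<omega> + (\<Sum>j\<in>{1..M}. boot_proc n j (phi t N j) \<omega>)" for n \<omega>
  proof -
    have "(\<Sum>s\<in>Fin N. t s * Vn N (xe n \<omega>) s) = (\<Sum>j\<le>M. if j = 0 then emp_proc n (phi t N j) \<omega> else boot_proc n j (phi t N j) \<omega>)"
      unfolding Fin_sum by (intro sum.cong refl xe_linear) simp
    also have "\<dots> = emp_proc n (phi t N 0) \<omega> + (\<Sum>j\<in>{1..M}. boot_proc n j (phi t N j) \<omega>)"
      unfolding M0 by (subst sum.insert) (auto intro!: sum.cong)
    finally show ?thesis .
  qed
  have gi: "?\<gamma> g \<in> bl.idx_set" if "g \<in> ?G" for g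
  proof -
    have "pt N (snd g) \<in> grid N" using that by (auto simp: grid_def)
    then show ?thesis by (auto simp: bl.idx_set_def dyadics_def)
  qed
  have var: "mean (\<lambda>y. (phi t N j y)\<^sup>2) - (mean (phi t N j))\<^sup>2 = (\<Sum>g\<in>?G. \<Sum>g'\<in>?G. t (j, g) * t (j, g') * bl.cov (?\<gamma> g) (?\<gamma> g'))" if "j \<le> M" for j
  proof -
    have pj: "phi t N j y = (\<Sum>g\<in>?G. t (j, g) * bl.ff (?\<gamma> g) y)" for y using that by (simp add: phi_def)
    have "mean (\<lambda>y. (phi t N j y)\<^sup>2) = (\<integral>y. (phi t N j y)\<^sup>2 \<partial>Q)" "mean (phi t N j) = (\<integral>y. phi t N j y \<partial>Q)"
      by (rule mean_eq, measurable)+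
    then show ?thesis using bl.cov_quadratic_form[of ?G "\<lambda>g. t (j, g)" ?\<gamma>] by (simp add: pj)
  qed
  have "(\<integral>w. exp (\<i> * complex_of_real (\<Sum>s\<in>Fin N. t s * Vn N w s)) \<partial>LQ)
      = (\<integral>\<omega>. exp (\<i> * complex_of_real (\<Sum>s\<in>Fin N. t s * Vn N (Tm \<omega>) s)) \<partial>noise)"
    unfolding LQ_def by (rule integral_distr) measurable
  also have "\<dots> = (\<integral>\<omega>. exp (\<i> * complex_of_real (\<Sum>j\<in>{..M}. \<Sum>g\<in>?G. t (j, g) * bl.raw (\<lambda>l. \<omega> (j, l)) (?\<gamma> g))) \<partial>noise)"
  proof (rule integral_cong_AE)
    have "AE \<omega> in noise. \<forall>j\<in>{..M}. bl.good (\<lambda>l. \<omega> (j, l))"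
      by (intro AE_finite_allI bl.AE_good) simp
    then show "AE \<omega> in noise. exp (\<i> * complex_of_real (\<Sum>s\<in>Fin N. t s * Vn N (Tm \<omega>) s))
       = exp (\<i> * complex_of_real (\<Sum>j\<in>{..M}. \<Sum>g\<in>?G. t (j, g) * bl.raw (\<lambda>l. \<omega> (j, l)) (?\<gamma> g)))"
    proof eventually_elim
      case (elim \<omega>)
      have "Tm \<omega> (j, fst g, pt N (snd g)) = bl.raw (\<lambda>l. \<omega> (j, l)) (?\<gamma> g)" if "j \<in> {..M}" "g \<in> ?G" for j g
        using elim that bl.path_grid[of "\<lambda>l. \<omega> (j, l)" "fst g" "pt N (snd g)" N] by (auto simp: Tm_def grid_def)
      then show ?case unfolding Fin_sum by simp
    qed
    show "(\<lambda>\<omega>. exp (\<i> * complex_of_real (\<Sum>s\<in>Fin N. t s * Vn N (Tm \<omega>) s))) \<in> borel_measurable noise"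
      using measurable_compose[OF Tm_measurable coord_Mpath] by measurable
  qed measurable
  also have "\<dots> = complex_of_real (exp (- (\<Sum>j\<in>{..M}. \<Sum>g\<in>?G. \<Sum>g'\<in>?G. t (j, g) * t (j, g') * bl.cov (?\<gamma> g) (?\<gamma> g')) / 2))"
    by (rule bl.raw_joint_char[where c="\<lambda>j g. t (j, g)"]) (use gi in auto)
  also have "\<dots> = complex_of_real (exp (- (\<Sum>j\<le>M. mean (\<lambda>y. (phi t N j y)\<^sup>2) - (mean (phi t N j))\<^sup>2) / 2))"
    by (simp add: var)
  finally have R: "(\<integral>w. exp (\<i> * complex_of_real (\<Sum>s\<in>Fin N. t s * Vn N w s)) \<partial>LQ)
      = complex_of_real (exp (- (\<Sum>j\<le>M. mean (\<lambda>y. (phi t N j y)\<^sup>2) - (mean (phi t N j))\<^sup>2) / 2))" .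
  show ?thesis unfolding lin R by (rule joint_clt[OF phi_measurable phi_bound])
qed

text \<open>A phase-shifted cosine is the real part of a rotated exponential; this passes from
  characteristic functions to the test functions of the Cramer--Wold theorem.\<close>

lemma integral_cos_eq:
  assumes N: "prob_space N'" and [measurable]: "x \<in> borel_measurable N'"
  shows "(\<integral>\<omega>. cos (x \<omega> + b) \<partial>N') = Re (exp (\<i> * complex_of_real b) * (\<integral>\<omega>. exp (\<i> * complex_of_real (x \<omega>)) \<partial>N'))"
proof -
  interpret N: prob_space N' by fact
  have i: "integrable N' (\<lambda>\<omega>. exp (\<i> * complex_of_real (x \<omega>)))"
    by (rule N.integrable_const_bound[where B=1]) auto
  have "cos (x \<omega> + b) = Re (exp (\<i> * complex_of_real b) * exp (\<i> * complex_of_real (x \<omega>)))" for \<omega>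
  proof -
    have e: "exp (\<i> * complex_of_real b) * exp (\<i> * complex_of_real (x \<omega>)) = cis (x \<omega> + b)"
      by (simp add: cis_conv_exp exp_add[symmetric] algebra_simps)
    show ?thesis unfolding e by simp
  qed
  then have "(\<integral>\<omega>. cos (x \<omega> + b) \<partial>N') = (\<integral>\<omega>. Re (exp (\<i> * complex_of_real b) * exp (\<i> * complex_of_real (x \<omega>))) \<partial>N')" by simp
  also have "\<dots> = Re (\<integral>\<omega>. exp (\<i> * complex_of_real b) * exp (\<i> * complex_of_real (x \<omega>)) \<partial>N')"
    using i by (intro integral_Re) simp
  finally show ?thesis using i by simp
qed

lemma fidi_convergence:
  fixes g :: "(nat \<times> nat \<times> (nat^'p) \<Rightarrow> real) \<Rightarrow> real"
  assumes cont: "continuous_on UNIV g" and B: "\<And>y. \<bar>g y\<bar> \<le> B"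
  shows "(\<lambda>n. \<integral>\<omega>. g (Vn N (xe n \<omega>)) \<partial>P) \<longlonglongrightarrow> (\<integral>w. g (Vn N w) \<partial>LQ)"
proof (rule cramer_wold_finite[where F="Fin N", OF _ prob_space_LQ finite_Fin _ _ _ _ _ _ _ cont B])
  interpret LQ: prob_space LQ by (rule prob_space_LQ)
  show "prob_space P" by unfold_locales
  show mV: "(\<lambda>\<omega>. Vn N (xe n \<omega>) s) \<in> borel_measurable P" for n s by measurable
  show mV0: "(\<lambda>w. Vn N w s) \<in> borel_measurable LQ" for s by measurable
  show "Vn N (xe n \<omega>) s = 0" if "s \<notin> Fin N" for n \<omega> s using that by (simp add: Vn_def)
  show "Vn N w s = 0" if "s \<notin> Fin N" for w s using that by (simp add: Vn_def)
  show "\<exists>r\<ge>0. LQ.prob {w\<in>space LQ. \<exists>s\<in>Fin N. \<bar>Vn N w s\<bar> > r} \<le> e" if "e > 0" for e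
    by (rule LQ.finite_family_tight[OF finite_Fin mV0 that])
  show "\<exists>r\<ge>0. \<forall>\<^sub>F n in sequentially. prob {\<omega>\<in>space P. \<exists>s\<in>Fin N. \<bar>Vn N (xe n \<omega>) s\<bar> > r} \<le> e" if e: "e > 0" for e
  proof -
    \<comment> \<open>Tightness by a union bound over the grid, since the pointwise exponential
      tails do not depend on \<open>n\<close>.\<close>
    define b where "b = real (card (Fin N)) * (2 * exp 2)"
    have "((\<lambda>K::real. exp (- K)) \<longlongrightarrow> 0) at_top"
      by (intro filterlim_compose[OF exp_at_bot] filterlim_uminus_at_bot_at_top)
    then have "((\<lambda>K. b * exp (- K)) \<longlongrightarrow> 0) at_top" by (rule tendsto_mult_right_zero)
    then have "\<forall>\<^sub>F K in at_top. b * exp (- K) < e" using e by (intro order_tendstoD(2)) auto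
    then have "\<forall>\<^sub>F K in at_top. b * exp (- K) < e \<and> 0 \<le> K" using eventually_ge_at_top[of 0] by eventually_elim simp
    then obtain r where r: "b * exp (- r) < e" "r \<ge> 0" by (auto simp: eventually_at_top_linorder)
    have "\<forall>\<^sub>F n in sequentially. prob {\<omega>\<in>space P. \<exists>s\<in>Fin N. \<bar>Vn N (xe n \<omega>) s\<bar> > r} \<le> e"
      using eventually_gt_at_top[of 0]
    proof eventually_elim
      case (elim n)
      have un: "{\<omega>\<in>space P. \<exists>s\<in>Fin N. \<bar>Vn N (xe n \<omega>) s\<bar> > r} = (\<Union>s\<in>Fin N. {\<omega>\<in>space P. \<bar>Vn N (xe n \<omega>) s\<bar> > r})" by auto
      have "prob {\<omega>\<in>space P. \<exists>s\<in>Fin N. \<bar>Vn N (xe n \<omega>) s\<bar> > r} \<le> (\<Sum>s\<in>Fin N. prob {\<omega>\<in>space P. \<bar>Vn N (xe n \<omega>) s\<bar> > r})"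
        unfolding un using mV by (intro measure_UNION_le) auto
      also have "\<dots> \<le> (\<Sum>s\<in>Fin N. 2 * exp 2 * exp (- r))"
      proof (rule sum_mono)
        fix s assume s: "s \<in> Fin N"
        then have "fst s \<le> M" by (auto simp: Fin_def)
        then show "prob {\<omega>\<in>space P. \<bar>Vn N (xe n \<omega>) s\<bar> > r} \<le> 2 * exp 2 * exp (- r)"
          using xe_point_tail[where j="fst s" and n=n and k="fst (snd s)" and a="pt N (snd (snd s))" and t=r] s elim by (simp add: Vn_def)
      qed
      also have "\<dots> = b * exp (- r)" by (simp add: b_def)
      finally show ?case using r(1) by simp
    qed
    then show ?thesis using r(2) by blast
  qed
  show "(\<lambda>n. \<integral>\<omega>. cos ((\<Sum>s\<in>Fin N. t s * Vn N (xe n \<omega>) s) + b) \<partial>P)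
     \<longlonglongrightarrow> (\<integral>w. cos ((\<Sum>s\<in>Fin N. t s * Vn N w s) + b) \<partial>LQ)" for t b
  proof -
    have 1: "(\<integral>\<omega>. cos ((\<Sum>s\<in>Fin N. t s * Vn N (xe n \<omega>) s) + b) \<partial>P)
      = Re (exp (\<i> * complex_of_real b) * (\<integral>\<omega>. exp (\<i> * complex_of_real (\<Sum>s\<in>Fin N. t s * Vn N (xe n \<omega>) s)) \<partial>P))" for n
      using mV by (intro integral_cos_eq) (unfold_locales, measurable)
    have 2: "(\<integral>w. cos ((\<Sum>s\<in>Fin N. t s * Vn N w s) + b) \<partial>LQ)
      = Re (exp (\<i> * complex_of_real b) * (\<integral>w. exp (\<i> * complex_of_real (\<Sum>s\<in>Fin N. t s * Vn N w s)) \<partial>LQ))"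
      using mV0 by (intro integral_cos_eq) (unfold_locales, measurable)
    show ?thesis unfolding 1 2 by (intro tendsto_intros char_limit)
  qed
qed

end

section \<open>Weak convergence of the concatenated process\<close>

context boot_copula
begin

text \<open>With m = 0 the coordinate set is empty and \<open>linf_dist\<close> would involve a
  supremum over it, so the metric argument is confined to m > 0.\<close>

context
  assumes m_pos: "m > 0"
begin

interpretation E: linf TT II
  using TT_ne m_pos by unfold_locales auto

lemma LN_dist: "E.d (LN N y) (LN N y') \<le> Lam * (\<Sum>s\<in>Fin N. \<bar>y s - y' s\<bar>)"
  by (intro linf_dist_le E.T E.I LN_lip)

lemma continuous_LN_bound: "continuous_on UNIV (\<lambda>y. Lam * (\<Sum>s\<in>Fin N. \<bar>y s - y0 s\<bar>))"
  by (intro continuous_intros continuous_on_coordinate)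

text \<open>Lipschitz dependence on finitely many coordinates gives openness in the product
  topology, hence Borel measurability of the discretised limits.\<close>

lemma LN_open:
  assumes U: "linf_open TT II U"
  shows "open {y. LN N y \<in> U}"
proof (subst open_subopen, intro ballI)
  fix y0 assume "y0 \<in> {y. LN N y \<in> U}"
  then obtain e where e: "e > 0" "\<And>g. g \<in> E.E \<Longrightarrow> E.d (LN N y0) g < e \<Longrightarrow> g \<in> U"
    using U unfolding linf_open_def by blast
  let ?T = "{y. Lam * (\<Sum>s\<in>Fin N. \<bar>y s - y0 s\<bar>) < e}"
  have "open ?T" by (intro open_Collect_less continuous_LN_bound continuous_on_const)
  moreover have "y0 \<in> ?T" using e(1) by simp
  moreover have "?T \<subseteq> {y. LN N y \<in> U}"
  proof
    fix y assume y: "y \<in> ?T"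
    have "E.d (LN N y0) (LN N y) \<le> Lam * (\<Sum>s\<in>Fin N. \<bar>y s - y0 s\<bar>)"
      using LN_dist[of N y0 y] by (simp add: abs_minus_commute)
    then show "y \<in> {y. LN N y \<in> U}" using y e(2)[OF LN_space] by auto
  qed
  ultimately show "\<exists>T. open T \<and> y0 \<in> T \<and> T \<subseteq> {y. LN N y \<in> U}" by blast
qed

lemma LN_lipschitz_continuous:
  assumes h: "E.lipschitz c h" and c: "c \<ge> 0"
  shows "continuous_on UNIV (\<lambda>y. h (LN N y))"
  unfolding continuous_on_eq_continuous_at[OF open_UNIV] isCont_def
proof (rule ballI, rule LIM_zero_cancel, rule Lim_null_comparison)
  fix y0
  show "\<forall>\<^sub>F y in at y0. norm (h (LN N y) - h (LN N y0)) \<le> c * (Lam * (\<Sum>s\<in>Fin N. \<bar>y s - y0 s\<bar>))"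
  proof (rule always_eventually, rule allI)
    fix y
    have "norm (h (LN N y) - h (LN N y0)) \<le> c * E.d (LN N y) (LN N y0)"
      using h LN_space unfolding E.lipschitz_def real_norm_def by blast
    also have "\<dots> \<le> c * (Lam * (\<Sum>s\<in>Fin N. \<bar>y s - y0 s\<bar>))" by (intro mult_left_mono LN_dist c)
    finally show "norm (h (LN N y) - h (LN N y0)) \<le> c * (Lam * (\<Sum>s\<in>Fin N. \<bar>y s - y0 s\<bar>))" .
  qed
  have "continuous_on UNIV (\<lambda>y. c * (Lam * (\<Sum>s\<in>Fin N. \<bar>y s - y0 s\<bar>)))"
    by (intro continuous_on_mult_left continuous_LN_bound)
  then have "isCont (\<lambda>y. c * (Lam * (\<Sum>s\<in>Fin N. \<bar>y s - y0 s\<bar>))) y0"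
    by (simp add: continuous_on_eq_continuous_at)
  then show "((\<lambda>y. c * (Lam * (\<Sum>s\<in>Fin N. \<bar>y s - y0 s\<bar>))) \<longlongrightarrow> 0) (at y0)"
    unfolding isCont_def by simp
qed

lemma Vn_LQ_measurable: "Vn N \<in> borel_measurable LQ"
  by (rule measurable_coordinatewise_then_product) measurable

lemma LN_tendsto:
  assumes w: "w \<in> Sp"
  shows "(\<lambda>N. E.d (LN N (Vn N w)) (Lproc Q A M m w)) \<longlonglongrightarrow> 0"
proof (rule LIMSEQ_I)
  fix r :: real assume r: "r > 0"
  define e where "e = r / (2 * (Lam + 1))"
  have e: "e > 0" using r Lam_nonneg by (simp add: e_def)
  have "Lam * e \<le> (Lam + 1) * e" using e by (intro mult_right_mono) auto
  also have "\<dots> = r / 2" using Lam_nonneg by (simp add: e_def field_simps)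
  finally have Le: "Lam * e < r" using r by linarith
  have "\<forall>\<^sub>F N in sequentially. norm (E.d (LN N (Vn N w)) (Lproc Q A M m w) - 0) < r"
    using Sp_uniform[OF w e]
  proof eventually_elim
    case (elim N)
    have "E.d (LN N (Vn N w)) (Lproc Q A M m w) \<le> Lam * e"
      unfolding E.d_commute[of "LN N (Vn N w)"]
      by (intro linf_dist_le E.T E.I LN_Vn_close) (use elim e in auto)
    moreover have "0 \<le> E.d (LN N (Vn N w)) (Lproc Q A M m w)" by (intro E.d_nonneg LN_space Lproc_xe_space w)
    ultimately show ?case using Le by simp
  qed
  then show "\<exists>no. \<forall>N\<ge>no. norm (E.d (LN N (Vn N w)) (Lproc Q A M m w) - 0) < r"
    by (simp add: eventually_sequentially)
qed

text \<open>The discretised limits are measurable through finite vectors and converge in the sup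
  distance along every path of \<open>Sp\<close>, which is the gain from restricting the
  space.\<close>

lemma Lproc_measurable: "Lproc Q A M m \<in> measurable LQ (linf_borel TT II)"
proof (rule E.linf_borel_limit[where X="\<lambda>N w. LN N (Vn N w)"])
  fix N U assume "linf_open TT II U"
  then have "{y. LN N y \<in> U} \<in> sets borel" by (intro borel_open LN_open)
  then have "Vn N -` {y. LN N y \<in> U} \<inter> space LQ \<in> sets LQ" by (rule measurable_sets[OF Vn_LQ_measurable])
  also have "Vn N -` {y. LN N y \<in> U} \<inter> space LQ = {w \<in> space LQ. LN N (Vn N w) \<in> U}" by auto
  finally show "{w \<in> space LQ. LN N (Vn N w) \<in> U} \<in> sets LQ" .
qed (auto simp: space_LQ intro: LN_space Lproc_xe_space LN_tendsto)

lemma lipschitz_LN_tendsto: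
  assumes h: "E.lipschitz c h" and c: "c \<ge> 0" and w: "w \<in> Sp"
  shows "(\<lambda>N. h (LN N (Vn N w))) \<longlonglongrightarrow> h (Lproc Q A M m w)"
proof (rule LIM_zero_cancel, rule Lim_null_comparison)
  show "\<forall>\<^sub>F N in sequentially. norm (h (LN N (Vn N w)) - h (Lproc Q A M m w)) \<le> c * E.d (LN N (Vn N w)) (Lproc Q A M m w)"
    using h LN_space Lproc_xe_space[OF w] unfolding E.lipschitz_def real_norm_def by (intro always_eventually) blast
  show "(\<lambda>N. c * E.d (LN N (Vn N w)) (Lproc Q A M m w)) \<longlonglongrightarrow> 0"
    by (intro tendsto_mult_right_zero LN_tendsto w)
qed

lemma lipschitz_LN_measurable:
  assumes h: "E.lipschitz c h" and c: "c \<ge> 0"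
  shows "(\<lambda>w. h (LN N (Vn N w))) \<in> borel_measurable LQ"
  using measurable_compose[OF Vn_LQ_measurable borel_measurable_continuous_onI[OF LN_lipschitz_continuous[OF h c]]] .

lemma lipschitz_Lproc_measurable:
  assumes h: "E.lipschitz c h" and c: "c \<ge> 0"
  shows "(\<lambda>w. h (Lproc Q A M m w)) \<in> borel_measurable LQ"
proof (rule borel_measurable_LIMSEQ_real)
  show "(\<lambda>N. h (LN N (Vn N w))) \<longlonglongrightarrow> h (Lproc Q A M m w)" if "w \<in> space LQ" for w
    using that by (intro lipschitz_LN_tendsto[OF h c]) (simp add: space_LQ)
  show "(\<lambda>w. h (LN N (Vn N w))) \<in> borel_measurable LQ" for N by (rule lipschitz_LN_measurable[OF h c])
qed

text \<open>Chain of comparisons: the processes with \<open>Lproc\<close> of \<open>xe\<close>, this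
  with its discretisation, the discretisation with that of the limit by finite-dimensional
  convergence, and finally back to the limit. The majorant is built from the discretisation and the
  exceptional event, hence is measurable even where the processes are not.\<close>

lemma upper_bound:
  assumes h: "E.lipschitz c h" and c: "c \<ge> 0" and B: "\<And>f. f \<in> E.E \<Longrightarrow> \<bar>h f\<bar> \<le> B" and e: "e > 0"
  shows "\<forall>\<^sub>F n in sequentially. \<exists>g. integrable P g \<and> (\<forall>\<omega>\<in>space P. h (Eproc Q A M m X Z W n \<omega>) \<le> g \<omega>) \<and>
     integral\<^sup>L P g \<le> (\<integral>w. h (Lproc Q A M m w) \<partial>LQ) + e"
proof -
  interpret LQ: prob_space LQ by (rule prob_space_LQ)
  have B0: "B \<ge> 0" using B[OF E.zero_in_E] by linarith
  \<comment> \<open>Makes the exceptional event cost at most e / 4, as \<open>h\<close> varies there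
    by at most 2B; the denominator has B + 1 because \<open>B\<close> may be 0.\<close>
  obtain N1 K where bb: "bad_bound N1 K \<le> e / (8 * (B + 1))"
    using bad_bound_small[of "e / (8 * (B + 1))"] e B0 by auto
  have "2 * B * bad_bound N1 K \<le> 2 * (B + 1) * (e / (8 * (B + 1)))"
    using bb B0 e by (intro mult_mono') (auto simp: bad_bound_def intro!: mult_nonneg_nonneg add_nonneg_nonneg less_imp_le[OF link_const_pos])
  also have "\<dots> = e / 4" using B0 by (simp add: field_simps)
  finally have b2: "2 * B * bad_bound N1 K \<le> e / 4" .
  define \<epsilon> where "\<epsilon> = e / (8 * (c + 1))"
  have \<epsilon>: "\<epsilon> > 0" "c * \<epsilon> \<le> e / 8"
  proof -
    show "\<epsilon> > 0" using e c by (simp add: \<epsilon>_def)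
    then have "c * \<epsilon> \<le> (c + 1) * \<epsilon>" by (intro mult_right_mono) auto
    also have "\<dots> = e / 8" using c by (simp add: \<epsilon>_def field_simps)
    finally show "c * \<epsilon> \<le> e / 8" .
  qed
  have "(\<lambda>N. c * (Lam * (4 * \<tau> N))) \<longlonglongrightarrow> c * (Lam * (4 * 0))" by (intro tendsto_intros tau_tendsto)
  then have ev1: "\<forall>\<^sub>F N in sequentially. c * (Lam * (4 * \<tau> N)) < e / 8" using e by (intro order_tendstoD(2)) auto
  have "(\<lambda>N. \<integral>w. h (LN N (Vn N w)) \<partial>LQ) \<longlonglongrightarrow> (\<integral>w. h (Lproc Q A M m w) \<partial>LQ)"
  proof (rule integral_dominated_convergence[where w="\<lambda>_. B"])
    show "AE w in LQ. (\<lambda>N. h (LN N (Vn N w))) \<longlonglongrightarrow> h (Lproc Q A M m w)"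
      by (intro AE_I2 lipschitz_LN_tendsto[OF h c]) (simp add: space_LQ)
    show "AE w in LQ. norm (h (LN N (Vn N w))) \<le> B" for N using B LN_space by (intro AE_I2) auto
  qed (auto intro: lipschitz_LN_measurable[OF h c] lipschitz_Lproc_measurable[OF h c])
  then have ev2: "\<forall>\<^sub>F N in sequentially. (\<integral>w. h (LN N (Vn N w)) \<partial>LQ) < (\<integral>w. h (Lproc Q A M m w) \<partial>LQ) + e / 8"
    using e by (intro order_tendstoD(2)) auto
  \<comment> \<open>The level \<open>N\<close> is fixed before \<open>n\<close> grows; it must not
    lie below \<open>N1\<close>, where chaining starts.\<close>
  obtain N where N: "N1 \<le> N" "c * (Lam * (4 * \<tau> N)) < e / 8"
    "(\<integral>w. h (LN N (Vn N w)) \<partial>LQ) < (\<integral>w. h (Lproc Q A M m w) \<partial>LQ) + e / 8"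
    using eventually_happens'[OF _ eventually_conj[OF eventually_ge_at_top[of N1] eventually_conj[OF ev1 ev2]]] by auto
  have gc: "continuous_on UNIV (\<lambda>y. h (LN N y))" by (rule LN_lipschitz_continuous[OF h c])
  have gB: "\<bar>h (LN N y)\<bar> \<le> B" for y by (rule B[OF LN_space])
  have ev3: "\<forall>\<^sub>F n in sequentially. (\<integral>\<omega>. h (LN N (Vn N (xe n \<omega>))) \<partial>P) < (\<integral>w. h (LN N (Vn N w)) \<partial>LQ) + e / 8"
    using fidi_convergence[OF gc gB] e by (intro order_tendstoD(2)) auto
  have "(\<lambda>n. c * (Lam * (2 * small (real CARD('p)) 2 n))) \<longlonglongrightarrow> c * (Lam * (2 * 0))" by (intro tendsto_intros small_tendsto)
  then have ev4: "\<forall>\<^sub>F n in sequentially. c * (Lam * (2 * small (real CARD('p)) 2 n)) < e / 8" using e by (intro order_tendstoD(2)) auto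
  have ev5: "\<forall>\<^sub>F n in sequentially. N \<le> lg n" using lg_at_top by (auto simp: filterlim_at_top)
  show ?thesis
    using ev3 ev4 ev5 eventually_gt_at_top[of 0] Eproc_approx[OF \<epsilon>(1), of N1 K]
  proof eventually_elim
    case (elim n)
    define D where "D = bad n N1 K \<union> null_set"
    have Dev: "D \<in> events" using bad_prob(1)[OF elim(4)] null_set(1) by (simp add: D_def)
    have "prob D \<le> prob (bad n N1 K) + prob null_set"
      unfolding D_def by (rule measure_Un_le[OF bad_prob(1)[OF elim(4)] null_set(1)])
    then have Dp: "prob D \<le> bad_bound N1 K" using bad_prob(2)[OF elim(4), of N1 K] null_set(2) by linarith
    define s where "s = 2 * (2 * \<tau> N + small (real CARD('p)) 2 n)"
    define \<delta> where "\<delta> = c * (\<epsilon> + Lam * s)"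
    have sm0: "0 \<le> small (real CARD('p)) 2 n" using rho_gt_1 by (simp add: small_def)
    have s0: "0 \<le> s" using sm0 tau_nonneg[of N] by (simp add: s_def)
    have \<delta>0: "0 \<le> \<delta>" using c \<epsilon>(1) Lam_nonneg s0 by (simp add: \<delta>_def)
    have \<delta>e: "\<delta> \<le> 3 * (e / 8)"
    proof -
      have eq: "\<delta> = c * \<epsilon> + (c * (Lam * (4 * \<tau> N)) + c * (Lam * (2 * small (real CARD('p)) 2 n)))"
        unfolding \<delta>_def s_def by (simp add: algebra_simps)
      have "a \<le> e / 8 \<Longrightarrow> b < e / 8 \<Longrightarrow> d < e / 8 \<Longrightarrow> a + (b + d) \<le> 3 * (e / 8)" for a b d :: real by linarith
      from this[OF \<epsilon>(2) N(2) elim(2)] show ?thesis unfolding eq .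
    qed
    define g where "g \<omega> = h (LN N (Vn N (xe n \<omega>))) + (\<delta> + 2 * B * indicator D \<omega>)" for \<omega>
    have [measurable]: "(\<lambda>\<omega>. Vn N (xe n \<omega>)) \<in> borel_measurable P"
      by (rule measurable_coordinatewise_then_product) measurable
    have hm: "(\<lambda>\<omega>. h (LN N (Vn N (xe n \<omega>)))) \<in> borel_measurable P"
      by (rule measurable_compose[OF _ borel_measurable_continuous_onI[OF gc]]) measurable
    have hi: "integrable P (\<lambda>\<omega>. h (LN N (Vn N (xe n \<omega>))))"
      by (rule integrable_const_bound[where B=B, OF _ hm]) (rule AE_I2, unfold real_norm_def, rule gB)
    have gi: "integrable P g" unfolding g_def
      by (intro Bochner_Integration.integrable_add hi integrable_affine_indicator Dev)
    have "integral\<^sup>L P g = (\<integral>\<omega>. h (LN N (Vn N (xe n \<omega>))) \<partial>P) + (\<delta> + 2 * B * prob D)"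
      unfolding g_def
      by (subst Bochner_Integration.integral_add[OF hi integrable_affine_indicator[OF Dev]]) (simp only: expectation_affine_indicator[OF Dev])
    moreover have "2 * B * prob D \<le> e / 4"
    proof -
      have "2 * B * prob D \<le> 2 * B * bad_bound N1 K" using Dp B0 by (intro mult_left_mono) auto
      then show ?thesis using b2 by linarith
    qed
    \<comment> \<open>The budget: e/8 for each of the two limits, 3e/8 for the uniform
      approximations, and e/4 for the exceptional event.\<close>
    ultimately have Ig: "integral\<^sup>L P g \<le> (\<integral>w. h (Lproc Q A M m w) \<partial>LQ) + e"
      using elim(1) N(3) \<delta>e e by linarith
    have maj: "h (Eproc Q A M m X Z W n \<omega>) \<le> g \<omega>" if w: "\<omega> \<in> space P" for \<omega>
    proof (cases "\<omega> \<in> D")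
      case True
      then show ?thesis using B[OF Eproc_space, of n \<omega>] gB[of "Vn N (xe n \<omega>)"] \<delta>0 by (simp add: g_def)
    next
      case False
      then have w': "\<omega> \<in> space P - bad n N1 K - null_set" "\<omega> \<in> space P - bad n N1 K" using w by (auto simp: D_def)
      have "E.d (Eproc Q A M m X Z W n \<omega>) (LN N (Vn N (xe n \<omega>))) \<le> \<epsilon> + Lam * s"
      proof (rule linf_dist_le[OF E.T E.I])
        fix t i assume ti: "t \<in> TT" "i \<in> II"
        have "\<bar>Eproc Q A M m X Z W n \<omega> t i - Lproc Q A M m (xe n \<omega>) t i\<bar> \<le> \<epsilon>" using elim(5) w'(1) ti by blast
        moreover have "\<bar>Lproc Q A M m (xe n \<omega>) t i - LN N (Vn N (xe n \<omega>)) t i\<bar> \<le> Lam * s"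
          unfolding s_def by (rule LN_Vn_close[OF xe_prj[OF elim(4) w'(2) N(1) elim(3)]]) (use s0 in \<open>simp_all add: s_def\<close>)
        ultimately show "\<bar>Eproc Q A M m X Z W n \<omega> t i - LN N (Vn N (xe n \<omega>)) t i\<bar> \<le> \<epsilon> + Lam * s" by linarith
      qed
      then have "c * E.d (Eproc Q A M m X Z W n \<omega>) (LN N (Vn N (xe n \<omega>))) \<le> \<delta>"
        unfolding \<delta>_def by (intro mult_left_mono c)
      moreover have "\<bar>h (Eproc Q A M m X Z W n \<omega>) - h (LN N (Vn N (xe n \<omega>)))\<bar> \<le> c * E.d (Eproc Q A M m X Z W n \<omega>) (LN N (Vn N (xe n \<omega>)))"
        using h Eproc_space LN_space unfolding E.lipschitz_def by blast
      ultimately show ?thesis using False by (simp add: g_def)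
    qed
    show ?case using gi maj Ig by blast
  qed
qed

lemma weak_conv_pos: "weak_conv_linf TT II P (Eproc Q A M m X Z W) LQ (Lproc Q A M m)"
proof (rule E.weak_conv_linfI[OF _ prob_space_LQ])
  show "prob_space P" by unfold_locales
  show "Eproc Q A M m X Z W n \<omega> \<in> E.E" for n \<omega> by (rule Eproc_space)
  show "Lproc Q A M m w \<in> E.E" if "w \<in> space LQ" for w using that by (intro Lproc_xe_space) (simp add: space_LQ)
  show "(\<lambda>w. h (Lproc Q A M m w)) \<in> borel_measurable LQ" if "E.lipschitz c h" "c \<ge> 0" for h c
    by (rule lipschitz_Lproc_measurable[OF that])
  show "\<forall>\<^sub>F n in sequentially. \<exists>g. integrable P g \<and> (\<forall>\<omega>\<in>space P. h (Eproc Q A M m X Z W n \<omega>) \<le> g \<omega>) \<and>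
     integral\<^sup>L P g \<le> (\<integral>w. h (Lproc Q A M m w) \<partial>LQ) + e"
    if "E.lipschitz c h" "c \<ge> 0" "\<And>f. f \<in> E.E \<Longrightarrow> \<bar>h f\<bar> \<le> B" "e > 0" for h c B e
    by (rule upper_bound[OF that])
qed (rule Lproc_measurable)

end

text \<open>Without conditioning sets both processes are identically 0, and it remains to see that
  the outer expectation of a constant is that constant.\<close>

lemma weak_conv_zero:
  assumes m: "m = 0"
  shows "weak_conv_linf TT II P (Eproc Q A M m X Z W) LQ (Lproc Q A M m)"
proof -
  interpret LQ: prob_space LQ by (rule prob_space_LQ)
  have E0: "Eproc Q A M m X Z W n \<omega> = (\<lambda>_ _. 0)" for n \<omega> using m by (auto simp: Eproc_def fun_eq_iff)
  have L0: "Lproc Q A M m w = (\<lambda>_ _. 0)" for w using m by (auto simp: Lproc_def fun_eq_iff)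
  have sp: "(\<lambda>_ _. 0) \<in> linf_space TT II" by (auto simp: linf_space_def)
  have "space (linf_borel TT II) = linf_space TT II" unfolding linf_borel_def
    by (rule space_measure_of) (auto simp: linf_open_def)
  then have "Lproc Q A M m \<in> measurable LQ (linf_borel TT II)"
    unfolding L0[abs_def] using sp by (intro measurable_const) simp
  moreover have "outer_exp P (\<lambda>_. a) = a" for a :: real
    unfolding outer_exp_def
  proof (rule cInf_eq_minimum)
    have "a = integral\<^sup>L P (\<lambda>_. a)" by (simp add: prob_space)
    then show "a \<in> {integral\<^sup>L P g |g. g \<in> borel_measurable P \<and> integrable P g \<and> (\<forall>\<omega>\<in>space P. a \<le> g \<omega>)}" by force
    fix x assume "x \<in> {integral\<^sup>L P g |g. g \<in> borel_measurable P \<and> integrable P g \<and> (\<forall>\<omega>\<in>space P. a \<le> g \<omega>)}"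
    then obtain g where g: "x = integral\<^sup>L P g" "integrable P g" "\<forall>\<omega>\<in>space P. a \<le> g \<omega>" by auto
    have "(\<integral>\<omega>. a \<partial>P) \<le> integral\<^sup>L P g" using g by (intro integral_mono) auto
    then show "a \<le> x" using g(1) by (simp add: prob_space)
  qed
  ultimately show ?thesis
    unfolding weak_conv_linf_def E0 L0 using sp by (simp add: LQ.prob_space L0[abs_def])
qed

lemma weak_convergence: "weak_conv_linf TT II P (Eproc Q A M m X Z W) LQ (Lproc Q A M m)"
  using weak_conv_pos weak_conv_zero by blast

end

theorem theorem8:
  fixes P :: "'a measure"
    and X :: "nat \<Rightarrow> 'a \<Rightarrow> real^'p"
    and Z :: "nat \<Rightarrow> 'a \<Rightarrow> 'z::euclidean_space"
    and W :: "nat \<Rightarrow> nat \<Rightarrow> nat \<Rightarrow> 'a \<Rightarrow> nat"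
    and A :: "nat \<Rightarrow> 'z set"
    and m M :: nat
  assumes P: "prob_space P"
    and iid: "prob_space.indep_vars P (\<lambda>_. borel) (\<lambda>i \<omega>. (X i \<omega>, Z i \<omega>)) UNIV"
    and ident: "\<forall>i. distr P borel (\<lambda>\<omega>. (X i \<omega>, Z i \<omega>)) = distr P borel (\<lambda>\<omega>. (X 0 \<omega>, Z 0 \<omega>))"
    and W_meas: "\<forall>n j l. W n j l \<in> measurable P (count_space UNIV)"
    and W_unif: "\<forall>n j l x. 1 \<le> j \<and> j \<le> M \<and> l < n \<longrightarrow>
                   measure P {\<omega>\<in>space P. W n j l \<omega> = x} = (if x < n then 1 / real n else 0)"
    and W_indep: "\<forall>n. prob_space.indep_vars P (\<lambda>_. count_space UNIV)
                        (\<lambda>jl \<omega>. W n (fst jl) (snd jl) \<omega>) ({1..M} \<times> {..<n})"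
    and W_data_indep: "\<forall>n. prob_space.indep_set P
          {(\<lambda>\<omega>. \<lambda>i. (X i \<omega>, Z i \<omega>)) -` S \<inter> space P | S. S \<in> sets (Pi\<^sub>M UNIV (\<lambda>_. borel))}
          {(\<lambda>\<omega>. restrict (\<lambda>jl. W n (fst jl) (snd jl) \<omega>) ({1..M} \<times> {..<n})) -` S \<inter> space P
             | S. S \<in> sets (Pi\<^sub>M ({1..M} \<times> {..<n}) (\<lambda>_. count_space UNIV))}"
    and A_borel: "\<forall>k<m. A k \<in> sets borel"
    and A_pos: "\<forall>k<m. pA (law P X Z) (A k) > 0"
    and margins_cont: "\<forall>k<m. \<forall>i. continuous_on UNIV (condF (law P X Z) (A k) i)"
    and C1: "\<forall>k<m. C1_on_cube (condcop (law P X Z) (A k))"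
    and M2: "M \<ge> 2"
  shows "\<exists>Q :: (nat \<times> nat \<times> (real^'p) \<Rightarrow> real) measure.
           prob_space Q \<and>
           (\<forall>s. (\<lambda>\<omega>. \<omega> s) \<in> borel_measurable Q) \<and>
           (\<forall>j\<le>M. centered_gaussian_family Q ({..<m} \<times> cube)
                     (\<lambda>ku \<omega>. \<omega> (j, fst ku, snd ku))
                     (\<lambda>ku kv. Bcov (law P X Z) (A (fst ku)) (A (fst kv)) (snd ku) (snd kv))) \<and>
           prob_space.indep_vars Q (\<lambda>_. Pi\<^sub>M UNIV (\<lambda>_. borel))
             (\<lambda>j \<omega>. \<lambda>ku. \<omega> (j, fst ku, snd ku)) {..M} \<and>
           weak_conv_linf (Tset M m) ({..M} \<times> {..<m}) P
             (Eproc (law P X Z) A M m X Z W) Q (Lproc (law P X Z) A M m)"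
proof -
  interpret prob_space P by (rule P)
  interpret boot_copula P X Z W M A m
    using iid ident W_meas W_unif W_indep W_data_indep A_borel A_pos margins_cont C1
    by unfold_locales auto
  \<comment> \<open>The witness is \<open>LQ\<close>, the image of the independent normals on the
    restricted path space, with one coordinate for each copy, set and point.\<close>
  show ?thesis
    unfolding Q_def[symmetric]
    using prob_space_LQ coord_LQ LQ_gaussian LQ_indep weak_convergence by blast
qed

end
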